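(* Let $m>n\ge 0$ be integers and let $\Omega\subset\mathbb R^{2m}$ be open. Let $\boldsymbol G_2^1=\begin{pmatrix} G_1 & G_2 \\ G_2 & G_1 \end{pmatrix}$ with $G_1,G_2\in C^\infty(\Omega)\otimes\mathfrak G_{2n}\otimes\mathcal C_{2m,2n}$ be (left) $\boldsymbol{SH}$-monogenic, i.e. $\boldsymbol{\mathcal D}_{(\mathbf Z,\mathbf Z^\dagger)}\boldsymbol G_2^1=\boldsymbol 0$ in $\Omega$. Let $g=g_0+\mathbf g\in C^\infty(\mathbb R^{2m})\otimes\mathfrak G_{2n}^{(ev)}$ be a phase function such that $\{g_0\le0\}\subset\Omega$ is compact and the gradient of $g_0$ does not vanish on $g_0^{-1}(0)$. Then $$\int_{\mathbb R^{2m|2n}}\boldsymbol\Psi^{m|n}_{2\times2}(\mathbf Z-\mathbf U)\,\delta(g(\mathbf x))\,\boldsymbol{\mathcal D}_{(\mathbf Z,\mathbf Z^\dagger)}[g(\mathbf x)]\,\boldsymbol G_2^1(\mathbf x)=\begin{cases}\boldsymbol G_2^1(\mathbf y),&g_0(\underline y)<0,\\ 0,&g_0(\underline y)>0.\end{cases}$$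
   Context: Superspace. Commuting variables $x_1,\dots,x_{2m}$ (coordinates of $\underline x\in\mathbb R^{2m}$), anticommuting variables $\grave x_1,\dots,\grave x_{2n}$ commuting with the $x_j$; $\mathfrak G_{2n}$ is the Grassmann algebra generated by the $\grave x_j$, $\mathfrak G_{2n}^{(ev)}$ its even part. Superfunctions are $F=\sum_A F_A(\underline x)\grave{\underline x}_A$ with $F_A$ complex-valued smooth and $\grave{\underline x}_A$ ordered monomials; body $F_0=F_\emptyset$, nilpotent part $F-F_0$; real if all $F_A$ are real. A phase function is an even real superfunction $g=g_0+\mathbf g$ (body plus nilpotent part). For an even real superfunction $a=a_0+\mathbf a$ with $a_0>0$, $a^p=\sum_{j=0}^n\frac{\mathbf a^j}{j!}p(p-1)\cdots(p-j+1)a_0^{p-j}$. $\partial_{\grave x_j}F$ is the left derivative ($\partial_{\grave x_j}[1]=0$, $\partial_{\grave x_j}\grave x_k+\grave x_k\partial_{\grave x_j}=\delta_{jk}$, commuting with the $x_k$). Clifford generators. $\mathcal C_{2m,2n}$ is generated by $e_1,\dots,e_{2m},\grave e_1,\dots,\grave e_{2n}$ with $e_je_k+e_ke_j=-2\delta_{jk}$, $e_j\grave e_k+\grave e_ke_j=0$, $\grave e_j\grave e_k-\grave e_k\grave e_j=g_{jk}$, where $g_{2j,2k}=g_{2j-1,2k-1}=0$, $g_{2j-1,2k}=-g_{2k,2j-1}=\delta_{jk}$; it commutes with all variables and partial derivatives. Complex scalars are allowed. Put $\mathfrak f_j=\frac12(e_j-ie_{m+j})$, $\mathfrak f_j^\dagger=-\frac12(e_j+ie_{m+j})$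 ($1\le j\le m$), $\grave{\mathfrak f}_j=\frac12(\grave e_{2j-1}-i\grave e_{2j})$, $\grave{\mathfrak f}_j^\dagger=-\frac12(\grave e_{2j-1}+i\grave e_{2j})$ ($1\le j\le n$). Complex variables: $z_j=x_j+ix_{m+j}$, $z_j^c=x_j-ix_{m+j}$, $\grave z_j=\grave x_{2j-1}+i\grave x_{2j}$, $\grave z_j^c=\grave x_{2j-1}-i\grave x_{2j}$; $\partial_{z_j}=\frac12(\partial_{x_j}-i\partial_{x_{m+j}})$, $\partial_{z_j^c}=\frac12(\partial_{x_j}+i\partial_{x_{m+j}})$, $\partial_{\grave z_j}=\frac12(\partial_{\grave x_{2j-1}}-i\partial_{\grave x_{2j}})$, $\partial_{\grave z_j^c}=\frac12(\partial_{\grave x_{2j-1}}+i\partial_{\grave x_{2j}})$. Hermitian Dirac operators: $\partial_{\mathbf Z}F=\sum_{j=1}^m\mathfrak f_j^\dagger\partial_{z_j}F+2i\sum_{j=1}^n\grave{\mathfrak f}_j^\dagger\partial_{\grave z_j}F$, $\partial_{\mathbf Z^\dagger}F=\sum_{j=1}^m\mathfrak f_j\partial_{z_j^c}F-2i\sum_{j=1}^n\grave{\mathfrak f}_j\partial_{\grave z_j^c}F$. Matrix Dirac operator (acting by matrix multiplication): $\boldsymbol{\mathcal D}_{(\mathbf Z,\mathbf Z^\dagger)}=\begin{pmatrix}\partial_{\mathbf Z}&\partial_{\mathbf Z^\dagger}\\ \partial_{\mathbf Z^\dagger}&\partial_{\mathbf Z}\end{pmatrix}$; also $\boldsymbol{\mathcal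 D}_{(\mathbf Z,\mathbf Z^\dagger)}[g]=\begin{pmatrix}\partial_{\mathbf Z}[g]&\partial_{\mathbf Z^\dagger}[g]\\ \partial_{\mathbf Z^\dagger}[g]&\partial_{\mathbf Z}[g]\end{pmatrix}$. Kernel. $\mathbf Z=\sum_j z_j\mathfrak f_j+\sum_j\grave z_j\grave{\mathfrak f}_j$, $\mathbf Z^\dagger=\sum_j z_j^c\mathfrak f_j^\dagger+\sum_j\grave z_j^c\grave{\mathfrak f}_j^\dagger$, $|\mathbf Z|^2=\mathbf Z\mathbf Z^\dagger+\mathbf Z^\dagger\mathbf Z=\sum_j z_jz_j^c-\frac i2\sum_j\grave z_j\grave z_j^c$. $\mathbf y=\underline y+\grave{\underline y}$ consists of a point $\underline y\in\mathbb R^{2m}$ and further anticommuting parameters $\grave y_1,\dots,\grave y_{2n}$ (also anticommuting with the $\grave x_j$); $\mathbf U,\mathbf U^\dagger$ are built from $\mathbf y$ as $\mathbf Z,\mathbf Z^\dagger$ are from the $x_j,\grave x_j$. With $M=2m-2n$ and $|\mathbb S^{2m-1|2n}|=2\pi^{M/2}/\Gamma(M/2)$, $$\Psi_1^{m|n}(\mathbf Z)=\frac{2}{|\mathbb S^{2m-1|2n}|}\frac{\mathbf Z}{|\mathbf Z|^M},\quad {\Psi_1^{m|n}}^\dagger(\mathbf Z)=\frac{2}{|\mathbb S^{2m-1|2n}|}\frac{\mathbf Z^\dagger}{|\mathbf Z|^M},\quad \boldsymbol\Psi^{m|n}_{2\times2}=\begin{pmatrix}\Psi_1^{m|n}&{\Psi_1^{m|n}}^\dagger\\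 {\Psi_1^{m|n}}^\dagger&\Psi_1^{m|n}\end{pmatrix}.$$ Integration. $\int_B=\pi^{-n}\partial_{\grave x_{2n}}\cdots\partial_{\grave x_1}$. For a compactly supported superdistribution $\alpha=\sum_A\alpha_A\grave{\underline x}_A$ ($\alpha_A$ distributions on $\mathbb R^{2m}$) and $F=\sum_BF_B\grave{\underline x}_B$ smooth near the support, $\int_{\mathbb R^{2m|2n}}\alpha F=\sum_{A,B}\langle\alpha_A,F_B\rangle\int_B\grave{\underline x}_A\grave{\underline x}_B$, extended entrywise and linearly to Clifford-valued matrices, the $\grave y_j$ being constants. $\delta(g)=\sum_{j=0}^n\frac{\mathbf g^j}{j!}\delta^{(j)}(g_0)$, with $\delta^{(j)}(g_0)$ the pullback of $\delta^{(j)}$ by $g_0$. The kernel is smooth in $\underline x$ away from $\underline y$, so its product with $\delta(g)$ is well defined when $g_0(\underline y)\ne0$. *)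

theory Defs
  imports "HOL-Analysis.Analysis" "HOL-Library.Poly_Mapping"
begin

section \<open>The Clifford algebra, by generators and relations\<close>

text \<open>The free complex algebra on a set of generators is the monoid algebra of the free monoid,
  i.e.\ of words under concatenation.\<close>

datatype 'g fmon = Fmon (letters: "'g list")

instantiation fmon :: (type) monoid_add
begin
definition "0 = Fmon []"
definition "u + v = Fmon (letters u @ letters v)"
instance by standard (simp_all add: zero_fmon_def plus_fmon_def)
end

text \<open>\<open>Ge i\<close> stands for the orthogonal generator \<open>e\<^sub>i\<close>, \<open>Gs j\<close> for the symplectic generator
  \<open>e`\<^sub>j\<close> (with \<open>j \<ge> 1\<close>). A fixed type carries symplectic generators of every index; the algebra
  with \<open>2n\<close> of them is the subalgebra \<open>clifford_sub n\<close> below.\<close>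

datatype 'i cgen = Ge 'i | Gs nat

type_synonym 'i free_alg = "'i cgen fmon \<Rightarrow>\<^sub>0 complex"

definition fgen :: "'i cgen \<Rightarrow> 'i free_alg" where
  "fgen s = Poly_Mapping.single (Fmon [s]) 1"

definition fscalar :: "complex \<Rightarrow> 'i free_alg" where
  "fscalar c = Poly_Mapping.single 0 c"

definition symp_form :: "nat \<Rightarrow> nat \<Rightarrow> complex" where
  "symp_form j k = (if odd j \<and> k = Suc j then 1 else if odd k \<and> j = Suc k then -1 else 0)"

inductive_set clifford_ideal :: "'i free_alg set" where
  orthogonal: "fgen (Ge j) * fgen (Ge k) + fgen (Ge k) * fgen (Ge j)
       - fscalar (if j = k then -2 else 0) \<in> clifford_ideal"
| mixed: "fgen (Ge j) * fgen (Gs k) + fgen (Gs k) * fgen (Ge j) \<in> clifford_ideal"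
| symplectic: "fgen (Gs j) * fgen (Gs k) - fgen (Gs k) * fgen (Gs j) - fscalar (symp_form j k)
       \<in> clifford_ideal"
| add: "p \<in> clifford_ideal \<Longrightarrow> q \<in> clifford_ideal \<Longrightarrow> p + q \<in> clifford_ideal"
| mult: "p \<in> clifford_ideal \<Longrightarrow> a * p * b \<in> clifford_ideal"

lemma clifford_ideal_zero: "0 \<in> clifford_ideal"
  using clifford_ideal.mult[OF clifford_ideal.mixed, of 0] by simp

lemma clifford_ideal_minus: "p \<in> clifford_ideal \<Longrightarrow> - p \<in> clifford_ideal"
  using clifford_ideal.mult[of p "-1" 1] by simp

definition clifford_eq :: "'i free_alg \<Rightarrow> 'i free_alg \<Rightarrow> bool" where
  "clifford_eq p q \<longleftrightarrow> p - q \<in> clifford_ideal"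

lemma clifford_eq_equivp: "equivp (clifford_eq :: 'i free_alg \<Rightarrow> _)"
proof (rule equivpI)
  show "reflp (clifford_eq :: 'i free_alg \<Rightarrow> _)"
    by (simp add: reflp_def clifford_eq_def clifford_ideal_zero)
  show "symp (clifford_eq :: 'i free_alg \<Rightarrow> _)"
  proof (rule sympI)
    fix p q :: "'i free_alg"
    assume "clifford_eq p q"
    then show "clifford_eq q p"
      using clifford_ideal_minus[of "p - q"] by (simp add: clifford_eq_def)
  qed
  show "transp (clifford_eq :: 'i free_alg \<Rightarrow> _)"
  proof (rule transpI)
    fix p q r :: "'i free_alg"
    assume "clifford_eq p q" "clifford_eq q r"
    then show "clifford_eq p r"
      using clifford_ideal.add[of "p - q" "q - r"] by (simp add: clifford_eq_def)
  qed
qed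

quotient_type 'i clifford = "'i free_alg" / clifford_eq
  by (rule clifford_eq_equivp)

text \<open>The quotient is not trivial: it acts on the functions below (a Fock-type representation), so
  \<open>0 \<noteq> 1\<close>.\<close>

type_synonym fock = "nat set \<Rightarrow> (nat \<Rightarrow> nat) \<Rightarrow> complex"

definition cl_idx :: "'i::finite \<Rightarrow> nat" where
  "cl_idx = (SOME f. inj f)"

lemma inj_cl_idx: "inj (cl_idx :: 'i::finite \<Rightarrow> nat)"
proof -
  have "\<exists>f :: 'i \<Rightarrow> nat. inj f"
    using finite_imp_inj_to_nat_seg[of "UNIV :: 'i set"] by auto
  then show ?thesis unfolding cl_idx_def by (rule someI_ex)
qed

definition flip :: "nat \<Rightarrow> nat set \<Rightarrow> nat set" where
  "flip k S = (if k \<in> S then S - {k} else insert k S)"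

definition ladder :: "nat \<Rightarrow> ((nat \<Rightarrow> nat) \<Rightarrow> complex) \<Rightarrow> (nat \<Rightarrow> nat) \<Rightarrow> complex" where
  "ladder k \<psi> \<alpha> =
     (if odd k then (let l = Suc k div 2 in of_nat (Suc (\<alpha> l)) * \<psi> (\<alpha>(l := Suc (\<alpha> l))))
      else (let l = k div 2 in if \<alpha> l = 0 then 0 else \<psi> (\<alpha>(l := \<alpha> l - 1))))"

fun cl_act :: "'i::finite cgen \<Rightarrow> fock \<Rightarrow> fock" where
  "cl_act (Ge i) \<phi> = (\<lambda>S \<alpha>. \<i> * (-1) ^ card (S \<inter> {..<cl_idx i}) * \<phi> (flip (cl_idx i) S) \<alpha>)"
| "cl_act (Gs k) \<phi> = (\<lambda>S \<alpha>. (-1) ^ card (S \<inter> range (cl_idx :: 'i \<Rightarrow> nat)) * ladder k (\<phi> S) \<alpha>)"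

lemma flip_flip [simp]: "flip k (flip k S) = S"
  by (auto simp: flip_def)

lemma flip_commute: "flip k (flip l S) = flip l (flip k S)"
  by (auto simp: flip_def)

lemma sign_flip:
  assumes "finite T"
  shows "(-1 :: complex) ^ card (flip k S \<inter> T) =
         (if k \<in> T then - ((-1) ^ card (S \<inter> T)) else (-1) ^ card (S \<inter> T))"
proof (cases "k \<in> T")
  case True
  show ?thesis
  proof (cases "k \<in> S")
    case kS: True
    have e: "S \<inter> T = insert k (flip k S \<inter> T)" "k \<notin> flip k S \<inter> T"
      using True kS by (auto simp: flip_def)
    then have "card (S \<inter> T) = Suc (card (flip k S \<inter> T))"
      using assms by (metis card_insert_disjoint finite_Int)
    then show ?thesis using True by simp
  next
    case kS: False
    have e: "flip k S \<inter> T = insert k (S \<inter> T)" "k \<notin> S \<inter> T"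
      using True kS by (auto simp: flip_def)
    then have "card (flip k S \<inter> T) = Suc (card (S \<inter> T))"
      using assms by simp
    then show ?thesis using True by simp
  qed
next
  case False
  then have "flip k S \<inter> T = S \<inter> T" by (auto simp: flip_def)
  then show ?thesis using False by simp
qed

lemma cl_act_orthogonal:
  "cl_act (Ge i) (cl_act (Ge j) \<phi>) S \<alpha> + cl_act (Ge j) (cl_act (Ge i) \<phi>) S \<alpha>
     = (if i = j then -2 else 0) * \<phi> S \<alpha>" for i j :: "'i::finite"
proof (cases "i = j")
  case True
  then show ?thesis by (simp add: sign_flip power_mult_distrib[symmetric])
next
  case False
  then have "cl_idx i \<noteq> cl_idx j" using inj_cl_idx by (metis injD)
  then consider "cl_idx i < cl_idx j" | "cl_idx j < cl_idx i" by linarith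
  then show ?thesis
    using False by cases (simp_all add: sign_flip flip_commute[of "cl_idx i" "cl_idx j"])
qed

lemma ladder_scale: "ladder k (\<lambda>\<alpha>. c * \<psi> \<alpha>) \<alpha> = c * ladder k \<psi> \<alpha>"
  by (simp add: ladder_def Let_def)

lemma cl_act_mixed:
  "cl_act (Ge (i :: 'i)) (cl_act (Gs k :: 'i::finite cgen) \<phi>) S \<alpha>
     + cl_act (Gs k :: 'i cgen) (cl_act (Ge i) \<phi>) S \<alpha> = 0"
  by (simp add: sign_flip ladder_scale)

lemma ladder_commutator:
  "ladder j (ladder k \<psi>) \<alpha> - ladder k (ladder j \<psi>) \<alpha> = symp_form j k * \<psi> \<alpha>"
proof -
  consider a b where "j = 2 * a + 1" "k = 2 * b + 1" | a b where "j = 2 * a" "k = 2 * b"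
    | a b where "j = 2 * a + 1" "k = 2 * b" | a b where "j = 2 * a" "k = 2 * b + 1"
    by (metis oddE evenE)
  then show ?thesis
  proof cases
    case 1
    then show ?thesis
      using fun_upd_twist[of "Suc a" "Suc b" \<alpha>] by (cases "a = b") (simp_all add: ladder_def symp_form_def)
  next
    case 2
    have "2 * b \<noteq> Suc (2 * a)" "2 * a \<noteq> Suc (2 * b)" by presburger+
    then show ?thesis
      using 2 fun_upd_twist[of a b \<alpha>] by (cases "a = b") (simp_all add: ladder_def symp_form_def)
  next
    case 3
    then show ?thesis
      using fun_upd_twist[of "Suc a" b \<alpha>] by (cases "b = Suc a") (simp_all add: ladder_def symp_form_def algebra_simps)
  next
    case 4
    then show ?thesis
      using fun_upd_twist[of a "Suc b" \<alpha>] by (cases "a = Suc b") (simp_all add: ladder_def symp_form_def algebra_simps)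
  qed
qed

lemma cl_act_symplectic:
  "cl_act (Gs j :: 'i::finite cgen) (cl_act (Gs k :: 'i cgen) \<phi>) S \<alpha>
     - cl_act (Gs k :: 'i cgen) (cl_act (Gs j :: 'i cgen) \<phi>) S \<alpha>
     = symp_form j k * \<phi> S \<alpha>"
proof -
  have sq: "(-1 :: complex) ^ c * ((-1) ^ c * x) = x" for c x
    by (simp add: mult.assoc[symmetric] power_mult_distrib[symmetric])
  show ?thesis by (simp add: ladder_scale sq ladder_commutator)
qed

definition fword_act :: "'i::finite cgen fmon \<Rightarrow> fock \<Rightarrow> fock" where
  "fword_act w = foldr cl_act (letters w)"

definition free_act :: "'i::finite free_alg \<Rightarrow> fock \<Rightarrow> fock" where
  "free_act p \<phi> = (\<lambda>S \<alpha>. \<Sum>w\<in>Poly_Mapping.keys p. Poly_Mapping.lookup p w * fword_act w \<phi> S \<alpha>)"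

lemma free_act_superset:
  assumes "finite W" "Poly_Mapping.keys p \<subseteq> W"
  shows "free_act p \<phi> S \<alpha> = (\<Sum>w\<in>W. Poly_Mapping.lookup p w * fword_act w \<phi> S \<alpha>)"
  unfolding free_act_def using assms by (intro sum.mono_neutral_left) (auto simp: in_keys_iff)

lemma free_act_add: "free_act (p + q) \<phi> S \<alpha> = free_act p \<phi> S \<alpha> + free_act q \<phi> S \<alpha>"
proof -
  have W: "finite (Poly_Mapping.keys p \<union> Poly_Mapping.keys q)" "Poly_Mapping.keys (p + q) \<subseteq> Poly_Mapping.keys p \<union> Poly_Mapping.keys q"
    by (simp_all add: Poly_Mapping.keys_add)
  show ?thesis
    using W by (simp add: free_act_superset[of "Poly_Mapping.keys p \<union> Poly_Mapping.keys q"] lookup_add distrib_right sum.distrib)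
qed

lemma free_act_single: "free_act (Poly_Mapping.single w c) \<phi> S \<alpha> = c * fword_act w \<phi> S \<alpha>"
  by (subst free_act_superset[of "{w}"]) (auto simp: keys_single lookup_single)

lemma free_act_uminus: "free_act (- p) \<phi> S \<alpha> = - free_act p \<phi> S \<alpha>"
  using free_act_add[of p "- p" \<phi> S \<alpha>] by (simp add: free_act_def add_eq_0_iff)

lemma free_act_diff: "free_act (p - q) \<phi> S \<alpha> = free_act p \<phi> S \<alpha> - free_act q \<phi> S \<alpha>"
  using free_act_add[of p "- q" \<phi> S \<alpha>] by (simp add: free_act_uminus)

lemma cl_act_sum: "cl_act s (\<lambda>S \<alpha>. \<Sum>w\<in>W. c w * f w S \<alpha>) S \<alpha> = (\<Sum>w\<in>W. c w * cl_act s (f w) S \<alpha>)"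
  by (cases s) (auto simp: ladder_def Let_def sum_distrib_left mult_ac)

lemma fword_act_sum:
  "fword_act u (\<lambda>S \<alpha>. \<Sum>w\<in>W. c w * f w S \<alpha>) S \<alpha> = (\<Sum>w\<in>W. c w * fword_act u (f w) S \<alpha>)"
proof -
  have "foldr cl_act l (\<lambda>S \<alpha>. \<Sum>w\<in>W. c w * f w S \<alpha>)
      = (\<lambda>S \<alpha>. \<Sum>w\<in>W. c w * foldr cl_act l (f w) S \<alpha>)" for l
    by (induction l) (auto simp: cl_act_sum)
  from fun_cong[OF fun_cong[OF this[of "letters u"]]] show ?thesis
    unfolding fword_act_def .
qed

lemma fword_act_plus: "fword_act (u + v) \<phi> = fword_act u (fword_act v \<phi>)"
  by (simp add: fword_act_def plus_fmon_def)

lemma single_induct [case_names zero single add]: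
  assumes "P 0" "\<And>w c. P (Poly_Mapping.single w c)" "\<And>p q. P p \<Longrightarrow> P q \<Longrightarrow> P (p + q)"
  shows "P (p :: 'w \<Rightarrow>\<^sub>0 'b::comm_monoid_add)"
proof (induction p rule: update_induct)
  case const
  then show ?case using assms(1) by simp
next
  case (update f a b)
  have "Poly_Mapping.update a b f = f + Poly_Mapping.single a b"
    using update by (intro poly_mapping_eqI) (auto simp: lookup_update lookup_add lookup_single in_keys_iff when_def)
  then show ?case using assms(2,3) update by simp
qed

lemma free_act_mult: "free_act (p * q) \<phi> = free_act p (free_act q \<phi>)"
proof (induction p rule: single_induct)
  case zero
  show ?case by (simp add: free_act_def)
next
  case (single u c)
  show ?case
  proof (induction q rule: single_induct)
    case zero
    have "fword_act u (\<lambda>S \<alpha>. 0) S \<alpha> = 0" for S \<alpha>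
      using fword_act_sum[where u = u and W = "{}"] by simp
    then show ?case by (auto simp: fun_eq_iff free_act_single) (simp add: free_act_def)
  next
    case (single v d)
    have "fword_act u (\<lambda>S \<alpha>. d * fword_act v \<phi> S \<alpha>) S \<alpha> = d * fword_act u (fword_act v \<phi>) S \<alpha>" for S \<alpha>
      using fword_act_sum[where u = u and W = "{0 :: nat}" and c = "\<lambda>_. d" and f = "\<lambda>_. fword_act v \<phi>"] by simp
    moreover have "free_act (Poly_Mapping.single v d) \<phi> = (\<lambda>S \<alpha>. d * fword_act v \<phi> S \<alpha>)"
      by (simp add: fun_eq_iff free_act_single)
    ultimately show ?case
      by (simp add: fun_eq_iff mult_single free_act_single fword_act_plus)
  next
    case (add q r)
    have "fword_act u (\<lambda>S \<alpha>. f S \<alpha> + h S \<alpha>) S \<alpha> = fword_act u f S \<alpha> + fword_act u h S \<alpha>" for f h S \<alpha>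
      using fword_act_sum[where u = u and W = "{True, False}" and c = "\<lambda>_. 1" and f = "\<lambda>b. if b then f else h"] by simp
    moreover have "free_act (q + r) \<phi> = (\<lambda>S \<alpha>. free_act q \<phi> S \<alpha> + free_act r \<phi> S \<alpha>)"
      by (simp add: fun_eq_iff free_act_add)
    ultimately show ?case
      using add by (simp add: fun_eq_iff distrib_left free_act_add free_act_single)
  qed
next
  case (add p r)
  then show ?case by (simp add: fun_eq_iff distrib_right free_act_add)
qed

lemma free_act_fgen: "free_act (fgen s) \<phi> = cl_act s \<phi>"
  by (simp add: fun_eq_iff fgen_def free_act_single fword_act_def)

lemma free_act_fscalar: "free_act (fscalar c) \<phi> S \<alpha> = c * \<phi> S \<alpha>"
  by (simp add: fscalar_def free_act_single fword_act_def zero_fmon_def)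

lemma free_act_ideal:
  assumes "p \<in> clifford_ideal"
  shows "free_act p \<phi> = (\<lambda>S \<alpha>. 0)"
  using assms
proof (induction arbitrary: \<phi>)
  case (orthogonal j k)
  show ?case
    by (intro ext) (simp add: free_act_add free_act_diff free_act_mult free_act_fgen
        free_act_fscalar cl_act_orthogonal del: cl_act.simps)
next
  case (mixed j k)
  show ?case
    by (intro ext) (simp add: free_act_add free_act_mult free_act_fgen cl_act_mixed
        del: cl_act.simps)
next
  case (symplectic j k)
  show ?case
    by (intro ext) (simp add: free_act_diff free_act_mult free_act_fgen
        free_act_fscalar cl_act_symplectic del: cl_act.simps)
next
  case (add p q)
  then show ?case by (simp add: fun_eq_iff free_act_add)
next
  case (mult p a b)
  have "free_act a (\<lambda>S \<alpha>. 0) = (\<lambda>S \<alpha>. 0)"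
    using free_act_mult[of a 0] by (simp add: free_act_def)
  then show ?case using mult by (simp add: free_act_mult)
qed

instantiation clifford :: (finite) ring_1
begin

lift_definition zero_clifford :: "'a clifford" is 0 .
lift_definition one_clifford :: "'a clifford" is 1 .

lift_definition plus_clifford :: "'a clifford \<Rightarrow> 'a clifford \<Rightarrow> 'a clifford" is "(+)"
proof -
  fix p p' q q' :: "'a free_alg"
  assume "clifford_eq p p'" "clifford_eq q q'"
  then have "(p - p') + (q - q') \<in> clifford_ideal"
    by (auto simp: clifford_eq_def intro: clifford_ideal.add)
  then show "clifford_eq (p + q) (p' + q')" by (simp add: clifford_eq_def algebra_simps)
qed

lift_definition uminus_clifford :: "'a clifford \<Rightarrow> 'a clifford" is uminus
proof -
  fix p p' :: "'a free_alg"
  assume "clifford_eq p p'"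
  then have "- (p - p') \<in> clifford_ideal"
    by (auto simp: clifford_eq_def intro: clifford_ideal_minus simp del: minus_diff_eq)
  then show "clifford_eq (- p) (- p')" by (simp add: clifford_eq_def)
qed

lift_definition minus_clifford :: "'a clifford \<Rightarrow> 'a clifford \<Rightarrow> 'a clifford" is "(-)"
proof -
  fix p p' q q' :: "'a free_alg"
  assume "clifford_eq p p'" "clifford_eq q q'"
  then have "(p - p') + - (q - q') \<in> clifford_ideal"
    unfolding clifford_eq_def by (intro clifford_ideal.add clifford_ideal_minus)
  then show "clifford_eq (p - q) (p' - q')" by (simp add: clifford_eq_def algebra_simps)
qed

lift_definition times_clifford :: "'a clifford \<Rightarrow> 'a clifford \<Rightarrow> 'a clifford" is "(*)"
proof -
  fix p p' q q' :: "'a free_alg"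
  assume "clifford_eq p p'" "clifford_eq q q'"
  then have "1 * (p - p') * q + p' * (q - q') * 1 \<in> clifford_ideal"
    by (intro clifford_ideal.add clifford_ideal.mult) (simp_all add: clifford_eq_def)
  then show "clifford_eq (p * q) (p' * q')" by (simp add: clifford_eq_def algebra_simps)
qed

lemma clifford_eq_refl: "p = q \<Longrightarrow> clifford_eq p q"
  by (simp add: clifford_eq_def clifford_ideal_zero)

instance
proof
  fix a b c :: "'a clifford"
  show "a * b * c = a * (b * c)"
    by (transfer, rule clifford_eq_refl, rule mult.assoc)
  show "a + b + c = a + (b + c)"
    by (transfer, rule clifford_eq_refl, rule add.assoc)
  show "a + b = b + a"
    by (transfer, rule clifford_eq_refl, rule add.commute)
  show "0 + a = a" "- a + a = 0" "a - b = a + - b" "1 * a = a" "a * 1 = a"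
    by (transfer, rule clifford_eq_refl, simp)+
  show "(a + b) * c = a * c + b * c"
    by (transfer, rule clifford_eq_refl, rule distrib_right)
  show "a * (b + c) = a * b + a * c"
    by (transfer, rule clifford_eq_refl, rule distrib_left)
  show "(0 :: 'a clifford) \<noteq> 1"
  proof transfer
    show "\<not> clifford_eq (0 :: 'a free_alg) 1"
    proof
      assume "clifford_eq (0 :: 'a free_alg) 1"
      then have "(1 :: 'a free_alg) \<in> clifford_ideal"
        using clifford_ideal_minus[of "- 1"] by (simp add: clifford_eq_def)
      moreover have "(1 :: 'a free_alg) = fscalar 1"
        by (simp add: fscalar_def)
      ultimately have "fscalar 1 \<in> (clifford_ideal :: 'a free_alg set)"
        by simp
      from free_act_ideal[OF this, of "\<lambda>S \<alpha>. 1"] show False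
        by (simp add: fun_eq_iff free_act_fscalar)
    qed
  qed
qed

end

lift_definition cl_scalar :: "complex \<Rightarrow> 'i::finite clifford" is fscalar .
lift_definition cl_e :: "'i::finite \<Rightarrow> 'i clifford" is "\<lambda>i. fgen (Ge i)" .
lift_definition cl_s :: "nat \<Rightarrow> 'i::finite clifford" is "\<lambda>j. fgen (Gs j)" .

lemma cl_relations:
  "cl_e i * cl_e k + cl_e k * cl_e i = cl_scalar (if i = k then -2 else 0)"
  "cl_e i * cl_s j + cl_s j * cl_e i = 0"
  "cl_s j * cl_s l - cl_s l * cl_s j = cl_scalar (symp_form j l)"
  by (transfer, simp add: clifford_eq_def clifford_ideal.intros)+

inductive_set clifford_sub :: "nat \<Rightarrow> 'i::finite clifford set" for n where
  "cl_scalar c \<in> clifford_sub n"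
| "cl_e i \<in> clifford_sub n"
| "1 \<le> j \<Longrightarrow> j \<le> 2 * n \<Longrightarrow> cl_s j \<in> clifford_sub n"
| "a \<in> clifford_sub n \<Longrightarrow> b \<in> clifford_sub n \<Longrightarrow> a + b \<in> clifford_sub n"
| "a \<in> clifford_sub n \<Longrightarrow> b \<in> clifford_sub n \<Longrightarrow> a * b \<in> clifford_sub n"


section \<open>The Grassmann algebra\<close>

text \<open>Grassmann algebra on generators indexed by \<open>nat\<close>, with coefficients in a ring whose elements
  commute with the generators; \<open>gcoeff a A\<close> is the coefficient of the monomial with index set \<open>A\<close>,
  its factors taken in increasing order.\<close>

typedef (overloaded) 'a grass =
  "{f :: nat set \<Rightarrow> 'a::zero. finite {A. f A \<noteq> 0} \<and> (\<forall>A. f A \<noteq> 0 \<longrightarrow> finite A)}"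
  morphisms gcoeff Abs_grass
  by (intro exI[of _ "\<lambda>_. 0"]) simp

setup_lifting type_definition_grass

lemma grass_eqI: "(\<And>A. gcoeff a A = gcoeff b A) \<Longrightarrow> a = b"
  by (simp add: gcoeff_inject[symmetric] fun_eq_iff)

lemma gcoeff_infinite: "infinite A \<Longrightarrow> gcoeff a A = 0"
  using gcoeff[of a] by auto

definition inversions :: "nat set \<Rightarrow> nat set \<Rightarrow> nat" where
  "inversions A B = card {(a, b). a \<in> A \<and> b \<in> B \<and> b < a}"

lemma inversions_empty [simp]: "inversions {} B = 0" "inversions A {} = 0"
  by (simp_all add: inversions_def)

lemma inversions_Un_left:
  assumes "finite A" "finite B" "finite C" "A \<inter> B = {}"
  shows "inversions (A \<union> B) C = inversions A C + inversions B C"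
proof -
  have "{(a, b). a \<in> A \<union> B \<and> b \<in> C \<and> b < a}
      = {(a, b). a \<in> A \<and> b \<in> C \<and> b < a} \<union> {(a, b). a \<in> B \<and> b \<in> C \<and> b < a}" by auto
  moreover have "finite {(a, b). a \<in> X \<and> b \<in> C \<and> b < a}" if "finite X" for X
    by (rule finite_subset[OF _ finite_cartesian_product[OF that assms(3)]]) auto
  ultimately show ?thesis
    unfolding inversions_def using assms by (subst card_Un_disjoint[symmetric]) auto
qed

lemma inversions_Un_right:
  assumes "finite A" "finite B" "finite C" "B \<inter> C = {}"
  shows "inversions A (B \<union> C) = inversions A B + inversions A C"
proof -
  have "{(a, b). a \<in> A \<and> b \<in> B \<union> C \<and> b < a}
      = {(a, b). a \<in> A \<and> b \<in> B \<and> b < a} \<union> {(a, b). a \<in> A \<and> b \<in> C \<and> b < a}" by auto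
  moreover have "finite {(a, b). a \<in> A \<and> b \<in> X \<and> b < a}" if "finite X" for X
    by (rule finite_subset[OF _ finite_cartesian_product[OF assms(1) that]]) auto
  ultimately show ?thesis
    unfolding inversions_def using assms by (subst card_Un_disjoint[symmetric]) auto
qed

lemma minus_one_power_commute: "(-1) ^ k * x = x * (-1) ^ k" for x :: "'a::ring_1"
  by (cases "even k") simp_all

instantiation grass :: (ab_group_add) ab_group_add
begin

lift_definition zero_grass :: "'a grass" is "\<lambda>_. 0" by simp

lift_definition plus_grass :: "'a grass \<Rightarrow> 'a grass \<Rightarrow> 'a grass" is "\<lambda>a b A. a A + b A"
proof (intro conjI)
  fix a b :: "nat set \<Rightarrow> 'a"
  assume *: "finite {A. a A \<noteq> 0} \<and> (\<forall>A. a A \<noteq> 0 \<longrightarrow> finite A)"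
    "finite {A. b A \<noteq> 0} \<and> (\<forall>A. b A \<noteq> 0 \<longrightarrow> finite A)"
  then have "finite ({A. a A \<noteq> 0} \<union> {A. b A \<noteq> 0})" by simp
  then show "finite {A. a A + b A \<noteq> 0}" by (rule rev_finite_subset) auto
  show "\<forall>A. a A + b A \<noteq> 0 \<longrightarrow> finite A"
  proof (intro allI impI)
    fix A assume "a A + b A \<noteq> 0"
    then have "a A \<noteq> 0 \<or> b A \<noteq> 0" by auto
    then show "finite A" using * by auto
  qed
qed

lift_definition uminus_grass :: "'a grass \<Rightarrow> 'a grass" is "\<lambda>a A. - a A" by simp

definition minus_grass :: "'a grass \<Rightarrow> 'a grass \<Rightarrow> 'a grass" where "minus_grass a b = a + - b"

instance
  by standard (simp add: minus_grass_def | transfer, simp add: fun_eq_iff algebra_simps)+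

end

lemma gcoeff_add [simp]: "gcoeff (a + b) A = gcoeff a A + gcoeff b A"
  by transfer simp

lemma gcoeff_uminus [simp]: "gcoeff (- a) A = - gcoeff a A"
  by transfer simp

lemma gcoeff_diff [simp]: "gcoeff (a - b) A = gcoeff a A - gcoeff b A"
  using gcoeff_add[of a "- b" A] by simp

lemma gcoeff_zero [simp]: "gcoeff 0 A = 0"
  by transfer simp

lift_definition gconst :: "'a::zero \<Rightarrow> 'a grass" is "\<lambda>c A. if A = {} then c else 0"
  by (auto intro: finite_subset[of _ "{{}}"])

lift_definition gmono :: "nat set \<Rightarrow> 'a::zero_neq_one grass" is
  "\<lambda>B A. if A = B \<and> finite A then 1 else 0"
  by (auto intro: finite_subset[of _ "{_}"])

instantiation grass :: (ring_1) ring_1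
begin

definition one_grass :: "'a grass" where "one_grass = gconst 1"

lift_definition times_grass :: "'a grass \<Rightarrow> 'a grass \<Rightarrow> 'a grass" is
  "\<lambda>a b C. \<Sum>A\<in>Pow C. (-1) ^ inversions A (C - A) * a A * b (C - A)"
proof (intro conjI)
  fix a b :: "nat set \<Rightarrow> 'a"
  assume *: "finite {A. a A \<noteq> 0} \<and> (\<forall>A. a A \<noteq> 0 \<longrightarrow> finite A)"
    "finite {A. b A \<noteq> 0} \<and> (\<forall>A. b A \<noteq> 0 \<longrightarrow> finite A)"
  let ?p = "\<lambda>C. \<Sum>A\<in>Pow C. (-1) ^ inversions A (C - A) * a A * b (C - A)"
  have sub: "\<exists>A \<subseteq> C. a A \<noteq> 0 \<and> b (C - A) \<noteq> 0" if "?p C \<noteq> 0" for C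
  proof (rule ccontr)
    assume "\<not> ?thesis"
    then have "?p C = 0" by (intro sum.neutral) auto
    with that show False by simp
  qed
  have "{C. ?p C \<noteq> 0} \<subseteq> (\<lambda>(A, B). A \<union> B) ` ({A. a A \<noteq> 0} \<times> {A. b A \<noteq> 0})"
  proof
    fix C assume "C \<in> {C. ?p C \<noteq> 0}"
    then obtain A where "A \<subseteq> C" "a A \<noteq> 0" "b (C - A) \<noteq> 0" using sub by auto
    then show "C \<in> (\<lambda>(A, B). A \<union> B) ` ({A. a A \<noteq> 0} \<times> {A. b A \<noteq> 0})"
      by (intro image_eqI[of _ _ "(A, C - A)"]) auto
  qed
  then show "finite {C. ?p C \<noteq> 0}"
    by (rule finite_subset) (use * in auto)
  show "\<forall>C. ?p C \<noteq> 0 \<longrightarrow> finite C"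
  proof (intro allI impI)
    fix C assume "?p C \<noteq> 0"
    then have "finite (Pow C)" using sum.infinite by blast
    then show "finite C" by simp
  qed
qed

instance
proof
  fix a b c :: "'a grass"
  show "a * b * c = a * (b * c)"
  proof (rule grass_eqI)
    fix D
    show "gcoeff (a * b * c) D = gcoeff (a * (b * c)) D"
    proof (cases "finite D")
      case fin: True
      have fs: "finite A" if "A \<subseteq> D" for A using fin that by (rule rev_finite_subset)
      let ?t = "\<lambda>C A. (-1) ^ inversions C (D - C) * ((-1) ^ inversions A (C - A) * gcoeff a A * gcoeff b (C - A))
                   * gcoeff c (D - C)"
      let ?u = "\<lambda>A B. (-1) ^ inversions A (D - A) * gcoeff a A *
                   ((-1) ^ inversions B (D - A - B) * gcoeff b B * gcoeff c (D - A - B))"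
      have eq: "?u A (C - A) = ?t C A" if "C \<subseteq> D" "A \<subseteq> C" for A C
      proof -
        have sets: "D - A - (C - A) = D - C" "C = A \<union> (C - A)" "D - A = (C - A) \<union> (D - C)"
          using that by auto
        have "inversions C (D - C) = inversions A (D - C) + inversions (C - A) (D - C)"
          by (subst sets(2), rule inversions_Un_left) (use that fs in auto)
        moreover have "inversions A (D - A) = inversions A (C - A) + inversions A (D - C)"
          by (subst sets(3), rule inversions_Un_right) (use that fs in auto)
        ultimately have sgn: "inversions A (D - A) + inversions (C - A) (D - C)
            = inversions C (D - C) + inversions A (C - A)" by simp
        have "?u A (C - A) = (-1) ^ inversions A (D - A) * (gcoeff a A * (-1) ^ inversions (C - A) (D - C))
             * gcoeff b (C - A) * gcoeff c (D - C)"
          by (simp add: sets(1) mult.assoc)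
        also have "\<dots> = (-1) ^ (inversions A (D - A) + inversions (C - A) (D - C))
             * gcoeff a A * gcoeff b (C - A) * gcoeff c (D - C)"
          by (simp only: minus_one_power_commute[of _ "gcoeff a A", symmetric] power_add mult.assoc)
        also have "\<dots> = ?t C A"
          by (simp only: sgn power_add mult.assoc)
        finally show ?thesis .
      qed
      have "gcoeff (a * b * c) D = (\<Sum>C\<in>Pow D. \<Sum>A\<in>Pow C. ?t C A)"
        by (simp add: times_grass.rep_eq sum_distrib_left sum_distrib_right)
      also have "\<dots> = (\<Sum>(C, A)\<in>Sigma (Pow D) Pow. ?t C A)"
        using fin by (intro sum.Sigma) (auto intro: fs)
      also have "\<dots> = (\<Sum>(A, B)\<in>(SIGMA A:Pow D. Pow (D - A)). ?u A B)"
        by (rule sum.reindex_bij_witness[of _ "\<lambda>(A, B). (A \<union> B, A)" "\<lambda>(C, A). (A, C - A)"])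
           (auto simp: eq)
      also have "\<dots> = (\<Sum>A\<in>Pow D. \<Sum>B\<in>Pow (D - A). ?u A B)"
        using fin by (intro sum.Sigma[symmetric]) auto
      also have "\<dots> = gcoeff (a * (b * c)) D"
        by (simp add: times_grass.rep_eq sum_distrib_left)
      finally show ?thesis .
    qed (simp add: gcoeff_infinite)
  qed
  show "(a + b) * c = a * c + b * c" "a * (b + c) = a * b + a * c"
    by (rule grass_eqI, simp add: times_grass.rep_eq distrib_left distrib_right sum.distrib)+
  show "1 * a = a"
  proof (rule grass_eqI)
    fix C
    show "gcoeff (1 * a) C = gcoeff a C"
    proof (cases "finite C")
      case True
      have "gcoeff (1 * a) C = (\<Sum>A\<in>Pow C. if A = {} then gcoeff a C else 0)"
        unfolding times_grass.rep_eq one_grass_def gconst.rep_eq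
        by (intro sum.cong) simp_all
      with True show ?thesis by simp
    qed (simp add: gcoeff_infinite)
  qed
  show "a * 1 = a"
  proof (rule grass_eqI)
    fix C
    show "gcoeff (a * 1) C = gcoeff a C"
    proof (cases "finite C")
      case True
      have "gcoeff (a * 1) C = (\<Sum>A\<in>Pow C. if A = C then gcoeff a C else 0)"
        unfolding times_grass.rep_eq one_grass_def gconst.rep_eq
        by (intro sum.cong) auto
      with True show ?thesis by simp
    qed (simp add: gcoeff_infinite)
  qed
  have "gcoeff (0 :: 'a grass) {} \<noteq> gcoeff 1 {}"
    by (simp add: one_grass_def gconst.rep_eq)
  then show "(0 :: 'a grass) \<noteq> 1" by (rule contrapos_nn) simp
qed

end

text \<open>Left derivative with respect to the \<open>j\<close>-th generator: moving that generator to the front of an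
  increasing monomial produces the sign.\<close>

lift_definition gderiv :: "nat \<Rightarrow> 'a::ring_1 grass \<Rightarrow> 'a grass" is
  "\<lambda>j a A. if j \<in> A then 0 else (-1) ^ card {i \<in> A. i < j} * a (insert j A)"
proof (intro conjI)
  fix j and a :: "nat set \<Rightarrow> 'a"
  assume *: "finite {A. a A \<noteq> 0} \<and> (\<forall>A. a A \<noteq> 0 \<longrightarrow> finite A)"
  let ?d = "\<lambda>A. if j \<in> A then 0 else (-1) ^ card {i \<in> A. i < j} * a (insert j A)"
  have "{A. ?d A \<noteq> 0} \<subseteq> (\<lambda>A. A - {j}) ` {A. a A \<noteq> 0}"
  proof
    fix A assume "A \<in> {A. ?d A \<noteq> 0}"
    then have "j \<notin> A" "a (insert j A) \<noteq> 0" by (auto split: if_splits)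
    then show "A \<in> (\<lambda>A. A - {j}) ` {A. a A \<noteq> 0}"
      by (intro image_eqI[of _ _ "insert j A"]) auto
  qed
  then show "finite {A. ?d A \<noteq> 0}"
    by (rule finite_subset) (use * in auto)
  show "\<forall>A. ?d A \<noteq> 0 \<longrightarrow> finite A"
  proof (intro allI impI)
    fix A assume "?d A \<noteq> 0"
    then have "a (insert j A) \<noteq> 0" by (auto split: if_splits)
    from mp[OF spec[OF conjunct2[OF *]] this] have "finite (insert j A)" .
    then show "finite A" by simp
  qed
qed

lemma cl_scalar_zero [simp]: "cl_scalar 0 = 0"
  by transfer (simp add: fscalar_def clifford_eq_refl)

lift_definition gcomplex :: "complex grass \<Rightarrow> 'i::finite clifford grass" is
  "\<lambda>a A. cl_scalar (a A)"
proof (intro conjI)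
  fix a :: "nat set \<Rightarrow> complex"
  assume *: "finite {A. a A \<noteq> 0} \<and> (\<forall>A. a A \<noteq> 0 \<longrightarrow> finite A)"
  have sub: "a A \<noteq> 0" if "cl_scalar (a A) \<noteq> 0" for A
    using that by auto
  show "finite {A. cl_scalar (a A) \<noteq> 0}"
    by (rule finite_subset[of _ "{A. a A \<noteq> 0}"]) (use * sub in auto)
  show "\<forall>A. cl_scalar (a A) \<noteq> 0 \<longrightarrow> finite A"
    by (intro allI impI) (rule mp[OF spec[OF conjunct2[OF *]] sub])
qed

lemma gderiv_one: "gderiv j 1 = 0"
  by (rule grass_eqI) (simp add: gderiv.rep_eq one_grass_def gconst.rep_eq)

lemma gderiv_generator:
  "gderiv j (gmono {k} * a) + gmono {k} * gderiv j a = (if j = k then a else 0)"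
proof (rule grass_eqI)
  fix A
  have mono: "gcoeff (gmono {k} * b) B = (if k \<in> B then (-1) ^ card {i \<in> B. i < k} * gcoeff b (B - {k}) else 0)"
    for b :: "'a grass" and B
  proof (cases "finite B")
    case True
    have "gcoeff (gmono {k} * b) B
        = (\<Sum>C\<in>Pow B. if C = {k} then (-1) ^ inversions {k} (B - {k}) * gcoeff b (B - {k}) else 0)"
      unfolding times_grass.rep_eq gmono.rep_eq by (intro sum.cong) auto
    also have "\<dots> = (if k \<in> B then (-1) ^ inversions {k} (B - {k}) * gcoeff b (B - {k}) else 0)"
      using True by simp
    also have "inversions {k} (B - {k}) = card {i \<in> B. i < k}"
      unfolding inversions_def
      by (rule bij_betw_same_card[of snd]) (auto simp: bij_betw_def inj_on_def image_iff)
    finally show ?thesis .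
  qed (simp add: gcoeff_infinite)
  show "gcoeff (gderiv j (gmono {k} * a) + gmono {k} * gderiv j a) A = gcoeff (if j = k then a else 0) A"
  proof (cases "finite A")
    case fin: True
    show ?thesis
    proof (cases "j = k")
      case True
      have "{i \<in> insert k A. i < k} = {i \<in> A. i < k}" "{i \<in> A - {k}. i < k} = {i \<in> A. i < k}" by auto
      then show ?thesis
        using True by (simp add: mono gderiv.rep_eq insert_absorb mult.assoc[symmetric] power_mult_distrib[symmetric] flip: power_add)
    next
      case ne: False
      show ?thesis
      proof (cases "j \<notin> A \<and> k \<in> A")
        case jk: True
        have e1: "insert j A - {k} = insert j (A - {k})" using ne by auto
        have c1: "card {i \<in> insert j A. i < k} = card {i \<in> A. i < k} + (if j < k then 1 else 0)"
        proof (cases "j < k")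
          case True
          then have "{i \<in> insert j A. i < k} = insert j {i \<in> A. i < k}" by auto
          then show ?thesis using True jk fin by simp
        qed (auto intro: arg_cong[of _ _ card])
        have c2: "card {i \<in> A. i < j} = card {i \<in> A - {k}. i < j} + (if k < j then 1 else 0)"
        proof (cases "k < j")
          case True
          then have "{i \<in> A. i < j} = insert k {i \<in> A - {k}. i < j}" using jk by auto
          then show ?thesis using True fin by simp
        next
          case False
          then have "{i \<in> A. i < j} = {i \<in> A - {k}. i < j}" by auto
          then show ?thesis using False by simp
        qed
        have comm: "(-1 :: 'a) ^ p * ((-1) ^ q * x) = (-1) ^ q * ((-1) ^ p * x)" for p q x
          by (simp add: mult.assoc[symmetric] power_add[symmetric] add.commute)
        have l1: "gcoeff (gderiv j (gmono {k} * a)) A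
            = (-1) ^ card {i \<in> A. i < j} * ((-1) ^ card {i \<in> insert j A. i < k} * gcoeff a (insert j A - {k}))"
          using jk ne by (simp add: gderiv.rep_eq mono)
        have l2: "gcoeff (gmono {k} * gderiv j a) A
            = (-1) ^ card {i \<in> A. i < k} * ((-1) ^ card {i \<in> A - {k}. i < j} * gcoeff a (insert j (A - {k})))"
          using jk ne by (simp add: gderiv.rep_eq mono)
        show ?thesis
          unfolding gcoeff_add l1 l2 c1 c2 e1 using ne by (cases "j < k") (simp_all add: comm)
      qed (use ne in \<open>auto simp: mono gderiv.rep_eq\<close>)
    qed
  qed (simp add: gcoeff_infinite)
qed

abbreviation cnum :: "complex \<Rightarrow> 'i::finite clifford grass" where
  "cnum c \<equiv> gconst (cl_scalar c)"

definition berezin :: "nat \<Rightarrow> 'i::finite clifford grass \<Rightarrow> 'i clifford grass" where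
  "berezin n a = cnum (of_real (1 / pi ^ n)) * fold gderiv [1..<2 * n + 1] a"

definition body :: "complex grass \<Rightarrow> real" where
  "body a = Re (gcoeff a {})"

definition nilpart :: "complex grass \<Rightarrow> complex grass" where
  "nilpart a = a - gconst (gcoeff a {})"

definition gpow :: "nat \<Rightarrow> complex grass \<Rightarrow> real \<Rightarrow> complex grass" where
  "gpow n a p = (\<Sum>j=0..n. gconst (of_real ((\<Prod>i<j. p - real i) / fact j * body a powr (p - real j)))
                   * nilpart a ^ j)"


section \<open>Smooth functions and distributions\<close>

primrec ck_on :: "nat \<Rightarrow> 'v::real_normed_vector set \<Rightarrow> ('v \<Rightarrow> complex) \<Rightarrow> bool" where
  "ck_on 0 S f \<longleftrightarrow> continuous_on S f"
| "ck_on (Suc k) S f \<longleftrightarrow> (\<forall>x\<in>S. f differentiable (at x)) \<and>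
     (\<forall>v. ck_on k S (\<lambda>x. frechet_derivative f (at x) v))"

text \<open>Meant for open \<open>S\<close> only.\<close>

definition smooth_on :: "'v::real_normed_vector set \<Rightarrow> ('v \<Rightarrow> complex) \<Rightarrow> bool" where
  "smooth_on S f \<longleftrightarrow> (\<forall>k. ck_on k S f)"

definition pderivative :: "'i \<Rightarrow> (real ^ 'i \<Rightarrow> complex) \<Rightarrow> real ^ 'i::finite \<Rightarrow> complex" where
  "pderivative i f x = frechet_derivative f (at x) (axis i 1)"

type_synonym 'v distribution = "('v \<Rightarrow> complex) \<Rightarrow> complex"

definition test_function :: "('v::real_normed_vector \<Rightarrow> complex) \<Rightarrow> bool" where
  "test_function \<phi> \<longleftrightarrow> smooth_on UNIV \<phi> \<and> compact (closure {x. \<phi> x \<noteq> 0})"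

definition dist_support :: "'v::real_normed_vector distribution \<Rightarrow> 'v set" where
  "dist_support T = - \<Union> {W. open W \<and>
     (\<forall>\<phi>. test_function \<phi> \<longrightarrow> closure {x. \<phi> x \<noteq> 0} \<subseteq> W \<longrightarrow> T \<phi> = 0)}"

text \<open>Pairing of a compactly supported distribution with a function that is smooth near its support
  only: multiply by a cutoff that is 1 near the support. The value does not depend on the cutoff.\<close>

definition dist_pair :: "'v::real_normed_vector distribution \<Rightarrow> ('v \<Rightarrow> complex) \<Rightarrow> complex" where
  "dist_pair T f = (THE c. \<exists>S W \<eta>. open S \<and> smooth_on S f \<and> test_function \<eta> \<and>
     closure {x. \<eta> x \<noteq> 0} \<subseteq> S \<and> open W \<and> dist_support T \<subseteq> W \<and> (\<forall>x\<in>W. \<eta> x = 1) \<and>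
     c = T (\<lambda>x. \<eta> x * f x))"

definition delta_deriv :: "nat \<Rightarrow> real distribution" where
  "delta_deriv j \<psi> = (-1) ^ j * ((\<lambda>h t. vector_derivative h (at t)) ^^ j) \<psi> 0"

text \<open>Integration of \<open>\<phi>\<close> over the fibres of \<open>h\<close>: the Lebesgue density of the image of the measure
  \<open>\<phi> dx\<close> under \<open>h\<close>. The pullback of a distribution by \<open>h\<close> is the transpose of this operation. For
  \<open>delta_deriv j\<close> only the values near \<open>t = 0\<close> matter, where the fibre integral of a test function is
  smooth as soon as the gradient of \<open>h\<close> does not vanish on \<open>h = 0\<close>.\<close>

definition fibre_integral ::
    "('v::euclidean_space \<Rightarrow> real) \<Rightarrow> ('v \<Rightarrow> complex) \<Rightarrow> real \<Rightarrow> complex" where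
  "fibre_integral h \<phi> t = vector_derivative (\<lambda>s. LINT x:{x. h x \<le> s}|lborel. \<phi> x) (at t)"

definition dist_pullback ::
    "('v::euclidean_space \<Rightarrow> real) \<Rightarrow> real distribution \<Rightarrow> 'v distribution" where
  "dist_pullback h u \<phi> = u (fibre_integral h \<phi>)"

text \<open>Extension of a linear operation \<open>L\<close> on smooth scalar functions near \<open>K\<close> to functions with values
  in the Clifford algebra, i.e.\ to elements \<open>\<Sum> f\<^sub>k \<otimes> c\<^sub>k\<close> of the algebraic tensor product. The value
  does not depend on the representation.\<close>

definition tensor_repr :: "'v::real_normed_vector set \<Rightarrow> ('v \<Rightarrow> 'i::finite clifford) \<Rightarrow> nat \<Rightarrow>
    (nat \<Rightarrow> 'v \<Rightarrow> complex) \<Rightarrow> (nat \<Rightarrow> 'i clifford) \<Rightarrow> bool" where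
  "tensor_repr S F N f c \<longleftrightarrow> (\<forall>k<N. smooth_on S (f k)) \<and>
     (\<forall>x\<in>S. F x = (\<Sum>k<N. cl_scalar (f k x) * c k))"

definition tensor_ext :: "(('v::real_normed_vector \<Rightarrow> complex) \<Rightarrow> complex) \<Rightarrow> 'v set \<Rightarrow>
    ('v \<Rightarrow> 'i::finite clifford) \<Rightarrow> 'i clifford" where
  "tensor_ext L K F = (THE v. \<exists>S N f c. open S \<and> K \<subseteq> S \<and> tensor_repr S F N f c \<and>
     v = (\<Sum>k<N. cl_scalar (L (f k)) * c k))"


section \<open>Superfunctions and superdistributions\<close>

text \<open>The coordinates of \<open>R\<^bsup>2m\<^esup>\<close> are indexed by \<open>'m + 'm\<close> with \<open>m = CARD('m)\<close>; \<open>Inl j\<close> and \<open>Inr j\<close> stand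
  for the indices \<open>j\<close> and \<open>m + j\<close>. Among the Grassmann generators, those with index \<open>1, \<dots>, 2n\<close> are the
  variables \<open>x`\<^sub>j\<close>, and the one with index \<open>2n + j\<close> is the parameter \<open>y`\<^sub>j\<close>.\<close>

type_synonym 'm point = "real ^ ('m + 'm)"
type_synonym 'm cliff = "('m + 'm) clifford"
type_synonym 'm sval = "('m + 'm) clifford grass"

definition super_space :: "nat \<Rightarrow> 'm::finite point set \<Rightarrow> ('m point \<Rightarrow> 'm sval) set" where
  "super_space n S = {F. \<forall>A. (\<not> A \<subseteq> {1..2*n} \<longrightarrow> (\<forall>x\<in>S. gcoeff (F x) A = 0)) \<and>
     (\<exists>N f c. (\<forall>k<N. c k \<in> clifford_sub n) \<and> tensor_repr S (\<lambda>x. gcoeff (F x) A) N f c)}"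

definition phase_function :: "nat \<Rightarrow> ('m::finite point \<Rightarrow> complex grass) \<Rightarrow> bool" where
  "phase_function n g \<longleftrightarrow> (\<forall>A. smooth_on UNIV (\<lambda>x. gcoeff (g x) A)) \<and>
     (\<forall>x A. gcoeff (g x) A \<in> \<real>) \<and>
     (\<forall>x A. gcoeff (g x) A \<noteq> 0 \<longrightarrow> A \<subseteq> {1..2*n} \<and> even (card A))"

type_synonym 'm superdist = "nat set \<Rightarrow> 'm point distribution"

definition super_delta :: "nat \<Rightarrow> ('m::finite point \<Rightarrow> complex grass) \<Rightarrow> 'm superdist" where
  "super_delta n g A \<phi> = (\<Sum>j=0..n. dist_pullback (\<lambda>x. body (g x)) (delta_deriv j)
     (\<lambda>x. gcoeff (nilpart (g x) ^ j) A / fact j * \<phi> x))"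

text \<open>The integral of \<open>F \<alpha> H\<close>, with the three factors in this order, where \<open>F\<close> and \<open>H\<close> may involve all
  the generators \<open>x`\<^sub>j\<close>, \<open>y`\<^sub>j\<close> and the superdistribution \<open>\<alpha>\<close> only the \<open>x`\<^sub>j\<close>.\<close>

definition super_integral :: "nat \<Rightarrow> ('m::finite point \<Rightarrow> 'm sval) \<Rightarrow> 'm superdist \<Rightarrow>
    ('m point \<Rightarrow> 'm sval) \<Rightarrow> 'm sval" where
  "super_integral n F \<alpha> H = (\<Sum>A\<in>Pow {1..4*n}. \<Sum>B\<in>Pow {1..2*n}. \<Sum>C\<in>Pow {1..4*n}.
     gconst (tensor_ext (dist_pair (\<alpha> B)) (dist_support (\<alpha> B)) (\<lambda>x. gcoeff (F x) A * gcoeff (H x) C))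
     * berezin n (gmono A * gmono B * gmono C))"

definition super_integral_mat :: "nat \<Rightarrow> ('m::finite point \<Rightarrow> 'm sval ^ 2 ^ 2) \<Rightarrow> 'm superdist \<Rightarrow>
    ('m point \<Rightarrow> 'm sval ^ 2 ^ 2) \<Rightarrow> 'm sval ^ 2 ^ 2" where
  "super_integral_mat n F \<alpha> H =
     (\<chi> i k. \<Sum>l\<in>UNIV. super_integral n (\<lambda>x. F x $ i $ l) \<alpha> (\<lambda>x. H x $ l $ k))"

definition circulant :: "'a \<Rightarrow> 'a \<Rightarrow> 'a ^ 2 ^ 2" where
  "circulant a b = (\<chi> i k. if i = k then a else b)"

definition eval_y :: "nat \<Rightarrow> ('m::finite point \<Rightarrow> 'm sval) \<Rightarrow> 'm point \<Rightarrow> 'm sval" where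
  "eval_y n F y = (\<Sum>A\<in>Pow {1..2*n}. gconst (gcoeff (F y) A) * gmono ((\<lambda>j. 2 * n + j) ` A))"


section \<open>Hermitian Dirac operators\<close>

definition ff :: "'m::finite \<Rightarrow> 'm cliff" where
  "ff j = cl_scalar (1/2) * (cl_e (Inl j) - cl_scalar \<i> * cl_e (Inr j))"

definition ff_dag :: "'m::finite \<Rightarrow> 'm cliff" where
  "ff_dag j = cl_scalar (-1/2) * (cl_e (Inl j) + cl_scalar \<i> * cl_e (Inr j))"

definition fs :: "nat \<Rightarrow> 'm::finite cliff" where
  "fs j = cl_scalar (1/2) * (cl_s (2*j-1) - cl_scalar \<i> * cl_s (2*j))"

definition fs_dag :: "nat \<Rightarrow> 'm::finite cliff" where
  "fs_dag j = cl_scalar (-1/2) * (cl_s (2*j-1) + cl_scalar \<i> * cl_s (2*j))"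

definition dx :: "nat \<Rightarrow> 'm + 'm \<Rightarrow> ('m::finite point \<Rightarrow> 'm sval) \<Rightarrow> 'm point \<Rightarrow> 'm sval" where
  "dx n i F x = (\<Sum>A\<in>Pow {1..2*n}.
     gconst (tensor_ext (\<lambda>f. pderivative i f x) {x} (\<lambda>x'. gcoeff (F x') A)) * gmono A)"

definition dz :: "nat \<Rightarrow> 'm \<Rightarrow> ('m::finite point \<Rightarrow> 'm sval) \<Rightarrow> 'm point \<Rightarrow> 'm sval" where
  "dz n j F x = cnum (1/2) * (dx n (Inl j) F x - cnum \<i> * dx n (Inr j) F x)"

definition dzc :: "nat \<Rightarrow> 'm \<Rightarrow> ('m::finite point \<Rightarrow> 'm sval) \<Rightarrow> 'm point \<Rightarrow> 'm sval" where
  "dzc n j F x = cnum (1/2) * (dx n (Inl j) F x + cnum \<i> * dx n (Inr j) F x)"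

definition dsz :: "nat \<Rightarrow> 'm::finite sval \<Rightarrow> 'm sval" where
  "dsz j a = cnum (1/2) * (gderiv (2*j-1) a - cnum \<i> * gderiv (2*j) a)"

definition dszc :: "nat \<Rightarrow> 'm::finite sval \<Rightarrow> 'm sval" where
  "dszc j a = cnum (1/2) * (gderiv (2*j-1) a + cnum \<i> * gderiv (2*j) a)"

definition dirac_Z :: "nat \<Rightarrow> ('m::finite point \<Rightarrow> 'm sval) \<Rightarrow> 'm point \<Rightarrow> 'm sval" where
  "dirac_Z n F x = (\<Sum>j\<in>UNIV. gconst (ff_dag j) * dz n j F x)
     + cnum (2 * \<i>) * (\<Sum>j=1..n. gconst (fs_dag j) * dsz j (F x))"

definition dirac_Z_dag :: "nat \<Rightarrow> ('m::finite point \<Rightarrow> 'm sval) \<Rightarrow> 'm point \<Rightarrow> 'm sval" where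
  "dirac_Z_dag n F x = (\<Sum>j\<in>UNIV. gconst (ff j) * dzc n j F x)
     - cnum (2 * \<i>) * (\<Sum>j=1..n. gconst (fs j) * dszc j (F x))"

definition dirac_matrix ::
    "nat \<Rightarrow> ('m::finite point \<Rightarrow> 'm sval ^ 2 ^ 2) \<Rightarrow> 'm point \<Rightarrow> 'm sval ^ 2 ^ 2" where
  "dirac_matrix n F x = (\<chi> i k. \<Sum>l\<in>UNIV.
     (if i = l then dirac_Z n else dirac_Z_dag n) (\<lambda>x. F x $ l $ k) x)"

definition dirac_matrix_of ::
    "nat \<Rightarrow> ('m::finite point \<Rightarrow> complex grass) \<Rightarrow> 'm point \<Rightarrow> 'm sval ^ 2 ^ 2" where
  "dirac_matrix_of n g x =
     circulant (dirac_Z n (\<lambda>x. gcomplex (g x)) x) (dirac_Z_dag n (\<lambda>x. gcomplex (g x)) x)"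


section \<open>The Cauchy kernel\<close>

text \<open>Functions of the vector variable take its \<open>2m\<close> commuting components \<open>x\<close> and its \<open>2n\<close>
  anticommuting components \<open>\<theta> 1, \<dots>, \<theta> (2n)\<close> as arguments.\<close>

definition zco :: "'m::finite point \<Rightarrow> 'm \<Rightarrow> complex" where
  "zco x j = of_real (x $ Inl j) + \<i> * of_real (x $ Inr j)"

definition zco_c :: "'m::finite point \<Rightarrow> 'm \<Rightarrow> complex" where
  "zco_c x j = of_real (x $ Inl j) - \<i> * of_real (x $ Inr j)"

definition szco :: "(nat \<Rightarrow> complex grass) \<Rightarrow> nat \<Rightarrow> complex grass" where
  "szco \<theta> j = \<theta> (2*j-1) + gconst \<i> * \<theta> (2*j)"

definition szco_c :: "(nat \<Rightarrow> complex grass) \<Rightarrow> nat \<Rightarrow> complex grass" where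
  "szco_c \<theta> j = \<theta> (2*j-1) - gconst \<i> * \<theta> (2*j)"

definition Zvec :: "nat \<Rightarrow> 'm::finite point \<Rightarrow> (nat \<Rightarrow> complex grass) \<Rightarrow> 'm sval" where
  "Zvec n x \<theta> = (\<Sum>j\<in>UNIV. cnum (zco x j) * gconst (ff j))
     + (\<Sum>j=1..n. gcomplex (szco \<theta> j) * gconst (fs j))"

definition Zvec_dag :: "nat \<Rightarrow> 'm::finite point \<Rightarrow> (nat \<Rightarrow> complex grass) \<Rightarrow> 'm sval" where
  "Zvec_dag n x \<theta> = (\<Sum>j\<in>UNIV. cnum (zco_c x j) * gconst (ff_dag j))
     + (\<Sum>j=1..n. gcomplex (szco_c \<theta> j) * gconst (fs_dag j))"

definition Znorm2 :: "nat \<Rightarrow> 'm::finite point \<Rightarrow> (nat \<Rightarrow> complex grass) \<Rightarrow> complex grass" where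
  "Znorm2 n x \<theta> = gconst (\<Sum>j\<in>UNIV. zco x j * zco_c x j)
     - gconst (\<i> / 2) * (\<Sum>j=1..n. szco \<theta> j * szco_c \<theta> j)"

definition superdim :: "nat \<Rightarrow> 'm::finite itself \<Rightarrow> real" where
  "superdim n _ = 2 * real CARD('m) - 2 * real n"

definition supersphere_area :: "nat \<Rightarrow> 'm::finite itself \<Rightarrow> real" where
  "supersphere_area n m = 2 * pi powr (superdim n m / 2) / Gamma (superdim n m / 2)"

definition Psi1 :: "nat \<Rightarrow> 'm::finite point \<Rightarrow> (nat \<Rightarrow> complex grass) \<Rightarrow> 'm sval" where
  "Psi1 n x \<theta> = cnum (of_real (2 / supersphere_area n TYPE('m)))
     * Zvec n x \<theta> * gcomplex (gpow n (Znorm2 n x \<theta>) (- (superdim n TYPE('m) / 2)))"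

definition Psi1_dag :: "nat \<Rightarrow> 'm::finite point \<Rightarrow> (nat \<Rightarrow> complex grass) \<Rightarrow> 'm sval" where
  "Psi1_dag n x \<theta> = cnum (of_real (2 / supersphere_area n TYPE('m)))
     * Zvec_dag n x \<theta> * gcomplex (gpow n (Znorm2 n x \<theta>) (- (superdim n TYPE('m) / 2)))"

text \<open>The kernel at \<open>Z - U\<close>, whose components are \<open>x - y\<close> and \<open>x`\<^sub>j - y`\<^sub>j\<close>.\<close>

definition Psi_matrix :: "nat \<Rightarrow> 'm::finite point \<Rightarrow> 'm point \<Rightarrow> 'm sval ^ 2 ^ 2" where
  "Psi_matrix n y x = (let \<theta> = (\<lambda>j. gmono {j} - gmono {2 * n + j})
     in circulant (Psi1 n (x - y) \<theta>) (Psi1_dag n (x - y) \<theta>))"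

end

theory Submission
  imports Defs
begin

text \<open>A circulant matrix with entries \<open>a, b\<close> is diagonalised by the combinations \<open>a + s b\<close> with
  \<open>s = 1\<close> and \<open>s = -1\<close>. So it suffices to treat, for both signs, the kernel
  \<open>\<Psi>\<^sub>1 + s \<Psi>\<^sub>1\<^sup>\<dagger>\<close> and the Dirac operator \<open>D = \<partial>\<^sub>Z + s \<partial>\<^sub>Z\<^sub>\<dagger>\<close>, after applying linear functionals that
  separate the values.

  The derivatives of \<open>\<delta>\<close> at \<open>g\<^sub>0\<close> are the derivatives, at level \<open>0\<close>, of integrals over the sublevel sets of
  \<open>g\<^sub>0\<close>. Integration by parts at each level and a telescoping sum over the powers of the nilpotent part
  of \<open>g\<close> yield a Stokes formula, which turns the integral of \<open>F \<delta>(g) D[g] G\<close> into one over \<open>g\<^sub>0 \<le> 0\<close>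
  of \<open>(F D) G + F (D G)\<close>, provided that \<open>F D\<close> and \<open>D G\<close> vanish near \<open>g\<^sub>0 = 0\<close>.

  The kernel is \<open>X |X|^(-M)\<close> with \<open>X\<close> the Clifford vector of \<open>Z - U\<close>. Replacing \<open>|X|^(-M)\<close> near \<open>y\<close> by a smooth
  function of \<open>|X|\<^sup>2\<close> does not affect the left-hand side and makes \<open>F D\<close> a function of \<open>|X|\<^sup>2\<close> supported in
  a small ball around \<open>y\<close>. Shrinking the ball, only the top power \<open>\<zeta>^n\<close> of the nilpotent part \<open>\<zeta>\<close> of \<open>|X|\<^sup>2\<close>
  survives in the Taylor expansion, and \<open>\<zeta>^n\<close> is a multiple of the odd delta function at \<open>y\<close>. The
  constant is a radial moment, computed by repeated integration by parts.\<close>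

section \<open>Smooth functions\<close>

text \<open>The pairing with a distribution and its extension to Clifford values are definite
  descriptions, so nothing can be computed before uniqueness is known; under a scalar functional the
  value no longer mentions the chosen representation, which is why the functionals come in. Sublevel
  integrals exist at every level, whereas surface measures do not, but they may jump; a factor from
  grad h makes them Lipschitz, and near a regular level every test function is a sum of such
  products. Put M = m - n = p + 1. The right Dirac operator turns X f(|X|^2) into (M + r d/dr) f at
  r = |X|^2. This Euler operator kills r^-M, so the image of the smoothed kernel c^M W(c r) lives
  where c r < 1. With x = y + v / sqrt c the j-th Taylor term scales like c^(j-n), so j = n alone
  survives. Its constant is the product of p!/pi^(p+1) (kernel), 1/n! (Taylor), (-1)^n pi^m/p!
  (radial integral) and (-1)^n n!/pi^n (Berezin integral), which is 1.\<close>

lemma ck_on_cong: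
  assumes "open S" "ck_on k S f" "\<And>x. x \<in> S \<Longrightarrow> f x = g x"
  shows "ck_on k S g"
  using assms(2,3)
proof (induction k arbitrary: f g)
  case 0
  then show ?case using continuous_on_cong[of S S f g] by auto
next
  case (Suc k)
  have d: "(g has_derivative frechet_derivative f (at x)) (at x)" if "x \<in> S" for x
  proof (rule has_derivative_transform_within_open[OF _ assms(1) that])
    show "(f has_derivative frechet_derivative f (at x)) (at x)"
      using Suc.prems(1) that frechet_derivative_works by auto
  qed (rule Suc.prems(2))
  then have e: "frechet_derivative f (at x) = frechet_derivative g (at x)" if "x \<in> S" for x
    using that frechet_derivative_at by blast
  have "ck_on k S (\<lambda>x. frechet_derivative g (at x) v)" for v
  proof (rule Suc.IH)
    show "ck_on k S (\<lambda>x. frechet_derivative f (at x) v)" using Suc.prems(1) by simp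
  qed (simp only: e)
  then show ?case using d unfolding ck_on.simps differentiable_def by blast
qed

text \<open>\<open>frechet_derivative\<close> is a choice and would have to be identified in every
  smoothness proof. Here any explicit derivative family \<open>D\<close> may be supplied; openness
  of \<open>S\<close> lets \<open>ck_on_cong\<close> exchange the two.\<close>

lemma ck_on_SucI:
  assumes "open S" "\<And>x. x \<in> S \<Longrightarrow> (f has_derivative D x) (at x)" "\<And>v. ck_on k S (\<lambda>x. D x v)"
  shows "ck_on (Suc k) S f"
proof -
  have "D x = frechet_derivative f (at x)" if "x \<in> S" for x
    using assms(2)[OF that] by (rule frechet_derivative_at)
  then have "ck_on k S (\<lambda>x. frechet_derivative f (at x) v)" for v
    using assms by (intro ck_on_cong[OF assms(1) assms(3)[of v]]) auto
  then show ?thesis using assms(2) by (auto simp: differentiable_def)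
qed

lemma ck_on_has_derivative:
  "ck_on (Suc k) S f \<Longrightarrow> x \<in> S \<Longrightarrow> (f has_derivative frechet_derivative f (at x)) (at x)"
  by (simp add: frechet_derivative_works[symmetric])

lemma ck_on_deriv: "ck_on (Suc k) S f \<Longrightarrow> ck_on k S (\<lambda>x. frechet_derivative f (at x) v)"
  by simp

lemma ck_on_continuous: "ck_on k S f \<Longrightarrow> continuous_on S f"
proof (cases k)
  case (Suc j)
  assume "ck_on k S f"
  then have "\<forall>x\<in>S. f differentiable (at x)" using Suc by simp
  then show ?thesis
    by (meson continuous_at_imp_continuous_on differentiable_imp_continuous_within)
qed simp

lemma ck_on_Suc_imp: "ck_on (Suc k) S f \<Longrightarrow> ck_on k S f"
proof (induction k arbitrary: f)
  case 0
  then show ?case using ck_on_continuous[of 1 S f] by simp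
next
  case (Suc k)
  then show ?case by simp
qed

lemma ck_on_subset: "ck_on k S f \<Longrightarrow> T \<subseteq> S \<Longrightarrow> ck_on k T f"
  by (induction k arbitrary: f) (auto intro: continuous_on_subset)

lemma ck_on_const: "ck_on k S (\<lambda>x. c)"
  by (induction k arbitrary: c) simp_all

lemma ck_on_add:
  assumes "open S" shows "ck_on k S f \<Longrightarrow> ck_on k S g \<Longrightarrow> ck_on k S (\<lambda>x. f x + g x)"
proof (induction k arbitrary: f g)
  case 0
  then show ?case by (auto intro: continuous_intros)
next
  case (Suc k)
  show ?case
    by (rule ck_on_SucI[OF assms, where D = "\<lambda>x v. frechet_derivative f (at x) v + frechet_derivative g (at x) v"])
       (auto intro!: has_derivative_add ck_on_has_derivative Suc.IH ck_on_deriv intro: Suc.prems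
         simp del: ck_on.simps)
qed

lemma ck_on_mult:
  assumes "open S" shows "ck_on k S f \<Longrightarrow> ck_on k S g \<Longrightarrow> ck_on k S (\<lambda>x. f x * g x)"
proof (induction k arbitrary: f g)
  case 0
  then show ?case by (auto intro: continuous_intros)
next
  case (Suc k)
  show ?case
    by (rule ck_on_SucI[OF assms, where D = "\<lambda>x v. f x * frechet_derivative g (at x) v
          + frechet_derivative f (at x) v * g x"])
       (auto intro!: has_derivative_mult ck_on_add[OF assms] ck_on_has_derivative Suc.IH ck_on_deriv
         intro: Suc.prems ck_on_Suc_imp simp del: ck_on.simps)
qed

lemma ck_on_bounded_linear:
  assumes "bounded_linear f" "open S" shows "ck_on k S f"
proof (cases k)
  case 0
  then show ?thesis by (simp add: assms linear_continuous_on)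
next
  case (Suc j)
  then show ?thesis
    using assms by (auto intro!: ck_on_SucI[where D = "\<lambda>_. f"] ck_on_const bounded_linear_imp_has_derivative
        simp del: ck_on.simps)
qed

text \<open>The derivative of 1/f is -f'/f^2, in which 1/f is needed to order k only, so the
  induction closes. It is written as a product with the constant -1 so that
  \<open>ck_on_mult\<close> and \<open>ck_on_const\<close> apply.\<close>

lemma ck_on_inverse:
  fixes f :: "'v::real_normed_vector \<Rightarrow> complex"
  assumes "open S" "\<And>x. x \<in> S \<Longrightarrow> f x \<noteq> 0"
  shows "ck_on k S f \<Longrightarrow> ck_on k S (\<lambda>x. inverse (f x))"
  using assms(2)
proof (induction k)
  case 0
  then show ?case by (auto intro: continuous_intros)
next
  case (Suc k)
  have "((\<lambda>x. inverse (f x)) has_derivative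
       (\<lambda>v. -1 * (frechet_derivative f (at x) v * (inverse (f x) * inverse (f x))))) (at x)"
    if "x \<in> S" for x
  proof -
    have "((\<lambda>x. inverse (f x)) has_derivative
       (\<lambda>h. - (inverse (f x) * frechet_derivative f (at x) h * inverse (f x)))) (at x)"
      by (rule Deriv.has_derivative_inverse)
         (use Suc.prems that ck_on_has_derivative in blast)+
    then show ?thesis by (simp add: mult_ac)
  qed
  moreover have "ck_on k S (\<lambda>x. inverse (f x))"
    using Suc ck_on_Suc_imp by blast
  ultimately show ?case
    using ck_on_deriv[OF Suc.prems(1)]
    by (intro ck_on_SucI[OF assms(1), where D = "\<lambda>x v. -1 * (frechet_derivative f (at x) v
          * (inverse (f x) * inverse (f x)))"] ck_on_mult[OF assms(1)] ck_on_const)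
qed

text \<open>Smoothness is defined for complex-valued functions, so a real function is carried
  through its complex embedding. Taking real parts recovers the real derivative, and uniqueness of
  derivatives shows that the embedded one has real values.\<close>

lemma has_derivative_of_real_iff:
  fixes q :: "'v::real_normed_vector \<Rightarrow> real"
  assumes "((\<lambda>x. complex_of_real (q x)) has_derivative D) (at x)"
  shows "(q has_derivative (\<lambda>v. Re (D v))) (at x)" "D v = of_real (Re (D v))"
proof -
  have "((\<lambda>x. Re (complex_of_real (q x))) has_derivative (\<lambda>v. Re (D v))) (at x)"
    by (rule bounded_linear.has_derivative[OF bounded_linear_Re assms])
  then show *: "(q has_derivative (\<lambda>v. Re (D v))) (at x)" by simp
  have "((\<lambda>x. complex_of_real (q x)) has_derivative (\<lambda>v. of_real (Re (D v)))) (at x)"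
    by (rule bounded_linear.has_derivative[OF bounded_linear_of_real *])
  from has_derivative_unique[OF assms this] show "D v = of_real (Re (D v))" by meson
qed

lemma ck_on_compose:
  fixes q :: "'v::real_normed_vector \<Rightarrow> real" and f :: "real \<Rightarrow> complex"
  assumes S: "open S" "open U" and q: "ck_on k S (\<lambda>x. complex_of_real (q x))" "\<And>x. x \<in> S \<Longrightarrow> q x \<in> U"
  shows "ck_on k U f \<Longrightarrow> ck_on k S (\<lambda>x. f (q x))"
  using q
proof (induction k arbitrary: f)
  case 0
  then have "continuous_on S (\<lambda>x. Re (complex_of_real (q x)))"
    using bounded_linear.continuous_on[OF bounded_linear_Re] by (metis ck_on.simps(1))
  then have "continuous_on S q" by simp
  moreover have "continuous_on U f" using 0 by simp
  ultimately show ?case using 0(3) continuous_on_compose2[of U f S q] by auto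
next
  case (Suc k)
  let ?q' = "\<lambda>x. frechet_derivative (\<lambda>x. complex_of_real (q x)) (at x)"
  let ?f' = "\<lambda>t. frechet_derivative f (at t) 1"
  have d: "((\<lambda>x. f (q x)) has_derivative (\<lambda>v. ?q' x v * ?f' (q x))) (at x)" if x: "x \<in> S" for x
  proof -
    note dq = has_derivative_of_real_iff[OF ck_on_has_derivative[OF Suc.prems(2) x]]
    have df: "(f has_derivative frechet_derivative f (at (q x))) (at (q x))"
      using ck_on_has_derivative[OF Suc.prems(1)] Suc.prems(3)[OF x] .
    \<comment> \<open>A real-linear map on the line is determined by its value at 1; this separates
      the direction v from the base point, as \<open>ck_on_mult\<close> requires.\<close>
    have lin: "frechet_derivative f (at (q x)) r = of_real r * ?f' (q x)" for r
      using linear_scale[OF has_derivative_linear[OF df], of r 1] by (simp add: scaleR_conv_of_real)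
    have "((\<lambda>x. f (q x)) has_derivative (\<lambda>v. frechet_derivative f (at (q x)) (Re (?q' x v)))) (at x)"
      by (rule has_derivative_compose[OF dq(1) df])
    also have "(\<lambda>v. frechet_derivative f (at (q x)) (Re (?q' x v))) = (\<lambda>v. ?q' x v * ?f' (q x))"
      using dq(2) lin by (metis (lifting))
    finally show ?thesis .
  qed
  have "ck_on k S (\<lambda>x. ?f' (q x))"
    by (rule Suc.IH) (use Suc.prems ck_on_Suc_imp in auto)
  then show ?case
    using Suc.prems(2)
    by (intro ck_on_SucI[OF S(1), where D = "\<lambda>x v. ?q' x v * ?f' (q x)"] d ck_on_mult[OF S(1)]) auto
qed

lemma ck_on_local:
  assumes "\<And>x. x \<in> S \<Longrightarrow> \<exists>T. open T \<and> x \<in> T \<and> ck_on k T f"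
  shows "ck_on k S f"
  using assms
proof (induction k arbitrary: f)
  case 0
  have "isCont f x" if "x \<in> S" for x
    using 0[OF that] continuous_on_eq_continuous_at by auto
  then show ?case by (simp add: continuous_at_imp_continuous_on)
next
  case (Suc k)
  have "f differentiable (at x)" if "x \<in> S" for x
    using Suc.prems[OF that] by auto
  moreover have "ck_on k S (\<lambda>x. frechet_derivative f (at x) v)" for v
    by (rule Suc.IH) (use Suc.prems in force)
  ultimately show ?case by simp
qed

lemma smooth_on_cong:
  "smooth_on S f \<Longrightarrow> open S \<Longrightarrow> (\<And>x. x \<in> S \<Longrightarrow> f x = g x) \<Longrightarrow> smooth_on S g"
  unfolding smooth_on_def using ck_on_cong by blast

lemma smooth_on_local:
  "(\<And>x. x \<in> S \<Longrightarrow> \<exists>T. open T \<and> x \<in> T \<and> smooth_on T f) \<Longrightarrow> smooth_on S f"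
  unfolding smooth_on_def using ck_on_local by metis

lemma smooth_on_subset: "smooth_on S f \<Longrightarrow> T \<subseteq> S \<Longrightarrow> smooth_on T f"
  unfolding smooth_on_def using ck_on_subset by blast

lemma smooth_on_const [simp]: "smooth_on S (\<lambda>x. c)"
  by (simp add: smooth_on_def ck_on_const)

lemma smooth_on_add: "smooth_on S f \<Longrightarrow> smooth_on S g \<Longrightarrow> open S \<Longrightarrow> smooth_on S (\<lambda>x. f x + g x)"
  by (simp add: smooth_on_def ck_on_add)

lemma smooth_on_mult: "smooth_on S f \<Longrightarrow> smooth_on S g \<Longrightarrow> open S \<Longrightarrow> smooth_on S (\<lambda>x. f x * g x)"
  by (simp add: smooth_on_def ck_on_mult)

lemma smooth_on_minus: "smooth_on S f \<Longrightarrow> open S \<Longrightarrow> smooth_on S (\<lambda>x. - f x)"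
  using smooth_on_mult[of S "\<lambda>_. -1" f] by simp

lemma smooth_on_diff: "smooth_on S f \<Longrightarrow> smooth_on S g \<Longrightarrow> open S \<Longrightarrow> smooth_on S (\<lambda>x. f x - g x)"
  using smooth_on_add[of S f "\<lambda>x. - g x"] smooth_on_minus[of S g] by simp

lemma smooth_on_sum:
  "(\<And>i. i \<in> I \<Longrightarrow> smooth_on S (f i)) \<Longrightarrow> open S \<Longrightarrow> smooth_on S (\<lambda>x. \<Sum>i\<in>I. f i x)"
  by (induction I rule: infinite_finite_induct) (auto intro: smooth_on_add)

lemma smooth_on_prod:
  "(\<And>i. i \<in> I \<Longrightarrow> smooth_on S (f i)) \<Longrightarrow> open S \<Longrightarrow> smooth_on S (\<lambda>x. \<Prod>i\<in>I. f i x)"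
  by (induction I rule: infinite_finite_induct) (auto intro: smooth_on_mult)

lemma smooth_on_power: "smooth_on S f \<Longrightarrow> open S \<Longrightarrow> smooth_on S (\<lambda>x. f x ^ k)"
  by (induction k) (auto intro: smooth_on_mult)

lemma smooth_on_inverse:
  "smooth_on S f \<Longrightarrow> open S \<Longrightarrow> (\<And>x. x \<in> S \<Longrightarrow> f x \<noteq> 0) \<Longrightarrow> smooth_on S (\<lambda>x. inverse (f x))"
  by (simp add: smooth_on_def ck_on_inverse)

lemma smooth_on_compose:
  "smooth_on U f \<Longrightarrow> smooth_on S (\<lambda>x. complex_of_real (q x)) \<Longrightarrow> open S \<Longrightarrow> open U \<Longrightarrow>
    (\<And>x. x \<in> S \<Longrightarrow> q x \<in> U) \<Longrightarrow> smooth_on S (\<lambda>x. f (q x))"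
  by (simp add: smooth_on_def ck_on_compose)

lemma smooth_on_bounded_linear: "bounded_linear f \<Longrightarrow> open S \<Longrightarrow> smooth_on S f"
  by (simp add: smooth_on_def ck_on_bounded_linear)

lemma smooth_on_deriv: "smooth_on S f \<Longrightarrow> smooth_on S (\<lambda>x. frechet_derivative f (at x) v)"
  by (metis smooth_on_def ck_on_deriv)

lemma smooth_on_has_derivative:
  "smooth_on S f \<Longrightarrow> x \<in> S \<Longrightarrow> (f has_derivative frechet_derivative f (at x)) (at x)"
  unfolding smooth_on_def using ck_on_has_derivative by blast

lemma smooth_on_continuous: "smooth_on S f \<Longrightarrow> continuous_on S f"
  unfolding smooth_on_def using ck_on_continuous by blast

lemma smooth_on_inner [simp]: "open S \<Longrightarrow> smooth_on S (\<lambda>x. complex_of_real (x \<bullet> b))"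
  by (rule smooth_on_bounded_linear)
     (auto intro!: bounded_linear_compose[OF bounded_linear_of_real] bounded_linear_inner_left)

lemma smooth_on_dist2:
  fixes a :: "'v::euclidean_space"
  assumes "open S" shows "smooth_on S (\<lambda>x. complex_of_real ((x - a) \<bullet> (x - a)))"
proof -
  have "complex_of_real ((x - a) \<bullet> (x - a)) =
      (\<Sum>b\<in>Basis. (complex_of_real (x \<bullet> b) - of_real (a \<bullet> b)) ^ 2)" for x
    by (subst euclidean_inner) (simp add: inner_diff_left power2_eq_square)
  then show ?thesis
    using assms by (auto intro!: smooth_on_sum smooth_on_power smooth_on_diff)
qed

section \<open>Smooth cutoff functions\<close>

text \<open>The power of 1/t makes the family closed under differentiation up to linear
  combinations; the case p = 0 alone is not.\<close>

definition flat_exp :: "nat \<Rightarrow> real \<Rightarrow> real" where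
  "flat_exp p t = (if t > 0 then (1 / t) ^ p * exp (- 1 / t) else 0)"

lemma flat_exp_tendsto: "(flat_exp p \<longlongrightarrow> 0) (at 0)"
proof -
  have "((\<lambda>t::real. (1 / t) ^ p * exp (- 1 / t)) \<longlongrightarrow> 0) (at_right 0)"
    using filterlim_compose[OF tendsto_power_div_exp_0[of p] filterlim_inverse_at_top_right]
    by (simp add: exp_minus divide_inverse mult.commute)
  then have "(flat_exp p \<longlongrightarrow> 0) (at_right 0)"
    by (rule Lim_transform_eventually) (auto simp: eventually_at_filter flat_exp_def)
  moreover have "(flat_exp p \<longlongrightarrow> 0) (at_left 0)"
    by (rule Lim_transform_eventually[OF tendsto_const]) (auto simp: eventually_at_filter flat_exp_def)
  ultimately show ?thesis by (simp add: filterlim_split_at)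
qed

lemma flat_exp_deriv:
  "(flat_exp p has_real_derivative flat_exp (p + 2) t - real p * flat_exp (p + 1) t) (at t)"
proof -
  consider "t > 0" | "t < 0" | "t = 0" by linarith
  then show ?thesis
  proof cases
    case 1
    have "((\<lambda>t. (1 / t) ^ p * exp (- 1 / t)) has_real_derivative
        flat_exp (p + 2) t - real p * flat_exp (p + 1) t) (at t)"
    proof (cases p)
      case 0
      then show ?thesis using 1
        by (auto intro!: derivative_eq_intros simp: flat_exp_def power2_eq_square divide_simps)
    next
      case (Suc q)
      then show ?thesis using 1
        by (auto intro!: derivative_eq_intros simp: flat_exp_def power2_eq_square divide_simps)
           (cases q; simp add: algebra_simps)
    qed
    then show ?thesis
      by (rule has_field_derivative_transform_within_open[of _ _ _ "{0<..}"])
         (use 1 in \<open>auto simp: flat_exp_def\<close>)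
  next
    case 2
    have "((\<lambda>_. 0) has_real_derivative 0) (at t)" by simp
    then have "(flat_exp p has_real_derivative 0) (at t)"
      by (rule has_field_derivative_transform_within_open[of _ _ _ "{..<0}"])
         (use 2 in \<open>auto simp: flat_exp_def\<close>)
    then show ?thesis using 2 by (simp add: flat_exp_def)
  next
    case 3
    \<comment> \<open>At 0 the difference quotient is itself a member of the family,
      \<open>flat_exp (Suc p)\<close>, whose limit is known.\<close>
    have "((\<lambda>h. (flat_exp p (0 + h) - flat_exp p 0) / h) \<longlongrightarrow> 0) (at 0)"
      by (rule Lim_transform_eventually[OF flat_exp_tendsto[of "Suc p"]])
         (auto simp: eventually_at_filter flat_exp_def)
    then show ?thesis using 3 by (simp add: DERIV_def flat_exp_def)
  qed
qed

lemma smooth_on_flat_exp: "smooth_on UNIV (\<lambda>t. complex_of_real (flat_exp p t))"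
proof -
  have d: "((\<lambda>t. complex_of_real (flat_exp p t)) has_derivative
      (\<lambda>v. of_real v * (of_real (flat_exp (p + 2) t) + of_real (- real p) * of_real (flat_exp (p + 1) t)))) (at t)"
    for p t
    using bounded_linear.has_derivative[OF bounded_linear_of_real[where 'a = complex]
        flat_exp_deriv[of p t, unfolded has_field_derivative_def]]
    by (simp add: mult_ac algebra_simps)
  have "ck_on k UNIV (\<lambda>t. complex_of_real (flat_exp p t))" for k
  proof (induction k arbitrary: p)
    case 0
    show ?case unfolding ck_on.simps
      by (rule continuous_at_imp_continuous_on) (blast intro: has_derivative_continuous[OF d])
  next
    case (Suc k)
    show ?case
      by (rule ck_on_SucI[OF open_UNIV d]) (intro ck_on_mult ck_on_add ck_on_const Suc open_UNIV)
  qed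
  then show ?thesis by (simp add: smooth_on_def)
qed

text \<open>The denominator never vanishes, since t and 1 - t are not both nonpositive; for t \<ge>
  1 its second summand is 0 and the quotient is exactly 1.\<close>

definition smooth_step :: "real \<Rightarrow> complex" where
  "smooth_step t = of_real (flat_exp 0 t) * inverse (of_real (flat_exp 0 t) + of_real (flat_exp 0 (1 - t)))"

lemma smooth_step_eq: "t \<le> 0 \<Longrightarrow> smooth_step t = 0" "t \<ge> 1 \<Longrightarrow> smooth_step t = 1"
  by (auto simp: smooth_step_def flat_exp_def)

lemma smooth_on_smooth_step: "smooth_on UNIV smooth_step"
proof -
  have *: "smooth_on UNIV (\<lambda>t. complex_of_real (1 - t))"
    using smooth_on_diff[OF smooth_on_const[of UNIV 1]
        smooth_on_bounded_linear[OF bounded_linear_of_real open_UNIV] open_UNIV] by simp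
  have ne: "complex_of_real (flat_exp 0 t) + of_real (flat_exp 0 (1 - t)) \<noteq> 0" for t
  proof -
    have "flat_exp 0 t \<ge> 0" "flat_exp 0 (1 - t) \<ge> 0" "flat_exp 0 t > 0 \<or> flat_exp 0 (1 - t) > 0"
      by (auto simp: flat_exp_def)
    then have "flat_exp 0 t + flat_exp 0 (1 - t) \<noteq> 0" by linarith
    then show ?thesis by (metis of_real_add of_real_eq_0_iff)
  qed
  show ?thesis unfolding smooth_step_def[abs_def]
    by (intro smooth_on_mult smooth_on_inverse smooth_on_add smooth_on_flat_exp open_UNIV ne
         smooth_on_compose[OF smooth_on_flat_exp *]) auto
qed

text \<open>Being 1 on an open set around K, and not merely on K, makes multiplication by \<eta>
  invisible to a linear distribution supported in K.\<close>

definition cutoff :: "'v::real_normed_vector set \<Rightarrow> 'v set \<Rightarrow> ('v \<Rightarrow> complex) \<Rightarrow> bool" where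
  "cutoff K U \<eta> \<longleftrightarrow> test_function \<eta> \<and> closure {x. \<eta> x \<noteq> 0} \<subseteq> U \<and>
     (\<exists>W. open W \<and> K \<subseteq> W \<and> (\<forall>x\<in>W. \<eta> x = 1))"

lemma cutoff_exists:
  fixes K :: "'v::euclidean_space set"
  assumes "compact K" "open U" "K \<subseteq> U"
  obtains \<eta> where "cutoff K U \<eta>"
proof -
  have "\<exists>r>0. cball a (2 * r) \<subseteq> U" if a: "a \<in> K" for a
  proof -
    obtain e where "e > 0" "cball a e \<subseteq> U" using assms a open_contains_cball by (metis in_mono)
    then show ?thesis by (intro exI[of _ "e / 2"]) auto
  qed
  then obtain r where r: "\<And>a. a \<in> K \<Longrightarrow> r a > 0 \<and> cball a (2 * r a) \<subseteq> U" by metis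
  have "K \<subseteq> (\<Union>a\<in>K. ball a (r a))" using r by force
  then obtain C where C: "C \<subseteq> K" "finite C" "K \<subseteq> (\<Union>a\<in>C. ball a (r a))"
    using compactE_image[OF assms(1), of K "\<lambda>a. ball a (r a)"] by auto
  \<comment> \<open>With r = \<open>r a\<close> the argument is at least 1 iff |x - a| \<le> r and
    at most 0 iff |x - a| \<ge> 2r; unlike the norm it is polynomial in x.\<close>
  define b where "b a x = smooth_step ((4 * (r a)\<^sup>2 - (x - a) \<bullet> (x - a)) / (3 * (r a)\<^sup>2))" for a x
  \<comment> \<open>Near K some factor 1 - b vanishes, and away from the larger balls all factors
    are 1.\<close>
  define \<eta> where "\<eta> x = 1 - (\<Prod>a\<in>C. 1 - b a x)" for x
  have sb: "smooth_on UNIV (b a)" for a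
  proof -
    have "smooth_on UNIV (\<lambda>x. (4 * of_real ((r a)\<^sup>2) - complex_of_real ((x - a) \<bullet> (x - a)))
        * of_real (1 / (3 * (r a)\<^sup>2)))"
      by (intro smooth_on_mult smooth_on_diff smooth_on_dist2 smooth_on_const open_UNIV)
    then have "smooth_on UNIV (\<lambda>x. complex_of_real ((4 * (r a)\<^sup>2 - (x - a) \<bullet> (x - a)) / (3 * (r a)\<^sup>2)))"
      by simp
    from smooth_on_compose[OF smooth_on_smooth_step this] show ?thesis
      unfolding b_def[abs_def] by simp
  qed
  have one: "b a x = 1" if "a \<in> C" "x \<in> ball a (r a)" for a x
  proof -
    have ra: "r a > 0" using r C that by auto
    have "norm (x - a) \<le> r a" using that by (simp add: dist_norm norm_minus_commute)
    then have "(norm (x - a))\<^sup>2 \<le> (r a)\<^sup>2" by (simp add: power_mono)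
    then show ?thesis using ra unfolding b_def
      by (intro smooth_step_eq) (simp add: dot_square_norm field_simps)
  qed
  have zero: "b a x = 0" if "a \<in> C" "x \<notin> cball a (2 * r a)" for a x
  proof -
    have ra: "r a > 0" using r C that by auto
    have "norm (x - a) \<ge> 2 * r a" using that by (simp add: dist_norm norm_minus_commute)
    then have "(norm (x - a))\<^sup>2 \<ge> (2 * r a)\<^sup>2" using ra by (intro power_mono) auto
    then have "4 * (r a)\<^sup>2 - (x - a) \<bullet> (x - a) \<le> 0" by (simp add: dot_square_norm)
    then show ?thesis using ra unfolding b_def by (intro smooth_step_eq) (simp add: divide_le_0_iff)
  qed
  have cl: "closure {x. \<eta> x \<noteq> 0} \<subseteq> (\<Union>a\<in>C. cball a (2 * r a))"
  proof (rule closure_minimal)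
    show "{x. \<eta> x \<noteq> 0} \<subseteq> (\<Union>a\<in>C. cball a (2 * r a))"
      unfolding \<eta>_def using zero by (force intro: prod.neutral)
    show "closed (\<Union>a\<in>C. cball a (2 * r a))" using C by auto
  qed
  have comp: "compact (\<Union>a\<in>C. cball a (2 * r a))" using C by auto
  have "smooth_on UNIV \<eta>" unfolding \<eta>_def[abs_def]
    by (intro smooth_on_diff smooth_on_prod smooth_on_const sb open_UNIV)
  then have "test_function \<eta>"
    using compact_Int_closed[OF comp closed_closure[of "{x. \<eta> x \<noteq> 0}"]] cl
    by (simp add: test_function_def Int_absorb1)
  moreover have "closure {x. \<eta> x \<noteq> 0} \<subseteq> U" using cl r C by fastforce
  moreover have "\<forall>x\<in>(\<Union>a\<in>C. ball a (r a)). \<eta> x = 1"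
    unfolding \<eta>_def using one C by (force intro!: prod_zero)
  moreover have "open (\<Union>a\<in>C. ball a (r a))" by auto
  ultimately have "cutoff K U \<eta>" unfolding cutoff_def using C by meson
  then show ?thesis using that by blast
qed

section \<open>Test functions\<close>

lemma test_functionI:
  assumes "smooth_on UNIV f" "compact K" "\<And>x. x \<notin> K \<Longrightarrow> f x = 0"
  shows "test_function f"
proof -
  have "closure {x. f x \<noteq> 0} \<subseteq> K"
    using assms by (intro closure_minimal) (auto simp: compact_imp_closed)
  then have "closure {x. f x \<noteq> 0} = K \<inter> closure {x. f x \<noteq> 0}" by auto
  then have "compact (closure {x. f x \<noteq> 0})"
    using assms(2) by (metis closed_closure compact_Int_closed)
  then show ?thesis using assms by (simp add: test_function_def)
qed

lemma test_function_outside: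
  "x \<notin> closure {x. f x \<noteq> 0} \<Longrightarrow> f x = 0"
  using closure_subset[of "{x. f x \<noteq> 0}"] by blast

lemma test_function_smooth: "test_function f \<Longrightarrow> smooth_on UNIV f"
  by (simp add: test_function_def)

lemma test_function_zero [simp]: "test_function (\<lambda>x. 0)"
  by (simp add: test_function_def)

lemma test_function_add:
  assumes "test_function f" "test_function g" shows "test_function (\<lambda>x. f x + g x)"
proof (rule test_functionI)
  show "smooth_on UNIV (\<lambda>x. f x + g x)" "compact (closure {x. f x \<noteq> 0} \<union> closure {x. g x \<noteq> 0})"
    using assms by (auto simp: test_function_def intro: smooth_on_add)
  show "f x + g x = 0" if "x \<notin> closure {x. f x \<noteq> 0} \<union> closure {x. g x \<noteq> 0}" for x
    using test_function_outside[of x f] test_function_outside[of x g] that by simp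
qed

text \<open>The product is smooth on U and identically 0 off the support of f; these two open sets
  cover the space, so smoothness is glued. This admits factors like the kernel, which are smooth
  only near the support.\<close>

lemma test_function_mult_local:
  assumes f: "test_function f" and U: "open U" "closure {x. f x \<noteq> 0} \<subseteq> U" and w: "smooth_on U w"
  shows "test_function (\<lambda>x. f x * w x)"
proof (rule test_functionI)
  let ?K = "closure {x. f x \<noteq> 0}"
  show "smooth_on UNIV (\<lambda>x. f x * w x)"
  proof (rule smooth_on_local)
    fix x
    show "\<exists>T. open T \<and> x \<in> T \<and> smooth_on T (\<lambda>x. f x * w x)"
    proof (cases "x \<in> ?K")
      case True
      have "smooth_on U (\<lambda>x. f x * w x)"
        using f U w by (auto intro!: smooth_on_mult simp: test_function_def intro: smooth_on_subset)
      then show ?thesis using U True by blast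
    next
      case False
      have "smooth_on (- ?K) (\<lambda>x. f x * w x)"
      proof (rule smooth_on_cong[OF smooth_on_const[of _ 0]])
        show "0 = f x * w x" if "x \<in> - ?K" for x
          using test_function_outside[of x f] that by simp
      qed (rule open_Compl[OF closed_closure])
      then show ?thesis using False
        by (intro exI[of _ "- ?K"] conjI open_Compl[OF closed_closure]) auto
    qed
  qed
  show "compact ?K" using f by (simp add: test_function_def)
  show "f x * w x = 0" if "x \<notin> ?K" for x
    using test_function_outside[of x f] that by simp
qed

lemma closure_supp_mult: "closure {x. f x * w x \<noteq> (0::complex)} \<subseteq> closure {x. f x \<noteq> 0}"
  by (rule closure_mono) auto

lemma test_function_mult:
  "test_function f \<Longrightarrow> smooth_on UNIV w \<Longrightarrow> test_function (\<lambda>x. f x * w x)"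
  by (rule test_function_mult_local[of _ UNIV]) auto

lemma test_function_cmult: "test_function f \<Longrightarrow> test_function (\<lambda>x. c * f x)"
  using test_function_mult[of f "\<lambda>_. c"] by (simp add: mult.commute)

lemma test_function_sum:
  "(\<And>i. i \<in> I \<Longrightarrow> test_function (f i)) \<Longrightarrow> test_function (\<lambda>x. \<Sum>i\<in>I. f i x)"
  by (induction I rule: infinite_finite_induct) (auto intro: test_function_add)

lemma deriv_outside:
  assumes "x \<notin> closure {x. f x \<noteq> 0}" shows "frechet_derivative f (at x) v = 0"
proof -
  have "((\<lambda>_. 0) has_derivative (\<lambda>_. 0)) (at x)" by simp
  then have "(f has_derivative (\<lambda>_. 0)) (at x)"
  proof (rule has_derivative_transform_within_open[of _ _ _ _ "- closure {x. f x \<noteq> 0}"])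
    show "0 = f x" if "x \<in> - closure {x. f x \<noteq> 0}" for x
      using test_function_outside[of x f] that by simp
  qed (use assms in auto)
  then show ?thesis using frechet_derivative_at by metis
qed

lemma closure_supp_deriv:
  "closure {x. frechet_derivative f (at x) v \<noteq> 0} \<subseteq> closure {x. f x \<noteq> 0}"
  by (rule closure_minimal) (use deriv_outside[of _ f v] in \<open>blast, simp\<close>)

lemma test_function_deriv:
  assumes "test_function f" shows "test_function (\<lambda>x. frechet_derivative f (at x) v)"
  by (rule test_functionI[where K = "closure {x. f x \<noteq> 0}"])
     (use assms in \<open>auto simp: test_function_def intro: smooth_on_deriv deriv_outside\<close>)

lemma test_function_pderivative:
  fixes f :: "real ^ 'i::finite \<Rightarrow> complex"
  shows "test_function f \<Longrightarrow> test_function (pderivative i f)"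
  using test_function_deriv by (simp add: pderivative_def[abs_def])

lemma compact_support_integrable:
  fixes f :: "'v::euclidean_space \<Rightarrow> complex"
  assumes "continuous_on UNIV f" "compact K" "\<And>x. x \<notin> K \<Longrightarrow> f x = 0"
  shows "integrable lborel f"
proof -
  have "integrable lborel (\<lambda>x. indicator K x *\<^sub>R f x)"
    using assms by (intro borel_integrable_compact) (auto intro: continuous_on_subset)
  moreover have "(\<lambda>x. indicator K x *\<^sub>R f x) = f"
    using assms(3) by (auto simp: indicator_def fun_eq_iff)
  ultimately show ?thesis by simp
qed

lemma test_function_integrable:
  fixes f :: "'v::euclidean_space \<Rightarrow> complex"
  assumes "test_function f" shows "integrable lborel f"
  using assms
  by (intro compact_support_integrable[where K = "closure {x. f x \<noteq> 0}"] test_function_outside)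
     (auto simp: test_function_def smooth_on_continuous)

text \<open>The difference quotients integrate to zero because the Lebesgue measure is translation invariant.\<close>

lemma integral_derivative_zero:
  fixes f :: "'v::euclidean_space \<Rightarrow> complex"
  assumes d: "\<And>x. (f has_derivative D x) (at x)" and c: "continuous_on UNIV (\<lambda>x. D x v)"
    and K: "compact K" "\<And>x. x \<notin> K \<Longrightarrow> f x = 0"
  shows "(LINT x|lborel. D x v) = 0"
proof -
  have fc: "continuous_on UNIV f"
    using d by (meson continuous_at_imp_continuous_on has_derivative_continuous)
  have D0: "D x v = 0" if "x \<notin> K" for x
  proof -
    have "((\<lambda>_. 0) has_derivative (\<lambda>_. 0)) (at x)" by simp
    then have "(f has_derivative (\<lambda>_. 0)) (at x)"
      by (rule has_derivative_transform_within_open[of _ _ _ _ "- K"])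
         (use that K compact_imp_closed in auto)
    then show ?thesis using has_derivative_unique[OF d] by metis
  qed
  obtain R where "\<forall>x\<in>K. norm x \<le> R" using compact_imp_bounded[OF K(1)] by (auto simp: bounded_iff)
  then have R: "K \<subseteq> cball 0 R" by auto
  \<comment> \<open>\<open>C\<close> contains every (t, x) with 0 \<le> t \<le> 1 and x + t v in K,
    so \<open>P\<close> is a continuous function restricted to a compact set and Fubini
    applies.\<close>
  define C where "C = {0..1::real} \<times> cball (0::'v) (R + norm v)"
  define P where "P z = indicator C z *\<^sub>R D (snd z + fst z *\<^sub>R v) v" for z :: "real \<times> 'v"
  have intP: "integrable (lborel \<Otimes>\<^sub>M lborel) P"
    unfolding lborel_prod P_def[abs_def]
  proof (rule borel_integrable_compact)
    show "compact C" by (simp add: C_def compact_Times)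
    show "continuous_on C (\<lambda>z. D (snd z + fst z *\<^sub>R v) v)"
      by (intro continuous_on_compose2[OF c] continuous_intros) auto
  qed
  have P: "P (t, x) = indicator {0..1} t *\<^sub>R D (x + t *\<^sub>R v) v" for t x
  proof (cases "t \<in> {0..1} \<and> x \<notin> cball 0 (R + norm v)")
    case True
    have "norm x \<le> norm (x + t *\<^sub>R v) + norm (t *\<^sub>R v)"
      by (metis add_diff_cancel norm_triangle_ineq4)
    moreover have "norm (t *\<^sub>R v) \<le> norm v" using True by (simp add: mult_left_le_one_le)
    ultimately have "x + t *\<^sub>R v \<notin> K" using R True by auto
    then show ?thesis using D0 by (simp add: P_def C_def)
  qed (auto simp: P_def C_def indicator_def)
  have i1: "(LINT t|lborel. P (t, x)) = f (x + v) - f x" for x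
  proof -
    have "((\<lambda>t. f (x + t *\<^sub>R v)) has_vector_derivative D (x + t *\<^sub>R v) v) (at t within {0..1})" for t
    proof -
      have "((\<lambda>t. x + t *\<^sub>R v) has_derivative (\<lambda>t. t *\<^sub>R v)) (at t)"
        by (auto intro!: derivative_eq_intros)
      from has_derivative_compose[OF this d] have
        "((\<lambda>t. f (x + t *\<^sub>R v)) has_derivative (\<lambda>s. D (x + t *\<^sub>R v) (s *\<^sub>R v))) (at t)" .
      moreover have "D (x + t *\<^sub>R v) (s *\<^sub>R v) = s *\<^sub>R D (x + t *\<^sub>R v) v" for s
        using linear_scale[OF has_derivative_linear[OF d]] .
      ultimately show ?thesis
        unfolding has_vector_derivative_def by (auto intro: has_derivative_at_withinI)
    qed
    then have "((\<lambda>t. D (x + t *\<^sub>R v) v) has_integral f (x + 1 *\<^sub>R v) - f (x + 0 *\<^sub>R v)) {0..1}"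
      by (intro fundamental_theorem_of_calculus) auto
    moreover have "set_integrable lborel {0..1} (\<lambda>t. D (x + t *\<^sub>R v) v)"
      by (intro borel_integrable_atLeastAtMost' continuous_on_compose2[OF c] continuous_intros) auto
    ultimately have "(LINT t:{0..1}|lborel. D (x + t *\<^sub>R v) v) = f (x + v) - f x"
      by (simp add: set_borel_integral_eq_integral(2) integral_unique)
    then show ?thesis by (simp add: P set_lebesgue_integral_def)
  qed
  have tr: "(LINT x|lborel. g (x + w)) = (LINT x|lborel. g x)"
    if "g \<in> borel_measurable borel" for g :: "'v \<Rightarrow> complex" and w
  proof -
    have "(LINT x|lborel. g x) = (LINT x|distr lborel borel ((+) w). g x)"
      by (subst lborel_distr_plus) simp
    also have "\<dots> = (LINT x|lborel. g (w + x))"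
      using that by (intro integral_distr) auto
    finally show ?thesis by (simp add: add.commute)
  qed
  have fi: "integrable lborel f" by (rule compact_support_integrable[OF fc K])
  have fi': "integrable lborel (\<lambda>x. f (x + v))"
  proof (rule compact_support_integrable[where K = "(\<lambda>x. x - v) ` K"])
    show "continuous_on UNIV (\<lambda>x. f (x + v))"
      by (intro continuous_on_compose2[OF fc] continuous_intros) auto
    show "compact ((\<lambda>x. x - v) ` K)" by (intro compact_continuous_image K continuous_intros)
    fix x assume "x \<notin> (\<lambda>x. x - v) ` K"
    then have "x + v \<notin> K" by (metis add_diff_cancel_right' imageI)
    then show "f (x + v) = 0" using K by simp
  qed
  have Dm: "(\<lambda>x. D x v) \<in> borel_measurable borel" using c by (rule borel_measurable_continuous_onI)
  have fm: "f \<in> borel_measurable borel" using fc by (rule borel_measurable_continuous_onI)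
  \<comment> \<open>Integrating t first leaves f (x + v) - f x, whose integral is 0 by translation
    invariance; integrating x first leaves the integral of D x v for every t in the unit
    interval.\<close>
  have "(LINT x|lborel. LINT t|lborel. P (t, x)) = (LINT t|lborel. LINT x|lborel. P (t, x))"
    using lborel_pair.Fubini_integral[of "\<lambda>t x. P (t, x)"] intP by simp
  moreover have "(LINT x|lborel. LINT t|lborel. P (t, x)) = 0"
    using tr[OF fm] fi fi' by (simp add: i1)
  moreover have "(LINT t|lborel. LINT x|lborel. P (t, x))
      = (LINT t|lborel. indicator {0..1::real} t *\<^sub>R (LINT x|lborel. D x v))"
    by (simp add: P tr[OF Dm])
  moreover have "\<dots> = (LINT x|lborel. D x v)" by simp
  ultimately show ?thesis by simp
qed

section \<open>Integrals over sublevel sets\<close>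

text \<open>The fibre integral is by definition its derivative in t, so pullbacks of derivatives of
  the delta distribution become higher derivatives of this one function.\<close>

definition level_int :: "('v::euclidean_space \<Rightarrow> real) \<Rightarrow> ('v \<Rightarrow> complex) \<Rightarrow> real \<Rightarrow> complex" where
  "level_int h \<phi> t = (LINT x:{x. h x \<le> t}|lborel. \<phi> x)"

lemma set_integrable_lborel:
  fixes f :: "'v::euclidean_space \<Rightarrow> complex"
  shows "integrable lborel f \<Longrightarrow> A \<in> sets borel \<Longrightarrow> set_integrable lborel A f"
  unfolding set_integrable_def by (rule integrable_mult_indicator) auto

section \<open>Continuously differentiable approximations of the step function\<close>

definition pos_part :: "real \<Rightarrow> real" where "pos_part u = max 0 u"

lemma pos_part_square_deriv: "((\<lambda>u. (pos_part u)\<^sup>2) has_real_derivative 2 * pos_part u) (at u)"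
proof -
  consider "u > 0" | "u < 0" | "u = 0" by linarith
  then show ?thesis
  proof cases
    case 1
    have "((\<lambda>u. u\<^sup>2) has_real_derivative 2 * pos_part u) (at u)"
      using 1 by (auto intro!: derivative_eq_intros simp: pos_part_def)
    then show ?thesis
      by (rule has_field_derivative_transform_within_open[of _ _ _ "{0<..}"])
         (use 1 in \<open>auto simp: pos_part_def\<close>)
  next
    case 2
    have "((\<lambda>u. 0) has_real_derivative 2 * pos_part u) (at u)"
      using 2 by (auto intro!: derivative_eq_intros simp: pos_part_def)
    then show ?thesis
      by (rule has_field_derivative_transform_within_open[of _ _ _ "{..<0}"])
         (use 2 in \<open>auto simp: pos_part_def\<close>)
  next
    case 3
    have "((\<lambda>h. (pos_part h)\<^sup>2 / h) \<longlongrightarrow> 0) (at 0)"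
    proof (rule Lim_null_comparison[OF _ tendsto_norm_zero[OF tendsto_ident_at]])
      show "\<forall>\<^sub>F x in at 0. norm ((pos_part x)\<^sup>2 / x) \<le> norm x"
        by (auto simp: eventually_at_filter pos_part_def max_def power2_eq_square)
    qed
    then show ?thesis using 3 by (simp add: DERIV_def pos_part_def)
  qed
qed

lemma pos_part_shift:
  assumes "d \<ge> 0"
  shows "0 \<le> pos_part u - pos_part (u - d)" "pos_part u - pos_part (u - d) \<le> d"
    "0 \<le> pos_part u + pos_part (u - d)" "pos_part u + pos_part (u - d) \<le> 2 * \<bar>u\<bar>"
  using assms by (auto simp: pos_part_def max_def)

text \<open>For c > 0 a continuous approximation of the step function of u > 0: it is 0 for u \<le>
  0, linear up to u = 1/c, and 1 afterwards. \<open>ramp_int\<close> is its primitive; as a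
  combination of squares of \<open>pos_part\<close> it is C^1.\<close>

definition ramp :: "real \<Rightarrow> real \<Rightarrow> real" where
  "ramp c u = c * (pos_part u - pos_part (u - 1 / c))"

definition ramp_int :: "real \<Rightarrow> real \<Rightarrow> real" where
  "ramp_int c u = c / 2 * ((pos_part u)\<^sup>2 - (pos_part (u - 1 / c))\<^sup>2)"

lemma ramp_int_deriv: "(ramp_int c has_real_derivative ramp c u) (at u)"
proof -
  have "((\<lambda>u. (pos_part (u - 1 / c))\<^sup>2) has_real_derivative 2 * pos_part (u - 1 / c) * (1 - 0)) (at u)"
    by (rule DERIV_chain2[OF pos_part_square_deriv]) (intro derivative_intros)
  from DERIV_cmult[OF DERIV_diff[OF pos_part_square_deriv this], of "c / 2"] show ?thesis
    unfolding ramp_int_def[abs_def] ramp_def by (simp add: right_diff_distrib)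
qed

lemma continuous_on_ramp: "continuous_on UNIV (ramp c)"
  unfolding ramp_def[abs_def] pos_part_def by (intro continuous_intros)

text \<open>Uniform in c, like \<open>ramp_int_bound\<close>; the two supply the dominating
  functions when c tends to infinity.\<close>

lemma ramp_bound: assumes "c > 0" shows "\<bar>ramp c u\<bar> \<le> 1"
proof -
  have "0 \<le> pos_part u - pos_part (u - 1 / c)" "pos_part u - pos_part (u - 1 / c) \<le> 1 / c"
    using assms by (intro pos_part_shift; simp)+
  then have "0 \<le> ramp c u" "ramp c u \<le> 1"
    using assms by (auto simp: ramp_def pos_le_divide_eq mult.commute)
  then show ?thesis by simp
qed

lemma ramp_int_bound: assumes "c > 0" shows "\<bar>ramp_int c u\<bar> \<le> \<bar>u\<bar>"
proof -
  have *: "ramp_int c u = ramp c u * ((pos_part u + pos_part (u - 1 / c)) / 2)"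
    by (simp add: ramp_int_def ramp_def square_diff_square_factored power2_eq_square)
  have "\<bar>ramp_int c u\<bar> = \<bar>ramp c u\<bar> * \<bar>(pos_part u + pos_part (u - 1 / c)) / 2\<bar>"
    unfolding * by (rule abs_mult)
  also have "\<dots> \<le> 1 * \<bar>u\<bar>"
    using ramp_bound[OF assms] pos_part_shift[of "1 / c" u] assms by (intro mult_mono) auto
  finally show ?thesis by simp
qed

lemma eventually_inverse_Suc_less: "u > 0 \<Longrightarrow> \<forall>\<^sub>F k in sequentially. 1 / real (Suc k) < u"
  using LIMSEQ_inverse_real_of_nat order_tendstoD(2) by (fastforce simp: inverse_eq_divide)

lemma ramp_tendsto: "(\<lambda>k. ramp (real (Suc k)) u) \<longlonglongrightarrow> (if u > 0 then 1 else 0)"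
proof (cases "u > 0")
  case True
  have "\<forall>\<^sub>F k in sequentially. ramp (real (Suc k)) u = (if u > 0 then 1 else 0)"
    using eventually_inverse_Suc_less[OF True]
    by eventually_elim (use True in \<open>simp add: ramp_def pos_part_def field_simps\<close>)
  then show ?thesis by (rule tendsto_eventually)
next
  case False
  have "1 / real (Suc k) > 0" for k by simp
  then have "u - 1 / real (Suc k) \<le> 0" for k using False by (smt (verit))
  then have "ramp (real (Suc k)) u = 0" for k using False by (simp add: ramp_def pos_part_def max_absorb1)
  then show ?thesis using False by simp
qed

lemma ramp_int_tendsto: "(\<lambda>k. ramp_int (real (Suc k)) u) \<longlonglongrightarrow> pos_part u"
proof (cases "u > 0")
  case True
  have "(\<lambda>k. u - 1 / 2 * (1 / real (Suc k))) \<longlonglongrightarrow> u - 1 / 2 * 0"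
    using LIMSEQ_inverse_real_of_nat by (intro tendsto_intros) (simp add: inverse_eq_divide)
  moreover have "\<forall>\<^sub>F k in sequentially. u - 1 / 2 * (1 / real (Suc k)) = ramp_int (real (Suc k)) u"
    using eventually_inverse_Suc_less[OF True]
  proof eventually_elim
    case (elim k)
    have "c / 2 * (u\<^sup>2 - (u - 1 / c)\<^sup>2) = u - 1 / 2 * (1 / c)" if "c > 0" for c :: real
      using that by (simp add: power2_eq_square field_simps)
    from this[of "real (Suc k)"] show ?case
      using elim True by (simp add: ramp_int_def pos_part_def)
  qed
  ultimately have "(\<lambda>k. ramp_int (real (Suc k)) u) \<longlonglongrightarrow> u"
    using Lim_transform_eventually by fastforce
  then show ?thesis using True by (simp add: pos_part_def)
next
  case False
  have "1 / real (Suc k) > 0" for k by simp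
  then have "u - 1 / real (Suc k) \<le> 0" for k using False by (smt (verit))
  then have "ramp_int (real (Suc k)) u = 0" for k
    using False by (simp add: ramp_int_def pos_part_def max_absorb1)
  then show ?thesis using False by (simp add: pos_part_def)
qed

lemma smooth_on_real:
  fixes h :: "'v::real_normed_vector \<Rightarrow> real"
  assumes "smooth_on UNIV (\<lambda>x. complex_of_real (h x))"
  shows "continuous_on UNIV h"
    "(h has_derivative (\<lambda>v. Re (frechet_derivative (\<lambda>x. complex_of_real (h x)) (at x) v))) (at x)"
    "frechet_derivative (\<lambda>x. complex_of_real (h x)) (at x) v
       = of_real (Re (frechet_derivative (\<lambda>x. complex_of_real (h x)) (at x) v))"
proof -
  have "continuous_on UNIV (\<lambda>x. Re (complex_of_real (h x)))"
    by (intro continuous_intros smooth_on_continuous assms)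
  then show "continuous_on UNIV h" by simp
  note * = smooth_on_has_derivative[OF assms UNIV_I, of x]
  from has_derivative_of_real_iff[OF *]
  show "(h has_derivative (\<lambda>v. Re (frechet_derivative (\<lambda>x. complex_of_real (h x)) (at x) v))) (at x)"
    "frechet_derivative (\<lambda>x. complex_of_real (h x)) (at x) v
       = of_real (Re (frechet_derivative (\<lambda>x. complex_of_real (h x)) (at x) v))" by blast+
qed

text \<open>The step function of \<open>h\<close> is a pointwise limit of \<open>C\<^sup>1\<close> functions of \<open>h\<close>, for which this is the
  product rule.\<close>

lemma superlevel_parts:
  fixes h :: "'v::euclidean_space \<Rightarrow> real"
  assumes h: "smooth_on UNIV (\<lambda>x. complex_of_real (h x))" and f: "test_function f"
  shows "(LINT x|lborel. of_real (if h x > a then 1 else 0) *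
            (frechet_derivative (\<lambda>x. complex_of_real (h x)) (at x) v * f x))
       = - (LINT x|lborel. of_real (pos_part (h x - a)) * frechet_derivative f (at x) v)"
proof -
  let ?h' = "\<lambda>x. frechet_derivative (\<lambda>x. complex_of_real (h x)) (at x) v"
  let ?f' = "\<lambda>x. frechet_derivative f (at x) v"
  let ?c = "\<lambda>k. real (Suc k)"
  note hr = smooth_on_real[OF h]
  have hfi: "integrable lborel (\<lambda>x. ?h' x * f x)"
    using test_function_mult[OF f smooth_on_deriv[OF h]]
    by (simp add: test_function_integrable mult.commute)
  have f't: "test_function ?f'" by (rule test_function_deriv[OF f])
  have habsi: "integrable lborel (\<lambda>x. of_real \<bar>h x - a\<bar> * ?f' x)"
  proof (rule compact_support_integrable[where K = "closure {x. f x \<noteq> 0}"])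
    show "continuous_on UNIV (\<lambda>x. of_real \<bar>h x - a\<bar> * ?f' x)"
      using f't by (intro continuous_intros hr(1) smooth_on_continuous) (simp add: test_function_def)
  qed (use f in \<open>auto simp: test_function_def intro: deriv_outside\<close>)
  have hm [measurable]: "h \<in> borel_measurable borel"
    using hr(1) by (rule borel_measurable_continuous_onI)
  have [measurable]: "ramp c \<in> borel_measurable borel" for c
    by (rule borel_measurable_continuous_onI[OF continuous_on_ramp])
  have ric: "continuous_on UNIV (ramp_int c)" for c
    by (meson DERIV_isCont continuous_at_imp_continuous_on ramp_int_deriv)
  then have [measurable]: "ramp_int c \<in> borel_measurable borel" for c
    by (rule borel_measurable_continuous_onI)
  have [measurable]: "pos_part \<in> borel_measurable borel"
    unfolding pos_part_def[abs_def] by measurable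
  have [measurable]: "?f' \<in> borel_measurable borel"
    using test_function_integrable[OF f't] by (simp add: integrable_iff_bounded)
  have [measurable]: "(\<lambda>x. ?h' x * f x) \<in> borel_measurable borel"
    using hfi by (simp add: integrable_iff_bounded)
  \<comment> \<open>For fixed k, \<open>ramp_int\<close> of h - a times f is C^1 with compact
    support, so its derivative integrates to 0; the product rule splits this into the two
    sides.\<close>
  have eq: "(LINT x|lborel. of_real (ramp (?c k) (h x - a)) * (?h' x * f x))
      = - (LINT x|lborel. of_real (ramp_int (?c k) (h x - a)) * ?f' x)" for k
  proof -
    let ?D = "\<lambda>x v. of_real (ramp_int (?c k) (h x - a)) * frechet_derivative f (at x) v
        + of_real (ramp (?c k) (h x - a)) * frechet_derivative (\<lambda>x. complex_of_real (h x)) (at x) v * f x"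
    have d: "((\<lambda>x. of_real (ramp_int (?c k) (h x - a)) * f x) has_derivative ?D x) (at x)" for x
    proof (rule has_derivative_mult[OF _ smooth_on_has_derivative[OF test_function_smooth[OF f] UNIV_I]])
      have "((\<lambda>x. h x - a) has_derivative (\<lambda>v. Re (frechet_derivative (\<lambda>x. complex_of_real (h x)) (at x) v) - 0)) (at x)"
        by (intro has_derivative_diff hr(2) has_derivative_const)
      from has_derivative_compose[OF this ramp_int_deriv[unfolded has_field_derivative_def]]
      have "((\<lambda>x. ramp_int (?c k) (h x - a)) has_derivative
        (\<lambda>v. ramp (?c k) (h x - a) * Re (frechet_derivative (\<lambda>x. complex_of_real (h x)) (at x) v))) (at x)"
        by simp
      from bounded_linear.has_derivative[OF bounded_linear_of_real[where 'a = complex] this]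
      show "((\<lambda>x. complex_of_real (ramp_int (?c k) (h x - a))) has_derivative
        (\<lambda>v. of_real (ramp (?c k) (h x - a)) * frechet_derivative (\<lambda>x. complex_of_real (h x)) (at x) v)) (at x)"
        by (simp flip: hr(3))
    qed
    have c1: "continuous_on UNIV (\<lambda>x. of_real (ramp_int (?c k) (h x - a)) * ?f' x)"
      using f't by (intro continuous_intros continuous_on_compose2[OF ric] hr(1) smooth_on_continuous)
         (auto simp: test_function_def)
    have c2: "continuous_on UNIV (\<lambda>x. of_real (ramp (?c k) (h x - a)) * (?h' x * f x))"
      using h f by (intro continuous_intros continuous_on_compose2[OF continuous_on_ramp] hr(1)
          smooth_on_continuous smooth_on_deriv) (auto simp: test_function_def)
    define K where "K = closure {x. f x \<noteq> 0}"
    have z: "x \<notin> K \<Longrightarrow> f x = 0" "x \<notin> K \<Longrightarrow> ?f' x = 0" for x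
      unfolding K_def by (rule test_function_outside deriv_outside; assumption)+
    have K: "compact K" using f by (simp add: test_function_def K_def)
    have "(LINT x|lborel. ?D x v) = 0"
      by (rule integral_derivative_zero[OF d _ K])
         (use continuous_on_add[OF c1 c2] z in \<open>auto simp: mult.assoc\<close>)
    moreover have "integrable lborel (\<lambda>x. of_real (ramp_int (?c k) (h x - a)) * ?f' x)"
      by (rule compact_support_integrable[OF c1 K]) (simp add: z)
    moreover have "integrable lborel (\<lambda>x. of_real (ramp (?c k) (h x - a)) * (?h' x * f x))"
      by (rule compact_support_integrable[OF c2 K]) (simp add: z)
    ultimately show ?thesis by (simp add: mult.assoc add_eq_0_iff)
  qed
  have l1: "(\<lambda>k. LINT x|lborel. of_real (ramp (?c k) (h x - a)) * (?h' x * f x)) \<longlonglongrightarrow>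
     (LINT x|lborel. of_real (if h x > a then 1 else 0) * (?h' x * f x))"
  proof (rule integral_dominated_convergence[where w = "\<lambda>x. norm (?h' x * f x)"])
    show "AE x in lborel. (\<lambda>k. of_real (ramp (?c k) (h x - a)) * (?h' x * f x))
        \<longlonglongrightarrow> of_real (if h x > a then 1 else 0) * (?h' x * f x)"
      using ramp_tendsto[of "h x - a" for x]
      by (intro AE_I2 tendsto_mult tendsto_const tendsto_of_real) (auto split: if_splits)
    have "norm (of_real (ramp (?c k) (h x - a)) * (?h' x * f x)) \<le> 1 * norm (?h' x * f x)" for k x
      unfolding norm_mult norm_of_real using ramp_bound[of "?c k" "h x - a"]
      by (intro mult_right_mono) auto
    then show "AE x in lborel. norm (of_real (ramp (?c k) (h x - a)) * (?h' x * f x)) \<le> norm (?h' x * f x)" for k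
      by simp
  qed (use hfi in auto)
  have l2: "(\<lambda>k. LINT x|lborel. of_real (ramp_int (?c k) (h x - a)) * ?f' x) \<longlonglongrightarrow>
     (LINT x|lborel. of_real (pos_part (h x - a)) * ?f' x)"
  proof (rule integral_dominated_convergence[where w = "\<lambda>x. norm (of_real \<bar>h x - a\<bar> * ?f' x)"])
    show "AE x in lborel. (\<lambda>k. of_real (ramp_int (?c k) (h x - a)) * ?f' x)
        \<longlonglongrightarrow> of_real (pos_part (h x - a)) * ?f' x"
      by (intro AE_I2 tendsto_mult tendsto_const tendsto_of_real ramp_int_tendsto)
    have "norm (of_real (ramp_int (?c k) (h x - a)) * ?f' x) \<le> norm (of_real \<bar>h x - a\<bar> * ?f' x)" for k x
      unfolding norm_mult norm_of_real using ramp_int_bound[of "?c k" "h x - a"]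
      by (intro mult_right_mono) auto
    then show "AE x in lborel. norm (of_real (ramp_int (?c k) (h x - a)) * ?f' x)
       \<le> norm (of_real \<bar>h x - a\<bar> * ?f' x)" for k by simp
  qed (use habsi in auto)
  show ?thesis
    using LIMSEQ_unique[OF l1[unfolded eq] tendsto_minus[OF l2]] .
qed

text \<open>Complements and \<open>superlevel_parts\<close> at the levels a and b give the integral
  of \<open>pos_part (h x - b) - pos_part (h x - a)\<close> against the derivative of f. Up to the
  constant b - a this weight is the length of the set of s in [a, b] with h x \<le> s, and Fubini
  turns it into the integral over s. The weight grad h makes the identity hold across critical
  levels too.\<close>

lemma level_int_parts:
  fixes h :: "'v::euclidean_space \<Rightarrow> real"
  assumes h: "smooth_on UNIV (\<lambda>x. complex_of_real (h x))" and f: "test_function f" and ab: "a \<le> b"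
  shows "level_int h (\<lambda>x. frechet_derivative (\<lambda>x. complex_of_real (h x)) (at x) v * f x) b
       - level_int h (\<lambda>x. frechet_derivative (\<lambda>x. complex_of_real (h x)) (at x) v * f x) a
       = (LINT s:{a..b}|lborel. level_int h (\<lambda>x. frechet_derivative f (at x) v) s)"
proof -
  let ?F = "\<lambda>x. frechet_derivative (\<lambda>x. complex_of_real (h x)) (at x) v * f x"
  let ?f' = "\<lambda>x. frechet_derivative f (at x) v"
  note hr = smooth_on_real[OF h]
  have hm [measurable]: "h \<in> borel_measurable borel"
    using hr(1) by (rule borel_measurable_continuous_onI)
  have Ft: "test_function ?F"
    using test_function_mult[OF f smooth_on_deriv[OF h]] by (simp add: mult.commute)
  have f't: "test_function ?f'" by (rule test_function_deriv[OF f])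
  note Fi = test_function_integrable[OF Ft] and f'i = test_function_integrable[OF f't]
  have [measurable]: "?f' \<in> borel_measurable borel"
    using f'i by (simp add: integrable_iff_bounded)
  \<comment> \<open>This disposes of the constant b - a by which the weight differs from the length
    computed below.\<close>
  have f'0: "(LINT x|lborel. ?f' x) = 0"
    using f f't by (intro integral_derivative_zero[where f = f and K = "closure {x. f x \<noteq> 0}"]
        smooth_on_has_derivative[OF test_function_smooth[OF f]] test_function_outside)
       (auto simp: test_function_def smooth_on_continuous)
  have "level_int h \<phi> t = (LINT x|lborel. \<phi> x)
      - (LINT x|lborel. of_real (if h x > t then 1 else 0) * \<phi> x)"
    if "integrable lborel \<phi>" for \<phi> t
  proof -
    have i1: "integrable lborel (\<lambda>x. indicator {x. h x > t} x *\<^sub>R \<phi> x)"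
      by (intro integrable_mult_indicator that) auto
    have "level_int h \<phi> t = (LINT x|lborel. \<phi> x - indicator {x. h x > t} x *\<^sub>R \<phi> x)"
      unfolding level_int_def set_lebesgue_integral_def
      by (intro Bochner_Integration.integral_cong) (auto simp: indicator_def)
    also have "\<dots> = (LINT x|lborel. \<phi> x) - (LINT x|lborel. indicator {x. h x > t} x *\<^sub>R \<phi> x)"
      using i1 that by simp
    also have "(LINT x|lborel. indicator {x. h x > t} x *\<^sub>R \<phi> x)
        = (LINT x|lborel. of_real (if h x > t then 1 else 0) * \<phi> x)"
      by (intro Bochner_Integration.integral_cong) (auto simp: indicator_def)
    finally show ?thesis .
  qed
  note level = this
  have pi: "integrable lborel (\<lambda>x. of_real (pos_part (h x - t)) * ?f' x)" for t
  proof (rule compact_support_integrable[where K = "closure {x. f x \<noteq> 0}"])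
    show "continuous_on UNIV (\<lambda>x. of_real (pos_part (h x - t)) * ?f' x)"
      using f't unfolding pos_part_def
      by (intro continuous_intros hr(1) smooth_on_continuous) (simp add: test_function_def)
  qed (use f in \<open>auto simp: test_function_def intro: deriv_outside\<close>)
  have "level_int h ?F b - level_int h ?F a
      = (LINT x|lborel. of_real (pos_part (h x - b)) * ?f' x) - (LINT x|lborel. of_real (pos_part (h x - a)) * ?f' x)"
    unfolding level[OF Fi] superlevel_parts[OF h f] by simp
  also have "\<dots> = (LINT x|lborel. of_real (pos_part (h x - b) - pos_part (h x - a)) * ?f' x)"
    using pi by (simp add: left_diff_distrib)
  finally have lhs: "level_int h ?F b - level_int h ?F a
      = (LINT x|lborel. of_real (pos_part (h x - b) - pos_part (h x - a)) * ?f' x)" .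
  define P where "P z = indicator {z. fst z \<in> {a..b} \<and> h (snd z) \<le> fst z} z *\<^sub>R ?f' (snd z)" for z :: "real \<times> 'v"
  have Pm: "{z \<in> space (lborel \<Otimes>\<^sub>M lborel). fst z \<in> {a..b} \<and> h (snd z) \<le> fst z} \<in> sets (lborel \<Otimes>\<^sub>M lborel)"
    by measurable
  have base: "integrable (lborel \<Otimes>\<^sub>M lborel) (\<lambda>z. indicator ({a..b} \<times> closure {x. f x \<noteq> 0}) z *\<^sub>R ?f' (snd z))"
    unfolding lborel_prod
  proof (rule borel_integrable_compact)
    show "compact ({a..b} \<times> closure {x. f x \<noteq> 0})" using f by (simp add: compact_Times test_function_def)
    have c: "continuous_on UNIV ?f'" using f't by (simp add: test_function_def smooth_on_continuous)
    show "continuous_on ({a..b} \<times> closure {x. f x \<noteq> 0}) (\<lambda>z. ?f' (snd z))"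
      by (intro continuous_on_compose2[OF c] continuous_intros) auto
  qed
  have Pi: "integrable (lborel \<Otimes>\<^sub>M lborel) P"
  proof -
    have "integrable (lborel \<Otimes>\<^sub>M lborel) (\<lambda>z. indicator {z. fst z \<in> {a..b} \<and> h (snd z) \<le> fst z} z *\<^sub>R
        (indicator ({a..b} \<times> closure {x. f x \<noteq> 0}) z *\<^sub>R ?f' (snd z)))"
      using Pm by (intro integrable_mult_indicator base) (simp add: space_pair_measure)
    moreover have "indicator {z. fst z \<in> {a..b} \<and> h (snd z) \<le> fst z} z *\<^sub>R
        (indicator ({a..b} \<times> closure {x. f x \<noteq> 0}) z *\<^sub>R ?f' (snd z)) = P z" for z
      using deriv_outside[of "snd z" f v] by (cases z) (auto simp: P_def indicator_def)
    ultimately show ?thesis by simp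
  qed
  have in1: "(LINT x|lborel. P (t, x)) = indicator {a..b} t *\<^sub>R level_int h ?f' t" for t
    unfolding level_int_def set_lebesgue_integral_def P_def by (cases "t \<in> {a..b}") (auto simp: indicator_def)
  \<comment> \<open>The length of the interval from max a u to b in a single formula, which also
    gives 0 when the interval is empty.\<close>
  have len: "(LINT t|lborel. indicator {t. t \<in> {a..b} \<and> u \<le> t} t) = (b - a) + pos_part (u - b) - pos_part (u - a)" for u
  proof -
    have "{t. t \<in> {a..b} \<and> u \<le> t} = {max a u..b}" by auto
    moreover have "max a u \<le> b \<Longrightarrow> b - max a u = (b - a) + pos_part (u - b) - pos_part (u - a)"
      using ab by (auto simp: pos_part_def max_def split: if_splits)
    moreover have "\<not> max a u \<le> b \<Longrightarrow> (b - a) + pos_part (u - b) - pos_part (u - a) = 0"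
      using ab by (auto simp: pos_part_def max_def split: if_splits)
    ultimately show ?thesis by auto
  qed
  have in2: "(LINT t|lborel. P (t, x)) = of_real ((b - a) + pos_part (h x - b) - pos_part (h x - a)) * ?f' x" for x
  proof -
    have fin: "emeasure lborel {t. t \<in> {a..b} \<and> h x \<le> t} < \<infinity>"
      by (rule le_less_trans[OF emeasure_mono[of _ "{a..b}"]]) (auto simp: emeasure_lborel_Icc_eq)
    have "(LINT t|lborel. P (t, x)) = (LINT t|lborel. indicator {t. t \<in> {a..b} \<and> h x \<le> t} t *\<^sub>R ?f' x)"
      unfolding P_def by (intro Bochner_Integration.integral_cong) (auto simp: indicator_def)
    also have "\<dots> = (LINT t|lborel. indicator {t. t \<in> {a..b} \<and> h x \<le> t} t) *\<^sub>R ?f' x"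
      using fin by (intro integral_scaleR_left integrable_real_indicator) auto
    finally show ?thesis unfolding len scaleR_conv_of_real .
  qed
  have "(LINT t|lborel. LINT x|lborel. P (t, x)) = (LINT x|lborel. LINT t|lborel. P (t, x))"
    using lborel_pair.Fubini_integral[of "\<lambda>t x. P (t, x)"] Pi by simp
  then have "(LINT s:{a..b}|lborel. level_int h ?f' s)
      = (LINT x|lborel. of_real ((b - a) + pos_part (h x - b) - pos_part (h x - a)) * ?f' x)"
    by (simp add: in1 in2 set_lebesgue_integral_def)
  also have "\<dots> = (LINT x|lborel. of_real (b - a) * ?f' x
      + of_real (pos_part (h x - b) - pos_part (h x - a)) * ?f' x)"
    by (intro Bochner_Integration.integral_cong) (auto simp: algebra_simps)
  also have "\<dots> = (LINT x|lborel. of_real (b - a) * ?f' x)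
      + (LINT x|lborel. of_real (pos_part (h x - b) - pos_part (h x - a)) * ?f' x)"
    using pi[of b] pi[of a] f'i
    by (intro Bochner_Integration.integral_add) (auto simp: left_diff_distrib)
  also have "(LINT x|lborel. of_real (b - a) * ?f' x) = 0" using f'0 by simp
  finally show ?thesis using lhs by simp
qed

section \<open>Iterated derivatives of functions of one real variable\<close>

definition vd :: "(real \<Rightarrow> complex) \<Rightarrow> real \<Rightarrow> complex" where
  "vd u t = vector_derivative u (at t)"

lemma vd_eqI: "(u has_vector_derivative d) (at t) \<Longrightarrow> vd u t = d"
  by (simp add: vd_def vector_derivative_at)

lemma smooth_on_vd:
  assumes "smooth_on U u"
  shows "t \<in> U \<Longrightarrow> (u has_vector_derivative vd u t) (at t)" "open U \<Longrightarrow> smooth_on U (vd u)"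
proof -
  have *: "(u has_vector_derivative frechet_derivative u (at t) 1) (at t)" if "t \<in> U" for t
  proof -
    note d = smooth_on_has_derivative[OF assms that]
    have "frechet_derivative u (at t) s = s *\<^sub>R frechet_derivative u (at t) 1" for s
      using linear_scale[OF has_derivative_linear[OF d], of s 1] by simp
    then have "frechet_derivative u (at t) = (\<lambda>s. s *\<^sub>R frechet_derivative u (at t) 1)" by blast
    then show ?thesis using d unfolding has_vector_derivative_def by simp
  qed
  then show "t \<in> U \<Longrightarrow> (u has_vector_derivative vd u t) (at t)" using vd_eqI by metis
  show "smooth_on U (vd u)" if "open U"
    by (rule smooth_on_cong[OF smooth_on_deriv[OF assms] that]) (rule vd_eqI[OF *, symmetric])
qed

text \<open>\<open>vector_derivative\<close> chooses among all derivatives at t, and functions that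
  agree near t have the same ones; so the choices agree even where no derivative exists.\<close>

lemma vd_cong:
  assumes "open U" "t \<in> U" "\<And>s. s \<in> U \<Longrightarrow> u s = w s"
  shows "vd u t = vd w t"
proof -
  have "(u has_vector_derivative d) (at t) \<longleftrightarrow> (w has_vector_derivative d) (at t)" for d
    using has_vector_derivative_transform_within_open[of u d t U w]
      has_vector_derivative_transform_within_open[of w d t U u] assms by auto
  then show ?thesis by (simp add: vd_def vector_derivative_def)
qed

lemma vd_iter_cong:
  assumes "open U" "\<And>s. s \<in> U \<Longrightarrow> u s = w s"
  shows "t \<in> U \<Longrightarrow> (vd ^^ k) u t = (vd ^^ k) w t"
proof (induction k arbitrary: t)
  case (Suc k)
  then show ?case using vd_cong[OF assms(1), of t "(vd ^^ k) u" "(vd ^^ k) w"] by simp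
qed (simp add: assms)

lemma smooth_on_vd_iter: "smooth_on U u \<Longrightarrow> open U \<Longrightarrow> smooth_on U ((vd ^^ k) u)"
  by (induction k) (auto intro: smooth_on_vd)

lemma vd_iter_add:
  assumes "smooth_on U u" "smooth_on U w" "open U"
  shows "t \<in> U \<Longrightarrow> (vd ^^ k) (\<lambda>s. u s + w s) t = (vd ^^ k) u t + (vd ^^ k) w t"
proof (induction k arbitrary: t)
  case (Suc k)
  have "vd ((vd ^^ k) (\<lambda>s. u s + w s)) t = vd (\<lambda>s. (vd ^^ k) u s + (vd ^^ k) w s) t"
    by (rule vd_cong[OF assms(3) Suc.prems Suc.IH])
  also have "\<dots> = vd ((vd ^^ k) u) t + vd ((vd ^^ k) w) t"
    by (intro vd_eqI has_vector_derivative_add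
        smooth_on_vd(1)[OF smooth_on_vd_iter[OF assms(1,3)] Suc.prems]
        smooth_on_vd(1)[OF smooth_on_vd_iter[OF assms(2,3)] Suc.prems])
  finally show ?case by simp
qed simp

lemma vd_iter_cmult:
  assumes "smooth_on U u" "open U"
  shows "t \<in> U \<Longrightarrow> (vd ^^ k) (\<lambda>s. c * u s) t = c * (vd ^^ k) u t"
proof (induction k arbitrary: t)
  case (Suc k)
  have "vd ((vd ^^ k) (\<lambda>s. c * u s)) t = vd (\<lambda>s. c * (vd ^^ k) u s) t"
    by (rule vd_cong[OF assms(2) Suc.prems Suc.IH])
  also have "\<dots> = c * vd ((vd ^^ k) u) t"
    by (intro vd_eqI has_vector_derivative_mult_right
        smooth_on_vd(1)[OF smooth_on_vd_iter[OF assms(1,2)] Suc.prems])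
  finally show ?case by simp
qed simp

lemma vd_iter_const: "k \<ge> 1 \<Longrightarrow> (vd ^^ k) (\<lambda>s. c) = (\<lambda>_. 0)"
proof (induction k)
  case (Suc k)
  have "vd (\<lambda>s. d) = (\<lambda>_. 0)" for d using vd_eqI[OF has_vector_derivative_const] by auto
  then show ?case using Suc by (cases "k = 0") auto
qed simp

lemma vector_derivative_of_integral_identity:
  fixes u w :: "real \<Rightarrow> complex"
  assumes "\<And>a b. a \<le> b \<Longrightarrow> u b - u a = (LINT s:{a..b}|lborel. w s)"
    and c: "continuous_on {l<..<r} w" and t: "t \<in> {l<..<r}"
  shows "(u has_vector_derivative w t) (at t)"
proof -
  \<comment> \<open>Midpoints keep [a, b] inside the interval where w is continuous, with t in its
    interior, so the derivative within [a, b] is a derivative at t.\<close>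
  define a where "a = (l + t) / 2" define b where "b = (t + r) / 2"
  have ab: "l < a" "a < t" "t < b" "b < r" using t by (auto simp: a_def b_def)
  have c': "continuous_on {a..b} w" by (rule continuous_on_subset[OF c]) (use ab in auto)
  have e: "u s = u a + integral {a..s} w" if "s \<in> {a..b}" for s
  proof -
    have "set_integrable lborel {a..s} w"
      by (rule borel_integrable_atLeastAtMost', rule continuous_on_subset[OF c']) (use that in auto)
    then show ?thesis using assms(1)[of a s] that
      by (simp add: set_borel_integral_eq_integral(2) algebra_simps)
  qed
  have "((\<lambda>s. u a + integral {a..s} w) has_vector_derivative 0 + w t) (at t within {a..b})"
    by (intro has_vector_derivative_add has_vector_derivative_const integral_has_vector_derivative c') (use ab in auto)
  then have "((\<lambda>s. u a + integral {a..s} w) has_vector_derivative w t) (at t within {a..b})" by simp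
  then have "(u has_vector_derivative w t) (at t within {a..b})"
    using has_vector_derivative_transform[of t "{a..b}" u, OF _ e] ab by simp
  then show ?thesis using ab by (simp add: at_within_Icc_at)
qed


section \<open>Linearity and continuity of sublevel integrals\<close>

lemma level_int_add:
  fixes h :: "'v::euclidean_space \<Rightarrow> real"
  assumes "continuous_on UNIV h" "integrable lborel f" "integrable lborel g"
  shows "level_int h (\<lambda>x. f x + g x) t = level_int h f t + level_int h g t"
proof -
  have [measurable]: "h \<in> borel_measurable borel"
    using assms(1) by (rule borel_measurable_continuous_onI)
  show ?thesis unfolding level_int_def
    using assms by (intro set_integral_add set_integrable_lborel) auto
qed

lemma level_int_cmult: "level_int h (\<lambda>x. c * f x) t = c * level_int h f t"
  by (simp add: level_int_def)

lemma level_int_sum: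
  fixes h :: "'v::euclidean_space \<Rightarrow> real"
  assumes "continuous_on UNIV h" "\<And>i. i \<in> I \<Longrightarrow> integrable lborel (f i)"
  shows "level_int h (\<lambda>x. \<Sum>i\<in>I. f i x) t = (\<Sum>i\<in>I. level_int h (f i) t)"
  using assms(2)
proof (induction I rule: infinite_finite_induct)
  case (insert i I)
  then show ?case using assms(1) by (simp add: level_int_add)
qed (simp_all add: level_int_def)

lemma level_int_bound:
  fixes h :: "'v::euclidean_space \<Rightarrow> real"
  assumes "integrable lborel f"
  shows "norm (level_int h f t) \<le> (LINT x|lborel. norm (f x))"
proof -
  have "norm (level_int h f t) \<le> (LINT x|lborel. norm (indicator {x. h x \<le> t} x *\<^sub>R f x))"
    unfolding level_int_def set_lebesgue_integral_def by (rule integral_norm_bound)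
  also have "\<dots> \<le> (LINT x|lborel. norm (f x))"
    using assms by (intro integral_mono') (auto simp: indicator_def)
  finally show ?thesis .
qed

text \<open>\<open>level_int_parts\<close> bounds the increment over [a, b] by b - a times the L^1
  norm of the derivative of f. Without the weight grad h a jump occurs, for instance, at a level
  where h is constant on a set on which f has nonzero integral.\<close>

lemma level_int_gradient_continuous:
  fixes h :: "'v::euclidean_space \<Rightarrow> real"
  assumes h: "smooth_on UNIV (\<lambda>x. complex_of_real (h x))" and f: "test_function f"
  shows "continuous_on UNIV (level_int h (\<lambda>x. frechet_derivative (\<lambda>x. complex_of_real (h x)) (at x) v * f x))"
    (is "continuous_on UNIV ?u")
proof -
  let ?f' = "\<lambda>x. frechet_derivative f (at x) v"
  define M where "M = (LINT x|lborel. norm (?f' x))"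
  have M0: "M \<ge> 0" by (simp add: M_def)
  have f'i: "integrable lborel ?f'" by (intro test_function_integrable test_function_deriv f)
  have b: "norm (?u b - ?u a) \<le> M * (b - a)" if "a \<le> b" for a b
  proof -
    have "norm (?u b - ?u a) \<le> (LINT s|lborel. norm (indicator {a..b} s *\<^sub>R level_int h ?f' s))"
      unfolding level_int_parts[OF h f that] set_lebesgue_integral_def by (rule integral_norm_bound)
    also have "\<dots> \<le> (LINT s|lborel. indicator {a..b} s *\<^sub>R M)"
      using level_int_bound[OF f'i, of h] M0
      by (intro integral_mono' integrable_scaleR_left integrable_real_indicator)
         (auto simp: indicator_def M_def emeasure_lborel_Icc_eq)
    also have "\<dots> = M * (b - a)" using that by simp
    finally show ?thesis .
  qed
  have "M-lipschitz_on UNIV ?u"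
  proof (rule lipschitz_onI[OF _ M0])
    fix s t :: real
    show "dist (?u s) (?u t) \<le> M * dist s t"
      using b[of s t] b[of t s] by (cases "s \<le> t") (auto simp: dist_norm norm_minus_commute)
  qed
  then show ?thesis by (rule lipschitz_on_continuous_on)
qed

section \<open>Sublevel integrals near a regular level\<close>

locale level_set =
  fixes h :: "real ^ 'i::finite \<Rightarrow> real"
  assumes smooth_h: "smooth_on UNIV (\<lambda>x. complex_of_real (h x))"
    and compact_zero: "compact {x. h x = 0}"
    and regular: "h x = 0 \<Longrightarrow> \<exists>i. pderivative i (\<lambda>x. complex_of_real (h x)) x \<noteq> 0"
begin

definition grd :: "'i \<Rightarrow> real ^ 'i \<Rightarrow> complex" where
  "grd i = pderivative i (\<lambda>x. complex_of_real (h x))"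

definition gsq :: "real ^ 'i \<Rightarrow> complex" where
  "gsq x = (\<Sum>i\<in>UNIV. (grd i x)\<^sup>2)"

definition reg :: "(real ^ 'i) set" where "reg = {x. gsq x \<noteq> 0}"

lemma continuous_h: "continuous_on UNIV h"
  using smooth_h by (rule smooth_on_real(1))

lemma smooth_grd: "smooth_on UNIV (grd i)"
  unfolding grd_def pderivative_def[abs_def] using smooth_h by (rule smooth_on_deriv)

lemma smooth_gsq: "smooth_on UNIV gsq"
  unfolding gsq_def[abs_def] by (intro smooth_on_sum smooth_on_power smooth_grd open_UNIV)

lemma open_reg: "open reg"
  unfolding reg_def using smooth_on_continuous[OF smooth_gsq]
  by (intro open_Collect_neq) auto

lemma zero_subset_reg: "{x. h x = 0} \<subseteq> reg"
proof
  fix x assume "x \<in> {x. h x = 0}"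
  then obtain i where i: "grd i x \<noteq> 0" using regular by (auto simp: grd_def)
  define r where "r j = Re (grd j x)" for j
  \<comment> \<open>\<open>gsq\<close> is a sum of complex squares, which could cancel; that the
    gradient is real rules this out.\<close>
  have re: "grd j x = of_real (r j)" for j
    unfolding grd_def r_def pderivative_def by (rule smooth_on_real(3)[OF smooth_h])
  have "(\<Sum>j\<in>UNIV. (r j)\<^sup>2) > 0"
    using i re[of i] by (intro sum_pos2[of UNIV i]) auto
  then have "complex_of_real (\<Sum>j\<in>UNIV. (r j)\<^sup>2) \<noteq> 0" by (metis less_irrefl of_real_eq_0_iff)
  then show "x \<in> reg" by (simp add: reg_def gsq_def re)
qed

text \<open>The vector field f grad h / |grad h|^2, whose scalar product with grad h is f. The
  integral of its divergence \<open>level_deriv f\<close> over h \<le> t will be the t-derivative of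
  that of f.\<close>

definition flux :: "'i \<Rightarrow> (real ^ 'i \<Rightarrow> complex) \<Rightarrow> real ^ 'i \<Rightarrow> complex" where
  "flux i f x = f x * (grd i x * inverse (gsq x))"

definition level_deriv :: "(real ^ 'i \<Rightarrow> complex) \<Rightarrow> real ^ 'i \<Rightarrow> complex" where
  "level_deriv f x = (\<Sum>i\<in>UNIV. pderivative i (flux i f) x)"

lemma test_flux:
  assumes "test_function f" "closure {x. f x \<noteq> 0} \<subseteq> reg" shows "test_function (flux i f)"
proof -
  have "smooth_on reg (\<lambda>x. grd i x * inverse (gsq x))"
    using smooth_grd smooth_gsq open_reg
    by (intro smooth_on_mult smooth_on_inverse) (auto intro: smooth_on_subset simp: reg_def)
  from test_function_mult_local[OF assms(1) open_reg assms(2) this] show ?thesis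
    by (simp add: flux_def[abs_def])
qed

lemma sum_flux:
  assumes "closure {x. f x \<noteq> 0} \<subseteq> reg" shows "(\<Sum>i\<in>UNIV. grd i x * flux i f x) = f x"
proof (cases "x \<in> reg")
  case True
  have "(\<Sum>i\<in>UNIV. grd i x * flux i f x) = (\<Sum>i\<in>UNIV. f x * inverse (gsq x) * (grd i x)\<^sup>2)"
    by (simp add: flux_def power2_eq_square mult_ac)
  also have "\<dots> = f x * inverse (gsq x) * gsq x" by (simp add: gsq_def sum_distrib_left)
  finally have "(\<Sum>i\<in>UNIV. grd i x * flux i f x) = f x * inverse (gsq x) * gsq x" .
  then show ?thesis using True by (simp add: reg_def)
next
  case False
  then have "f x = 0" using assms closure_subset[of "{x. f x \<noteq> 0}"] by auto
  then show ?thesis by (simp add: flux_def)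
qed

lemma closure_supp_pderivative:
  "closure {x. pderivative i f x \<noteq> 0} \<subseteq> closure {x. f x \<noteq> 0}"
  unfolding pderivative_def by (rule closure_supp_deriv)

lemma test_level_deriv:
  assumes "test_function f" "closure {x. f x \<noteq> 0} \<subseteq> reg"
  shows "test_function (level_deriv f)" "closure {x. level_deriv f x \<noteq> 0} \<subseteq> reg"
proof -
  show "test_function (level_deriv f)"
    unfolding level_deriv_def[abs_def] by (intro test_function_sum test_function_pderivative test_flux assms)
  have "level_deriv f x = 0" if x: "x \<notin> closure {x. f x \<noteq> 0}" for x
    unfolding level_deriv_def
  proof (intro sum.neutral ballI)
    fix i
    have "closure {x. flux i f x \<noteq> 0} \<subseteq> closure {x. f x \<noteq> 0}"
      unfolding flux_def by (rule closure_supp_mult)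
    then show "pderivative i (flux i f) x = 0"
      unfolding pderivative_def using x by (intro deriv_outside) auto
  qed
  then have "closure {x. level_deriv f x \<noteq> 0} \<subseteq> closure {x. f x \<noteq> 0}"
    by (intro closure_minimal) auto
  then show "closure {x. level_deriv f x \<noteq> 0} \<subseteq> reg" using assms by blast
qed

lemma level_int_split:
  assumes "test_function f" "closure {x. f x \<noteq> 0} \<subseteq> reg"
  shows "level_int h f t = (\<Sum>i\<in>UNIV. level_int h (\<lambda>x. grd i x * flux i f x) t)"
proof -
  have "integrable lborel (\<lambda>x. grd i x * flux i f x)" for i
    using test_function_mult[OF test_flux[OF assms] smooth_grd]
    by (simp add: test_function_integrable mult.commute)
  then show ?thesis by (simp add: level_int_sum[OF continuous_h, symmetric] sum_flux[OF assms(2)])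
qed

lemma level_int_continuous:
  assumes "test_function f" "closure {x. f x \<noteq> 0} \<subseteq> reg"
  shows "continuous_on UNIV (level_int h f)"
proof -
  have "continuous_on UNIV (level_int h (\<lambda>x. grd i x * flux i f x))" for i
    using level_int_gradient_continuous[OF smooth_h test_flux[OF assms]]
    by (simp add: grd_def pderivative_def)
  then have "continuous_on UNIV (\<lambda>t. \<Sum>i\<in>UNIV. level_int h (\<lambda>x. grd i x * flux i f x) t)"
    by (intro continuous_on_sum)
  then show ?thesis by (simp flip: level_int_split[OF assms])
qed

lemma parts:
  assumes "test_function f" "a \<le> b"
  shows "level_int h (\<lambda>x. grd i x * f x) b - level_int h (\<lambda>x. grd i x * f x) a
    = (LINT s:{a..b}|lborel. level_int h (pderivative i f) s)"
  using level_int_parts[OF smooth_h assms] by (simp add: grd_def pderivative_def[abs_def])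

text \<open>Writing f as the sum of \<open>grd i\<close> times \<open>flux i f\<close> makes
  \<open>parts\<close> applicable in each coordinate. The support of \<open>level_deriv f\<close>
  stays inside \<open>reg\<close>, so the step can be repeated; this is the induction in
  \<open>level_int_smooth\<close>.\<close>

lemma level_int_derivative:
  assumes "test_function f" "closure {x. f x \<noteq> 0} \<subseteq> reg"
  shows "(level_int h f has_vector_derivative level_int h (level_deriv f) t) (at t)"
proof (rule vector_derivative_of_integral_identity[where l = "t - 1" and r = "t + 1"])
  have pi: "integrable lborel (pderivative i (flux i f))" for i
    by (intro test_function_integrable test_function_pderivative test_flux assms)
  show "level_int h f b - level_int h f a = (LINT s:{a..b}|lborel. level_int h (level_deriv f) s)"
    if "a \<le> b" for a b
  proof -
    have cont: "continuous_on UNIV (level_int h (pderivative i (flux i f)))" for i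
    proof (rule level_int_continuous)
      have "closure {x. flux i f x \<noteq> 0} \<subseteq> closure {x. f x \<noteq> 0}"
        unfolding flux_def by (rule closure_supp_mult)
      then show "closure {x. pderivative i (flux i f) x \<noteq> 0} \<subseteq> reg"
        using closure_supp_pderivative assms(2) by blast
    qed (intro test_function_pderivative test_flux assms)
    have "level_int h f b - level_int h f a
        = (\<Sum>i\<in>UNIV. LINT s:{a..b}|lborel. level_int h (pderivative i (flux i f)) s)"
      unfolding level_int_split[OF assms] sum_subtractf[symmetric]
      by (intro sum.cong refl parts test_flux assms that)
    also have "\<dots> = (LINT s:{a..b}|lborel. \<Sum>i\<in>UNIV. level_int h (pderivative i (flux i f)) s)"
    proof -
      have "integrable lborel (\<lambda>s. indicator {a..b} s *\<^sub>R level_int h (pderivative i (flux i f)) s)" for i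
        using borel_integrable_atLeastAtMost'[of a b] continuous_on_subset[OF cont]
        by (auto simp: set_integrable_def)
      then show ?thesis
        unfolding set_lebesgue_integral_def scaleR_sum_right
        by (intro Bochner_Integration.integral_sum[symmetric])
    qed
    also have "(\<lambda>s. \<Sum>i\<in>UNIV. level_int h (pderivative i (flux i f)) s) = level_int h (level_deriv f)"
      unfolding level_deriv_def[abs_def] by (rule ext) (simp add: level_int_sum[OF continuous_h] pi)
    finally show ?thesis .
  qed
  show "continuous_on {t - 1<..<t + 1} (level_int h (level_deriv f))"
    using level_int_continuous[OF test_level_deriv[OF assms]] by (rule continuous_on_subset) simp
qed simp

lemma level_int_smooth:
  assumes "test_function f" "closure {x. f x \<noteq> 0} \<subseteq> reg"
  shows "smooth_on UNIV (level_int h f)"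
proof -
  have "ck_on k UNIV (level_int h f)" for k
    using assms
  proof (induction k arbitrary: f)
    case 0
    then show ?case by (simp add: level_int_continuous)
  next
    case (Suc k)
    show ?case
    proof (rule ck_on_SucI)
      show "(level_int h f has_derivative (\<lambda>v. of_real v * level_int h (level_deriv f) t)) (at t)" for t
        using level_int_derivative[OF Suc.prems, of t]
        by (simp add: has_vector_derivative_def scaleR_conv_of_real)
      show "ck_on k UNIV (\<lambda>t. of_real v * level_int h (level_deriv f) t)" for v
        by (intro ck_on_mult ck_on_const Suc.IH test_level_deriv Suc.prems open_UNIV)
    qed simp
  qed
  then show ?thesis by (simp add: smooth_on_def)
qed

text \<open>On the compact set supp f - W the function |h| is bounded below by some e > 0, so for
  |t| < e the sublevel sets at t and at 0 differ only where f vanishes.\<close>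

lemma level_int_locally_constant:
  assumes f: "test_function f" and W: "open W" "{x. h x = 0} \<subseteq> W" "\<forall>x\<in>W. f x = 0"
  shows "\<exists>e>0. \<forall>t\<in>{-e<..<e}. level_int h f t = level_int h f 0"
proof -
  define K where "K = closure {x. f x \<noteq> 0} - W"
  have K: "compact K" unfolding K_def using f W by (intro compact_diff) (auto simp: test_function_def)
  have z: "f x = 0" if "x \<notin> K" for x
    using that W(3) test_function_outside[of x f] by (auto simp: K_def)
  obtain e where e: "e > 0" "\<And>x. x \<in> K \<Longrightarrow> e \<le> \<bar>h x\<bar>"
  proof (cases "K = {}")
    case True
    then show ?thesis using that[of 1] by simp
  next
    case False
    have "continuous_on K (\<lambda>x. \<bar>h x\<bar>)"
      by (intro continuous_intros continuous_on_subset[OF continuous_h]) simp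
    from continuous_attains_inf[OF K False this] obtain x0 where x0: "x0 \<in> K"
      "\<And>x. x \<in> K \<Longrightarrow> \<bar>h x0\<bar> \<le> \<bar>h x\<bar>" by blast
    have "h x0 \<noteq> 0" using x0(1) W(2) by (auto simp: K_def)
    then show ?thesis using that[of "\<bar>h x0\<bar>"] x0(2) by simp
  qed
  have "level_int h f t = level_int h f 0" if t: "t \<in> {-e<..<e}" for t
    unfolding level_int_def set_lebesgue_integral_def
  proof (intro Bochner_Integration.integral_cong refl)
    fix x
    show "indicator {x. h x \<le> t} x *\<^sub>R f x = indicator {x. h x \<le> 0} x *\<^sub>R f x"
    proof (cases "x \<in> K")
      case True
      from e(2)[OF this] t e(1) show ?thesis by (auto simp: indicator_def abs_if split: if_splits)
    qed (simp add: z)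
  qed
  with e(1) show ?thesis by blast
qed

text \<open>A cutoff \<theta> equal to 1 near h = 0 splits f: \<theta> f is supported in the regular
  set, and the sublevel integral of (1 - \<theta>) f is constant for small t.\<close>

lemma level_int_smooth_near_zero:
  assumes "test_function f"
  obtains e where "e > 0" "smooth_on {-e<..<e} (level_int h f)"
proof -
  obtain \<theta> where \<theta>: "cutoff {x. h x = 0} reg \<theta>"
    using cutoff_exists[OF compact_zero open_reg zero_subset_reg] by blast
  then obtain W where W: "open W" "{x. h x = 0} \<subseteq> W" "\<And>x. x \<in> W \<Longrightarrow> \<theta> x = 1"
    by (auto simp: cutoff_def)
  have t\<theta>: "test_function \<theta>" "closure {x. \<theta> x \<noteq> 0} \<subseteq> reg" using \<theta> by (auto simp: cutoff_def)
  have t1: "test_function (\<lambda>x. \<theta> x * f x)"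
    using assms by (intro test_function_mult t\<theta> test_function_smooth)
  have s1: "closure {x. \<theta> x * f x \<noteq> 0} \<subseteq> reg"
    using closure_supp_mult[of \<theta> f] t\<theta>(2) by blast
  have t2: "test_function (\<lambda>x. f x * (1 - \<theta> x))"
    using t\<theta> by (intro test_function_mult assms smooth_on_diff) (auto simp: test_function_def)
  have "\<forall>x\<in>W. f x * (1 - \<theta> x) = 0" using W(3) by simp
  from level_int_locally_constant[OF t2 W(1,2) this]
  obtain e where e: "e > 0"
    "\<forall>t\<in>{-e<..<e}. level_int h (\<lambda>x. f x * (1 - \<theta> x)) t = level_int h (\<lambda>x. f x * (1 - \<theta> x)) 0"
    by (elim exE conjE)
  have eq: "level_int h f t = level_int h (\<lambda>x. \<theta> x * f x) t + level_int h (\<lambda>x. f x * (1 - \<theta> x)) t" for t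
    using level_int_add[OF continuous_h test_function_integrable[OF t1] test_function_integrable[OF t2]]
    by (simp add: algebra_simps)
  have "smooth_on {-e<..<e} (\<lambda>t. level_int h (\<lambda>x. \<theta> x * f x) t + level_int h (\<lambda>x. f x * (1 - \<theta> x)) 0)"
    by (intro smooth_on_add smooth_on_const smooth_on_subset[OF level_int_smooth[OF t1 s1]]) auto
  then have "smooth_on {-e<..<e} (level_int h f)"
    by (rule smooth_on_cong) (simp, use e(2) in \<open>simp only: eq\<close>)
  with e(1) that show ?thesis by blast
qed

text \<open>\<open>Q (Suc j)\<close> is, up to the sign \<open>(-1)^j\<close>, the pullback of the \<open>j\<close>-th derivative of the delta distribution,
  while \<open>Q 0\<close> is the integral over the domain.\<close>

definition Q :: "nat \<Rightarrow> (real ^ 'i \<Rightarrow> complex) \<Rightarrow> complex" where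
  "Q k f = (vd ^^ k) (level_int h f) 0"

lemma Q_0: "Q 0 f = (LINT x:{x. h x \<le> 0}|lborel. f x)"
  by (simp add: Q_def level_int_def)

text \<open>The index is shifted by one because the fibre integral is already a derivative of
  \<open>level_int\<close>.\<close>

lemma dist_pullback_delta: "dist_pullback h (delta_deriv j) f = (-1) ^ j * Q (Suc j) f"
proof -
  have "fibre_integral h f = vd (level_int h f)"
    by (simp add: fibre_integral_def vd_def level_int_def[abs_def] fun_eq_iff)
  moreover have "(\<lambda>h t. vector_derivative h (at t)) = vd" by (simp add: vd_def[abs_def])
  ultimately show ?thesis
    by (simp add: dist_pullback_def delta_deriv_def Q_def funpow_Suc_right del: funpow.simps)
qed

lemma Q_add:
  assumes "test_function f" "test_function g"
  shows "Q k (\<lambda>x. f x + g x) = Q k f + Q k g"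
proof -
  obtain e1 where e1: "e1 > 0" "smooth_on {-e1<..<e1} (level_int h f)"
    using level_int_smooth_near_zero[OF assms(1)] .
  obtain e2 where e2: "e2 > 0" "smooth_on {-e2<..<e2} (level_int h g)"
    using level_int_smooth_near_zero[OF assms(2)] .
  define e where "e = min e1 e2"
  have e: "smooth_on {-e<..<e} (level_int h f)" "smooth_on {-e<..<e} (level_int h g)" "0 \<in> {-e<..<e}"
    using e1(1) e2(1) by (auto simp: e_def intro!: smooth_on_subset[OF e1(2)] smooth_on_subset[OF e2(2)])
  have "level_int h (\<lambda>x. f x + g x) = (\<lambda>t. level_int h f t + level_int h g t)"
    using level_int_add[OF continuous_h] assms test_function_integrable by blast
  then show ?thesis using vd_iter_add[OF e(1,2) _ e(3)] by (simp add: Q_def)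
qed

lemma Q_cmult:
  assumes "test_function f" shows "Q k (\<lambda>x. c * f x) = c * Q k f"
proof -
  obtain e where e: "e > 0" "smooth_on {-e<..<e} (level_int h f)"
    using level_int_smooth_near_zero[OF assms] .
  have "level_int h (\<lambda>x. c * f x) = (\<lambda>t. c * level_int h f t)"
    by (simp add: level_int_cmult fun_eq_iff)
  then show ?thesis using vd_iter_cmult[OF e(2)] e(1) by (simp add: Q_def)
qed

lemma Q_sum:
  "(\<And>i. i \<in> I \<Longrightarrow> test_function (f i)) \<Longrightarrow> Q k (\<lambda>x. \<Sum>i\<in>I. f i x) = (\<Sum>i\<in>I. Q k (f i))"
proof (induction I rule: infinite_finite_induct)
  case (insert i I)
  then show ?case by (simp add: Q_add test_function_sum)
qed (use Q_cmult[of "\<lambda>_. 0" k 0] in auto)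

text \<open>A locally constant sublevel integral is killed by one derivative, hence k \<ge> 1;
  \<open>Q 0\<close> sees the whole sublevel set.\<close>

lemma Q_local:
  assumes "k \<ge> 1" "test_function f" "open W" "{x. h x = 0} \<subseteq> W" "\<forall>x\<in>W. f x = 0"
  shows "Q k f = 0"
proof -
  from level_int_locally_constant[OF assms(2-5)]
  obtain e where e: "e > 0" "\<forall>t\<in>{-e<..<e}. level_int h f t = level_int h f 0"
    by (elim exE conjE)
  have "Q k f = (vd ^^ k) (\<lambda>_. level_int h f 0) 0"
    unfolding Q_def by (rule vd_iter_cong[of "{-e<..<e}"]) (simp, use e in blast, use e(1) in simp)
  then show ?thesis using vd_iter_const[OF assms(1)] by simp
qed

text \<open>The weight grad h lowers the order of differentiation in the level by one; the case k =
  0 is the divergence theorem on h \<le> 0.\<close>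

lemma Q_parts:
  assumes "test_function f" shows "Q (Suc k) (\<lambda>x. grd i x * f x) = Q k (pderivative i f)"
proof -
  obtain e where e: "e > 0" "smooth_on {-e<..<e} (level_int h (pderivative i f))"
    using level_int_smooth_near_zero[OF test_function_pderivative[OF assms]] .
  have "vd (level_int h (\<lambda>x. grd i x * f x)) t = level_int h (pderivative i f) t" if "t \<in> {-e<..<e}" for t
    by (rule vd_eqI, rule vector_derivative_of_integral_identity[OF parts[OF assms]
          smooth_on_continuous[OF e(2)] that])
  then have "(vd ^^ k) (vd (level_int h (\<lambda>x. grd i x * f x))) 0 = (vd ^^ k) (level_int h (pderivative i f)) 0"
    using e(1) by (intro vd_iter_cong[of "{-e<..<e}"]) auto
  then show ?thesis by (simp add: Q_def funpow_Suc_right del: funpow.simps)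
qed

end

section \<open>Algebra of Grassmann elements\<close>

lemma gcoeff_gconst_mult [simp]: "gcoeff (gconst c * a) A = c * gcoeff a A"
  for a :: "'a::ring_1 grass"
proof (cases "finite A")
  case True
  have "gcoeff (gconst c * a) A = (\<Sum>B\<in>Pow A. if B = {} then c * gcoeff a A else 0)"
    unfolding times_grass.rep_eq gconst.rep_eq by (intro sum.cong) auto
  then show ?thesis using True by simp
qed (simp add: gcoeff_infinite)

lemma gcoeff_mult_gconst [simp]: "gcoeff (a * gconst c) A = gcoeff a A * c"
  for a :: "'a::ring_1 grass"
proof (cases "finite A")
  case True
  have "gcoeff (a * gconst c) A = (\<Sum>B\<in>Pow A. if B = A then gcoeff a A * c else 0)"
    unfolding times_grass.rep_eq gconst.rep_eq by (intro sum.cong) auto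
  then show ?thesis using True by simp
qed (simp add: gcoeff_infinite)

lemma gcoeff_gconst: "gcoeff (gconst c) A = (if A = {} then c else 0)"
  by (simp add: gconst.rep_eq)

lemma gcoeff_one: "gcoeff 1 A = (if A = {} then 1 else 0)"
  by (simp add: one_grass_def gconst.rep_eq)

lemma gcoeff_gmono: "gcoeff (gmono B) A = (if A = B \<and> finite A then 1 else 0)"
  by (simp add: gmono.rep_eq)

lemma gcoeff_sum: "gcoeff (\<Sum>i\<in>I. f i) A = (\<Sum>i\<in>I. gcoeff (f i) A)"
  by (induction I rule: infinite_finite_induct) auto

lemma gconst_zero [simp]: "gconst (0::'a::ab_group_add) = 0"
  by (rule grass_eqI) (simp add: gcoeff_gconst)

lemma gconst_one [simp]: "gconst 1 = (1 :: 'a::ring_1 grass)"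
  by (simp add: one_grass_def)

lemma gconst_add: "gconst (a + b) = gconst a + gconst (b :: 'a::ab_group_add)"
  by (rule grass_eqI) (simp add: gcoeff_gconst)

lemma gconst_mult: "gconst (a * b) = gconst a * gconst (b :: 'a::ring_1)"
  by (rule grass_eqI) (simp add: gcoeff_gconst)

lemma gconst_uminus: "gconst (- a) = - gconst (a :: 'a::ab_group_add)"
  by (rule grass_eqI) (simp add: gcoeff_gconst)

lemma gconst_diff: "gconst (a - b) = gconst a - gconst (b :: 'a::ab_group_add)"
  by (rule grass_eqI) (simp add: gcoeff_gconst)

lemma gconst_sum: "gconst (\<Sum>i\<in>I. f i :: 'a::ab_group_add) = (\<Sum>i\<in>I. gconst (f i))"
  by (rule grass_eqI) (simp add: gcoeff_gconst gcoeff_sum)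

text \<open>Only the splitting of B into {k} and the rest contributes, and its inversions are the
  elements of B below k.\<close>

lemma gcoeff_generator_mult:
  fixes b :: "'a::ring_1 grass"
  shows "gcoeff (gmono {k} * b) B =
    (if k \<in> B then (-1) ^ card {i \<in> B. i < k} * gcoeff b (B - {k}) else 0)"
proof (cases "finite B")
  case True
  have "gcoeff (gmono {k} * b) B
      = (\<Sum>C\<in>Pow B. if C = {k} then (-1) ^ inversions {k} (B - {k}) * gcoeff b (B - {k}) else 0)"
    unfolding times_grass.rep_eq gmono.rep_eq by (intro sum.cong) auto
  also have "\<dots> = (if k \<in> B then (-1) ^ inversions {k} (B - {k}) * gcoeff b (B - {k}) else 0)"
    using True by simp
  also have "inversions {k} (B - {k}) = card {i \<in> B. i < k}"
    unfolding inversions_def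
    by (rule bij_betw_same_card[of snd]) (auto simp: bij_betw_def inj_on_def image_iff)
  finally show ?thesis .
qed (simp add: gcoeff_infinite)

lemma gmono_empty [simp]: "gmono {} = (1 :: 'a::ring_1 grass)"
  by (rule grass_eqI) (simp add: gcoeff_gmono gcoeff_one)

lemma gmono_insert_Min:
  assumes "finite A" "\<And>i. i \<in> A \<Longrightarrow> k < i"
  shows "gmono (insert k A) = gmono {k} * (gmono A :: 'a::ring_1 grass)"
proof (rule grass_eqI)
  fix B
  have k: "k \<notin> A" using assms(2) by blast
  show "gcoeff (gmono (insert k A)) B = gcoeff (gmono {k} * gmono A :: 'a grass) B"
  proof (cases "B = insert k A")
    case True
    have "{i \<in> B. i < k} = {}" using assms(2) True by force
    moreover have "B - {k} = A" using True k by auto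
    ultimately show ?thesis using assms(1) True
      by (simp add: gcoeff_generator_mult gcoeff_gmono del: Collect_empty_eq)
  next
    case False
    then have "k \<in> B \<Longrightarrow> B - {k} \<noteq> A" by auto
    then show ?thesis using False by (simp add: gcoeff_generator_mult gcoeff_gmono)
  qed
qed

lemma sign_left: "c * ((-1) ^ k * x) = (-1) ^ k * (c * (x :: 'a::ring_1))"
  by (metis minus_one_power_commute mult.assoc)

lemma grass_expand: 
  fixes a :: "'a::ring_1 grass"
  assumes "finite I" "\<And>A. gcoeff a A \<noteq> 0 \<Longrightarrow> A \<in> I"
  shows "a = (\<Sum>A\<in>I. gconst (gcoeff a A) * gmono A)"
proof (rule grass_eqI)
  fix B
  have "gcoeff (\<Sum>A\<in>I. gconst (gcoeff a A) * gmono A) B = (\<Sum>A\<in>I. if A = B then gcoeff a B else 0)"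
    unfolding gcoeff_sum by (intro sum.cong) (auto simp: gcoeff_gmono gcoeff_infinite)
  then show "gcoeff a B = gcoeff (\<Sum>A\<in>I. gconst (gcoeff a A) * gmono A) B"
    using assms by auto
qed

lemma gconst_generator_commute: "gconst c * gmono {k} = gmono {k} * (gconst c :: 'a::ring_1 grass)"
proof (rule grass_eqI)
  fix B
  show "gcoeff (gconst c * gmono {k}) B = gcoeff (gmono {k} * (gconst c :: 'a grass)) B"
  proof (cases "B = {k}")
    case True
    moreover have "{i \<in> {k}. i < k} = {}" by auto
    ultimately show ?thesis by (simp add: gcoeff_generator_mult gcoeff_gmono gcoeff_gconst)
  qed (auto simp: gcoeff_gmono)
qed

lemma gconst_gmono_commute: "gconst c * gmono A = gmono A * (gconst c :: 'a::ring_1 grass)"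
  by (rule grass_eqI) (auto simp: gcoeff_gmono)

text \<open>A monomial arises by multiplying with its smallest generator from the left, which costs
  no sign (\<open>gmono_insert_Min\<close>). Identities about parity and derivatives thus reduce to
  a single generator instead of sign counts over index sets.\<close>

lemma grass_induct [case_names const generator add]:
  fixes a :: "'a::ring_1 grass"
  assumes const: "\<And>c. P (gconst c)" and gen: "\<And>k a. P a \<Longrightarrow> P (gmono {k} * a)"
    and add: "\<And>a b. P a \<Longrightarrow> P b \<Longrightarrow> P (a + b)"
  shows "P a"
proof -
  have mono: "P (gconst c * gmono A)" if "finite A" for c A
    using that
  proof (induction A rule: finite_linorder_min_induct)
    case empty
    then show ?case using const by simp
  next
    case (insert k A)
    have "gconst c * gmono (insert k A) = gmono {k} * (gconst c * gmono A)"
      using insert by (subst gmono_insert_Min) (auto simp: mult.assoc[symmetric] gconst_generator_commute)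
    then show ?case using gen[OF insert.IH] by simp
  qed
  have sum: "P (\<Sum>A\<in>I. f A)" if "finite I" "\<And>A. A \<in> I \<Longrightarrow> P (f A)" for I :: "nat set set" and f
    using that
  proof (induction I)
    case empty
    then show ?case using const[of 0] by simp
  qed (auto intro: add)
  let ?I = "{A. gcoeff a A \<noteq> 0}"
  have I: "finite ?I" "\<And>A. A \<in> ?I \<Longrightarrow> finite A" using gcoeff[of a] by auto
  have "a = (\<Sum>A\<in>?I. gconst (gcoeff a A) * gmono A)" by (rule grass_expand[OF I(1)]) simp
  then show ?thesis using sum[OF I(1)] mono I(2) by (metis (no_types, lifting))
qed

section \<open>Parity, left derivatives and commutation rules\<close>

lift_definition gpar :: "'a::ring_1 grass \<Rightarrow> 'a grass" is "\<lambda>a A. (-1) ^ card A * a A"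
proof (intro conjI)
  fix a :: "nat set \<Rightarrow> 'a"
  assume *: "finite {A. a A \<noteq> 0} \<and> (\<forall>A. a A \<noteq> 0 \<longrightarrow> finite A)"
  show "finite {A. (-1) ^ card A * a A \<noteq> 0}"
    by (rule finite_subset[of _ "{A. a A \<noteq> 0}"]) (use * in auto)
  show "\<forall>A. (-1) ^ card A * a A \<noteq> 0 \<longrightarrow> finite A" using * by auto
qed

lemma gpar_add: "gpar (a + b) = gpar a + gpar b"
  by (rule grass_eqI) (simp add: gpar.rep_eq algebra_simps)

lemma gpar_gconst [simp]: "gpar (gconst c) = gconst c"
  by (rule grass_eqI) (simp add: gpar.rep_eq gcoeff_gconst)

lemma gpar_generator_mult: "gpar (gmono {k} * a) = - (gmono {k} * gpar a)"
proof (rule grass_eqI)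
  fix B
  have c: "(-1) ^ card B * ((-1) ^ p * x) = - ((-1) ^ p * ((-1) ^ card (B - {k}) * x))"
    if "k \<in> B" "finite B" for p and x :: 'a
  proof -
    have "card B = Suc (card (B - {k}))" using that card_Suc_Diff1 by fastforce
    then show ?thesis by (simp add: sign_left[of "(-1) ^ p"])
  qed
  show "gcoeff (gpar (gmono {k} * a)) B = gcoeff (- (gmono {k} * gpar a)) B"
  proof (cases "finite B \<and> k \<in> B")
    case True
    then show ?thesis using c by (simp only: gpar.rep_eq gcoeff_generator_mult gcoeff_uminus if_True)
  qed (auto simp: gpar.rep_eq gcoeff_generator_mult gcoeff_infinite)
qed

lemma gpar_mult: "gpar (a * b) = gpar a * gpar b"
proof (induction a rule: grass_induct)
  case (const c)
  show ?case by (rule grass_eqI) (simp add: gpar.rep_eq sign_left)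
next
  case (generator k a)
  then show ?case by (simp add: gpar_generator_mult mult.assoc)
qed (simp add: gpar_add distrib_right)

lemma gpar_gpar [simp]: "gpar (gpar a) = a"
  by (rule grass_eqI) (simp add: gpar.rep_eq mult.assoc[symmetric] power_add[symmetric])

lemma gpar_minus: "gpar (- a) = - gpar a"
  by (rule grass_eqI) (simp add: gpar.rep_eq)

lemma gpar_zero [simp]: "gpar 0 = 0"
  by (rule grass_eqI) (simp add: gpar.rep_eq)

lemma gpar_sum: "gpar (\<Sum>i\<in>I. f i) = (\<Sum>i\<in>I. gpar (f i))"
  by (induction I rule: infinite_finite_induct) (auto simp: gpar_add)

lemma gderiv_add: "gderiv j (a + b) = gderiv j a + gderiv j b"
  by (rule grass_eqI) (simp add: gderiv.rep_eq algebra_simps)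

lemma gderiv_minus: "gderiv j (- a) = - gderiv j a"
  by (rule grass_eqI) (simp add: gderiv.rep_eq)

lemma gderiv_zero [simp]: "gderiv j 0 = 0"
  by (rule grass_eqI) (simp add: gderiv.rep_eq)

lemma gderiv_gconst [simp]: "gderiv j (gconst c) = 0"
  by (rule grass_eqI) (simp add: gderiv.rep_eq gcoeff_gconst)

lemma gderiv_sum: "gderiv j (\<Sum>i\<in>I. f i) = (\<Sum>i\<in>I. gderiv j (f i))"
  by (induction I rule: infinite_finite_induct) (auto simp: gderiv_add)

lemma gderiv_generator_mult:
  "gderiv j (gmono {k} * a) = (if j = k then a else 0) - gmono {k} * gderiv j a"
  using gderiv_generator[of j k a] by (simp add: eq_diff_eq)

lemma gderiv_gconst_mult: "gderiv j (gconst c * a) = gconst c * gderiv j a"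
  by (rule grass_eqI) (simp add: gderiv.rep_eq sign_left)

lemma gderiv_mult: "gderiv j (a * b) = gderiv j a * b + gpar a * gderiv j b"
proof (induction a rule: grass_induct)
  case (const c)
  show ?case by (simp add: gderiv_gconst_mult)
next
  case (generator k a)
  have "gderiv j (gmono {k} * a * b) = (if j = k then a * b else 0) - gmono {k} * gderiv j (a * b)"
    unfolding mult.assoc by (rule gderiv_generator_mult)
  then show ?case
    by (simp add: generator gderiv_generator_mult gpar_generator_mult algebra_simps)
qed (simp add: gderiv_add gpar_add algebra_simps)

lemma gderiv_gderiv_same: "gderiv j (gderiv j a) = 0"
proof (induction a rule: grass_induct)
  case (generator k a)
  have "gderiv j (gderiv j (gmono {k} * a)) = (if j = k then gderiv j a else 0) - gderiv j (gmono {k} * gderiv j a)"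
    by (subst gderiv_generator_mult) (simp add: gderiv_add[of _ _ "- _", simplified] gderiv_minus)
  also have "gderiv j (gmono {k} * gderiv j a) = (if j = k then gderiv j a else 0) - gmono {k} * gderiv j (gderiv j a)"
    by (rule gderiv_generator_mult)
  finally show ?case using generator by simp
qed (simp_all add: gderiv_add)

lemma gderiv_anticommute: "gderiv i (gderiv j a) = - gderiv j (gderiv i a)"
proof (cases "i = j")
  case False
  show ?thesis
  proof (induction a rule: grass_induct)
    case (generator k a)
    have *: "gderiv p (gderiv q (gmono {k} * a)) = (if q = k then gderiv p a else 0)
        - (if p = k then gderiv q a else 0) + gmono {k} * gderiv p (gderiv q a)" for p q
    proof -
      have "gderiv p (gderiv q (gmono {k} * a)) = (if q = k then gderiv p a else 0) - gderiv p (gmono {k} * gderiv q a)"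
        by (subst gderiv_generator_mult) (simp add: gderiv_add[of _ _ "- _", simplified] gderiv_minus)
      then show ?thesis by (simp add: gderiv_generator_mult)
    qed
    show ?case unfolding * using generator False by simp
  qed (simp_all add: gderiv_add)
qed (simp add: gderiv_gderiv_same)

lemma generator_commute: "gmono {k} * a = gpar a * gmono {k}"
proof (induction a rule: grass_induct)
  case (const c)
  show ?case by (simp add: gconst_generator_commute)
next
  case (generator l a)
  \<comment> \<open>For k = l both sides vanish. Otherwise both live at B = {k, l}, where each sign
    records whether the left factor is the larger generator, so exactly one of the two is
    -1.\<close>
  have sw: "gmono {k} * gmono {l} = - (gmono {l} * gmono {k} :: 'a grass)"
  proof (rule grass_eqI)
    fix B
    have "{i. (i = k \<or> i = l) \<and> i < m} = (if m = k then (if l < k then {l} else {}) else if k < l then {k} else {})"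
      if "m = k \<or> m = l" for m using that by auto
    then have "card {i \<in> {k, l}. i < k} = (if l < k then 1 else 0)"
      "k \<noteq> l \<Longrightarrow> card {i \<in> {k, l}. i < l} = (if k < l then 1 else 0)" by auto
    moreover have "k \<in> B \<and> B - {k} = {l} \<longleftrightarrow> k \<noteq> l \<and> B = {k, l}" "l \<in> B \<and> B - {l} = {k} \<longleftrightarrow> k \<noteq> l \<and> B = {k, l}"
      by auto
    ultimately show "gcoeff (gmono {k} * gmono {l}) B = gcoeff (- (gmono {l} * gmono {k} :: 'a grass)) B"
      by (cases "k \<noteq> l \<and> B = {k, l}")
         (auto simp: gcoeff_generator_mult gcoeff_gmono)
  qed
  have "gmono {k} * (gmono {l} * a) = - (gmono {l} * (gmono {k} * a))"
    by (simp add: mult.assoc[symmetric] sw)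
  also have "\<dots> = gpar (gmono {l} * a) * gmono {k}"
    by (simp add: generator gpar_generator_mult mult.assoc)
  finally show ?case .
qed (simp add: gpar_add algebra_simps)

lemma gmono_commute:
  "finite A \<Longrightarrow> even (card A) \<Longrightarrow> gmono A * a = a * gmono A"
  "finite A \<Longrightarrow> odd (card A) \<Longrightarrow> gmono A * a = gpar a * gmono A"
proof (induction A rule: finite_linorder_min_induct)
  case (insert k A)
  have e: "gmono (insert k A) * a = gmono {k} * (gmono A * a)" for a :: "'a grass"
    using insert by (simp add: gmono_insert_Min mult.assoc)
  have c: "card (insert k A) = Suc (card A)" using insert by auto
  show "gmono (insert k A) * a = a * gmono (insert k A)" if "even (card (insert k A))"
    using that insert c unfolding e
    by (simp add: gmono_insert_Min mult.assoc[symmetric] generator_commute[of k "gpar a"])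
  show "gmono (insert k A) * a = gpar a * gmono (insert k A)" if "odd (card (insert k A))"
    using that insert c unfolding e
    by (simp add: gmono_insert_Min mult.assoc[symmetric] generator_commute[of k a])
qed simp_all

section \<open>Support and degree of Grassmann elements\<close>

definition gsup :: "nat set \<Rightarrow> 'a::ring_1 grass \<Rightarrow> bool" where
  "gsup N a \<longleftrightarrow> (\<forall>A. gcoeff a A \<noteq> 0 \<longrightarrow> A \<subseteq> N)"

definition gdeg_ge :: "nat \<Rightarrow> 'a::ring_1 grass \<Rightarrow> bool" where
  "gdeg_ge d a \<longleftrightarrow> (\<forall>A. gcoeff a A \<noteq> 0 \<longrightarrow> d \<le> card A)"

lemma gcoeff_mult_nonzero:
  fixes a :: "'a::ring_1 grass"
  assumes "gcoeff (a * b) C \<noteq> 0"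
  shows "\<exists>A\<subseteq>C. gcoeff a A \<noteq> 0 \<and> gcoeff b (C - A) \<noteq> 0"
proof (rule ccontr)
  assume *: "\<not> ?thesis"
  have "gcoeff (a * b) C = 0"
    unfolding times_grass.rep_eq
  proof (intro sum.neutral ballI)
    fix A assume "A \<in> Pow C"
    then have "gcoeff a A = 0 \<or> gcoeff b (C - A) = 0" using * by blast
    then show "(-1) ^ inversions A (C - A) * gcoeff a A * gcoeff b (C - A) = 0" by auto
  qed
  with assms show False by simp
qed

lemma gsup_mult: assumes "gsup N a" "gsup N b" shows "gsup N (a * b)"
  unfolding gsup_def
proof (intro allI impI)
  fix C assume "gcoeff (a * b) C \<noteq> 0"
  from gcoeff_mult_nonzero[OF this]
  obtain A where A: "A \<subseteq> C" "gcoeff a A \<noteq> 0" "gcoeff b (C - A) \<noteq> 0" by blast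
  then have "A \<subseteq> N" "C - A \<subseteq> N" using assms by (auto simp: gsup_def)
  then show "C \<subseteq> N" by auto
qed

lemma gsup_add: "gsup N a \<Longrightarrow> gsup N b \<Longrightarrow> gsup N (a + b)"
  unfolding gsup_def by (metis add.right_neutral gcoeff_add)

lemma gsup_diff: "gsup N a \<Longrightarrow> gsup N b \<Longrightarrow> gsup N (a - b)"
  unfolding gsup_def by (metis diff_zero gcoeff_diff)

lemma gsup_gconst [simp]: "gsup N (gconst c)"
  by (simp add: gsup_def gcoeff_gconst)

lemma gsup_zero [simp]: "gsup N 0"
  by (simp add: gsup_def)

lemma gsup_one [simp]: "gsup N (1 :: 'a::ring_1 grass)"
  by (simp add: gsup_def gcoeff_one)

lemma gsup_gmono: "A \<subseteq> N \<Longrightarrow> gsup N (gmono A)"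
  by (simp add: gsup_def gcoeff_gmono)

lemma gsup_sum: "(\<And>i. i \<in> I \<Longrightarrow> gsup N (f i)) \<Longrightarrow> gsup N (\<Sum>i\<in>I. f i)"
  by (induction I rule: infinite_finite_induct) (auto intro: gsup_add)

lemma gsup_power: "gsup N a \<Longrightarrow> gsup N (a ^ k)"
  by (induction k) (auto intro: gsup_mult)

lemma gsup_gderiv: "gsup N a \<Longrightarrow> gsup N (gderiv j a)"
  unfolding gsup_def gderiv.rep_eq by (metis insert_subset mult_zero_right)

lemma gsup_mono: "gsup M a \<Longrightarrow> M \<subseteq> N \<Longrightarrow> gsup N a"
  by (auto simp: gsup_def)

lemma gsup_expand:
  "gsup N a \<Longrightarrow> finite N \<Longrightarrow> a = (\<Sum>A\<in>Pow N. gconst (gcoeff a A) * gmono A)"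
  by (rule grass_expand) (auto simp: gsup_def)

lemma gdeg_ge_mult: assumes "gdeg_ge d a" "gdeg_ge e b" shows "gdeg_ge (d + e) (a * b)"
  unfolding gdeg_ge_def
proof (intro allI impI)
  fix C assume nz: "gcoeff (a * b) C \<noteq> 0"
  from gcoeff_mult_nonzero[OF this]
  obtain A where A: "A \<subseteq> C" "gcoeff a A \<noteq> 0" "gcoeff b (C - A) \<noteq> 0" by blast
  have "finite C" using nz gcoeff_infinite by blast
  then have "card C = card A + card (C - A)" using A(1)
    by (metis card_Diff_subset card_mono finite_subset le_add_diff_inverse)
  then show "d + e \<le> card C" using A assms unfolding gdeg_ge_def by (metis add_mono)
qed

lemma gdeg_ge_power: "gdeg_ge d a \<Longrightarrow> gdeg_ge (k * d) (a ^ k)"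
  by (induction k) (auto simp: gdeg_ge_mult, simp add: gdeg_ge_def)

lemma gdeg_ge_zero:
  assumes "gdeg_ge d a" "gsup N a" "finite N" "card N < d" shows "a = 0"
proof (rule grass_eqI)
  fix A
  have "card A \<le> card N" if "gcoeff a A \<noteq> 0"
    using assms that by (intro card_mono) (auto simp: gsup_def)
  then have "gcoeff a A = 0" using assms by (force simp: gdeg_ge_def)
  then show "gcoeff a A = gcoeff 0 A" by simp
qed

section \<open>Scalars in the Clifford algebra and linear functionals\<close>

lemma fscalar_add: "fscalar (a + b) = fscalar a + fscalar b"
  by (simp add: fscalar_def single_add)

lemma fscalar_mult: "fscalar (a * b) = fscalar a * fscalar b"
  by (simp add: fscalar_def mult_single)

lemma fscalar_commute: "fscalar c * p = p * fscalar c"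
proof (induction p rule: single_induct)
  case (single w d)
  show ?case by (simp add: fscalar_def mult_single mult.commute)
qed (simp_all add: distrib_left distrib_right)

lemma cl_scalar_add: "cl_scalar (a + b) = cl_scalar a + cl_scalar b"
  by transfer (rule clifford_eq_refl, rule fscalar_add)

lemma cl_scalar_mult: "cl_scalar (a * b) = cl_scalar a * cl_scalar b"
  by transfer (rule clifford_eq_refl, rule fscalar_mult)

lemma cl_scalar_one [simp]: "cl_scalar 1 = 1"
  by transfer (rule clifford_eq_refl, simp add: fscalar_def)

lemma cl_scalar_commute: "cl_scalar c * a = a * cl_scalar c"
  by transfer (rule clifford_eq_refl, rule fscalar_commute)

lemma cl_scalar_uminus: "cl_scalar (- a) = - cl_scalar a"
  using cl_scalar_add[of a "- a"] by (simp add: add_eq_0_iff)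

lemma cl_scalar_diff: "cl_scalar (a - b) = cl_scalar a - cl_scalar b"
  using cl_scalar_add[of a "- b"] by (simp add: cl_scalar_uminus)

lemma cl_scalar_sum: "cl_scalar (\<Sum>i\<in>I. f i) = (\<Sum>i\<in>I. cl_scalar (f i))"
  by (induction I rule: infinite_finite_induct) (auto simp: cl_scalar_add)

section \<open>Separating linear functionals\<close>

definition cl_lin :: "('i::finite clifford \<Rightarrow> complex) \<Rightarrow> bool" where
  "cl_lin l \<longleftrightarrow> (\<forall>a b. l (a + b) = l a + l b) \<and> (\<forall>c a. l (cl_scalar c * a) = c * l a)"

text \<open>The nonzero vector a - b extends to a basis, and its coordinate functional tells a from
  b. Only the vector space structure enters, not a normal form for words in the Clifford
  generators.\<close>

lemma cl_lin_separates:
  assumes "\<And>l. cl_lin l \<Longrightarrow> l a = l b" shows "a = b"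
proof (rule ccontr)
  assume "a \<noteq> b"
  interpret V: vector_space "\<lambda>c (a :: 'a clifford). cl_scalar c * a"
    by standard (simp_all add: distrib_left distrib_right cl_scalar_add cl_scalar_mult mult.assoc)
  have ind: "V.independent {a - b}" using \<open>a \<noteq> b\<close> by (simp add: V.dependent_single)
  define B where "B = V.extend_basis {a - b}"
  have B: "a - b \<in> B" "V.independent B" "V.span B = UNIV"
    unfolding B_def using V.extend_basis_superset[OF ind] V.independent_extend_basis[OF ind]
      V.span_extend_basis[OF ind] by auto
  define l where "l v = V.representation B v (a - b)" for v
  have "cl_lin l" unfolding cl_lin_def l_def
    using B by (simp add: V.representation_add V.representation_scale)
  from assms[OF this] have "l a = l b" .
  moreover have "l (a - b) = 1" unfolding l_def using V.representation_basis[OF B(2,1)] by simp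
  moreover have "l a = l (a - b) + l b" using \<open>cl_lin l\<close> unfolding cl_lin_def
    by (metis diff_add_cancel)
  ultimately show False by simp
qed

text \<open>Identities between Clifford-valued Grassmann elements are tested on all such
  functionals, which turn integrals and derivatives into those of scalar functions.\<close>

definition glin :: "('i::finite clifford grass \<Rightarrow> complex) \<Rightarrow> bool" where
  "glin l \<longleftrightarrow> (\<forall>a b. l (a + b) = l a + l b) \<and> (\<forall>c a. l (cnum c * a) = c * l a)"

lemma glin_add: "glin l \<Longrightarrow> l (a + b) = l a + l b"
  and glin_cnum: "glin l \<Longrightarrow> l (cnum c * a) = c * l a"
  by (auto simp: glin_def)

lemma glin_zero: "glin l \<Longrightarrow> l 0 = 0"
  using glin_cnum[of l 0 0] by simp

lemma glin_sum: "glin l \<Longrightarrow> l (\<Sum>i\<in>I. f i) = (\<Sum>i\<in>I. l (f i))"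
  by (induction I rule: infinite_finite_induct) (auto simp: glin_add glin_zero)

lemma glin_gcoeff: "cl_lin l \<Longrightarrow> glin (\<lambda>a. l (gcoeff a A))"
  by (simp add: glin_def cl_lin_def)

lemma glin_separates:
  assumes "\<And>l. glin l \<Longrightarrow> l a = l b" shows "a = b"
  by (rule grass_eqI, rule cl_lin_separates) (rule assms[OF glin_gcoeff])

lemma cnum_commute: "cnum c * a = a * cnum c"
  by (rule grass_eqI) (simp add: cl_scalar_commute)

lemma cnum_add: "cnum (a + b) = cnum a + cnum b"
  by (simp add: cl_scalar_add gconst_add)

lemma cnum_mult: "cnum (a * b) = cnum a * cnum b"
  by (simp add: cl_scalar_mult gconst_mult)

lemma cnum_one: "cnum 1 = 1"
  by simp

lemma gcoeff_gcomplex [simp]: "gcoeff (gcomplex a) A = cl_scalar (gcoeff a A)"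
  by (simp add: gcomplex.rep_eq)

lemma gcomplex_add: "gcomplex (a + b) = gcomplex a + gcomplex b"
  by (rule grass_eqI) (simp add: cl_scalar_add)

lemma gcomplex_diff: "gcomplex (a - b) = gcomplex a - gcomplex b"
  by (rule grass_eqI) (simp add: cl_scalar_diff)

lemma gcomplex_minus: "gcomplex (- a) = - gcomplex a"
  by (rule grass_eqI) (simp add: cl_scalar_uminus)

lemma cl_scalar_sign: "cl_scalar ((-1) ^ k * a) = (-1) ^ k * cl_scalar a"
  by (cases "even k") (simp_all add: cl_scalar_uminus)

lemma gcomplex_mult: "gcomplex (a * b) = gcomplex a * gcomplex b"
  by (rule grass_eqI)
     (simp add: times_grass.rep_eq cl_scalar_sum cl_scalar_mult cl_scalar_sign[where a = 1, simplified])

lemma gcomplex_gconst [simp]: "gcomplex (gconst c) = cnum c"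
  by (rule grass_eqI) (simp add: gcoeff_gconst)

lemma gcomplex_gmono [simp]: "gcomplex (gmono A) = gmono A"
  by (rule grass_eqI) (auto simp: gcoeff_gmono)

lemma gcomplex_zero [simp]: "gcomplex 0 = 0"
  by (rule grass_eqI) simp

lemma gcomplex_one [simp]: "gcomplex 1 = 1"
  by (rule grass_eqI) (auto simp: gcoeff_one)

lemma gcomplex_sum: "gcomplex (\<Sum>i\<in>I. f i) = (\<Sum>i\<in>I. gcomplex (f i))"
  by (induction I rule: infinite_finite_induct) (auto simp: gcomplex_add)

lemma gcomplex_power: "gcomplex (a ^ k) = gcomplex a ^ k"
  by (induction k) (auto simp: gcomplex_mult)

lemma gcomplex_gderiv: "gderiv j (gcomplex a) = gcomplex (gderiv j a)"
  by (rule grass_eqI) (auto simp: gderiv.rep_eq cl_scalar_sign)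

lemma gsup_gcomplex: "gsup N a \<Longrightarrow> gsup N (gcomplex a)"
  unfolding gsup_def gcoeff_gcomplex by (metis cl_scalar_zero)

lemma gconst_gcomplex_commute: "gconst e * gcomplex a = gcomplex a * gconst e"
  by (rule grass_eqI) (simp add: cl_scalar_commute)

definition geven :: "complex grass \<Rightarrow> bool" where
  "geven a \<longleftrightarrow> (\<forall>A. gcoeff a A \<noteq> 0 \<longrightarrow> even (card A))"

lemma gpar_even: "geven a \<Longrightarrow> gpar (gcomplex a) = gcomplex a"
proof (rule grass_eqI)
  fix A assume "geven a"
  then show "gcoeff (gpar (gcomplex a)) A = gcoeff (gcomplex a) A"
    by (cases "gcoeff a A = 0") (auto simp: gpar.rep_eq geven_def)
qed

section \<open>Central elements and the Berezin integral\<close>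

definition central :: "'i::finite clifford grass \<Rightarrow> bool" where
  "central a \<longleftrightarrow> (\<forall>b. a * b = b * a)"

lemma centralD: "central a \<Longrightarrow> a * b = b * a"
  by (simp add: central_def)

lemma central_add: "central a \<Longrightarrow> central b \<Longrightarrow> central (a + b)"
  by (simp add: central_def algebra_simps)

lemma central_minus: "central a \<Longrightarrow> central (- a)"
  by (simp add: central_def)

lemma central_mult: "central a \<Longrightarrow> central b \<Longrightarrow> central (a * b)"
  unfolding central_def by (metis mult.assoc)

lemma central_cnum [simp]: "central (cnum c)"
  by (simp add: central_def cnum_commute)

lemma central_zero [simp]: "central 0"
  by (simp add: central_def)

lemma central_one [simp]: "central 1"
  by (simp add: central_def)

lemma central_sum: "(\<And>i. i \<in> I \<Longrightarrow> central (f i)) \<Longrightarrow> central (\<Sum>i\<in>I. f i)"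
  by (induction I rule: infinite_finite_induct) (auto intro: central_add)

lemma central_power: "central a \<Longrightarrow> central (a ^ k)"
  by (induction k) (auto intro: central_mult)

text \<open>Even monomials commute with all generators, and complex scalars with the Clifford
  algebra. This frees the nilpotent part of the phase from every ordering constraint.\<close>

lemma central_even:
  assumes "geven a" shows "central (gcomplex a :: 'i::finite clifford grass)"
proof -
  define I where "I = {A. gcoeff a A \<noteq> 0}"
  have I: "finite I" "\<And>A. A \<in> I \<Longrightarrow> finite A" using gcoeff[of a] by (auto simp: I_def)
  have "a = (\<Sum>A\<in>I. gconst (gcoeff a A) * gmono A)" by (rule grass_expand[OF I(1)]) (simp add: I_def)
  then have "gcomplex a = gcomplex (\<Sum>A\<in>I. gconst (gcoeff a A) * gmono A)" by simp
  then have e: "gcomplex a = (\<Sum>A\<in>I. cnum (gcoeff a A) * (gmono A :: 'i clifford grass))"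
    by (simp add: gcomplex_sum gcomplex_mult)
  have "central (gmono A :: 'i clifford grass)" if "A \<in> I" for A
    using that I(2)[OF that] assms gmono_commute(1)[of A] by (auto simp: central_def geven_def I_def)
  then show ?thesis unfolding e by (intro central_sum central_mult central_cnum)
qed

text \<open>Anticommuting the derivatives brings the two copies of the j-th one together, and its
  square is 0. It is the odd counterpart of \<open>integral_derivative_zero\<close>.\<close>

lemma berezin_gderiv:
  assumes "j \<in> {1..2 * n}" shows "berezin n (gderiv j a) = 0"
proof -
  have add: "fold gderiv xs (- b) = - fold gderiv xs b" for xs and b :: "'b::ring_1 grass"
    by (induction xs arbitrary: b) (simp_all add: gderiv_minus)
  have zero: "fold gderiv xs 0 = (0 :: 'b::ring_1 grass)" for xs by (induction xs) simp_all
  have "fold gderiv xs (gderiv j a) = 0" if "j \<in> set xs" for xs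
    using that
  proof (induction xs arbitrary: a)
    case (Cons x xs)
    show ?case
    proof (cases "x = j")
      case True
      then show ?thesis by (simp add: gderiv_gderiv_same zero)
    next
      case False
      then have "fold gderiv xs (gderiv j (gderiv x a)) = 0" using Cons by simp
      then show ?thesis using False by (simp add: gderiv_anticommute[of x j] add)
    qed
  qed simp
  moreover have "j \<in> set [1..<2 * n + 1]" using assms by auto
  ultimately show ?thesis by (metis berezin_def mult_zero_right)
qed

lemma berezin_add: "berezin n (a + b) = berezin n a + berezin n b"
proof -
  have "fold gderiv xs (a + b) = fold gderiv xs a + fold gderiv xs b" for xs
    by (induction xs arbitrary: a b) (simp_all add: gderiv_add)
  then show ?thesis by (simp add: berezin_def distrib_left)
qed

lemma berezin_gconst_mult: "berezin n (gconst c * a) = gconst c * berezin n a"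
proof -
  have "fold gderiv xs (gconst c * a) = gconst c * fold gderiv xs a" for xs
    by (induction xs arbitrary: a) (simp_all add: gderiv_gconst_mult)
  then show ?thesis unfolding berezin_def by (metis cnum_commute mult.assoc)
qed

lemma berezin_zero [simp]: "berezin n 0 = 0"
  using berezin_gconst_mult[of n 0 0] by simp

lemma berezin_sum: "berezin n (\<Sum>i\<in>I. f i) = (\<Sum>i\<in>I. berezin n (f i))"
  by (induction I rule: infinite_finite_induct) (auto simp: berezin_add)

lemma glin_berezin: "glin l \<Longrightarrow> glin (\<lambda>a. l (berezin n a))"
  by (simp add: glin_def berezin_add berezin_gconst_mult)

section \<open>Smooth superfunctions of finite rank\<close>

text \<open>The algebraic tensor product of smooth functions and values, for which the Clifford
  algebra needs no topology. The rule \<open>cong\<close> makes the predicate depend only on the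
  values on S, and induction over the rules replaces explicit representations.\<close>

inductive smooth_fr :: "'m::finite point set \<Rightarrow> ('m point \<Rightarrow> 'm sval) \<Rightarrow> bool" for S where
  single: "smooth_on S f \<Longrightarrow> smooth_fr S (\<lambda>x. cnum (f x) * a)"
| add: "smooth_fr S F \<Longrightarrow> smooth_fr S G \<Longrightarrow> smooth_fr S (\<lambda>x. F x + G x)"
| cong: "smooth_fr S F \<Longrightarrow> (\<And>x. x \<in> S \<Longrightarrow> F x = G x) \<Longrightarrow> smooth_fr S G"

lemma fr_const: "smooth_fr S (\<lambda>x. a)"
  using smooth_fr.single[OF smooth_on_const[of S 1], of a] by simp

lemma fr_cnum: "smooth_on S f \<Longrightarrow> smooth_fr S (\<lambda>x. cnum (f x))"
  using smooth_fr.single[of S f 1] by simp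

lemma fr_subset:
  assumes "smooth_fr S F" "T \<subseteq> S" shows "smooth_fr T F"
  using assms(1)
proof (induction rule: smooth_fr.induct)
  case (single f a)
  then show ?case using assms(2) by (intro smooth_fr.single) (rule smooth_on_subset)
next
  case (add F G)
  then show ?case by (intro smooth_fr.add)
next
  case (cong F G)
  have "F x = G x" if "x \<in> T" for x using cong.hyps(2) that assms(2) by blast
  with cong.IH show ?case by (rule smooth_fr.cong)
qed

lemma fr_sum: "(\<And>i. i \<in> I \<Longrightarrow> smooth_fr S (F i)) \<Longrightarrow> smooth_fr S (\<lambda>x. \<Sum>i\<in>I. F i x)"
proof (induction I rule: infinite_finite_induct)
  case (insert i I)
  then have "smooth_fr S (\<lambda>x. F i x + (\<Sum>i\<in>I. F i x))" by (intro smooth_fr.add) simp_all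
  then show ?case using insert by simp
qed (simp_all add: fr_const)

lemma cnum_left: "b * (cnum c * a) = cnum c * (b * a)"
  by (simp only: mult.assoc[symmetric] cnum_commute[of c b])

lemma cnum_mult4: "cnum c * a * (cnum d * b) = cnum (c * d) * (a * b)"
  by (simp only: mult.assoc cnum_left[of a d] cnum_mult)

lemma fr_mult:
  assumes F: "smooth_fr S F" and G: "smooth_fr S G" and S: "open S"
  shows "smooth_fr S (\<lambda>x. F x * G x)"
  using F
proof (induction rule: smooth_fr.induct)
  case (single f a)
  show ?case using G
  proof (induction rule: smooth_fr.induct)
    case (single g b)
    have "smooth_fr S (\<lambda>x. cnum (f x * g x) * (a * b))"
      by (intro smooth_fr.single smooth_on_mult \<open>smooth_on S f\<close> single S)
    then show ?case by (simp only: cnum_mult4)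
  next
    case (add G H)
    then show ?case by (simp add: distrib_left smooth_fr.add)
  next
    case (cong G H)
    show ?case by (rule smooth_fr.cong[OF cong.IH]) (simp add: cong.hyps)
  qed
next
  case (add F H)
  then show ?case by (simp add: distrib_right smooth_fr.add)
next
  case (cong F H)
  show ?case by (rule smooth_fr.cong[OF cong.IH]) (simp add: cong.hyps)
qed

lemma fr_power: "smooth_fr S F \<Longrightarrow> open S \<Longrightarrow> smooth_fr S (\<lambda>x. F x ^ k)"
  by (induction k) (simp_all add: fr_const fr_mult)

text \<open>Operations on values: one-sided multiplication, \<open>gderiv\<close> and
  \<open>gpar\<close> are of this kind, and all of them commute with partial derivatives
  (\<open>pd_clinear_map\<close>).\<close>

definition clinear_map :: "('i::finite clifford grass \<Rightarrow> 'i clifford grass) \<Rightarrow> bool" where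
  "clinear_map L \<longleftrightarrow> (\<forall>a b. L (a + b) = L a + L b) \<and> (\<forall>c a. L (cnum c * a) = cnum c * L a)"

lemma clinear_map_left: "clinear_map (\<lambda>a. b * a)"
  unfolding clinear_map_def by (simp only: cnum_left distrib_left) simp

lemma clinear_map_right: "clinear_map (\<lambda>a. a * b)"
  unfolding clinear_map_def by (simp add: distrib_right mult.assoc)

lemma clinear_map_gderiv: "clinear_map (gderiv j)"
  unfolding clinear_map_def by (simp add: gderiv_add gderiv_gconst_mult)

lemma clinear_map_gpar: "clinear_map gpar"
  unfolding clinear_map_def by (simp add: gpar_add gpar_mult)

lemma glin_compose: "glin l \<Longrightarrow> clinear_map L \<Longrightarrow> glin (\<lambda>a. l (L a))"
  unfolding glin_def clinear_map_def by simp

lemma fr_clinear_map: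
  assumes "smooth_fr S F" "clinear_map L" shows "smooth_fr S (\<lambda>x. L (F x))"
  using assms(1)
proof (induction rule: smooth_fr.induct)
  case (single f a)
  then have "smooth_fr S (\<lambda>x. cnum (f x) * L a)" by (rule smooth_fr.single)
  then show ?case using assms(2) by (simp add: clinear_map_def)
next
  case (add F G)
  then show ?case using assms(2) smooth_fr.add[OF add.IH] by (simp add: clinear_map_def)
next
  case (cong F G)
  show ?case by (rule smooth_fr.cong[OF cong.IH]) (simp add: cong.hyps)
qed

lemma fr_glin:
  assumes "smooth_fr S F" "glin l" "open S" shows "smooth_on S (\<lambda>x. l (F x))"
  using assms(1)
proof (induction rule: smooth_fr.induct)
  case (single f a)
  then have "smooth_on S (\<lambda>x. f x * l a)" using assms by (intro smooth_on_mult) auto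
  then show ?case using assms(2) by (simp add: glin_cnum)
next
  case (add F G)
  then show ?case using assms by (simp add: glin_add smooth_on_add)
next
  case (cong F G)
  show ?case by (rule smooth_on_cong[OF cong.IH assms(3)]) (simp add: cong.hyps)
qed

lemma tensor_repr_add:
  assumes "tensor_repr S F N f c" "tensor_repr S G M g d"
  shows "\<exists>N f c. tensor_repr S (\<lambda>x. F x + G x) N f c"
proof -
  let ?f = "\<lambda>k. if k < N then f k else g (k - N)" and ?c = "\<lambda>k. if k < N then c k else d (k - N)"
  have "(\<Sum>k<N + M. cl_scalar (?f k x) * ?c k) = (\<Sum>k<N. cl_scalar (f k x) * c k) + (\<Sum>k<M. cl_scalar (g k x) * d k)" for x
  proof -
    have "(\<Sum>k<N + M. cl_scalar (?f k x) * ?c k)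
        = (\<Sum>k<N. cl_scalar (?f k x) * ?c k) + (\<Sum>k<M. cl_scalar (?f (N + k) x) * ?c (N + k))"
      by (induction M) (simp_all add: add.assoc)
    then show ?thesis by simp
  qed
  then have "tensor_repr S (\<lambda>x. F x + G x) (N + M) ?f ?c"
    using assms unfolding tensor_repr_def by auto
  then show ?thesis by blast
qed

lemma fr_tensor_repr:
  assumes "smooth_fr S F" shows "\<exists>N f c. tensor_repr S (\<lambda>x. gcoeff (F x) A) N f c"
  using assms
proof (induction rule: smooth_fr.induct)
  case (single f a)
  then have "tensor_repr S (\<lambda>x. gcoeff (cnum (f x) * a) A) 1 (\<lambda>_. f) (\<lambda>_. gcoeff a A)"
    by (simp add: tensor_repr_def)
  then show ?case by blast
next
  case (add F G)
  then show ?case using tensor_repr_add by fastforce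
next
  case (cong F G)
  then obtain N f c where "tensor_repr S (\<lambda>x. gcoeff (F x) A) N f c" by blast
  then have "tensor_repr S (\<lambda>x. gcoeff (G x) A) N f c" using cong.hyps(2) by (simp add: tensor_repr_def)
  then show ?case by blast
qed

lemma tensor_repr_fr:
  assumes "tensor_repr S F N f c" shows "smooth_fr S (\<lambda>x. gconst (F x))"
proof (rule smooth_fr.cong)
  show "smooth_fr S (\<lambda>x. \<Sum>k<N. cnum (f k x) * gconst (c k))"
    using assms by (intro fr_sum smooth_fr.single) (simp add: tensor_repr_def)
  show "(\<Sum>k<N. cnum (f k x) * gconst (c k)) = gconst (F x)" if "x \<in> S" for x
    using assms that by (simp add: tensor_repr_def gconst_sum gconst_mult)
qed

lemma super_space_gsup: "F \<in> super_space n S \<Longrightarrow> x \<in> S \<Longrightarrow> gsup {1..2*n} (F x)"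
  unfolding super_space_def gsup_def by blast

lemma super_space_fr:
  assumes "F \<in> super_space n S" shows "smooth_fr S F"
proof (rule smooth_fr.cong)
  have "smooth_fr S (\<lambda>x. gconst (gcoeff (F x) A))" for A
    using assms tensor_repr_fr unfolding super_space_def by fast
  then show "smooth_fr S (\<lambda>x. \<Sum>A\<in>Pow {1..2*n}. gconst (gcoeff (F x) A) * gmono A)"
    by (intro fr_sum fr_clinear_map[OF _ clinear_map_right])
  show "(\<Sum>A\<in>Pow {1..2*n}. gconst (gcoeff (F x) A) * gmono A) = F x" if "x \<in> S" for x
    using gsup_expand[OF super_space_gsup[OF assms that]] by simp
qed

lemma fr_gcomplex:
  assumes "\<And>A. smooth_on S (\<lambda>x. gcoeff (g x) A)" "\<And>x. gsup N (g x)" "finite N"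
  shows "smooth_fr S (\<lambda>x. gcomplex (g x))"
proof (rule smooth_fr.cong)
  show "smooth_fr S (\<lambda>x. \<Sum>A\<in>Pow N. cnum (gcoeff (g x) A) * gmono A)"
    by (intro fr_sum smooth_fr.single assms)
  show "(\<Sum>A\<in>Pow N. cnum (gcoeff (g x) A) * gmono A) = gcomplex (g x)" for x
    by (rule gsup_expand[OF gsup_gcomplex[OF assms(2)] assms(3), symmetric, unfolded gcoeff_gcomplex])
qed

subsection \<open>Partial derivatives\<close>

text \<open>Testing against all functionals makes the derivative independent of a representation of
  F; uniqueness is \<open>glin_separates\<close>, existence is \<open>pd_glin\<close>.\<close>

definition pd :: "'m + 'm \<Rightarrow> ('m::finite point \<Rightarrow> 'm sval) \<Rightarrow> 'm point \<Rightarrow> 'm sval" where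
  "pd i F x = (THE d. \<forall>l. glin l \<longrightarrow> l d = pderivative i (\<lambda>x. l (F x)) x)"

lemma pd_eqI:
  assumes "\<And>l. glin l \<Longrightarrow> l d = pderivative i (\<lambda>x. l (F x)) x" shows "pd i F x = d"
  unfolding pd_def by (rule the_equality) (use assms in \<open>auto intro!: glin_separates\<close>)

lemma pderivative_cong:
  assumes "open S" "x \<in> S" "\<And>x. x \<in> S \<Longrightarrow> f x = g x"
  shows "pderivative i f x = pderivative i g x"
proof -
  have "(f has_derivative D) (at x) \<longleftrightarrow> (g has_derivative D) (at x)" for D
    using has_derivative_transform_within_open[of f D x UNIV S g]
      has_derivative_transform_within_open[of g D x UNIV S f] assms by auto
  then show ?thesis by (simp add: pderivative_def frechet_derivative_def)
qed

lemma pderivative_add: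
  assumes "smooth_on S f" "smooth_on S g" "x \<in> S"
  shows "pderivative i (\<lambda>x. f x + g x) x = pderivative i f x + pderivative i g x"
  unfolding pderivative_def
  using frechet_derivative_at[OF has_derivative_add[OF smooth_on_has_derivative[OF assms(1,3)]
      smooth_on_has_derivative[OF assms(2,3)]], symmetric] by simp

lemma pderivative_mult:
  assumes "smooth_on S f" "smooth_on S g" "x \<in> S"
  shows "pderivative i (\<lambda>x. f x * g x) x = pderivative i f x * g x + f x * pderivative i g x"
  unfolding pderivative_def
  using frechet_derivative_at[OF has_derivative_mult[OF smooth_on_has_derivative[OF assms(1,3)]
      smooth_on_has_derivative[OF assms(2,3)]], symmetric] by simp

lemma pderivative_const [simp]: "pderivative i (\<lambda>x. c) x = 0"
  by (simp add: pderivative_def)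

lemma pderivative_multc: "smooth_on S f \<Longrightarrow> x \<in> S \<Longrightarrow> pderivative i (\<lambda>x. f x * c) x = pderivative i f x * c"
  using pderivative_mult[of S f "\<lambda>_. c" x i] by simp

lemma smooth_on_pderivative: "smooth_on S f \<Longrightarrow> smooth_on S (pderivative i f)"
  unfolding pderivative_def[abs_def] by (rule smooth_on_deriv)

lemma pd_glin:
  assumes "smooth_fr S F" "open S" "x \<in> S"
  shows "\<forall>l. glin l \<longrightarrow> l (pd i F x) = pderivative i (\<lambda>x. l (F x)) x"
proof -
  have "\<exists>d. \<forall>l. glin l \<longrightarrow> l d = pderivative i (\<lambda>x. l (F x)) x"
    using assms(1)
  proof (induction rule: smooth_fr.induct)
    case (single f a)
    have "l (cnum (pderivative i f x) * a) = pderivative i (\<lambda>x. l (cnum (f x) * a)) x" if "glin l" for l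
      using that single assms(3) by (simp add: glin_cnum pderivative_multc)
    then show ?case by blast
  next
    case (add F G)
    then obtain d e where de: "\<forall>l. glin l \<longrightarrow> l d = pderivative i (\<lambda>x. l (F x)) x"
      "\<forall>l. glin l \<longrightarrow> l e = pderivative i (\<lambda>x. l (G x)) x" by blast
    have "l (d + e) = pderivative i (\<lambda>x. l (F x + G x)) x" if "glin l" for l
      using that de pderivative_add[OF fr_glin[OF add.hyps(1) that assms(2)]
          fr_glin[OF add.hyps(2) that assms(2)] assms(3)] by (simp add: glin_add)
    then show ?case by blast
  next
    case (cong F G)
    then obtain d where d: "\<forall>l. glin l \<longrightarrow> l d = pderivative i (\<lambda>x. l (F x)) x" by blast
    have "pderivative i (\<lambda>x. l (F x)) x = pderivative i (\<lambda>x. l (G x)) x" for l :: "'a sval \<Rightarrow> complex"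
      by (rule pderivative_cong[OF assms(2,3)]) (simp add: cong)
    then show ?case using d by auto
  qed
  then obtain d where d: "\<forall>l. glin l \<longrightarrow> l d = pderivative i (\<lambda>x. l (F x)) x" by blast
  then show ?thesis using pd_eqI[of d i F x] by auto
qed

lemma pd_cong:
  assumes "open S" "x \<in> S" "\<And>x. x \<in> S \<Longrightarrow> F x = G x"
  shows "pd i F x = pd i G x"
proof -
  have "pderivative i (\<lambda>x. l (F x)) x = pderivative i (\<lambda>x. l (G x)) x" for l :: "'a sval \<Rightarrow> complex"
    by (rule pderivative_cong[OF assms(1,2)]) (simp add: assms)
  then show ?thesis by (simp add: pd_def)
qed

lemma pd_single:
  assumes "smooth_on S f" "x \<in> S"
  shows "pd i (\<lambda>x. cnum (f x) * a) x = cnum (pderivative i f x) * a"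
  by (rule pd_eqI) (use assms in \<open>simp add: glin_cnum pderivative_multc\<close>)

lemma pd_const [simp]: "pd i (\<lambda>x. a) x = 0"
  by (rule pd_eqI) (simp add: glin_zero)

lemma pd_add:
  assumes "smooth_fr S F" "smooth_fr S G" "open S" "x \<in> S"
  shows "pd i (\<lambda>x. F x + G x) x = pd i F x + pd i G x"
proof (rule pd_eqI)
  fix l :: "'a sval \<Rightarrow> complex" assume l: "glin l"
  show "l (pd i F x + pd i G x) = pderivative i (\<lambda>x. l (F x + G x)) x"
    using pd_glin[OF assms(1,3,4)] pd_glin[OF assms(2,3,4)] l
      pderivative_add[OF fr_glin[OF assms(1) l assms(3)] fr_glin[OF assms(2) l assms(3)] assms(4)]
    by (simp add: glin_add)
qed

lemma pd_clinear_map: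
  assumes "smooth_fr S F" "open S" "x \<in> S" "clinear_map L"
  shows "pd i (\<lambda>x. L (F x)) x = L (pd i F x)"
  by (rule pd_eqI) (use pd_glin[OF assms(1-3)] glin_compose[OF _ assms(4)] in auto)

lemma pd_sum:
  assumes "open S" "x \<in> S"
  shows "(\<And>j. j \<in> I \<Longrightarrow> smooth_fr S (F j)) \<Longrightarrow> pd i (\<lambda>x. \<Sum>j\<in>I. F j x) x = (\<Sum>j\<in>I. pd i (F j) x)"
proof (induction I rule: infinite_finite_induct)
  case (insert j I)
  then show ?case using pd_add[OF insert.prems[of j] fr_sum[of I S F] assms] by simp
qed simp_all

lemma fr_pd:
  assumes "smooth_fr S F" "open S" shows "smooth_fr S (pd i F)"
  using assms(1)
proof (induction rule: smooth_fr.induct)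
  case (single f a)
  show ?case
    by (rule smooth_fr.cong[OF smooth_fr.single[OF smooth_on_pderivative[OF single]]])
       (rule pd_single[OF single, symmetric])
next
  case (add F G)
  show ?case
    by (rule smooth_fr.cong[OF smooth_fr.add[OF add.IH]]) (rule pd_add[OF add.hyps assms(2), symmetric])
next
  case (cong F G)
  show ?case by (rule smooth_fr.cong[OF cong.IH]) (rule pd_cong[OF assms(2)], use cong in auto)
qed

lemma pd_mult:
  assumes F: "smooth_fr S F" and G: "smooth_fr S G" and S: "open S" and x: "x \<in> S"
  shows "pd i (\<lambda>x. F x * G x) x = pd i F x * G x + F x * pd i G x"
  using F
proof (induction rule: smooth_fr.induct)
  case f: (single f a)
  show ?case using G
  proof (induction rule: smooth_fr.induct)
    case g: (single g b)
    have "pd i (\<lambda>x. cnum (f x * g x) * (a * b)) x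
        = cnum (pderivative i f x * g x + f x * pderivative i g x) * (a * b)"
      by (subst pd_single[OF smooth_on_mult[OF f g S] x]) (simp add: pderivative_mult[OF f g x])
    then show ?case
      by (simp add: pd_single[OF f x] pd_single[OF g x] cnum_mult4) (simp add: cnum_add distrib_right)
  next
    case (add G H)
    note m = fr_mult[OF smooth_fr.single[OF f, of a] _ S]
    have "pd i (\<lambda>x. cnum (f x) * a * G x + cnum (f x) * a * H x) x
        = pd i (\<lambda>x. cnum (f x) * a * G x) x + pd i (\<lambda>x. cnum (f x) * a * H x) x"
      by (rule pd_add[OF m m S x]) (rule add.hyps)+
    then show ?case
      by (simp only: distrib_left pd_add[OF add.hyps S x] add.IH) (simp only: add_ac)
  next
    case (cong G H)
    have "pd i (\<lambda>x. cnum (f x) * a * H x) x = pd i (\<lambda>x. cnum (f x) * a * G x) x"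
      by (rule pd_cong[OF S x]) (simp add: cong)
    moreover have "pd i H x = pd i G x" by (rule pd_cong[OF S x]) (simp add: cong)
    ultimately show ?case using cong x by simp
  qed
next
  case (add F H)
  note m = fr_mult[OF _ G S]
  have "pd i (\<lambda>x. F x * G x + H x * G x) x = pd i (\<lambda>x. F x * G x) x + pd i (\<lambda>x. H x * G x) x"
    by (rule pd_add[OF m m S x]) (rule add.hyps)+
  then show ?case
    by (simp only: distrib_right pd_add[OF add.hyps S x] add.IH) (simp only: add_ac)
next
  case (cong F H)
  have "pd i (\<lambda>x. H x * G x) x = pd i (\<lambda>x. F x * G x) x"
    by (rule pd_cong[OF S x]) (simp add: cong)
  moreover have "pd i H x = pd i F x" by (rule pd_cong[OF S x]) (simp add: cong)
  ultimately show ?case using cong x by simp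
qed

lemma of_nat_mult_left: "y * (of_nat k * p * d) = of_nat k * (y * p * d)" for y :: "'r::ring_1"
  by (metis mult.assoc mult_of_nat_commute)

text \<open>In a noncommutative ring the usual formula needs F x to commute with its derivative,
  which centrality provides.\<close>

lemma pd_power:
  assumes F: "smooth_fr S F" and S: "open S" "x \<in> S" and c: "central (F x)"
  shows "pd i (\<lambda>x. F x ^ Suc k) x = of_nat (Suc k) * F x ^ k * pd i F x"
proof (induction k)
  case (Suc k)
  have "pd i (\<lambda>x. F x * F x ^ Suc k) x = pd i F x * F x ^ Suc k + F x * pd i (\<lambda>x. F x ^ Suc k) x"
    by (rule pd_mult[OF F fr_power[OF F S(1)] S])
  also have "pd i F x * F x ^ Suc k = F x ^ Suc k * pd i F x"
    by (rule centralD[OF central_power[OF c], symmetric])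
  also have "F x * pd i (\<lambda>x. F x ^ Suc k) x = of_nat (Suc k) * (F x ^ Suc k * pd i F x)"
    by (simp only: Suc.IH of_nat_mult_left) (simp only: power_Suc)
  finally show ?case by (simp only: of_nat_Suc[of "Suc k"] distrib_right mult_1 mult.assoc power_Suc)
qed simp

lemma gderiv_power:
  assumes c: "central a" and e: "gpar a = a"
  shows "gderiv j (a ^ Suc k) = of_nat (Suc k) * a ^ k * gderiv j a"
proof (induction k)
  case (Suc k)
  have "gderiv j (a ^ Suc (Suc k)) = gderiv j a * a ^ Suc k + a * gderiv j (a ^ Suc k)"
    using gderiv_mult[of j a "a ^ Suc k"] e by simp
  also have "gderiv j a * a ^ Suc k = a ^ Suc k * gderiv j a"
    by (rule centralD[OF central_power[OF c], symmetric])
  also have "a * gderiv j (a ^ Suc k) = of_nat (Suc k) * (a ^ Suc k * gderiv j a)"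
    by (simp only: Suc.IH of_nat_mult_left) (simp only: power_Suc)
  finally show ?case by (simp only: of_nat_Suc[of "Suc k"] distrib_right mult_1 mult.assoc)
qed simp

section \<open>Pairing of distributions with Clifford-valued functions\<close>

text \<open>The properties of L that make \<open>tensor_ext L K\<close> independent of the
  representation: linearity on functions smooth near K, and dependence on values near K
  only.\<close>

definition local_linear :: "(('v::real_normed_vector \<Rightarrow> complex) \<Rightarrow> complex) \<Rightarrow> 'v set \<Rightarrow> bool" where
  "local_linear L K \<longleftrightarrow> (\<forall>S f g. open S \<longrightarrow> K \<subseteq> S \<longrightarrow> smooth_on S f \<longrightarrow>
      (smooth_on S g \<longrightarrow> L (\<lambda>x. f x + g x) = L f + L g) \<and> (\<forall>c. L (\<lambda>x. f x * c) = L f * c) \<and>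
      ((\<forall>x\<in>S. f x = g x) \<longrightarrow> L f = L g))"

lemma local_linearD:
  assumes "local_linear L K" "open S" "K \<subseteq> S" "smooth_on S f"
  shows "smooth_on S g \<Longrightarrow> L (\<lambda>x. f x + g x) = L f + L g" "L (\<lambda>x. f x * c) = L f * c"
    "(\<And>x. x \<in> S \<Longrightarrow> f x = g x) \<Longrightarrow> L f = L g"
  using assms unfolding local_linear_def by blast+

lemma cl_lin_zero: "cl_lin l \<Longrightarrow> l 0 = 0"
  unfolding cl_lin_def by (metis cl_scalar_zero mult_zero_left)

lemma cl_lin_sum: "cl_lin l \<Longrightarrow> l (\<Sum>i\<in>I. f i) = (\<Sum>i\<in>I. l (f i))"
  by (induction I rule: infinite_finite_induct) (simp_all add: cl_lin_zero, simp add: cl_lin_def)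

text \<open>Under a functional l the sum built from any representation becomes L of the scalar
  function l F, which does not mention the representation. Since functionals separate values, all
  admissible sums coincide and the definite description is met.\<close>

lemma tensor_ext_cl_lin:
  assumes L: "local_linear L K" and S: "open S" "K \<subseteq> S" and F: "tensor_repr S F N f c" and l: "cl_lin l"
  shows "l (tensor_ext L K F) = L (\<lambda>x. l (F x))"
proof -
  have *: "l (\<Sum>k<N. cl_scalar (L (f k)) * c k) = L (\<lambda>x. l (F x))"
    if S: "open S" "K \<subseteq> S" and F: "tensor_repr S F N f c" and l: "cl_lin l"
    for S N f c and l :: "'b clifford \<Rightarrow> complex"
  proof -
    have sm: "smooth_on S (f k)" if "k < N" for k using F that by (simp add: tensor_repr_def)
    have "L (\<lambda>x. \<Sum>k<M. f k x * l (c k)) = (\<Sum>k<M. L (f k) * l (c k))" if "M \<le> N" for M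
      using that
    proof (induction M)
      case 0
      have "L (\<lambda>x. 0 * 0) = L (\<lambda>_. 0) * 0"
        by (rule local_linearD(2)[OF L S smooth_on_const])
      then show ?case by simp
    next
      case (Suc M)
      have s1: "smooth_on S (\<lambda>x. \<Sum>k<M. f k x * l (c k))"
        using Suc.prems by (intro smooth_on_sum smooth_on_mult sm smooth_on_const S) auto
      have s2: "smooth_on S (f M)" "smooth_on S (\<lambda>x. f M x * l (c M))"
        using Suc.prems by (auto intro!: smooth_on_mult sm S)
      have "L (\<lambda>x. (\<Sum>k<M. f k x * l (c k)) + f M x * l (c M))
          = L (\<lambda>x. \<Sum>k<M. f k x * l (c k)) + L (\<lambda>x. f M x * l (c M))"
        by (rule local_linearD(1)[OF L S s1 s2(2)])
      also have "L (\<lambda>x. f M x * l (c M)) = L (f M) * l (c M)"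
        by (rule local_linearD(2)[OF L S s2(1)])
      finally show ?case using Suc by simp
    qed
    from this[of N] have "L (\<lambda>x. \<Sum>k<N. f k x * l (c k)) = l (\<Sum>k<N. cl_scalar (L (f k)) * c k)"
      using l by (simp add: cl_lin_sum) (simp add: cl_lin_def)
    moreover have "L (\<lambda>x. \<Sum>k<N. f k x * l (c k)) = L (\<lambda>x. l (F x))"
    proof -
      have "smooth_on S (\<lambda>x. \<Sum>k<N. f k x * l (c k))"
        by (intro smooth_on_sum smooth_on_mult sm smooth_on_const S) auto
      moreover have "(\<Sum>k<N. f k x * l (c k)) = l (F x)" if "x \<in> S" for x
        using F l that by (simp add: tensor_repr_def cl_lin_sum) (simp add: cl_lin_def)
      ultimately show ?thesis by (rule local_linearD(3)[OF L S])
    qed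
    ultimately show ?thesis by simp
  qed
  have "tensor_ext L K F = (\<Sum>k<N. cl_scalar (L (f k)) * c k)"
    unfolding tensor_ext_def
  proof (rule the_equality)
    show "\<exists>S Na fa ca. open S \<and> K \<subseteq> S \<and> tensor_repr S F Na fa ca \<and>
       (\<Sum>k<N. cl_scalar (L (f k)) * c k) = (\<Sum>k<Na. cl_scalar (L (fa k)) * ca k)"
      using S F by blast
    fix v assume "\<exists>S N f c. open S \<and> K \<subseteq> S \<and> tensor_repr S F N f c \<and> v = (\<Sum>k<N. cl_scalar (L (f k)) * c k)"
    then obtain S' N' f' c' where v: "open S'" "K \<subseteq> S'" "tensor_repr S' F N' f' c'"
      "v = (\<Sum>k<N'. cl_scalar (L (f' k)) * c' k)" by blast
    show "v = (\<Sum>k<N. cl_scalar (L (f k)) * c k)"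
      by (rule cl_lin_separates) (simp add: v(4) *[OF v(1-3)] *[OF S F])
  qed
  then show ?thesis using *[OF S F l] by simp
qed

lemma local_linear_pderivative: "local_linear (\<lambda>f. pderivative i f x) {x}"
  unfolding local_linear_def
proof (intro allI impI conjI)
  fix S f g c assume S: "open S" "{x} \<subseteq> S" and f: "smooth_on S f"
  then have x: "x \<in> S" by simp
  show "pderivative i (\<lambda>x. f x + g x) x = pderivative i f x + pderivative i g x" if "smooth_on S g"
    by (rule pderivative_add[OF f that x])
  show "pderivative i (\<lambda>x. f x * c) x = pderivative i f x * c" by (rule pderivative_multc[OF f x])
  show "pderivative i f x = pderivative i g x" if "\<forall>x\<in>S. f x = g x"
    by (rule pderivative_cong[OF S(1) x]) (use that in auto)
qed

lemma gsup_pd: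
  assumes "smooth_fr S F" "open S" "x \<in> S" "\<And>x. x \<in> S \<Longrightarrow> gsup N (F x)"
  shows "gsup N (pd i F x)"
  unfolding gsup_def
proof (intro allI impI)
  fix A assume nz: "gcoeff (pd i F x) A \<noteq> 0"
  show "A \<subseteq> N"
  proof (rule ccontr)
    assume A: "\<not> A \<subseteq> N"
    have "gcoeff (pd i F x) A = 0"
    proof (rule cl_lin_separates)
      fix l :: "('a + 'a) clifford \<Rightarrow> complex" assume l: "cl_lin l"
      note l0 = cl_lin_zero[OF l]
      have "l (gcoeff (pd i F x) A) = pderivative i (\<lambda>x. l (gcoeff (F x) A)) x"
        by (rule pd_glin[OF assms(1-3), rule_format, OF glin_gcoeff[OF l]])
      also have "\<dots> = pderivative i (\<lambda>x. 0) x"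
      proof (rule pderivative_cong[OF assms(2,3)])
        fix x assume "x \<in> S"
        then have "gcoeff (F x) A = 0" using assms(4)[of x] A unfolding gsup_def by blast
        then show "l (gcoeff (F x) A) = 0" using l0 by simp
      qed
      finally show "l (gcoeff (pd i F x) A) = l 0" using l0 by simp
    qed
    with nz show False by simp
  qed
qed

text \<open>\<open>dx\<close> collects monomials in the first 2n generators only; the support
  hypothesis ensures that these are all.\<close>

lemma dx_eq_pd:
  assumes F: "smooth_fr S F" and S: "open S" "x \<in> S" and sup: "\<And>x. x \<in> S \<Longrightarrow> gsup {1..2*n} (F x)"
  shows "dx n i F x = pd i F x"
proof -
  have "tensor_ext (\<lambda>f. pderivative i f x) {x} (\<lambda>x'. gcoeff (F x') A) = gcoeff (pd i F x) A" for A
  proof (rule cl_lin_separates)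
    fix l :: "('a + 'a) clifford \<Rightarrow> complex" assume l: "cl_lin l"
    obtain N f c where r: "tensor_repr S (\<lambda>x. gcoeff (F x) A) N f c" using fr_tensor_repr[OF F] by blast
    have "l (tensor_ext (\<lambda>f. pderivative i f x) {x} (\<lambda>x'. gcoeff (F x') A))
        = pderivative i (\<lambda>x. l (gcoeff (F x) A)) x"
      by (rule tensor_ext_cl_lin[OF local_linear_pderivative S(1) _ r l]) (use S in simp)
    also have "\<dots> = l (gcoeff (pd i F x) A)"
      by (rule pd_glin[OF F S, rule_format, OF glin_gcoeff[OF l], symmetric])
    finally show "l (tensor_ext (\<lambda>f. pderivative i f x) {x} (\<lambda>x'. gcoeff (F x') A)) = l (gcoeff (pd i F x) A)" .
  qed
  then show ?thesis
    unfolding dx_def using gsup_expand[OF gsup_pd[OF F S sup], of i] by simp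
qed

section \<open>Distributions, supports and cutoffs\<close>

definition test_linear :: "('v::real_normed_vector) distribution \<Rightarrow> bool" where
  "test_linear T \<longleftrightarrow> (\<forall>f g. test_function f \<longrightarrow> test_function g \<longrightarrow> T (\<lambda>x. f x + g x) = T f + T g) \<and>
     (\<forall>f c. test_function f \<longrightarrow> T (\<lambda>x. f x * c) = T f * c)"

lemma closed_dist_support: "closed (dist_support T)"
  unfolding dist_support_def by (auto simp: closed_def)

text \<open>By definition T vanishes on each of a family of open sets; passing to their union needs
  a partition of unity. It is built by induction over a finite subcover, splitting off one set at a
  time.\<close>

lemma dist_support_null:
  fixes T :: "'v::euclidean_space distribution"
  assumes T: "test_linear T" and f: "test_function f" "closure {x. f x \<noteq> 0} \<inter> dist_support T = {}"
  shows "T f = 0"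
proof -
  define \<W> where "\<W> = {W. open W \<and> (\<forall>\<phi>. test_function \<phi> \<longrightarrow> closure {x. \<phi> x \<noteq> 0} \<subseteq> W \<longrightarrow> T \<phi> = 0)}"
  have T0: "T (\<lambda>x. 0) = 0"
  proof -
    have "T (\<lambda>x. 0 * 0) = T (\<lambda>x. 0) * 0" using T test_function_zero unfolding test_linear_def by blast
    then show ?thesis by simp
  qed
  have "closure {x. f x \<noteq> 0} \<subseteq> \<Union>\<W>" using f(2) unfolding dist_support_def \<W>_def by auto
  moreover have "compact (closure {x. f x \<noteq> 0})" using f(1) by (simp add: test_function_def)
  moreover have "open W" if "W \<in> \<W>" for W using that by (simp add: \<W>_def)
  ultimately obtain \<F> where F: "\<F> \<subseteq> \<W>" "finite \<F>" "closure {x. f x \<noteq> 0} \<subseteq> \<Union>\<F>"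
    using compactE by metis
  have "T f = 0" if "finite \<F>" "\<F> \<subseteq> \<W>" "test_function f" "closure {x. f x \<noteq> 0} \<subseteq> \<Union>\<F>" for \<F> f
    using that
  proof (induction \<F> arbitrary: f)
    case empty
    then have "f = (\<lambda>x. 0)" using closure_subset by fastforce
    then show ?case using T0 by simp
  next
    case (insert W \<F>)
    have K: "compact (closure {x. f x \<noteq> 0} - \<Union>\<F>)"
      using insert.prems by (intro compact_diff) (auto simp: test_function_def \<W>_def)
    \<comment> \<open>\<eta> is 1 near the part of the support that the remaining sets miss, so f (1
      - \<eta>) is supported in their union, while \<eta> f is supported in W.\<close>
    obtain \<eta> where \<eta>: "cutoff (closure {x. f x \<noteq> 0} - \<Union>\<F>) W \<eta>"
      using cutoff_exists[OF K, of W] insert.prems by (auto simp: \<W>_def)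
    then obtain V where V: "open V" "closure {x. f x \<noteq> 0} - \<Union>\<F> \<subseteq> V" "\<forall>x\<in>V. \<eta> x = 1"
      and t\<eta>: "test_function \<eta>" "closure {x. \<eta> x \<noteq> 0} \<subseteq> W" by (auto simp: cutoff_def)
    have t1: "test_function (\<lambda>x. \<eta> x * f x)"
      by (intro test_function_mult t\<eta> test_function_smooth insert.prems)
    have t2: "test_function (\<lambda>x. f x * (1 - \<eta> x))"
      by (intro test_function_mult smooth_on_diff smooth_on_const test_function_smooth t\<eta> insert.prems open_UNIV)
    have "closure {x. \<eta> x * f x \<noteq> 0} \<subseteq> W" using closure_supp_mult[of \<eta> f] t\<eta> by blast
    then have z1: "T (\<lambda>x. \<eta> x * f x) = 0" using t1 insert.prems by (auto simp: \<W>_def)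
    have "closure {x. f x * (1 - \<eta> x) \<noteq> 0} \<subseteq> \<Union>\<F>"
    proof -
      have "closure {x. f x * (1 - \<eta> x) \<noteq> 0} \<subseteq> closure {x. f x \<noteq> 0}" by (rule closure_supp_mult)
      moreover have "closure {x. f x * (1 - \<eta> x) \<noteq> 0} \<subseteq> - V"
        by (rule closure_minimal) (use V in auto)
      ultimately show ?thesis using V(2) by blast
    qed
    then have z2: "T (\<lambda>x. f x * (1 - \<eta> x)) = 0" using insert t2 by auto
    have "(\<lambda>x. \<eta> x * f x + f x * (1 - \<eta> x)) = f" by (auto simp: algebra_simps)
    moreover have "T (\<lambda>x. \<eta> x * f x + f x * (1 - \<eta> x)) = T (\<lambda>x. \<eta> x * f x) + T (\<lambda>x. f x * (1 - \<eta> x))"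
      using T t1 t2 unfolding test_linear_def by blast
    ultimately show ?case using z1 z2 by simp
  qed
  from this[OF F(2,1) f(1) F(3)] show ?thesis .
qed

text \<open>Two admissible cutoffs agree near the support of T, so the difference of the localised
  functions is supported away from it and \<open>dist_support_null\<close> applies.\<close>

lemma dist_pair_eq:
  fixes T :: "'v::euclidean_space distribution"
  assumes T: "test_linear T" and S: "open S" "smooth_on S f"
    and \<eta>: "cutoff (dist_support T) S \<eta>"
  shows "dist_pair T f = T (\<lambda>x. \<eta> x * f x)"
proof -
  obtain W where W: "open W" "dist_support T \<subseteq> W" "\<forall>x\<in>W. \<eta> x = 1"
    and t: "test_function \<eta>" "closure {x. \<eta> x \<noteq> 0} \<subseteq> S" using \<eta> by (auto simp: cutoff_def)
  show ?thesis unfolding dist_pair_def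
  proof (rule the_equality)
    show "\<exists>S W \<eta>'. open S \<and> smooth_on S f \<and> test_function \<eta>' \<and> closure {x. \<eta>' x \<noteq> 0} \<subseteq> S \<and> open W \<and>
       dist_support T \<subseteq> W \<and> (\<forall>x\<in>W. \<eta>' x = 1) \<and> T (\<lambda>x. \<eta> x * f x) = T (\<lambda>x. \<eta>' x * f x)"
      using S W t by blast
    fix c assume "\<exists>S W \<eta>. open S \<and> smooth_on S f \<and> test_function \<eta> \<and> closure {x. \<eta> x \<noteq> 0} \<subseteq> S \<and> open W \<and>
       dist_support T \<subseteq> W \<and> (\<forall>x\<in>W. \<eta> x = 1) \<and> c = T (\<lambda>x. \<eta> x * f x)"
    then obtain S' W' \<eta>' where S': "open S'" "smooth_on S' f"
      and W': "open W'" "dist_support T \<subseteq> W'" "\<forall>x\<in>W'. \<eta>' x = 1"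
      and t': "test_function \<eta>'" "closure {x. \<eta>' x \<noteq> 0} \<subseteq> S'" and c: "c = T (\<lambda>x. \<eta>' x * f x)" by blast
    have a: "test_function (\<lambda>x. \<eta> x * f x)" by (rule test_function_mult_local[OF t(1) S(1) t(2) S(2)])
    have a': "test_function (\<lambda>x. \<eta>' x * f x)" by (rule test_function_mult_local[OF t'(1) S'(1) t'(2) S'(2)])
    \<comment> \<open>The minus sign is a right factor because \<open>test_linear\<close> takes its
      scalars on the right.\<close>
    define d where "d = (\<lambda>x. \<eta>' x * f x * (- 1) + \<eta> x * f x)"
    have m: "test_function (\<lambda>x. \<eta>' x * f x * (- 1))" using test_function_mult[OF a' smooth_on_const[of _ "-1"]] .
    have d: "test_function d" unfolding d_def by (intro test_function_add m a)
    have "closure {x. d x \<noteq> 0} \<subseteq> - (W \<inter> W')"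
      by (rule closure_minimal) (use W W' in \<open>auto simp: d_def\<close>)
    then have "T d = 0" using W W' by (intro dist_support_null[OF T d]) blast
    moreover have "T d = T (\<lambda>x. \<eta>' x * f x * (- 1)) + T (\<lambda>x. \<eta> x * f x)"
      using T a m unfolding d_def test_linear_def by blast
    moreover have "T (\<lambda>x. \<eta>' x * f x * (- 1)) = T (\<lambda>x. \<eta>' x * f x) * (- 1)"
      using T a' unfolding test_linear_def by blast
    ultimately show "c = T (\<lambda>x. \<eta> x * f x)" using c by simp
  qed
qed

lemma cutoff_subset: "cutoff K U \<eta> \<Longrightarrow> L \<subseteq> K \<Longrightarrow> U \<subseteq> V \<Longrightarrow> cutoff L V \<eta>"
  unfolding cutoff_def by (meson order_trans)

lemma local_linear_dist_pair:
  fixes T :: "'v::euclidean_space distribution"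
  assumes T: "test_linear T" and K: "compact (dist_support T)"
  shows "local_linear (dist_pair T) (dist_support T)"
  unfolding local_linear_def
proof (intro allI impI)
  fix S f g assume S: "open S" "dist_support T \<subseteq> S" and f: "smooth_on S f"
  obtain \<eta> where \<eta>: "cutoff (dist_support T) S \<eta>" using cutoff_exists[OF K S] .
  have t: "test_function \<eta>" "closure {x. \<eta> x \<noteq> 0} \<subseteq> S" using \<eta> by (auto simp: cutoff_def)
  have a: "test_function (\<lambda>x. \<eta> x * h x)" if "smooth_on S h" for h
    by (rule test_function_mult_local[OF t(1) S(1) t(2) that])
  note e = dist_pair_eq[OF T S(1) _ \<eta>]
  have "dist_pair T (\<lambda>x. f x + g x) = dist_pair T f + dist_pair T g" if g: "smooth_on S g"
  proof -
    have "T (\<lambda>x. \<eta> x * f x + \<eta> x * g x) = T (\<lambda>x. \<eta> x * f x) + T (\<lambda>x. \<eta> x * g x)"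
      using T a[OF f] a[OF g] unfolding test_linear_def by blast
    then show ?thesis using e[OF f] e[OF g] e[OF smooth_on_add[OF f g S(1)]] by (simp add: distrib_left)
  qed
  moreover have "dist_pair T (\<lambda>x. f x * c) = dist_pair T f * c" for c
  proof -
    have "T (\<lambda>x. \<eta> x * f x * c) = T (\<lambda>x. \<eta> x * f x) * c"
      using T a[OF f] unfolding test_linear_def by blast
    then show ?thesis using e[OF f] e[OF smooth_on_mult[OF f smooth_on_const[of S c] S(1)]]
      by (simp add: mult.assoc)
  qed
  moreover have "dist_pair T f = dist_pair T g" if "\<forall>x\<in>S. f x = g x"
  proof -
    have "(\<lambda>x. \<eta> x * f x) = (\<lambda>x. \<eta> x * g x)"
    proof
      show "\<eta> x * f x = \<eta> x * g x" for x
        using that test_function_outside[of x \<eta>] t(2) by (cases "x \<in> S") auto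
    qed
    moreover have "smooth_on S g" using smooth_on_cong[OF f S(1)] that by blast
    ultimately show ?thesis using e[OF f] e[of g] by simp
  qed
  ultimately show "(smooth_on S g \<longrightarrow> dist_pair T (\<lambda>x. f x + g x) = dist_pair T f + dist_pair T g) \<and>
      (\<forall>c. dist_pair T (\<lambda>x. f x * c) = dist_pair T f * c) \<and>
      ((\<forall>x\<in>S. f x = g x) \<longrightarrow> dist_pair T f = dist_pair T g)" by blast
qed

section \<open>Stokes' formula for superfunctions\<close>

definition test_fr :: "('m::finite point \<Rightarrow> 'm sval) \<Rightarrow> bool" where
  "test_fr P \<longleftrightarrow> smooth_fr UNIV P \<and> (\<exists>K. compact K \<and> (\<forall>x. x \<notin> K \<longrightarrow> P x = 0))"

lemma test_fr_glin:
  assumes "test_fr P" "glin l" shows "test_function (\<lambda>x. l (P x))"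
proof -
  obtain K where K: "compact K" "\<And>x. x \<notin> K \<Longrightarrow> P x = 0" using assms(1) by (auto simp: test_fr_def)
  show ?thesis
    by (rule test_functionI[OF _ K(1)])
       (use assms K(2) in \<open>auto simp: test_fr_def glin_zero intro: fr_glin\<close>)
qed

lemma test_fr_mult_right: "test_fr P \<Longrightarrow> smooth_fr UNIV G \<Longrightarrow> test_fr (\<lambda>x. P x * G x)"
  unfolding test_fr_def using fr_mult[of UNIV P G] by fastforce

lemma test_fr_add:
  assumes "test_fr P" "test_fr R" shows "test_fr (\<lambda>x. P x + R x)"
proof -
  obtain K where K: "compact K" "\<And>x. x \<notin> K \<Longrightarrow> P x = 0" using assms(1) by (auto simp: test_fr_def)
  obtain L where L: "compact L" "\<And>x. x \<notin> L \<Longrightarrow> R x = 0" using assms(2) by (auto simp: test_fr_def)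
  have "compact (K \<union> L)" "\<forall>x. x \<notin> K \<union> L \<longrightarrow> P x + R x = 0" using K L by auto
  moreover have "smooth_fr UNIV (\<lambda>x. P x + R x)" using assms by (auto simp: test_fr_def intro: smooth_fr.add)
  ultimately show ?thesis unfolding test_fr_def by blast
qed

lemma test_fr_clinear_map:
  assumes "test_fr P" "clinear_map L" shows "test_fr (\<lambda>x. L (P x))"
proof -
  have "L 0 = 0" using assms(2) unfolding clinear_map_def by (metis cl_scalar_zero gconst_zero mult_zero_left)
  then show ?thesis using assms fr_clinear_map[of UNIV P L] unfolding test_fr_def by metis
qed

lemma test_fr_sum: "(\<And>i. i \<in> I \<Longrightarrow> test_fr (P i)) \<Longrightarrow> test_fr (\<lambda>x. \<Sum>i\<in>I. P i x)"
proof (induction I rule: infinite_finite_induct)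
  case (insert i I)
  then show ?case using test_fr_add[of "P i"] by simp
qed (auto simp: test_fr_def fr_const)

lemma test_fr_pd: assumes "test_fr P" shows "test_fr (pd i P)"
proof -
  obtain K where K: "compact K" "\<And>x. x \<notin> K \<Longrightarrow> P x = 0" using assms by (auto simp: test_fr_def)
  have "pd i P x = 0" if "x \<notin> K" for x
  proof -
    have "pd i P x = pd i (\<lambda>_. 0) x"
      by (rule pd_cong[of "- K"]) (use K that compact_imp_closed in auto)
    then show ?thesis by simp
  qed
  then show ?thesis using assms K(1) fr_pd[of UNIV P i] unfolding test_fr_def by auto
qed

text \<open>Multiplication by \<theta> extends a function from S by zero to the whole space, as
  \<theta> vanishes off S.\<close>

lemma fr_extend:
  assumes "smooth_fr S F" and \<theta>: "test_function \<theta>" "open S" "closure {x. \<theta> x \<noteq> 0} \<subseteq> S"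
  shows "test_fr (\<lambda>x. cnum (\<theta> x) * F x)"
proof -
  have "smooth_fr UNIV (\<lambda>x. cnum (\<theta> x) * F x)"
    using assms(1)
  proof (induction rule: smooth_fr.induct)
    case (single f a)
    have "smooth_fr UNIV (\<lambda>x. cnum (\<theta> x * f x) * a)"
      by (intro smooth_fr.single test_function_smooth test_function_mult_local[OF \<theta> single])
    then show ?case by (simp only: cnum_mult mult.assoc)
  next
    case (add F G)
    then show ?case by (simp add: distrib_left smooth_fr.add)
  next
    case (cong F G)
    have "cnum (\<theta> x) * F x = cnum (\<theta> x) * G x" for x
    proof (cases "x \<in> S")
      case False
      then have "\<theta> x = 0" using test_function_outside[of x \<theta>] \<theta>(3) by blast
      then show ?thesis by simp
    qed (simp add: cong.hyps)
    then show ?case using cong.IH by simp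
  qed
  moreover have "cnum (\<theta> x) * F x = 0" if "x \<notin> closure {x. \<theta> x \<noteq> 0}" for x
    using test_function_outside[OF that] by simp
  ultimately show ?thesis using \<theta>(1) unfolding test_fr_def test_function_def by blast
qed

lemma sum_product3:
  "(\<Sum>A\<in>I. f A) * (\<Sum>B\<in>J. p B) * (\<Sum>C\<in>K. q C) = (\<Sum>A\<in>I. \<Sum>B\<in>J. \<Sum>C\<in>K. f A * p B * q C)"
  for f p q :: "'x \<Rightarrow> 'r::ring_1"
proof -
  have e: "(\<Sum>A\<in>I. f A) * (\<Sum>B\<in>J. p B) * z = (\<Sum>A\<in>I. \<Sum>B\<in>J. f A * p B * z)" for z
    unfolding sum_product by (simp only: sum_distrib_right)
  show ?thesis unfolding e by (simp only: sum_distrib_left)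
qed

lemma of_nat_left: "a * (of_nat k * b) = of_nat k * (a * b)" for a :: "'r::ring_1"
  by (simp only: mult.assoc[symmetric] mult_of_nat_commute[of k a])

lemma central_left: "central p \<Longrightarrow> a * (p * b) = p * (a * b)"
  by (simp only: mult.assoc[symmetric] centralD[of p a])

lemma gmono_gconst_left: "gmono A * (gconst c * a) = gconst c * (gmono A * a)"
  by (simp only: mult.assoc[symmetric] gconst_gmono_commute)

locale phase =
  fixes n :: nat and g :: "'m::finite point \<Rightarrow> complex grass"
  assumes phase: "phase_function n g"
    and compact_zero_set: "compact {x. body (g x) = 0}"
    and gradient: "body (g x) = 0 \<Longrightarrow> GDERIV (\<lambda>x. body (g x)) x :> D \<Longrightarrow> D \<noteq> 0"
begin

abbreviation "h \<equiv> \<lambda>x. body (g x)"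

lemma gcoeff_empty: "gcoeff (g x) {} = of_real (h x)"
  using phase unfolding phase_function_def body_def by (metis of_real_Re)

sublocale level_set h
proof
  show sm: "smooth_on UNIV (\<lambda>x. complex_of_real (h x))"
    using phase unfolding phase_function_def by (simp flip: gcoeff_empty)
  show "compact {x. h x = 0}" by (rule compact_zero_set)
  fix x assume hx: "h x = 0"
  let ?D = "frechet_derivative (\<lambda>x. complex_of_real (h x)) (at x)"
  note d = smooth_on_real(2)[OF sm, of x]
  \<comment> \<open>The vector of partial derivatives represents the derivative of h, so it is its
    gradient in the sense of GDERIV and the hypothesis makes it nonzero.\<close>
  define v where "v = (\<chi> i. Re (?D (axis i 1)))"
  have "Re (?D w) = w \<bullet> v" for w
  proof -
    have "w = (\<Sum>i\<in>UNIV. (w $ i) *\<^sub>R axis i 1)"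
      by (simp add: vec_eq_iff axis_def if_distrib cong: if_cong)
    then have "Re (?D w) = (\<Sum>i\<in>UNIV. (w $ i) *\<^sub>R Re (?D (axis i 1)))"
      using linear_sum[OF has_derivative_linear[OF d], of "\<lambda>i. (w $ i) *\<^sub>R axis i 1" UNIV]
      by (simp add: linear_scale[OF has_derivative_linear[OF d]])
    then show ?thesis by (simp add: v_def inner_vec_def)
  qed
  then have "GDERIV h x :> v" using d by (simp add: Inner_Product.gderiv_def)
  then have "v \<noteq> 0" using gradient[OF hx] by blast
  then show "\<exists>i. pderivative i (\<lambda>x. complex_of_real (h x)) x \<noteq> 0"
    by (auto simp: v_def vec_eq_iff pderivative_def) (metis zero_complex.sel(1))
qed

definition bg :: "'m point \<Rightarrow> 'm sval" where "bg x = gcomplex (nilpart (g x))"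

lemma gcoeff_nilpart: "gcoeff (nilpart (g x)) A = (if A = {} then 0 else gcoeff (g x) A)"
  by (simp add: nilpart_def gcoeff_gconst)

lemma gsup_nilpart: "gsup {1..2*n} (nilpart (g x))"
  using phase by (auto simp: gsup_def phase_function_def gcoeff_nilpart)

lemma geven_nilpart: "geven (nilpart (g x))"
  using phase by (auto simp: geven_def phase_function_def gcoeff_nilpart)

lemma smooth_nilpart_power: "smooth_on UNIV (\<lambda>x. gcoeff (nilpart (g x) ^ j) A)"
proof (induction j arbitrary: A)
  case 0
  then show ?case by (simp add: gcoeff_one)
next
  case (Suc j)
  have "smooth_on UNIV (\<lambda>x. gcoeff (nilpart (g x)) A)" for A
    using phase by (cases "A = {}") (auto simp: gcoeff_nilpart phase_function_def)
  then show ?case using Suc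
    by (auto simp: times_grass.rep_eq intro!: smooth_on_sum smooth_on_mult)
qed

lemma fr_bg: "smooth_fr UNIV bg"
  unfolding bg_def[abs_def] using smooth_nilpart_power[of 1] gsup_nilpart by (intro fr_gcomplex) auto

lemma bg_props: "central (bg x)" "gpar (bg x) = bg x" "gsup {1..2*n} (bg x)"
  unfolding bg_def using geven_nilpart gsup_nilpart
  by (auto intro: central_even gpar_even gsup_gcomplex)

lemma bg_power: "bg x ^ j = gcomplex (nilpart (g x) ^ j)"
  by (simp add: bg_def gcomplex_power)

text \<open>Without body and with even monomials only, every term has degree at least 2, so the
  power n + 1 has degree at least 2n + 2, more than the 2n generators allow.\<close>

lemma bg_nilpotent: "bg x ^ Suc n = 0"
proof -
  have "gdeg_ge 2 (nilpart (g x))"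
    unfolding gdeg_ge_def
  proof (intro allI impI)
    fix A assume nz: "gcoeff (nilpart (g x)) A \<noteq> 0"
    have "A \<noteq> {}" using nz by (auto simp: gcoeff_nilpart)
    moreover have "even (card A)" using nz geven_nilpart unfolding geven_def by blast
    moreover have "finite A" using nz gcoeff_infinite by blast
    ultimately have "card A \<noteq> 0" "card A \<noteq> 1" by auto
    then show "2 \<le> card A" by linarith
  qed
  from gdeg_ge_power[OF this, of "Suc n"] have "nilpart (g x) ^ Suc n = 0"
    by (rule gdeg_ge_zero[OF _ gsup_power[OF gsup_nilpart]]) auto
  then show ?thesis by (simp only: bg_power gcomplex_zero)
qed

lemma gcomplex_g: "gcomplex (g x) = cnum (of_real (h x)) + bg x"
proof -
  have "g x = gconst (of_real (h x)) + nilpart (g x)" by (simp add: nilpart_def gcoeff_empty)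
  then show ?thesis unfolding bg_def by (metis gcomplex_add gcomplex_gconst)
qed

lemma pd_g: "pd i (\<lambda>x. gcomplex (g x)) x = cnum (grd i x) + pd i bg x"
proof -
  have "pd i (\<lambda>x. gcomplex (g x)) x = pd i (\<lambda>x. cnum (of_real (h x)) * 1 + bg x) x"
    by (simp add: gcomplex_g)
  also have "\<dots> = pd i (\<lambda>x. cnum (of_real (h x)) * 1) x + pd i bg x"
    by (rule pd_add[OF smooth_fr.single[OF smooth_h] fr_bg]) auto
  also have "pd i (\<lambda>x. cnum (of_real (h x)) * 1) x = cnum (grd i x) * 1"
    unfolding grd_def by (rule pd_single[OF smooth_h]) simp
  finally show ?thesis by simp
qed

lemma gderiv_g: "gderiv k (gcomplex (g x)) = gderiv k (bg x)"
  by (simp add: gcomplex_g gderiv_add)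

subsection \<open>The superdistribution\<close>

lemma super_delta_Q:
  "super_delta n g A \<phi> = (\<Sum>j=0..n. (-1) ^ j * Q (Suc j) (\<lambda>x. gcoeff (nilpart (g x) ^ j) A / fact j * \<phi> x))"
  by (simp add: super_delta_def dist_pullback_delta)

lemma test_super_delta:
  assumes "test_function \<phi>" shows "test_function (\<lambda>x. gcoeff (nilpart (g x) ^ j) A / fact j * \<phi> x)"
proof -
  have "test_function (\<lambda>x. \<phi> x * (gcoeff (nilpart (g x) ^ j) A * (1 / fact j)))"
    by (intro test_function_mult assms smooth_on_mult smooth_nilpart_power smooth_on_const open_UNIV)
  then show ?thesis by (simp add: mult.commute)
qed

lemma test_linear_super_delta: "test_linear (super_delta n g A)"
  unfolding test_linear_def
proof (intro conjI allI impI)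
  fix f1 f2 :: "'m point \<Rightarrow> complex" and c
  assume f1: "test_function f1"
  note t = test_super_delta
  show "super_delta n g A (\<lambda>x. f1 x + f2 x) = super_delta n g A f1 + super_delta n g A f2" if f2: "test_function f2"
    by (simp only: super_delta_Q distrib_left Q_add[OF t[OF f1] t[OF f2]] sum.distrib)
  have "gcoeff (nilpart (g x) ^ j) A / fact j * (f1 x * c) = c * (gcoeff (nilpart (g x) ^ j) A / fact j * f1 x)" for j x
    by simp
  then show "super_delta n g A (\<lambda>x. f1 x * c) = super_delta n g A f1 * c"
    by (simp only: super_delta_Q Q_cmult[OF t[OF f1]]) (simp add: sum_distrib_left mult_ac)
qed

lemma dist_support_super_delta: "dist_support (super_delta n g A) \<subseteq> {x. h x = 0}"
proof -
  have "closed {x. h x = 0}" using compact_zero_set by (rule compact_imp_closed)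
  then have o: "open (- {x. h x = 0})" by (rule open_Compl)
  have "super_delta n g A \<phi> = 0" if \<phi>: "test_function \<phi>" "closure {x. \<phi> x \<noteq> 0} \<subseteq> - {x. h x = 0}" for \<phi>
  proof -
    have "Q (Suc j) (\<lambda>x. gcoeff (nilpart (g x) ^ j) A / fact j * \<phi> x) = 0" for j
    proof (rule Q_local[OF _ test_super_delta[OF \<phi>(1)] open_Compl[OF closed_closure]])
      show "{x. h x = 0} \<subseteq> - closure {x. \<phi> x \<noteq> 0}" using \<phi>(2) by blast
      show "\<forall>x\<in>- closure {x. \<phi> x \<noteq> 0}. gcoeff (nilpart (g x) ^ j) A / fact j * \<phi> x = 0"
      proof
        fix x assume "x \<in> - closure {x. \<phi> x \<noteq> 0}"
        then show "gcoeff (nilpart (g x) ^ j) A / fact j * \<phi> x = 0"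
          using test_function_outside[of x \<phi>] by simp
      qed
    qed simp
    then show ?thesis by (simp add: super_delta_Q)
  qed
  then show ?thesis unfolding dist_support_def using o by blast
qed

text \<open>This collapses the defining triple sum over monomials: under l each summand is a scalar
  distribution applied to \<eta> times a smooth function, and linearity of \<open>Q\<close>
  reassembles the product. The sign (-1)^j comes from the derivative of delta, 1/j! from the Taylor
  expansion of delta at g.\<close>

lemma super_integral_glin:
  assumes F: "smooth_fr S F" "\<And>x. x \<in> S \<Longrightarrow> gsup {1..4*n} (F x)"
    and H: "smooth_fr S H" "\<And>x. x \<in> S \<Longrightarrow> gsup {1..4*n} (H x)"
    and S: "open S" and \<eta>: "cutoff {x. h x = 0} S \<eta>" and l: "glin l"
  shows "l (super_integral n F (super_delta n g) H)
    = (\<Sum>j=0..n. (-1) ^ j / fact j * Q (Suc j) (\<lambda>x. \<eta> x * l (berezin n (F x * bg x ^ j * H x))))"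
proof -
  define b :: "nat set \<Rightarrow> nat set \<Rightarrow> nat set \<Rightarrow> 'm sval"
    where "b A B C = berezin n (gmono A * gmono B * gmono C)" for A B C
  define w where "w A B C x = l (gconst (gcoeff (F x) A * gcoeff (H x) C) * b A B C)" for A B C x
  define \<gamma> where "\<gamma> j B x = gcoeff (nilpart (g x) ^ j) B" for j B x
  define I where "I = Pow {1..4*n} \<times> Pow {1..2*n} \<times> Pow {1..4*n}"
  have zS: "{x. h x = 0} \<subseteq> S" and t\<eta>: "test_function \<eta>" "closure {x. \<eta> x \<noteq> 0} \<subseteq> S"
    using \<eta> unfolding cutoff_def test_function_def by (auto dest: closure_subset[THEN subsetD])
      (use closure_subset in force)
  have frp: "smooth_fr S (\<lambda>x. gconst (gcoeff (F x) A) * gconst (gcoeff (H x) C))" for A C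
    using fr_tensor_repr[OF F(1), of A] fr_tensor_repr[OF H(1), of C]
    by (intro fr_mult S) (auto intro: tensor_repr_fr)
  have trp: "\<exists>N f c. tensor_repr S (\<lambda>x. gcoeff (F x) A * gcoeff (H x) C) N f c" for A C
    using fr_tensor_repr[OF frp[of A C], of "{}"] by (simp add: gcoeff_gconst)
  have cl: "cl_lin (\<lambda>c. l (gconst c * a))" for a
    using l unfolding cl_lin_def by (simp add: gconst_add gconst_mult glin_add glin_cnum distrib_right mult.assoc)
  have sw: "smooth_on S (w A B C)" for A B C
  proof -
    have "smooth_fr S (\<lambda>x. gconst (gcoeff (F x) A) * gconst (gcoeff (H x) C) * b A B C)"
      by (rule fr_clinear_map[OF frp clinear_map_right])
    from fr_glin[OF this l S] show ?thesis by (simp add: w_def[abs_def] gconst_mult)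
  qed
  have tw: "test_function (\<lambda>x. \<eta> x * w A B C x)" for A B C
    by (rule test_function_mult_local[OF t\<eta>(1) S t\<eta>(2) sw])
  have one: "l (gconst (tensor_ext (dist_pair (super_delta n g B)) (dist_support (super_delta n g B))
        (\<lambda>x. gcoeff (F x) A * gcoeff (H x) C)) * b A B C)
      = (\<Sum>j=0..n. (-1) ^ j / fact j * Q (Suc j) (\<lambda>x. \<gamma> j B x * (\<eta> x * w A B C x)))" for A B C
  proof -
    let ?T = "super_delta n g B"
    obtain N f c where r: "tensor_repr S (\<lambda>x. gcoeff (F x) A * gcoeff (H x) C) N f c" using trp by blast
    have sub: "dist_support ?T \<subseteq> {x. h x = 0}" by (rule dist_support_super_delta)
    have K: "compact (dist_support ?T)"
      using compact_Int_closed[OF compact_zero_set closed_dist_support[of ?T]] sub by (simp add: Int_absorb1)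
    have "l (gconst (tensor_ext (dist_pair ?T) (dist_support ?T) (\<lambda>x. gcoeff (F x) A * gcoeff (H x) C)) * b A B C)
        = dist_pair ?T (w A B C)"
      unfolding w_def[abs_def]
      by (rule tensor_ext_cl_lin[OF local_linear_dist_pair[OF test_linear_super_delta K] S _ r cl])
         (use sub zS in blast)
    also have "\<dots> = ?T (\<lambda>x. \<eta> x * w A B C x)"
      by (rule dist_pair_eq[OF test_linear_super_delta S sw cutoff_subset[OF \<eta> sub order_refl]])
    also have "\<dots> = (\<Sum>j=0..n. (-1) ^ j / fact j * Q (Suc j) (\<lambda>x. \<gamma> j B x * (\<eta> x * w A B C x)))"
      unfolding super_delta_Q
    proof (intro sum.cong refl)
      fix j
      have "test_function (\<lambda>x. \<eta> x * w A B C x * \<gamma> j B x)"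
        unfolding \<gamma>_def by (rule test_function_mult[OF tw smooth_nilpart_power])
      then have t: "test_function (\<lambda>x. \<gamma> j B x * (\<eta> x * w A B C x))" by (simp add: mult.commute)
      have "Q (Suc j) (\<lambda>x. gcoeff (nilpart (g x) ^ j) B / fact j * (\<eta> x * w A B C x))
          = Q (Suc j) (\<lambda>x. 1 / fact j * (\<gamma> j B x * (\<eta> x * w A B C x)))"
        by (simp add: \<gamma>_def)
      also have "\<dots> = 1 / fact j * Q (Suc j) (\<lambda>x. \<gamma> j B x * (\<eta> x * w A B C x))" by (rule Q_cmult[OF t])
      finally show "(-1) ^ j * Q (Suc j) (\<lambda>x. gcoeff (nilpart (g x) ^ j) B / fact j * (\<eta> x * w A B C x))
          = (-1) ^ j / fact j * Q (Suc j) (\<lambda>x. \<gamma> j B x * (\<eta> x * w A B C x))" by simp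
    qed
    finally show ?thesis .
  qed
  \<comment> \<open>Clifford coefficients move past Grassmann monomials, while those of F and H keep
    their order. Off S both sides vanish with \<eta>.\<close>
  have expand: "\<eta> x * l (berezin n (F x * bg x ^ j * H x)) = (\<Sum>(A, B, C)\<in>I. \<gamma> j B x * (\<eta> x * w A B C x))" for j x
  proof (cases "x \<in> S")
    case True
    have e: "F x = (\<Sum>A\<in>Pow {1..4*n}. gconst (gcoeff (F x) A) * gmono A)"
      "H x = (\<Sum>A\<in>Pow {1..4*n}. gconst (gcoeff (H x) A) * gmono A)"
      "bg x ^ j = (\<Sum>A\<in>Pow {1..2*n}. cnum (\<gamma> j A x) * gmono A)"
      using gsup_expand[OF F(2)[OF True]] gsup_expand[OF H(2)[OF True]]
        gsup_expand[OF gsup_power[OF bg_props(3)], of x j] by (simp_all add: \<gamma>_def bg_power)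
    have "F x * bg x ^ j * H x = (\<Sum>A\<in>Pow {1..4*n}. \<Sum>B\<in>Pow {1..2*n}. \<Sum>C\<in>Pow {1..4*n}.
        gconst (gcoeff (F x) A) * gmono A * (cnum (\<gamma> j B x) * gmono B) * (gconst (gcoeff (H x) C) * gmono C))"
      unfolding sum_product3[symmetric] by (simp only: e[symmetric])
    also have "\<dots> = (\<Sum>A\<in>Pow {1..4*n}. \<Sum>B\<in>Pow {1..2*n}. \<Sum>C\<in>Pow {1..4*n}.
        cnum (\<gamma> j B x) * (gconst (gcoeff (F x) A * gcoeff (H x) C) * (gmono A * gmono B * gmono C)))"
    proof (intro sum.cong refl)
      fix A B C
      let ?f = "gconst (gcoeff (F x) A)" and ?h = "gconst (gcoeff (H x) C)" and ?c = "cnum (\<gamma> j B x)"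
      have "?f * gmono A * (?c * gmono B) * (?h * gmono C) = ?c * (?f * (gmono A * (gmono B * (?h * gmono C))))"
        by (simp only: mult.assoc cnum_left[of "gmono A" "\<gamma> j B x"] cnum_left[of ?f "\<gamma> j B x"])
      also have "gmono A * (gmono B * (?h * gmono C)) = ?h * (gmono A * (gmono B * gmono C))"
        by (simp only: gmono_gconst_left)
      finally show "?f * gmono A * (?c * gmono B) * (?h * gmono C)
          = ?c * (gconst (gcoeff (F x) A * gcoeff (H x) C) * (gmono A * gmono B * gmono C))"
        by (simp only: mult.assoc gconst_mult)
    qed
    finally have "l (berezin n (F x * bg x ^ j * H x)) = (\<Sum>A\<in>Pow {1..4*n}. \<Sum>B\<in>Pow {1..2*n}. \<Sum>C\<in>Pow {1..4*n}.
        \<gamma> j B x * w A B C x)"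
      using l by (simp only: berezin_sum berezin_gconst_mult glin_sum glin_cnum w_def b_def)
    then show ?thesis
      unfolding I_def sum.cartesian_product[symmetric] by (simp add: sum_distrib_left mult_ac)
  next
    case False
    then have "\<eta> x = 0" using test_function_outside[of x \<eta>] t\<eta>(2) by blast
    then show ?thesis by (simp add: case_prod_unfold)
  qed
  have "l (super_integral n F (super_delta n g) H)
      = (\<Sum>(A, B, C)\<in>I. \<Sum>j=0..n. (-1) ^ j / fact j * Q (Suc j) (\<lambda>x. \<gamma> j B x * (\<eta> x * w A B C x)))"
    unfolding super_integral_def I_def sum.cartesian_product[symmetric]
    using l by (simp only: glin_sum one b_def[symmetric])
  also have "\<dots> = (\<Sum>j=0..n. \<Sum>(A, B, C)\<in>I. (-1) ^ j / fact j * Q (Suc j) (\<lambda>x. \<gamma> j B x * (\<eta> x * w A B C x)))"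
    unfolding case_prod_unfold by (rule sum.swap)
  also have "\<dots> = (\<Sum>j=0..n. (-1) ^ j / fact j * Q (Suc j) (\<lambda>x. \<eta> x * l (berezin n (F x * bg x ^ j * H x))))"
  proof (intro sum.cong refl)
    fix j
    have t: "test_function (\<lambda>x. \<gamma> j B x * (\<eta> x * w A B C x))" for A B C
      using test_function_mult[OF tw smooth_nilpart_power] by (simp add: \<gamma>_def mult.commute)
    show "(\<Sum>(A, B, C)\<in>I. (-1) ^ j / fact j * Q (Suc j) (\<lambda>x. \<gamma> j B x * (\<eta> x * w A B C x)))
       = (-1) ^ j / fact j * Q (Suc j) (\<lambda>x. \<eta> x * l (berezin n (F x * bg x ^ j * H x)))"
      unfolding expand case_prod_unfold by (subst Q_sum) (auto simp: t sum_distrib_left)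
  qed
  finally show ?thesis .
qed


subsection \<open>The divergence identity\<close>

definition q :: "('m sval \<Rightarrow> complex) \<Rightarrow> nat \<Rightarrow> ('m point \<Rightarrow> 'm sval) \<Rightarrow> complex" where
  "q \<mu> j P = Q j (\<lambda>x. \<mu> (P x))"

lemma q_add: "glin \<mu> \<Longrightarrow> test_fr P \<Longrightarrow> test_fr R \<Longrightarrow> q \<mu> j (\<lambda>x. P x + R x) = q \<mu> j P + q \<mu> j R"
  by (simp add: q_def glin_add Q_add test_fr_glin)

lemma q_sum: "glin \<mu> \<Longrightarrow> (\<And>i. i \<in> I \<Longrightarrow> test_fr (P i)) \<Longrightarrow> q \<mu> j (\<lambda>x. \<Sum>i\<in>I. P i x) = (\<Sum>i\<in>I. q \<mu> j (P i))"
  by (simp add: q_def glin_sum Q_sum test_fr_glin)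

lemma q_of_nat: "glin \<mu> \<Longrightarrow> test_fr P \<Longrightarrow> q \<mu> j (\<lambda>x. of_nat k * P x) = of_nat k * q \<mu> j P"
proof -
  assume a: "glin \<mu>" "test_fr P"
  have "of_nat k = (cnum (of_nat k) :: 'm sval)"
    by (induction k) (simp_all add: cl_scalar_add gconst_add)
  then show ?thesis using a by (simp add: q_def glin_cnum Q_cmult test_fr_glin)
qed

lemma q_parts:
  assumes "glin \<mu>" "test_fr P" shows "q \<mu> (Suc j) (\<lambda>x. cnum (grd i x) * P x) = q \<mu> j (pd i P)"
proof -
  have "smooth_fr UNIV P" using assms by (simp add: test_fr_def)
  from pd_glin[OF this open_UNIV UNIV_I, rule_format, OF assms(1)]
  have "(\<lambda>x. \<mu> (pd i P x)) = pderivative i (\<lambda>x. \<mu> (P x))" by (simp add: fun_eq_iff)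
  then show ?thesis using assms(1) Q_parts[OF test_fr_glin[OF assms(2,1)], of j i]
    by (simp add: q_def glin_cnum)
qed

text \<open>The part j r(j-1) of index j cancels r(j-1) of index j - 1. At j = 0 truncated
  subtraction produces r 0, but with coefficient 0.\<close>

lemma telescope:
  "(\<Sum>j=0..N. (-1) ^ j / fact j * (of_nat j * r (j - 1) + r j)) = (-1) ^ N / fact N * (r N :: complex)"
proof (induction N)
  case (Suc N)
  have "(-1) ^ Suc N / fact (Suc N) * (of_nat (Suc N) * r N) = - ((-1) ^ N / fact N * r N)"
    by (simp add: field_simps del: of_nat_Suc) 
  then show ?case using Suc by (simp add: distrib_left)
qed simp

context
  fixes F G :: "'m point \<Rightarrow> 'm sval" and l :: "'m sval \<Rightarrow> complex" and c :: "'m cliff"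
  assumes F: "test_fr F" and G: "smooth_fr UNIV G" and l: "glin l"
begin

lemma glin_mu: "glin (\<lambda>a. l (berezin n a))"
  using l by (rule glin_berezin)

lemma fr_G_bg: "smooth_fr UNIV (\<lambda>x. bg x ^ j * R x)" if "smooth_fr UNIV R"
  by (intro fr_mult fr_power fr_bg that open_UNIV)

text \<open>With P_j = F bg^j c G and R_j = F bg^j (d bg) c G, the product rule gives d P_j = A_j +
  j R_(j-1), where A_j is the term on the right. The body of the gradient yields q_j(d P_j) by
  parts, its nilpotent part adds q_(j+1)(R_j). So the R terms telescope to the one with j = n, which
  vanishes because bg^(n+1) = 0.\<close>

lemma stokes_even:
  "(\<Sum>j=0..n. (-1) ^ j / fact j * q (\<lambda>a. l (berezin n a)) (Suc j)
      (\<lambda>x. F x * bg x ^ j * (gconst c * (cnum (grd i x) + pd i bg x) * G x)))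
   = (\<Sum>j=0..n. (-1) ^ j / fact j * q (\<lambda>a. l (berezin n a)) j
      (\<lambda>x. pd i F x * gconst c * (bg x ^ j * G x) + F x * bg x ^ j * (gconst c * pd i G x)))"
proof -
  let ?\<mu> = "\<lambda>a. l (berezin n a)"
  define P where "P j x = F x * (bg x ^ j * (gconst c * G x))" for j x
  define R where "R j x = F x * (bg x ^ j * pd i bg x * (gconst c * G x))" for j x
  define A where "A j x = pd i F x * gconst c * (bg x ^ j * G x) + F x * bg x ^ j * (gconst c * pd i G x)" for j x
  have Ff: "smooth_fr UNIV F" using F by (simp add: test_fr_def)
  have Gc: "smooth_fr UNIV (\<lambda>x. gconst c * G x)" by (rule fr_clinear_map[OF G clinear_map_left])
  have bgd: "smooth_fr UNIV (pd i bg)" by (intro fr_pd fr_bg open_UNIV)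
  have comm: "gconst c * pd i bg x = pd i bg x * gconst c" for x
  proof -
    have "(\<lambda>x. gconst c * bg x) = (\<lambda>x. bg x * gconst c)" using centralD[OF bg_props(1)] by (simp add: fun_eq_iff)
    then show ?thesis
      using pd_clinear_map[OF fr_bg open_UNIV UNIV_I clinear_map_left, of i "gconst c" x]
        pd_clinear_map[OF fr_bg open_UNIV UNIV_I clinear_map_right, of i "gconst c" x] by simp
  qed
  have tP: "test_fr (P j)" for j unfolding P_def[abs_def]
    by (intro test_fr_mult_right F fr_mult fr_power fr_bg Gc open_UNIV)
  have tR: "test_fr (R j)" for j unfolding R_def[abs_def]
    by (intro test_fr_mult_right F fr_mult fr_power fr_bg Gc bgd open_UNIV)
  have tA: "test_fr (A j)" for j unfolding A_def[abs_def]
    by (intro test_fr_add test_fr_mult_right F test_fr_pd fr_mult fr_power fr_bg fr_const G fr_pd open_UNIV)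
  have "pd i (P j) x = A j x + of_nat j * R (j - 1) x" for j x
  proof -
    have "pd i (P j) x = pd i F x * (bg x ^ j * (gconst c * G x))
        + F x * (pd i (\<lambda>x. bg x ^ j) x * (gconst c * G x) + bg x ^ j * (gconst c * pd i G x))"
      unfolding P_def[abs_def]
      by (subst pd_mult[OF Ff fr_G_bg[OF Gc] open_UNIV UNIV_I],
          subst pd_mult[OF fr_power[OF fr_bg open_UNIV] Gc open_UNIV UNIV_I],
          subst pd_clinear_map[OF G open_UNIV UNIV_I clinear_map_left]) (rule refl)
    moreover have "F x * (pd i (\<lambda>x. bg x ^ j) x * (gconst c * G x)) = of_nat j * R (j - 1) x"
    proof (cases j)
      case (Suc k)
      have "pd i (\<lambda>x. bg x ^ j) x = of_nat j * bg x ^ k * pd i bg x"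
        unfolding Suc by (rule pd_power[OF fr_bg open_UNIV UNIV_I bg_props(1)])
      then show ?thesis unfolding R_def Suc diff_Suc_1
        by (simp only: mult.assoc of_nat_left[of "F x"])
    qed simp
    moreover have "bg x ^ j * (gconst c * G x) = gconst c * (bg x ^ j * G x)"
      by (rule central_left[OF central_power[OF bg_props(1)], symmetric])
    ultimately show ?thesis unfolding A_def by (simp only: distrib_left mult.assoc) (simp add: add_ac)
  qed
  then have pdP: "pd i (P j) = (\<lambda>x. A j x + of_nat j * R (j - 1) x)" for j by (simp add: fun_eq_iff)
  have "q ?\<mu> (Suc j) (\<lambda>x. F x * bg x ^ j * (gconst c * (cnum (grd i x) + pd i bg x) * G x))
      = q ?\<mu> j (A j) + (of_nat j * q ?\<mu> (Suc (j - 1)) (R (j - 1)) + q ?\<mu> (Suc j) (R j))" for j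
  proof -
    have e: "F x * bg x ^ j * (gconst c * (cnum (grd i x) + pd i bg x) * G x) = cnum (grd i x) * P j x + R j x" for x
    proof -
      have "F x * bg x ^ j * (gconst c * (cnum (grd i x) + pd i bg x) * G x)
        = F x * (bg x ^ j * (gconst c * (cnum (grd i x) * G x))) + F x * (bg x ^ j * (gconst c * pd i bg x * G x))"
        by (simp only: distrib_left distrib_right mult.assoc)
      moreover have "F x * (bg x ^ j * (gconst c * (cnum (grd i x) * G x))) = cnum (grd i x) * P j x"
        unfolding P_def
        by (simp only: cnum_left[of "gconst c" "grd i x"] cnum_left[of "bg x ^ j" "grd i x"] cnum_left[of "F x" "grd i x"])
      moreover have "F x * (bg x ^ j * (gconst c * pd i bg x * G x)) = R j x"
        unfolding R_def comm by (simp only: mult.assoc)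
      ultimately show ?thesis by simp
    qed
    have t1: "test_fr (\<lambda>x. cnum (grd i x) * P j x)"
    proof -
      have "test_fr (\<lambda>x. P j x * cnum (grd i x))" by (intro test_fr_mult_right tP fr_cnum smooth_grd)
      then show ?thesis by (simp only: cnum_commute)
    qed
    \<comment> \<open>The form \<open>telescope\<close> expects; for j = 0 both sides are 0,
      otherwise Suc (j - 1) = j.\<close>
    have "of_nat j * q ?\<mu> j (R (j - 1)) = of_nat j * q ?\<mu> (Suc (j - 1)) (R (j - 1))"
      by (cases j) auto
    then show ?thesis unfolding e
      using q_add[OF glin_mu t1 tR, of "Suc j"] q_parts[OF glin_mu tP, of j i] 
        q_add[OF glin_mu tA test_fr_clinear_map[OF tR clinear_map_left], of j j "of_nat j" "j - 1"]
        q_of_nat[OF glin_mu tR, of j j "j - 1"]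
      by (simp add: pdP)
  qed
  then have "(\<Sum>j=0..n. (-1) ^ j / fact j * q ?\<mu> (Suc j)
      (\<lambda>x. F x * bg x ^ j * (gconst c * (cnum (grd i x) + pd i bg x) * G x)))
    = (\<Sum>j=0..n. (-1) ^ j / fact j * q ?\<mu> j (A j))
      + (\<Sum>j=0..n. (-1) ^ j / fact j * (of_nat j * q ?\<mu> (Suc (j - 1)) (R (j - 1)) + q ?\<mu> (Suc j) (R j)))"
    by (simp only: distrib_left sum.distrib)
  also have "(\<Sum>j=0..n. (-1) ^ j / fact j * (of_nat j * q ?\<mu> (Suc (j - 1)) (R (j - 1)) + q ?\<mu> (Suc j) (R j))) = 0"
  proof -
    \<comment> \<open>The derivative of bg^(n+1) = 0. The factor n + 1 is cancelled later, among
      complex numbers.\<close>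
    have "of_nat (Suc n) * (bg x ^ n * pd i bg x) = 0" for x
    proof -
      have "pd i (\<lambda>x. bg x ^ Suc n) x = 0" unfolding bg_nilpotent by simp
      then show ?thesis
        using pd_power[OF fr_bg open_UNIV UNIV_I bg_props(1), of i n x] by (simp only: mult.assoc)
    qed
    then have z0: "F x * (of_nat (Suc n) * (bg x ^ n * pd i bg x) * (gconst c * G x)) = 0" for x
      by (simp only: mult_zero_left mult_zero_right)
    have "of_nat (Suc n) * R n x = 0" for x
      using z0[of x] unfolding R_def by (simp only: mult.assoc of_nat_left[of "F x"])
    then have "of_nat (Suc n) * q ?\<mu> (Suc n) (R n) = 0"
      using q_of_nat[OF glin_mu tR, of "Suc n" "Suc n" n] glin_zero[OF glin_mu] Q_cmult[of "\<lambda>_. 0" "Suc n" 0]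
      by (simp add: q_def)
    then have "q ?\<mu> (Suc n) (R n) = 0" by (simp del: of_nat_Suc)
    then show ?thesis using telescope[of "\<lambda>j. q ?\<mu> (Suc j) (R j)" n] by simp
  qed
  finally show ?thesis by (simp add: A_def[abs_def])
qed

text \<open>The order of differentiation in the level does not drop here:
  \<open>berezin_gderiv\<close> annihilates the total odd derivative pointwise, so j q_j(R_(j-1)) =
  - q_j(A_j), and the same telescoping sum of R terms vanishes.\<close>

lemma stokes_odd:
  assumes k: "k \<in> {1..2*n}"
  shows "(\<Sum>j=0..n. (-1) ^ j / fact j * q (\<lambda>a. l (berezin n a)) (Suc j)
      (\<lambda>x. F x * bg x ^ j * (gconst c * gderiv k (bg x) * G x)))
   = (\<Sum>j=0..n. (-1) ^ j / fact j * q (\<lambda>a. l (berezin n a)) j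
      (\<lambda>x. gderiv k (gpar (F x)) * gconst c * (bg x ^ j * G x) + F x * bg x ^ j * (gconst c * gderiv k (G x))))"
proof -
  let ?\<mu> = "\<lambda>a. l (berezin n a)"
  define R where "R j x = F x * (bg x ^ j * gderiv k (bg x) * (gconst c * G x))" for j x
  define A where "A j x = gderiv k (gpar (F x)) * gconst c * (bg x ^ j * G x) + F x * bg x ^ j * (gconst c * gderiv k (G x))" for j x
  have Gc: "smooth_fr UNIV (\<lambda>x. gconst c * G x)" by (rule fr_clinear_map[OF G clinear_map_left])
  have bgd: "smooth_fr UNIV (\<lambda>x. gderiv k (bg x))" by (intro fr_clinear_map[OF fr_bg] clinear_map_gderiv)
  have comm: "gconst c * gderiv k (bg x) = gderiv k (bg x) * gconst c" for x
    unfolding bg_def gcomplex_gderiv by (rule gconst_gcomplex_commute)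
  have comm_left: "gconst c * (gderiv k (bg x) * a) = gderiv k (bg x) * (gconst c * a)" for x a
    by (simp only: mult.assoc[symmetric] comm)
  have tR: "test_fr (R j)" for j unfolding R_def[abs_def]
    by (intro test_fr_mult_right F fr_mult fr_power fr_bg Gc bgd open_UNIV)
  have tA: "test_fr (A j)" for j unfolding A_def[abs_def]
    by (intro test_fr_add test_fr_mult_right F test_fr_clinear_map[OF _ clinear_map_gderiv]
         test_fr_clinear_map[OF _ clinear_map_gpar] fr_mult fr_power fr_bg fr_const G
         fr_clinear_map[OF G clinear_map_gderiv] open_UNIV)
  have z: "?\<mu> (A j x + of_nat j * R (j - 1) x) = 0" for j x
  proof -
    \<comment> \<open>Starting from \<open>gpar (F x)\<close>, the second Leibniz term carries
      parity twice, that is, F x itself.\<close>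
    have "gderiv k (gpar (F x) * (gconst c * (bg x ^ j * G x)))
        = gderiv k (gpar (F x)) * (gconst c * (bg x ^ j * G x))
          + F x * (gconst c * (gderiv k (bg x ^ j) * G x + bg x ^ j * gderiv k (G x)))"
    proof -
      have "gpar (bg x ^ j) = bg x ^ j"
        by (induction j) (simp_all add: gpar_mult bg_props(2) gpar_gconst[of 1, simplified])
      then show ?thesis by (simp add: gderiv_mult gderiv_gconst_mult)
    qed
    moreover have "F x * (gconst c * (gderiv k (bg x ^ j) * G x)) = of_nat j * R (j - 1) x"
    proof (cases j)
      case (Suc m)
      have "gderiv k (bg x ^ j) = of_nat j * bg x ^ m * gderiv k (bg x)"
        unfolding Suc by (rule gderiv_power[OF bg_props(1,2)])
      moreover have "gconst c * (of_nat j * bg x ^ m * gderiv k (bg x) * G x)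
          = of_nat j * (bg x ^ m * gderiv k (bg x) * (gconst c * G x))"
        by (simp only: mult.assoc of_nat_left[of "gconst c"] comm_left
            central_left[OF central_power[OF bg_props(1)], of "gconst c"])
      ultimately show ?thesis unfolding R_def Suc diff_Suc_1
        by (simp only: mult.assoc of_nat_left[of "F x"])
    qed (simp add: gderiv_gconst[of _ 1, simplified])
    moreover have "gconst c * (bg x ^ j * gderiv k (G x)) = bg x ^ j * (gconst c * gderiv k (G x))"
      by (rule central_left[OF central_power[OF bg_props(1)]])
    ultimately have "gderiv k (gpar (F x) * (gconst c * (bg x ^ j * G x))) = A j x + of_nat j * R (j - 1) x"
      unfolding A_def by (simp only: distrib_left mult.assoc) (simp add: add_ac)
    then show ?thesis using berezin_gderiv[OF k, of "gpar (F x) * (gconst c * (bg x ^ j * G x))"]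
      by (simp add: glin_zero[OF l])
  qed
  have eq: "of_nat j * q ?\<mu> (Suc (j - 1)) (R (j - 1)) = - q ?\<mu> j (A j)" for j
  proof -
    have "q ?\<mu> j (\<lambda>x. A j x + of_nat j * R (j - 1) x) = 0"
      unfolding q_def z using Q_cmult[of "\<lambda>_. 0" j 0] by simp
    then have "of_nat j * q ?\<mu> j (R (j - 1)) = - q ?\<mu> j (A j)"
      using q_add[OF glin_mu tA test_fr_clinear_map[OF tR clinear_map_left], of j j "of_nat j" "j - 1"]
        q_of_nat[OF glin_mu tR, of j j "j - 1"] by (simp add: add_eq_0_iff)
    then show ?thesis by (cases j) auto
  qed
  have e: "F x * bg x ^ j * (gconst c * gderiv k (bg x) * G x) = R j x" for j x
    unfolding R_def comm by (simp only: mult.assoc)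
  have "(\<Sum>j=0..n. (-1) ^ j / fact j * (of_nat j * q ?\<mu> (Suc (j - 1)) (R (j - 1)) + q ?\<mu> (Suc j) (R j))) = 0"
  proof -
    have "gderiv k (bg x ^ Suc n) = 0" for x by (simp only: bg_nilpotent gderiv_zero)
    then have "of_nat (Suc n) * (bg x ^ n * gderiv k (bg x)) = 0" for x
      using gderiv_power[OF bg_props(1,2), of k x n] by (simp only: mult.assoc)
    then have z0: "F x * (of_nat (Suc n) * (bg x ^ n * gderiv k (bg x)) * (gconst c * G x)) = 0" for x
      by (simp only: mult_zero_left mult_zero_right)
    have "of_nat (Suc n) * R n x = 0" for x
      using z0[of x] unfolding R_def by (simp only: mult.assoc of_nat_left[of "F x"])
    then have "of_nat (Suc n) * q ?\<mu> (Suc n) (R n) = 0"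
      using q_of_nat[OF glin_mu tR, of "Suc n" "Suc n" n] glin_zero[OF glin_mu] Q_cmult[of "\<lambda>_. 0" "Suc n" 0]
      by (simp add: q_def)
    then have "q ?\<mu> (Suc n) (R n) = 0" by (simp del: of_nat_Suc)
    then show ?thesis using telescope[of "\<lambda>j. q ?\<mu> (Suc j) (R j)" n] by simp
  qed
  then have "(\<Sum>j=0..n. (-1) ^ j / fact j * (- q ?\<mu> j (A j) + q ?\<mu> (Suc j) (R j))) = 0"
    unfolding eq .
  then have "(\<Sum>j=0..n. (-1) ^ j / fact j * q ?\<mu> (Suc j) (R j)) = (\<Sum>j=0..n. (-1) ^ j / fact j * q ?\<mu> j (A j))"
    by (simp only: distrib_left sum.distrib mult_minus_right sum_negf add_eq_0_iff minus_minus)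
  then show ?thesis unfolding e by (simp only: A_def[abs_def] R_def[abs_def])
qed

end

text \<open>In the operator acting from the right, the parity automorphism produces the signs of the graded
  Leibniz rule.\<close>

end

definition dirac_left where
  "dirac_left n e f G x = (\<Sum>i\<in>UNIV. gconst (e i) * pd i G x) + (\<Sum>k=1..2*n. gconst (f k) * gderiv k (G x))"

definition dirac_right where
  "dirac_right n e f F x = (\<Sum>i\<in>UNIV. pd i F x * gconst (e i)) + (\<Sum>k=1..2*n. gderiv k (gpar (F x)) * gconst (f k))"

context phase
begin

lemma dirac_left_g:
  "dirac_left n e f (\<lambda>x. gcomplex (g x)) x
    = (\<Sum>i\<in>UNIV. gconst (e i) * (cnum (grd i x) + pd i bg x)) + (\<Sum>k=1..2*n. gconst (f k) * gderiv k (bg x))"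
  by (simp add: dirac_left_def pd_g gderiv_g)

text \<open>The even and odd identities summed over all coordinates. The right side is the Taylor
  expansion of the Heaviside function at -g: j = 0 is the integral over h \<le> 0 and each j \<ge> 1
  a boundary term.\<close>

theorem stokes:
  assumes F: "test_fr F" and G: "smooth_fr UNIV G" and l: "glin l"
  shows "(\<Sum>j=0..n. (-1) ^ j / fact j * Q (Suc j)
      (\<lambda>x. l (berezin n (F x * bg x ^ j * (dirac_left n e f (\<lambda>x. gcomplex (g x)) x * G x)))))
   = (\<Sum>j=0..n. (-1) ^ j / fact j * Q j
      (\<lambda>x. l (berezin n (dirac_right n e f F x * (bg x ^ j * G x) + F x * bg x ^ j * dirac_left n e f G x))))"
proof -
  let ?\<mu> = "\<lambda>a. l (berezin n a)"
  note mu = glin_berezin[OF l, of n]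
  define L1 where "L1 i j x = F x * bg x ^ j * (gconst (e i) * (cnum (grd i x) + pd i bg x) * G x)" for i j x
  define L2 where "L2 k j x = F x * bg x ^ j * (gconst (f k) * gderiv k (bg x) * G x)" for k j x
  define R1 where "R1 i j x = pd i F x * gconst (e i) * (bg x ^ j * G x) + F x * bg x ^ j * (gconst (e i) * pd i G x)" for i j x
  define R2 where "R2 k j x = gderiv k (gpar (F x)) * gconst (f k) * (bg x ^ j * G x) + F x * bg x ^ j * (gconst (f k) * gderiv k (G x))" for k j x
  have L: "F x * bg x ^ j * (dirac_left n e f (\<lambda>x. gcomplex (g x)) x * G x)
      = (\<Sum>i\<in>UNIV. L1 i j x) + (\<Sum>k=1..2*n. L2 k j x)" for j x
    unfolding dirac_left_g L1_def L2_def by (simp only: distrib_left distrib_right sum_distrib_left sum_distrib_right)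
  have R: "dirac_right n e f F x * (bg x ^ j * G x) + F x * bg x ^ j * dirac_left n e f G x
      = (\<Sum>i\<in>UNIV. R1 i j x) + (\<Sum>k=1..2*n. R2 k j x)" for j x
    unfolding dirac_left_def dirac_right_def R1_def R2_def sum.distrib
    by (simp only: distrib_left distrib_right sum_distrib_left sum_distrib_right) (simp only: add_ac)
  have fG: "smooth_fr UNIV (\<lambda>x. gconst a * gderiv k (G x))" for a k
    by (intro fr_clinear_map[OF _ clinear_map_left] fr_clinear_map[OF _ clinear_map_gderiv] G)
  note frs = fr_mult fr_power fr_bg fr_const G fr_pd smooth_fr.add fr_cnum smooth_grd open_UNIV
    fr_clinear_map[OF _ clinear_map_gderiv]
  have t: "test_fr (L1 i j)" "test_fr (L2 k j)" "test_fr (R1 i j)" "test_fr (R2 k j)" for i j k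
    unfolding L1_def[abs_def] L2_def[abs_def] R1_def[abs_def] R2_def[abs_def]
    by (intro test_fr_add test_fr_mult_right F test_fr_pd test_fr_clinear_map[OF _ clinear_map_gderiv]
         test_fr_clinear_map[OF _ clinear_map_gpar] frs)+
  have q2: "q ?\<mu> j (\<lambda>x. (\<Sum>i\<in>UNIV. A i x) + (\<Sum>k=1..2*n. B k x)) = (\<Sum>i\<in>UNIV. q ?\<mu> j (A i)) + (\<Sum>k=1..2*n. q ?\<mu> j (B k))"
    if "\<And>i. test_fr (A i)" "\<And>k. test_fr (B k)" for A B j
    using that by (simp add: q_add[OF mu] q_sum[OF mu] test_fr_sum)
  have s1: "(\<Sum>j=0..n. (-1) ^ j / fact j * q ?\<mu> (Suc j) (L1 i j)) = (\<Sum>j=0..n. (-1) ^ j / fact j * q ?\<mu> j (R1 i j))" for i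
    using stokes_even[OF F G l, of "e i" i] by (simp add: L1_def[abs_def] R1_def[abs_def])
  have s2: "(\<Sum>j=0..n. (-1) ^ j / fact j * q ?\<mu> (Suc j) (L2 k j)) = (\<Sum>j=0..n. (-1) ^ j / fact j * q ?\<mu> j (R2 k j))"
    if "k \<in> {1..2*n}" for k
    using stokes_odd[OF F G l that, of "f k"] by (simp add: L2_def[abs_def] R2_def[abs_def])
  have sw: "(\<Sum>j=0..n. c j * ((\<Sum>i\<in>UNIV. A i j) + (\<Sum>k=1..2*n. B k j)))
      = (\<Sum>i\<in>(UNIV :: ('m + 'm) set). \<Sum>j=0..n. c j * A i j) + (\<Sum>k=1..2*n. \<Sum>j=0..n. c j * B k j)"
    for c :: "nat \<Rightarrow> complex" and A B
    by (simp add: distrib_left sum.distrib sum_distrib_left sum.swap[of _ "{0..n}"])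
  have a2: "(\<Sum>k=1..2*n. \<Sum>j=0..n. (-1) ^ j / fact j * q ?\<mu> (Suc j) (L2 k j))
      = (\<Sum>k=1..2*n. \<Sum>j=0..n. (-1) ^ j / fact j * q ?\<mu> j (R2 k j))"
    by (rule sum.cong[OF refl s2])
  show ?thesis
    unfolding L R q_def[where \<mu> = ?\<mu>, symmetric] q2[OF t(1,2)] q2[OF t(3,4)] sw s1 a2 ..
qed

end

section \<open>The Clifford vectors of the combined Dirac operators\<close>

text \<open>A circulant matrix is diagonalised by the combinations \<open>a + s b\<close> with \<open>s = 1\<close> and \<open>s = -1\<close>;
  \<open>ee s i\<close> and \<open>os s k\<close> are the coefficients of \<open>x\<^sub>i\<close> and \<open>x`\<^sub>k\<close> in \<open>Z + s Z\<^sup>\<dagger>\<close>, and \<open>de s i\<close> and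
  \<open>df s k\<close> those of the partial derivatives in the corresponding Dirac operator.\<close>

definition ee :: "complex \<Rightarrow> 'm + 'm \<Rightarrow> 'm::finite cliff" where
  "ee s i = (if s = 1 then (case i of Inl j \<Rightarrow> cl_scalar (-\<i>) * cl_e (Inr j) | Inr j \<Rightarrow> cl_scalar \<i> * cl_e (Inl j))
     else cl_e i)"

definition os :: "complex \<Rightarrow> nat \<Rightarrow> 'm::finite cliff" where
  "os s k = (if s = 1 then (if odd k then cl_scalar (-\<i>) * cl_s (Suc k) else cl_scalar \<i> * cl_s (k - 1))
     else cl_s k)"

definition de :: "complex \<Rightarrow> 'm + 'm \<Rightarrow> 'm::finite cliff" where
  "de s i = cl_scalar (s / 2) * ee s i"

definition df :: "complex \<Rightarrow> nat \<Rightarrow> 'm::finite cliff" where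
  "df s k = (if odd k then cl_scalar (- s) * os s (Suc k) else cl_scalar s * os s (k - 1))"

lemma cl_scalar_left: "a * (cl_scalar c * b) = cl_scalar c * (a * b)"
  by (simp only: mult.assoc[symmetric] cl_scalar_commute[of c a])

lemma cl_scalar_mult4: "cl_scalar c * a * (cl_scalar d * b) = cl_scalar (c * d) * (a * b)"
  by (simp only: mult.assoc cl_scalar_left[of a d] cl_scalar_mult)

text \<open>For s = 1 each generator is replaced by its partner times i or -i, which turns the
  square -1 into 1; for s = -1 nothing changes. So the square is s in both cases.\<close>

lemma ee_relation:
  fixes i j :: "'m::finite + 'm"
  assumes "s = 1 \<or> s = -1"
  shows "ee s i * ee s j + ee s j * ee s i = cl_scalar (if i = j then 2 * s else 0)"
proof (cases "s = 1")
  case True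
  define c where "c i = (case i of Inl _ \<Rightarrow> -\<i> | Inr _ \<Rightarrow> \<i>)" for i :: "'m + 'm"
  define \<sigma> where "\<sigma> i = (case i of Inl j \<Rightarrow> Inr j | Inr j \<Rightarrow> Inl j)" for i :: "'m + 'm"
  have e: "ee s i = cl_scalar (c i) * cl_e (\<sigma> i)" for i
    using True by (simp add: ee_def c_def \<sigma>_def split: sum.split)
  have \<sigma>: "\<sigma> i = \<sigma> j \<longleftrightarrow> i = j" by (auto simp: \<sigma>_def split: sum.splits)
  have "ee s i * ee s j + ee s j * ee s i
      = cl_scalar (c i * c j) * (cl_e (\<sigma> i) * cl_e (\<sigma> j) + cl_e (\<sigma> j) * cl_e (\<sigma> i))"
    unfolding e cl_scalar_mult4 by (simp add: mult.commute distrib_left)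
  also have "\<dots> = cl_scalar (if i = j then 2 * s else 0)"
    unfolding cl_relations using True
    by (auto simp: \<sigma> c_def cl_scalar_mult[symmetric] split: sum.split)
  finally show ?thesis .
next
  case False
  then have "s = -1" using assms by simp
  then show ?thesis by (simp add: ee_def cl_relations)
qed

lemma ee_os_relation: "ee s i * os s k + os s k * ee s i = 0"
proof -
  have r: "cl_scalar a * cl_e i * (cl_scalar b * cl_s k) + cl_scalar b * cl_s k * (cl_scalar a * cl_e i) = 0"
    for a b i k
    unfolding cl_scalar_mult4 mult.commute[of b a] distrib_left[symmetric] cl_relations by simp
  show ?thesis
    using r[of 1 _ 1] r by (auto simp: ee_def os_def cl_relations split: sum.split)
qed

text \<open>For s = 1 the swap within a pair reverses the symplectic form, while the two factors -i
  and i of the pair multiply to 1. Indices start at 1, so that 2a + 1 and 2a + 2 are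
  partners.\<close>

lemma os_relation:
  assumes "s = 1 \<or> s = -1" "k \<ge> 1" "j \<ge> 1"
  shows "os s k * os s j - os s j * os s k = cl_scalar (- s * symp_form k j)"
proof (cases "s = 1")
  case True
  define c where "c k = (if odd k then -\<i> else \<i>)" for k :: nat
  define \<tau> where "\<tau> k = (if odd k then Suc k else k - 1)" for k :: nat
  have e: "os s k = cl_scalar (c k) * cl_s (\<tau> k)" for k
    using True by (simp add: os_def c_def \<tau>_def)
  have "os s k * os s j - os s j * os s k
      = cl_scalar (c k * c j) * (cl_s (\<tau> k) * cl_s (\<tau> j) - cl_s (\<tau> j) * cl_s (\<tau> k))"
    unfolding e cl_scalar_mult4 by (simp add: mult.commute right_diff_distrib)
  also have "\<dots> = cl_scalar (c k * c j * symp_form (\<tau> k) (\<tau> j))"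
    unfolding cl_relations by (simp add: cl_scalar_mult)
  also have "c k * c j * symp_form (\<tau> k) (\<tau> j) = - s * symp_form k j"
  proof -
    have "\<exists>a. k = 2 * a + 1 \<or> k = 2 * a + 2" "\<exists>b. j = 2 * b + 1 \<or> j = 2 * b + 2"
      using assms(2,3) by presburger+
    then obtain a b where a: "k = 2 * a + 1 \<or> k = 2 * a + 2" and b: "j = 2 * b + 1 \<or> j = 2 * b + 2" by blast
    show ?thesis using a b True
      by (elim disjE) (simp_all add: c_def \<tau>_def symp_form_def double_not_eq_Suc_double Suc_double_not_eq_double)
  qed
  finally show ?thesis .
next
  case False
  then have "s = -1" using assms by simp
  then show ?thesis by (simp add: os_def cl_relations)
qed

text \<open>With z = x + i x' one has z f + s z^c f^dagger = x (f + s f^dagger) + i x' (f - s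
  f^dagger); \<open>fs_combine\<close> is the odd analogue.\<close>

lemma ff_combine:
  assumes "s = 1 \<or> s = -1"
  shows "ff j + cl_scalar s * ff_dag j = ee s (Inl j)"
    "cl_scalar \<i> * (ff j - cl_scalar s * ff_dag j) = ee s (Inr j)"
proof -
  have *: "cl_scalar a * (cl_e (Inl j) - cl_scalar \<i> * cl_e (Inr j)) + cl_scalar b * (cl_e (Inl j) + cl_scalar \<i> * cl_e (Inr j))
     = cl_scalar (a + b) * cl_e (Inl j) + cl_scalar (\<i> * (b - a)) * cl_e (Inr j)" for a b
    by (simp only: right_diff_distrib distrib_left cl_scalar_add cl_scalar_diff cl_scalar_mult mult.assoc[symmetric]
        cl_scalar_commute[of \<i> "cl_scalar a"] cl_scalar_commute[of \<i> "cl_scalar b"] distrib_right left_diff_distrib)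
      (simp add: algebra_simps)
  show "ff j + cl_scalar s * ff_dag j = ee s (Inl j)"
    using *[of "1/2" "s * (-1/2)"] assms
    by (auto simp: ff_def ff_dag_def ee_def mult.assoc[symmetric] cl_scalar_mult[symmetric])
  have "cl_scalar \<i> * (ff j - cl_scalar s * ff_dag j)
      = cl_scalar (\<i> * (1/2)) * (cl_e (Inl j) - cl_scalar \<i> * cl_e (Inr j))
        + cl_scalar (\<i> * s * (1/2)) * (cl_e (Inl j) + cl_scalar \<i> * cl_e (Inr j))"
    unfolding ff_def ff_dag_def right_diff_distrib mult.assoc[symmetric] cl_scalar_mult[symmetric]
    by (simp add: cl_scalar_uminus)
  then show "cl_scalar \<i> * (ff j - cl_scalar s * ff_dag j) = ee s (Inr j)"
    unfolding * using assms by (auto simp: ee_def algebra_simps)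
qed

lemma fs_combine:
  assumes "s = 1 \<or> s = -1" "j \<ge> 1"
  shows "fs j + cl_scalar s * fs_dag j = os s (2*j-1)"
    "cl_scalar \<i> * (fs j - cl_scalar s * fs_dag j) = os s (2*j)"
proof -
  have *: "cl_scalar a * (cl_s (2*j-1) - cl_scalar \<i> * cl_s (2*j)) + cl_scalar b * (cl_s (2*j-1) + cl_scalar \<i> * cl_s (2*j))
     = cl_scalar (a + b) * cl_s (2*j-1) + cl_scalar (\<i> * (b - a)) * cl_s (2*j)" for a b
    by (simp only: right_diff_distrib distrib_left cl_scalar_add cl_scalar_diff cl_scalar_mult mult.assoc[symmetric]
        cl_scalar_commute[of \<i> "cl_scalar a"] cl_scalar_commute[of \<i> "cl_scalar b"] distrib_right left_diff_distrib)
      (simp add: algebra_simps)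
  have odd: "odd (2 * j - 1)" "Suc (2 * j - 1) = 2 * j" using assms(2) by auto
  show "fs j + cl_scalar s * fs_dag j = os s (2*j-1)"
    using *[of "1/2" "s * (-1/2)"] assms odd
    by (auto simp: fs_def fs_dag_def os_def mult.assoc[symmetric] cl_scalar_mult[symmetric])
  have "cl_scalar \<i> * (fs j - cl_scalar s * fs_dag j)
      = cl_scalar (\<i> * (1/2)) * (cl_s (2*j-1) - cl_scalar \<i> * cl_s (2*j))
        + cl_scalar (\<i> * s * (1/2)) * (cl_s (2*j-1) + cl_scalar \<i> * cl_s (2*j))"
    unfolding fs_def fs_dag_def right_diff_distrib mult.assoc[symmetric] cl_scalar_mult[symmetric]
    by (simp add: cl_scalar_uminus)
  then show "cl_scalar \<i> * (fs j - cl_scalar s * fs_dag j) = os s (2*j)"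
    unfolding * using assms by (auto simp: os_def algebra_simps)
qed

text \<open>1/2 and -i/2 are the coefficients of the Wirtinger derivative; extracting s, by s^2 = 1,
  leaves the expressions of \<open>ff_combine\<close>.\<close>

lemma de_combine:
  assumes "s = 1 \<or> s = -1"
  shows "cl_scalar (1/2) * (ff_dag j + cl_scalar s * ff j) = de s (Inl j)"
    "cl_scalar (- \<i> / 2) * (ff_dag j - cl_scalar s * ff j) = de s (Inr j)"
proof -
  have ss: "s * s = 1" using assms by auto
  have "ff_dag j + cl_scalar s * ff j = cl_scalar s * (ff j + cl_scalar s * ff_dag j)"
    by (simp add: distrib_left mult.assoc[symmetric] cl_scalar_mult[symmetric] ss add.commute)
  then show "cl_scalar (1/2) * (ff_dag j + cl_scalar s * ff j) = de s (Inl j)"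
    unfolding de_def ff_combine(1)[OF assms, symmetric] by (simp add: mult.assoc[symmetric] cl_scalar_mult[symmetric])
  have "ff_dag j - cl_scalar s * ff j = - (cl_scalar s * (ff j - cl_scalar s * ff_dag j))"
    by (simp add: right_diff_distrib mult.assoc[symmetric] cl_scalar_mult[symmetric] ss)
  then show "cl_scalar (- \<i> / 2) * (ff_dag j - cl_scalar s * ff j) = de s (Inr j)"
    unfolding de_def ff_combine(2)[OF assms, symmetric]
    by (simp add: mult.assoc[symmetric] cl_scalar_mult[symmetric] cl_scalar_uminus mult.commute)
qed

text \<open>The prefactor 2i of the odd part times 1/2 gives i at the odd index and i (-i) = 1 at
  the even one. Hence the coefficient of a derivative belongs to the partner coordinate, as in
  \<open>df\<close>.\<close>

lemma df_combine:
  assumes "s = 1 \<or> s = -1" "j \<ge> 1"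
  shows "cl_scalar \<i> * (fs_dag j - cl_scalar s * fs j) = df s (2*j-1)"
    "fs_dag j + cl_scalar s * fs j = df s (2*j)"
proof -
  have ss: "s * s = 1" using assms by auto
  have odd: "odd (2 * j - 1)" "Suc (2 * j - 1) = 2 * j" using assms(2) by auto
  have e: "fs_dag j - cl_scalar s * fs j = - (cl_scalar s * (fs j - cl_scalar s * fs_dag j))"
    by (simp add: right_diff_distrib mult.assoc[symmetric] cl_scalar_mult[symmetric] ss)
  have "cl_scalar \<i> * (fs_dag j - cl_scalar s * fs j) = cl_scalar (- s) * (cl_scalar \<i> * (fs j - cl_scalar s * fs_dag j))"
    unfolding e by (simp add: mult.assoc[symmetric] cl_scalar_mult[symmetric] cl_scalar_uminus mult.commute)
  then show "cl_scalar \<i> * (fs_dag j - cl_scalar s * fs j) = df s (2*j-1)"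
    unfolding df_def fs_combine(2)[OF assms] using odd by simp
  have "fs_dag j + cl_scalar s * fs j = cl_scalar s * (fs j + cl_scalar s * fs_dag j)"
    by (simp add: distrib_left mult.assoc[symmetric] cl_scalar_mult[symmetric] ss add.commute)
  then show "fs_dag j + cl_scalar s * fs j = df s (2*j)"
    unfolding df_def fs_combine(1)[OF assms] by simp
qed

lemma sum_pairs: "(\<Sum>k=1..2*n. f k) = (\<Sum>j=1..n. f (2*j-1) + f (2*j))" for f :: "nat \<Rightarrow> 'b::comm_monoid_add"
  by (induction n) (simp_all add: add_ac)

lemma sum_UNIV_Plus: "(\<Sum>i\<in>UNIV. f i) = (\<Sum>j\<in>UNIV. f (Inl j)) + (\<Sum>j\<in>UNIV. f (Inr j))"
  for f :: "'a::finite + 'b::finite \<Rightarrow> 'c::comm_monoid_add"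
  using sum.Plus[of UNIV UNIV f] by (simp add: UNIV_Plus_UNIV comp_def)

lemma dirac_left_combine:
  assumes s: "s = 1 \<or> s = -1" and F: "smooth_fr S F" "open S" "x \<in> S" and sup: "\<And>x. x \<in> S \<Longrightarrow> gsup {1..2*n} (F x)"
  shows "dirac_Z n F x + cnum s * dirac_Z_dag n F x = dirac_left n (de s) (df s) F x"
proof -
  have dx: "dx n i F x = pd i F x" for i by (rule dx_eq_pd[OF F sup])
  have c2: "gconst a * (cnum c * b) = gconst (cl_scalar c * a) * b" for a c and b :: "'a sval"
    by (simp only: gconst_mult mult.assoc cnum_left[of "gconst a"])
  have "dirac_Z n F x + cnum s * dirac_Z_dag n F x
     = (\<Sum>j\<in>UNIV. gconst (de s (Inl j)) * pd (Inl j) F x + gconst (de s (Inr j)) * pd (Inr j) F x)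
     + (\<Sum>j=1..n. gconst (df s (2*j-1)) * gderiv (2*j-1) (F x) + gconst (df s (2*j)) * gderiv (2*j) (F x))"
  proof -
    have e1: "gconst (ff_dag j) * dz n j F x + cnum s * (gconst (ff j) * dzc n j F x)
        = gconst (de s (Inl j)) * pd (Inl j) F x + gconst (de s (Inr j)) * pd (Inr j) F x" for j
    proof -
      let ?a = "pd (Inl j) F x" and ?b = "pd (Inr j) F x"
      have "gconst (ff_dag j) * dz n j F x + cnum s * (gconst (ff j) * dzc n j F x)
        = gconst (cl_scalar (1/2) * ff_dag j) * ?a - gconst (cl_scalar \<i> * (cl_scalar (1/2) * ff_dag j)) * ?b
          + (gconst (cl_scalar s * (cl_scalar (1/2) * ff j)) * ?a + gconst (cl_scalar s * (cl_scalar \<i> * (cl_scalar (1/2) * ff j))) * ?b)"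
        unfolding dz_def dzc_def dx c2 by (simp only: right_diff_distrib distrib_left c2) (simp only: gconst_mult mult.assoc)
      also have "\<dots> = gconst (cl_scalar (1/2) * (ff_dag j + cl_scalar s * ff j)) * ?a
          + gconst (cl_scalar (- \<i> / 2) * (ff_dag j - cl_scalar s * ff j)) * ?b"
      proof -
        have 1: "cl_scalar (1/2) * (ff_dag j + cl_scalar s * ff j)
          = cl_scalar (1/2) * ff_dag j + cl_scalar s * (cl_scalar (1/2) * ff j)"
          by (simp add: distrib_left mult.assoc[symmetric] cl_scalar_mult[symmetric])
        have 2: "cl_scalar (- \<i> / 2) * (ff_dag j - cl_scalar s * ff j)
          = cl_scalar s * (cl_scalar \<i> * (cl_scalar (1/2) * ff j)) - cl_scalar \<i> * (cl_scalar (1/2) * ff_dag j)"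
          by (simp add: right_diff_distrib mult.assoc[symmetric] cl_scalar_mult[symmetric] cl_scalar_uminus mult.commute[of s])
        show ?thesis unfolding 1 2 gconst_add gconst_diff distrib_right left_diff_distrib by (simp add: add_ac)
      qed
      finally show ?thesis unfolding de_combine[OF s] .
    qed
    have e2: "cnum (2 * \<i>) * (gconst (fs_dag j) * dsz j (F x)) - cnum s * (cnum (2 * \<i>) * (gconst (fs j) * dszc j (F x)))
        = gconst (df s (2*j-1)) * gderiv (2*j-1) (F x) + gconst (df s (2*j)) * gderiv (2*j) (F x)"
      if j: "j \<in> {1..n}" for j
    proof -
      let ?a = "gderiv (2*j-1) (F x)" and ?b = "gderiv (2*j) (F x)"
      have "cnum (2 * \<i>) * (gconst (fs_dag j) * dsz j (F x)) - cnum s * (cnum (2 * \<i>) * (gconst (fs j) * dszc j (F x)))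
        = gconst (cl_scalar (2 * \<i>) * (cl_scalar (1/2) * fs_dag j)) * ?a - gconst (cl_scalar (2 * \<i>) * (cl_scalar \<i> * (cl_scalar (1/2) * fs_dag j))) * ?b
          - (gconst (cl_scalar (2 * \<i>) * (cl_scalar s * (cl_scalar (1/2) * fs j))) * ?a
             + gconst (cl_scalar (2 * \<i>) * (cl_scalar s * (cl_scalar \<i> * (cl_scalar (1/2) * fs j)))) * ?b)"
        unfolding dsz_def dszc_def c2 by (simp only: right_diff_distrib distrib_left c2) (simp only: gconst_mult mult.assoc)
      also have "\<dots> = gconst (cl_scalar \<i> * (fs_dag j - cl_scalar s * fs j)) * ?a
          + gconst (fs_dag j + cl_scalar s * fs j) * ?b"
      proof -
        have 1: "cl_scalar \<i> * (fs_dag j - cl_scalar s * fs j)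
          = cl_scalar (2 * \<i>) * (cl_scalar (1/2) * fs_dag j) - cl_scalar (2 * \<i>) * (cl_scalar s * (cl_scalar (1/2) * fs j))"
          by (simp add: right_diff_distrib mult.assoc[symmetric] cl_scalar_mult[symmetric])
        have "2 * \<i> * s * \<i> * (1 / 2) = - s" by (simp add: algebra_simps)
        then have 2: "fs_dag j + cl_scalar s * fs j
          = - (cl_scalar (2 * \<i>) * (cl_scalar \<i> * (cl_scalar (1/2) * fs_dag j))) - cl_scalar (2 * \<i>) * (cl_scalar s * (cl_scalar \<i> * (cl_scalar (1/2) * fs j)))"
          by (simp only: mult.assoc[symmetric] cl_scalar_mult[symmetric]) (simp add: cl_scalar_uminus)
        show ?thesis unfolding 1 2 gconst_add gconst_diff gconst_uminus distrib_right left_diff_distrib by (simp add: algebra_simps)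
      qed
      also have "\<dots> = gconst (df s (2*j-1)) * ?a + gconst (df s (2*j)) * ?b"
      proof -
        have "1 \<le> j" using j by simp
        then show ?thesis by (simp only: df_combine[OF s])
      qed
      finally show ?thesis .
    qed
    have "dirac_Z n F x + cnum s * dirac_Z_dag n F x
      = (\<Sum>j\<in>UNIV. gconst (ff_dag j) * dz n j F x + cnum s * (gconst (ff j) * dzc n j F x))
        + (\<Sum>j=1..n. cnum (2 * \<i>) * (gconst (fs_dag j) * dsz j (F x)) - cnum s * (cnum (2 * \<i>) * (gconst (fs j) * dszc j (F x))))"
      unfolding dirac_Z_def dirac_Z_dag_def right_diff_distrib sum_distrib_left sum.distrib sum_subtractf by simp
    also have "\<dots> = (\<Sum>j\<in>UNIV. gconst (de s (Inl j)) * pd (Inl j) F x + gconst (de s (Inr j)) * pd (Inr j) F x)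
     + (\<Sum>j=1..n. gconst (df s (2*j-1)) * gderiv (2*j-1) (F x) + gconst (df s (2*j)) * gderiv (2*j) (F x))"
      by (simp only: e1) (simp only: e2 cong: sum.cong)
    finally show ?thesis .
  qed
  then show ?thesis unfolding dirac_left_def sum_UNIV_Plus sum_pairs by (simp only: sum.distrib)
qed

section \<open>The Cauchy kernel\<close>

definition xi :: "nat \<Rightarrow> nat \<Rightarrow> 'a::ring_1 grass" where
  "xi n k = gmono {k} - gmono {2 * n + k}"

lemma gmono_square: "gmono {k} * gmono {k} = (0 :: 'a::ring_1 grass)"
  by (rule grass_eqI) (auto simp: gcoeff_generator_mult gcoeff_gmono)

lemma gpar_gmono1: "gpar (gmono {k}) = - (gmono {k} :: 'a::ring_1 grass)"
  by (rule grass_eqI) (simp add: gpar.rep_eq gcoeff_gmono)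

lemma gpar_diff: "gpar (a - b) = gpar a - gpar b"
  by (rule grass_eqI) (simp add: gpar.rep_eq algebra_simps)

lemma xi_commute: "xi n k * a = gpar a * xi n k"
  by (simp add: xi_def algebra_simps generator_commute)

lemma gpar_xi: "gpar (xi n k) = - xi n k"
  by (simp add: xi_def gpar_diff gpar_gmono1)

lemma xi_anticommute: "xi n k * xi n l = - (xi n l * xi n k)"
  by (simp add: xi_commute[of n k "xi n l"] gpar_xi)

lemma xi_square: "xi n k * xi n k = (0 :: 'a::ring_1 grass)"
proof -
  have "gmono {k} * gmono {2 * n + k} = - (gmono {2 * n + k} * gmono {k} :: 'a grass)"
    by (simp add: generator_commute[of k "gmono {2 * n + k}"] gpar_gmono1)
  then show ?thesis by (simp add: xi_def algebra_simps gmono_square)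
qed

lemma gderiv_xi:
  "k \<in> {1..2*n} \<Longrightarrow> l \<in> {1..2*n} \<Longrightarrow> gderiv k (xi n l) = (if k = l then 1 else 0 :: 'a::ring_1 grass)"
  using gderiv_generator_mult[of k l "1 :: 'a grass"] gderiv_generator_mult[of k "2 * n + l" "1 :: 'a grass"]
  by (auto simp: xi_def gderiv_add[of _ _ "- _", simplified] gderiv_minus gderiv_gconst[of _ 1, simplified])

lemma gsup_xi: "k \<in> {1..2*n} \<Longrightarrow> gsup {1..4*n} (xi n k)"
  unfolding xi_def by (intro gsup_diff gsup_gmono) auto

definition om :: "nat \<Rightarrow> nat \<Rightarrow> 'a::ring_1 grass" where
  "om n j = xi n (2 * j - 1) * xi n (2 * j)"

lemma om_commute: "om n j * a = a * om n j"
proof -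
  have "om n j * a = xi n (2 * j - 1) * (gpar a * xi n (2 * j))"
    unfolding om_def mult.assoc xi_commute[of n "2 * j" a] ..
  also have "\<dots> = xi n (2 * j - 1) * gpar a * xi n (2 * j)" by (simp only: mult.assoc)
  also have "\<dots> = a * om n j"
    unfolding xi_commute[of n "2 * j - 1" "gpar a"] om_def by (simp only: gpar_gpar mult.assoc)
  finally show ?thesis .
qed

lemma om_left: "a * (om n j * b) = om n j * (a * b)"
  by (simp only: mult.assoc[symmetric] om_commute[of n j a])

lemma om_square: "om n j * om n j = (0 :: 'a::ring_1 grass)"
proof -
  have "om n j * om n j = om n j * xi n (2*j-1) * (xi n (2*j) :: 'a grass)"
    unfolding om_def[of n j] by (simp only: mult.assoc)
  also have "om n j * xi n (2*j-1) = xi n (2*j-1) * (om n j :: 'a grass)" by (rule om_commute)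
  also have "\<dots> = xi n (2*j-1) * xi n (2*j-1) * xi n (2*j)" by (simp only: om_def mult.assoc)
  finally show ?thesis by (simp add: xi_square)
qed

text \<open>The nilpotent part of |Z - U|^2 (\<open>Znorm2_xi\<close>): for a pair of odd
  coordinates a, b one has (a + i b)(a - i b) = -2i a b, and the factor -i/2 gives -a b.\<close>

definition zeta :: "nat \<Rightarrow> 'a::ring_1 grass" where
  "zeta n = - (\<Sum>j=1..n. om n j)"

text \<open>A fold, since the product over a finite set presupposes a commutative type.\<close>

definition omprod :: "nat \<Rightarrow> nat \<Rightarrow> 'a::ring_1 grass" where
  "omprod n j = fold (\<lambda>i p. p * om n i) [1..<Suc j] 1"

lemma omprod_simps [simp]: "omprod n 0 = 1" "omprod n (Suc j) = omprod n j * om n (Suc j)"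
  by (simp_all add: omprod_def)

text \<open>The \<open>om\<close> commute and have square 0, so the multinomial formula keeps only
  products of distinct factors: j! times the full product in power j, and nothing in power j +
  1.\<close>

lemma power_sum_om:
  "(\<Sum>i=1..j. om n i) ^ j = of_nat (fact j) * (omprod n j :: 'a::ring_1 grass)"
  "(\<Sum>i=1..j. om n i) ^ Suc j = (0 :: 'a::ring_1 grass)"
proof (induction j)
  case 0
  { case 1 show ?case by simp next case 2 show ?case by simp }
next
  case (Suc j)
  let ?S = "\<Sum>i=1..j. om n i :: 'a grass" and ?w = "om n (Suc j) :: 'a grass"
  have S: "(\<Sum>i=1..Suc j. om n i) = ?S + ?w" by simp
  have cw: "?S * ?w = ?w * ?S" by (rule om_commute[symmetric])
  \<comment> \<open>The binomial formula, truncated after the linear term because the square of the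
    new summand is 0.\<close>
  have pw: "(?S + ?w) ^ Suc k = ?S ^ Suc k + of_nat (Suc k) * (?S ^ k * ?w)" for k
  proof (induction k)
    case (Suc k)
    have "(?S + ?w) ^ Suc (Suc k) = ?S * (?S + ?w) ^ Suc k + ?w * (?S + ?w) ^ Suc k"
      by (simp only: power_Suc[of _ "Suc k"] distrib_right)
    also have "?S * (?S + ?w) ^ Suc k = ?S ^ Suc (Suc k) + of_nat (Suc k) * (?S ^ Suc k * ?w)"
      unfolding Suc.IH by (simp only: distrib_left of_nat_left[of ?S] power_Suc mult.assoc)
    also have "?w * (?S + ?w) ^ Suc k = ?S ^ Suc k * ?w"
      unfolding Suc.IH by (simp only: distrib_left of_nat_left[of ?w] om_left[of "?S ^ k", symmetric] om_square)
        (simp add: om_left[of "?S ^ k"] om_commute om_square)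
    finally show ?case by (simp only: of_nat_Suc[of "Suc k"] distrib_right mult_1 add_ac)
  qed simp
  {
    case 1
    show ?case unfolding S pw Suc.IH by (simp add: mult.assoc distrib_right)
  next
    case 2
    show ?case unfolding S pw[of "Suc j"] using Suc.IH by (simp add: mult.assoc)
  }
qed

lemma zeta_power:
  "zeta n ^ n = of_nat (fact n) * ((-1) ^ n * (omprod n n :: 'a::ring_1 grass))"
  "zeta n ^ Suc n = (0 :: 'a grass)"
proof -
  have e: "zeta n ^ k = (-1) ^ k * (\<Sum>i=1..n. om n i :: 'a grass) ^ k" for k
    unfolding zeta_def by (rule power_minus)
  show "zeta n ^ n = of_nat (fact n) * ((-1) ^ n * (omprod n n :: 'a grass))"
    unfolding e power_sum_om by (rule of_nat_left)
  show "zeta n ^ Suc n = (0 :: 'a grass)" unfolding e power_sum_om by (rule mult_zero_right)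
qed

lemma gpar_om: "gpar (om n j) = om n j"
  by (simp add: om_def gpar_mult gpar_xi)

lemma gpar_zeta: "gpar (zeta n) = zeta n"
  by (simp add: zeta_def gpar_minus gpar_sum gpar_om)

lemma central_zeta: "central (zeta n)"
  unfolding zeta_def by (intro central_minus central_sum) (simp add: central_def om_commute)

lemma gsup_minus: "gsup N a \<Longrightarrow> gsup N (- a)"
  by (simp add: gsup_def)

lemma gsup_zeta: "gsup {1..4*n} (zeta n)"
  unfolding zeta_def om_def by (intro gsup_minus gsup_sum gsup_mult gsup_xi) auto

lemma gderiv_om:
  assumes "j \<in> {1..n}" "i \<in> {1..n}"
  shows "gderiv (2*j-1) (om n i) = (if i = j then xi n (2*j) else 0)"
    "gderiv (2*j) (om n i) = (if i = j then - xi n (2*j-1) else 0)"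
proof -
  have m: "2*j-1 \<in> {1..2*n}" "2*j \<in> {1..2*n}" "2*i-1 \<in> {1..2*n}" "2*i \<in> {1..2*n}" using assms by auto
  have e: "2*j-1 = 2*i-1 \<longleftrightarrow> i = j" "2*j-1 \<noteq> 2*i" "2*j \<noteq> 2*i-1" "2*j = 2*i \<longleftrightarrow> i = j"
    using assms by auto presburger+
  show "gderiv (2*j-1) (om n i) = (if i = j then xi n (2*j) else 0)"
    "gderiv (2*j) (om n i) = (if i = j then - xi n (2*j-1) else 0)"
    unfolding om_def gderiv_mult gderiv_xi[OF m(1,3)] gderiv_xi[OF m(1,4)] gderiv_xi[OF m(2,3)] gderiv_xi[OF m(2,4)] e
    using e by (auto simp: gpar_xi)
qed

lemma gderiv_zeta:
  assumes "j \<in> {1..n}"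
  shows "gderiv (2*j-1) (zeta n) = - (xi n (2*j) :: 'a::ring_1 grass)"
    "gderiv (2*j) (zeta n) = (xi n (2*j-1) :: 'a grass)"
proof -
  have "(\<Sum>i=1..n. gderiv (2*j-1) (om n i)) = (\<Sum>i=1..n. if i = j then xi n (2*j) else 0 :: 'a grass)"
    by (rule sum.cong[OF refl gderiv_om(1)[OF assms]])
  then show "gderiv (2*j-1) (zeta n) = - (xi n (2*j) :: 'a grass)"
    unfolding zeta_def gderiv_minus gderiv_sum using assms by simp
  have "(\<Sum>i=1..n. gderiv (2*j) (om n i)) = (\<Sum>i=1..n. if i = j then - xi n (2*j-1) else 0 :: 'a grass)"
    by (rule sum.cong[OF refl gderiv_om(2)[OF assms]])
  then show "gderiv (2*j) (zeta n) = (xi n (2*j-1) :: 'a grass)"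
    unfolding zeta_def gderiv_minus gderiv_sum using assms by simp
qed

text \<open>Derivatives 2j + 1 and 2j + 2, in this order, remove the factor
  \<open>om n (Suc j)\<close> with sign +; this is the order in the Berezin integral, so no sign
  accumulates.\<close>

lemma fold_gderiv_omprod:
  fixes a :: "'a::ring_1 grass"
  assumes "j \<le> n" "\<And>k. k \<in> {1..2*j} \<Longrightarrow> gderiv k a = 0"
  shows "fold gderiv [1..<2*j+1] (omprod n j * a) = a"
  using assms
proof (induction j arbitrary: a)
  case (Suc j)
  have m: "2*j+1 \<in> {1..2*n}" "2*j+2 \<in> {1..2*n}" using Suc.prems by auto
  have a0: "gderiv (2*j+1) a = 0" "gderiv (2*j+2) a = 0" using Suc.prems by auto
  have z: "gderiv k (om n (Suc j) * a) = 0" if "k \<in> {1..2*j}" for k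
  proof -
    have k: "k \<in> {1..2*n}" "k \<noteq> 2*j+1" "k \<noteq> 2*j+2" using that Suc.prems by auto
    have "gderiv k (xi n (2*j+1)) = (0 :: 'a grass)" "gderiv k (xi n (2*j+2)) = (0 :: 'a grass)"
      using k gderiv_xi[OF k(1) m(1)] gderiv_xi[OF k(1) m(2)] by simp_all
    then have "gderiv k (om n (Suc j) :: 'a grass) = 0"
      by (simp add: om_def gderiv_mult)
    then show ?thesis using Suc.prems(2)[of k] that by (simp add: gderiv_mult)
  qed
  have "[1..<2*Suc j+1] = [1..<2*j+1] @ [2*j+1, 2*j+2]" by simp
  then have "fold gderiv [1..<2*Suc j+1] (omprod n (Suc j) * a)
      = gderiv (2*j+2) (gderiv (2*j+1) (fold gderiv [1..<2*j+1] (omprod n j * (om n (Suc j) * a))))"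
    by (simp add: mult.assoc)
  also have "fold gderiv [1..<2*j+1] (omprod n j * (om n (Suc j) * a)) = om n (Suc j) * a"
    by (rule Suc.IH) (use Suc.prems z in auto)
  also have "gderiv (2*j+1) (om n (Suc j) * a) = xi n (2*j+2) * a"
    using gderiv_xi[OF m(1) m(1), where 'a = 'a] gderiv_xi[OF m(1) m(2), where 'a = 'a] a0 by (simp add: om_def gderiv_mult)
  also have "gderiv (2*j+2) (xi n (2*j+2) * a) = a"
    using gderiv_xi[OF m(2) m(2), where 'a = 'a] a0 by (simp add: gderiv_mult)
  finally show ?case .
qed simp

lemma omprod_commute: "omprod n j * a = a * omprod n j"
proof (induction j)
  case (Suc j)
  have "omprod n (Suc j) * a = omprod n j * a * om n (Suc j)"
    by (simp only: omprod_simps mult.assoc om_commute[of n "Suc j" a])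
  also have "omprod n j * a = a * omprod n j" by (rule Suc.IH)
  also have "a * omprod n j * om n (Suc j) = a * omprod n (Suc j)"
    by (simp only: omprod_simps mult.assoc)
  finally show ?case .
qed simp

lemma omprod_left: "a * (omprod n j * b) = omprod n j * (a * b)"
  by (simp only: mult.assoc[symmetric] omprod_commute[of n j a])

lemma omprod_xi:
  assumes "k \<in> {1..2*j}" shows "omprod n j * xi n k = (0 :: 'a::ring_1 grass)"
  using assms
proof (induction j)
  case (Suc j)
  show ?case
  proof (cases "k \<in> {1..2*j}")
    case True
    then have z: "omprod n j * xi n k = (0 :: 'a grass)" by (rule Suc.IH)
    have "omprod n (Suc j) * xi n k = omprod n j * xi n k * (om n (Suc j) :: 'a grass)"
      by (simp only: omprod_simps mult.assoc om_commute[of n "Suc j" "xi n k"])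
    then show ?thesis unfolding z by simp
  next
    case False
    then have "k = 2*j+1 \<or> k = 2*j+2" using Suc.prems by auto
    then have "om n (Suc j) * xi n k = (0 :: 'a grass)"
    proof
      assume k: "k = 2*j+2"
      then show ?thesis by (simp add: om_def mult.assoc xi_square)
    next
      assume k: "k = 2*j+1"
      have "om n (Suc j) * xi n k = xi n k * (om n (Suc j) :: 'a grass)" by (rule om_commute)
      also have "\<dots> = xi n k * xi n k * xi n (2*j+2)" unfolding k om_def by (simp add: mult.assoc)
      finally show ?thesis by (simp add: xi_square)
    qed
    then show ?thesis by (simp add: mult.assoc)
  qed
qed simp

text \<open>The full product contains every difference of an x and a y generator and so annihilates
  it; behind it x may be replaced by y. Thus it acts as the odd delta function at y. The shift by 2n
  preserves the order, hence no sign.\<close>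

lemma omprod_gmono:
  assumes "finite A" "A \<subseteq> {1..2*n}"
  shows "omprod n n * gmono A = omprod n n * (gmono ((\<lambda>j. 2 * n + j) ` A) :: 'a::ring_1 grass)"
  using assms
proof (induction A rule: finite_linorder_min_induct)
  case (insert k A)
  let ?P = "omprod n n :: 'a grass" and ?f = "\<lambda>j. 2 * n + j"
  have k: "?P * gmono {k} = ?P * gmono {2 * n + k}"
    using omprod_xi[of k n n] insert.prems by (simp add: xi_def right_diff_distrib)
  have "?P * gmono (insert k A) = ?P * gmono {k} * gmono A"
    using insert by (simp add: gmono_insert_Min mult.assoc)
  also have "\<dots> = gmono {2 * n + k} * (?P * gmono A)"
    unfolding k by (simp only: mult.assoc omprod_left)
  also have "\<dots> = ?P * (gmono {2 * n + k} * gmono (?f ` A))"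
    using insert by (simp add: omprod_left)
  also have "gmono {2 * n + k} * gmono (?f ` A) = (gmono (?f ` insert k A) :: 'a grass)"
    unfolding image_insert using insert.hyps by (intro gmono_insert_Min[symmetric]) auto
  finally show ?case .
qed simp

text \<open>(-1)^n n! stems from \<open>zeta_power\<close> and pi^-n from the normalisation of the
  Berezin integral. Once y has replaced x, the remaining factor is constant for the odd
  derivatives.\<close>

lemma berezin_zeta_power:
  fixes a :: "'m::finite sval"
  assumes "gsup {1..2*n} a"
  shows "berezin n (zeta n ^ n * a) = cnum ((-1) ^ n * fact n / pi ^ n)
    * (\<Sum>A\<in>Pow {1..2*n}. gconst (gcoeff a A) * gmono ((\<lambda>j. 2 * n + j) ` A))"
proof -
  let ?P = "omprod n n :: 'm sval" and ?f = "\<lambda>j. 2 * n + j"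
  define b where "b = (\<Sum>A\<in>Pow {1..2*n}. gconst (gcoeff a A) * gmono (?f ` A))"
  have "?P * a = ?P * (\<Sum>A\<in>Pow {1..2*n}. gconst (gcoeff a A) * gmono A)"
    using gsup_expand[OF assms] by simp
  also have "\<dots> = (\<Sum>A\<in>Pow {1..2*n}. gconst (gcoeff a A) * (?P * gmono A))"
    by (simp only: sum_distrib_left omprod_left)
  also have "\<dots> = (\<Sum>A\<in>Pow {1..2*n}. gconst (gcoeff a A) * (?P * gmono (?f ` A)))"
    by (intro sum.cong refl arg_cong2[of _ _ _ _ "(*)"] omprod_gmono) (auto intro: finite_subset)
  also have "\<dots> = ?P * b" by (simp only: b_def sum_distrib_left omprod_left)
  finally have Pa: "?P * a = ?P * b" .
  have "gsup {2*n+1..} b" unfolding b_def by (intro gsup_sum gsup_mult gsup_gconst gsup_gmono) auto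
  then have gb: "gderiv k b = 0" if "k \<in> {1..2*n}" for k
  proof -
    have "gcoeff b (insert k A) = 0" for A
      using \<open>gsup {2*n+1..} b\<close> that unfolding gsup_def by fastforce
    then show ?thesis by (intro grass_eqI) (simp add: gderiv.rep_eq)
  qed
  have nn: "of_nat k = (cnum (of_nat k) :: 'm sval)" for k
    by (induction k) (simp_all add: cl_scalar_add gconst_add)
  have mm: "(-1) ^ k = (cnum ((-1) ^ k) :: 'm sval)" for k
    by (induction k) (simp_all add: cl_scalar_uminus gconst_uminus)
  have "zeta n ^ n * a = cnum (fact n * (-1) ^ n) * (?P * b)"
    unfolding zeta_power(1) mult.assoc Pa by (simp only: nn mm cnum_mult mult.assoc of_nat_fact)
  then have "berezin n (zeta n ^ n * a) = cnum (fact n * (-1) ^ n) * berezin n (?P * b)"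
    by (simp only: berezin_gconst_mult)
  also have "berezin n (?P * b) = cnum (of_real (1 / pi ^ n)) * b"
    unfolding berezin_def by (subst fold_gderiv_omprod) (auto simp: gb)
  finally show ?thesis
    unfolding b_def[symmetric] by (simp only: mult.assoc[symmetric] cnum_mult[symmetric]) (simp add: field_simps)
qed

section \<open>The Clifford vector of Z - U and its square\<close>

definition Xv :: "nat \<Rightarrow> complex \<Rightarrow> 'm::finite point \<Rightarrow> 'm point \<Rightarrow> 'm sval" where
  "Xv n s y x = (\<Sum>i\<in>UNIV. cnum (of_real (x $ i - y $ i)) * gconst (ee s i)) + (\<Sum>k=1..2*n. xi n k * gconst (os s k))"

lemma cnum_sum: "cnum (\<Sum>i\<in>I. f i) = (\<Sum>i\<in>I. cnum (f i))"
  by (simp add: cl_scalar_sum gconst_sum)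

lemma cnum_cancel: "c \<noteq> 0 \<Longrightarrow> cnum c * a = cnum c * b \<Longrightarrow> a = b"
proof -
  assume c: "c \<noteq> 0" and e: "cnum c * a = cnum c * b"
  have "cnum (1 / c) * (cnum c * a) = cnum (1 / c) * (cnum c * b)" by (simp only: e)
  then show ?thesis using c by (simp only: mult.assoc[symmetric] cnum_mult[symmetric]) simp
qed

lemma cnum_two: "cnum 2 * a = a + a" for a :: "'i::finite clifford grass"
proof -
  have "cnum 2 = (cnum 1 + cnum 1 :: 'i clifford grass)" using cnum_add[of 1 1] by (simp only: one_add_one)
  then show ?thesis by (simp only: distrib_right cnum_one mult_1)
qed

text \<open>Only sums of the form ab + ba are known, so the square is doubled and symmetrised;
  \<open>cnum_cancel\<close> removes the 2 afterwards.\<close>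

lemma two_square_sum:
  assumes "\<And>i j. i \<in> I \<Longrightarrow> j \<in> I \<Longrightarrow> f i * f j + f j * f i = p i j"
  shows "cnum 2 * ((\<Sum>i\<in>I. f i) * (\<Sum>j\<in>I. f j)) = (\<Sum>i\<in>I. \<Sum>j\<in>I. p i j)"
proof -
  have "(\<Sum>i\<in>I. \<Sum>j\<in>I. p i j) = (\<Sum>i\<in>I. \<Sum>j\<in>I. f i * f j + f j * f i)"
    using assms by (intro sum.cong refl) simp
  also have "\<dots> = (\<Sum>i\<in>I. \<Sum>j\<in>I. f i * f j) + (\<Sum>j\<in>I. \<Sum>i\<in>I. f j * f i)"
    unfolding sum.distrib by (subst sum.swap[of "\<lambda>i j. f j * f i"]) simp
  finally show ?thesis by (simp add: cnum_two sum_product)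
qed

lemma gconst_xi_commute: "gconst c * xi n k = xi n k * gconst c"
  by (simp add: xi_def right_diff_distrib left_diff_distrib gconst_gmono_commute)

lemma xi_gconst_left: "gconst c * (xi n k * a) = xi n k * (gconst c * a)"
  by (simp only: mult.assoc[symmetric] gconst_xi_commute)

lemma Xv_even_square:
  fixes t :: "'m::finite + 'm \<Rightarrow> real"
  assumes s: "s = 1 \<or> s = -1"
  shows "(\<Sum>i\<in>UNIV. cnum (of_real (t i)) * gconst (ee s i)) * (\<Sum>i\<in>UNIV. cnum (of_real (t i)) * gconst (ee s i))
     = cnum (s * of_real (\<Sum>i\<in>UNIV. (t i)\<^sup>2))"
proof (rule cnum_cancel[of 2])
  let ?t = "\<lambda>i. complex_of_real (t i)"
  have "cnum 2 * ((\<Sum>i\<in>UNIV. cnum (?t i) * gconst (ee s i)) * (\<Sum>i\<in>UNIV. cnum (?t i) * gconst (ee s i)))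
     = (\<Sum>i\<in>UNIV. \<Sum>j\<in>UNIV. cnum (?t i * ?t j * (if i = j then 2 * s else 0)))"
  proof (rule two_square_sum)
    fix i j
    have "cnum (?t i) * gconst (ee s i) * (cnum (?t j) * gconst (ee s j)) + cnum (?t j) * gconst (ee s j) * (cnum (?t i) * gconst (ee s i))
        = cnum (?t i * ?t j) * gconst (ee s i * ee s j + ee s j * ee s i)"
      by (simp only: cnum_mult4 gconst_mult gconst_add distrib_left mult.commute[of "?t j" "?t i"])
    then show "cnum (?t i) * gconst (ee s i) * (cnum (?t j) * gconst (ee s j)) + cnum (?t j) * gconst (ee s j) * (cnum (?t i) * gconst (ee s i))
        = cnum (?t i * ?t j * (if i = j then 2 * s else 0))"
      unfolding ee_relation[OF s] cnum_mult .
  qed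
  also have "\<dots> = cnum (\<Sum>i\<in>UNIV. \<Sum>j\<in>UNIV. ?t i * ?t j * (if i = j then 2 * s else 0))"
    by (simp only: cnum_sum)
  also have "(\<Sum>i\<in>UNIV. \<Sum>j\<in>UNIV. ?t i * ?t j * (if i = j then 2 * s else 0)) = (\<Sum>i\<in>UNIV. ?t i * ?t i * (2 * s))"
    by (simp add: if_distrib cong: if_cong)
  also have "\<dots> = 2 * (s * of_real (\<Sum>i\<in>UNIV. (t i)\<^sup>2))"
    by (simp add: sum_distrib_left power2_eq_square mult_ac)
  finally show "cnum 2 * ((\<Sum>i\<in>UNIV. cnum (?t i) * gconst (ee s i)) * (\<Sum>i\<in>UNIV. cnum (?t i) * gconst (ee s i)))
     = cnum 2 * cnum (s * of_real (\<Sum>i\<in>UNIV. (t i)\<^sup>2))" unfolding cnum_mult .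
qed simp

lemma sum_symp_form:
  "(\<Sum>k=1..2*n. \<Sum>l=1..2*n. cnum (symp_form k l) * (xi n k * xi n l)) = cnum 2 * (\<Sum>j=1..n. om n j :: 'm::finite sval)"
proof -
  let ?f = "\<lambda>k l. cnum (symp_form k l) * (xi n k * xi n l) :: 'm sval"
  have sy: "symp_form (2*i-1) (2*j-1) = 0" "symp_form (2*i) (2*j) = 0"
    "symp_form (2*i-1) (2*j) = (if i = j then 1 else 0)" "symp_form (2*i) (2*j-1) = (if i = j then -1 else 0)"
    if "i \<in> {1..n}" "j \<in> {1..n}" for i j
  proof -
    have "odd (2*i-1)" "odd (2*j-1)" "Suc (2*i-1) = 2*i" "Suc (2*j-1) = 2*j" using that by auto
    then show "symp_form (2*i-1) (2*j-1) = 0" "symp_form (2*i) (2*j) = 0"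
      "symp_form (2*i-1) (2*j) = (if i = j then 1 else 0)" "symp_form (2*i) (2*j-1) = (if i = j then -1 else 0)"
      by (auto simp: symp_form_def) presburger+
  qed
  have "(\<Sum>k=1..2*n. \<Sum>l=1..2*n. ?f k l)
      = (\<Sum>i=1..n. \<Sum>j=1..n. ?f (2*i-1) (2*j-1) + ?f (2*i-1) (2*j) + (?f (2*i) (2*j-1) + ?f (2*i) (2*j)))"
    unfolding sum_pairs sum.distrib by (simp only: add_ac)
  also have "\<dots> = (\<Sum>i=1..n. \<Sum>j=1..n. if i = j then om n i + om n i else 0)"
  proof (intro sum.cong refl)
    fix i j assume ij: "i \<in> {1..n}" "j \<in> {1..n}"
    have "- (xi n (2*i) * xi n (2*i-1)) = (om n i :: 'm sval)"
      unfolding om_def by (rule xi_anticommute[symmetric])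
    then show "?f (2*i-1) (2*j-1) + ?f (2*i-1) (2*j) + (?f (2*i) (2*j-1) + ?f (2*i) (2*j)) = (if i = j then om n i + om n i else (0 :: 'm sval))"
      unfolding sy[OF ij] by (auto simp: om_def cl_scalar_uminus gconst_uminus)
  qed
  also have "\<dots> = (\<Sum>i=1..n. cnum 2 * om n i)" by (simp add: cnum_two)
  finally show ?thesis by (simp only: sum_distrib_left)
qed

text \<open>As the \<open>xi\<close> anticommute, symmetrising two terms produces a commutator of
  the \<open>os\<close>, and this is a scalar.\<close>

lemma Xv_odd_square:
  assumes s: "s = 1 \<or> s = -1"
  shows "(\<Sum>k=1..2*n. xi n k * gconst (os s k)) * (\<Sum>k=1..2*n. xi n k * gconst (os s k)) = cnum s * (zeta n :: 'm::finite sval)"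
proof (rule cnum_cancel[of 2])
  have "cnum 2 * ((\<Sum>k=1..2*n. xi n k * gconst (os s k)) * (\<Sum>k=1..2*n. xi n k * gconst (os s k)))
     = (\<Sum>k=1..2*n. \<Sum>l=1..2*n. cnum (- s) * (cnum (symp_form k l) * (xi n k * xi n l)) :: 'm sval)"
  proof (rule two_square_sum)
    fix k l assume kl: "k \<in> {1..2*n}" "l \<in> {1..2*n}"
    have m: "xi n k * gconst a * (xi n l * gconst b) = xi n k * xi n l * (gconst (a * b) :: 'm sval)" for k l a b
      by (simp only: mult.assoc gconst_mult xi_gconst_left[of a n l])
    have "xi n k * gconst (os s k) * (xi n l * gconst (os s l)) + xi n l * gconst (os s l) * (xi n k * gconst (os s k))
       = xi n k * xi n l * (gconst (os s k * os s l - os s l * os s k) :: 'm sval)"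
      unfolding m xi_anticommute[of n l k] by (simp add: gconst_diff right_diff_distrib)
    also have "os s k * os s l - os s l * os s k = cl_scalar (- s * symp_form k l)"
      by (rule os_relation[OF s]) (use kl in auto)
    also have "xi n k * xi n l * cnum (- s * symp_form k l) = cnum (- s) * (cnum (symp_form k l) * (xi n k * xi n l))"
      by (subst cnum_commute[symmetric]) (simp only: cnum_mult mult.assoc)
    finally show "xi n k * gconst (os s k) * (xi n l * gconst (os s l)) + xi n l * gconst (os s l) * (xi n k * gconst (os s k))
       = cnum (- s) * (cnum (symp_form k l) * (xi n k * xi n l :: 'm sval))" .
  qed
  also have "\<dots> = cnum (- s) * (cnum 2 * (\<Sum>j=1..n. om n j))"
    unfolding sum_symp_form[symmetric] by (simp only: sum_distrib_left)
  also have "\<dots> = cnum 2 * (cnum s * zeta n)"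
    by (simp add: zeta_def cl_scalar_uminus gconst_uminus cnum_left[of "cnum s" 2])
  finally show "cnum 2 * ((\<Sum>k=1..2*n. xi n k * gconst (os s k)) * (\<Sum>k=1..2*n. xi n k * gconst (os s k)))
     = cnum 2 * (cnum s * (zeta n :: 'm sval))" .
qed simp

definition rho :: "'m::finite point \<Rightarrow> 'm point \<Rightarrow> real" where
  "rho y x = (x - y) \<bullet> (x - y)"

lemma rho_sum: "rho y x = (\<Sum>i\<in>UNIV. (x $ i - y $ i)\<^sup>2)"
  by (simp add: rho_def inner_vec_def power2_eq_square)

text \<open>The cross terms cancel, because \<open>ee\<close> and \<open>os\<close> anticommute
  while the \<open>xi\<close> commute with both. So X is a square root of s |Z - U|^2.\<close>

lemma Xv_square:
  assumes s: "s = 1 \<or> s = -1"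
  shows "Xv n s y x * Xv n s y x = cnum s * (cnum (of_real (rho y x)) + zeta n)"
proof -
  let ?E = "\<Sum>i\<in>UNIV. cnum (of_real (x $ i - y $ i)) * gconst (ee s i)"
  let ?O = "\<Sum>k=1..2*n. xi n k * gconst (os s k)"
  have "?E * ?O + ?O * ?E = 0"
  proof -
    have "cnum (of_real (x $ i - y $ i)) * gconst (ee s i) * (xi n k * gconst (os s k))
        + xi n k * gconst (os s k) * (cnum (of_real (x $ i - y $ i)) * gconst (ee s i)) = 0" for i k
    proof -
      let ?c = "cnum (of_real (x $ i - y $ i))"
      have "?c * gconst (ee s i) * (xi n k * gconst (os s k)) + xi n k * gconst (os s k) * (?c * gconst (ee s i))
         = ?c * (xi n k * gconst (ee s i * os s k + os s k * ee s i))"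
        by (simp only: mult.assoc xi_gconst_left[of "ee s i"] cnum_left[of "gconst (os s k)"] cnum_left[of "xi n k"]
            gconst_mult gconst_add distrib_left)
      then show ?thesis by (simp add: ee_os_relation)
    qed
    then have "(\<Sum>i\<in>UNIV. \<Sum>k=1..2*n. cnum (of_real (x $ i - y $ i)) * gconst (ee s i) * (xi n k * gconst (os s k))
        + xi n k * gconst (os s k) * (cnum (of_real (x $ i - y $ i)) * gconst (ee s i))) = 0" by simp
    then show ?thesis unfolding sum.distrib sum_product
      by (subst (2) sum.swap) simp
  qed
  moreover have "Xv n s y x * Xv n s y x = ?E * ?E + ?O * ?O + (?E * ?O + ?O * ?E)"
    unfolding Xv_def by (simp only: distrib_left distrib_right add_ac)
  ultimately show ?thesis
    unfolding Xv_even_square[OF s, of "\<lambda>i. x $ i - y $ i"] Xv_odd_square[OF s] rho_sum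
    by (simp add: cnum_mult[unfolded] distrib_left cl_scalar_mult gconst_mult)
qed

lemma fr_Xv: "open S \<Longrightarrow> smooth_fr S (Xv n s y)"
  unfolding Xv_def[abs_def]
proof (intro smooth_fr.add fr_const fr_sum smooth_fr.single)
  fix i assume S: "open S"
  have "smooth_on S (\<lambda>x. complex_of_real (x \<bullet> axis i (1::real)) - of_real (y $ i))"
    by (intro smooth_on_diff smooth_on_inner smooth_on_const S)
  then show "smooth_on S (\<lambda>x. complex_of_real (x $ i - y $ i))"
    by (simp add: inner_axis real_inner_1_right)
qed

lemma pderivative_coordinate:
  "pderivative i (\<lambda>x. complex_of_real (x $ j - c)) x = (if i = j then 1 else 0)"
proof -
  have "((\<lambda>x. complex_of_real (x $ j - c)) has_derivative (\<lambda>v. complex_of_real (v $ j - 0))) (at x)"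
    by (intro bounded_linear.has_derivative[OF bounded_linear_of_real] has_derivative_diff has_derivative_const
        bounded_linear_imp_has_derivative bounded_linear_vec_nth)
  then show ?thesis by (simp add: pderivative_def frechet_derivative_at[symmetric] axis_def)
qed

lemma smooth_coordinate: "smooth_on UNIV (\<lambda>x. complex_of_real (x $ j - c))"
proof -
  have "smooth_on UNIV (\<lambda>x. complex_of_real (x \<bullet> axis j (1::real)) - of_real c)"
    by (intro smooth_on_diff smooth_on_inner smooth_on_const open_UNIV)
  then show ?thesis by (simp add: inner_axis real_inner_1_right)
qed

lemma pd_Xv: "pd i (Xv n s y) x = gconst (ee s i)"
proof -
  have "pd i (Xv n s y) x = pd i (\<lambda>x. \<Sum>j\<in>UNIV. cnum (of_real (x $ j - y $ j)) * gconst (ee s j)) x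
     + pd i (\<lambda>x. \<Sum>k=1..2*n. xi n k * gconst (os s k)) x"
    unfolding Xv_def[abs_def]
    by (rule pd_add[OF _ _ open_UNIV UNIV_I]) (intro fr_const fr_sum smooth_fr.single smooth_coordinate)+
  also have "pd i (\<lambda>x. \<Sum>j\<in>UNIV. cnum (of_real (x $ j - y $ j)) * gconst (ee s j)) x
      = (\<Sum>j\<in>UNIV. cnum (pderivative i (\<lambda>x. of_real (x $ j - y $ j)) x) * gconst (ee s j))"
    by (simp only: pd_sum[OF open_UNIV UNIV_I smooth_fr.single[OF smooth_coordinate]]
        pd_single[OF smooth_coordinate UNIV_I])
  also have "\<dots> = (\<Sum>j\<in>UNIV. if j = i then gconst (ee s j) else 0)"
    unfolding pderivative_coordinate by (intro sum.cong refl) auto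
  finally show ?thesis by simp
qed

lemma gderiv_gpar_Xv: "k \<in> {1..2*n} \<Longrightarrow> gderiv k (gpar (Xv n s y x)) = - gconst (os s k)"
proof -
  assume k: "k \<in> {1..2*n}"
  have "gderiv k (gpar (Xv n s y x)) = (\<Sum>l=1..2*n. - (gderiv k (xi n l) * gconst (os s l)))"
    by (simp add: Xv_def gpar_add gpar_sum gpar_mult gpar_xi gderiv_add gderiv_sum gderiv_mult gderiv_minus)
  also have "\<dots> = (\<Sum>l=1..2*n. if l = k then - gconst (os s l) else 0)"
    using k by (intro sum.cong refl) (auto simp: gderiv_xi)
  finally show ?thesis using k by simp
qed

lemma gsup_Xv: "gsup {1..4*n} (Xv n s y x)"
  unfolding Xv_def gconst_mult[symmetric] by (intro gsup_add gsup_sum gsup_mult gsup_gconst gsup_xi)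

lemma os_df_sum:
  assumes s: "s = 1 \<or> s = -1"
  shows "(\<Sum>k=1..2*n. os s k * df s k) = (cl_scalar (of_nat n) :: 'm::finite cliff)"
proof -
  have ss: "s * s = 1" using s by auto
  have "os s (2*j-1) * df s (2*j-1) + os s (2*j) * df s (2*j) = (cl_scalar 1 :: 'm cliff)" if j: "j \<in> {1..n}" for j
  proof -
    have o: "odd (2*j-1)" "Suc (2*j-1) = 2*j" using j by auto
    have "os s (2*j-1) * df s (2*j-1) + os s (2*j) * df s (2*j)
      = cl_scalar (- s) * (os s (2*j-1) * os s (2*j) - os s (2*j) * os s (2*j-1) :: 'm cliff)"
      using o by (simp add: df_def cl_scalar_left right_diff_distrib cl_scalar_uminus)
    also have "os s (2*j-1) * os s (2*j) - os s (2*j) * os s (2*j-1) = (cl_scalar (- s * symp_form (2*j-1) (2*j)) :: 'm cliff)"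
      by (rule os_relation[OF s]) (use j in auto)
    also have "symp_form (2*j-1) (2*j) = 1" using o by (simp add: symp_form_def)
    finally show ?thesis using ss by (simp only: cl_scalar_mult[symmetric]) simp
  qed
  then have "(\<Sum>k=1..2*n. os s k * df s k) = (\<Sum>j=1..n. cl_scalar 1 :: 'm cliff)"
    unfolding sum_pairs by (rule sum.cong[OF refl])
  also have "\<dots> = cl_scalar (\<Sum>j=1..n. 1)" by (simp only: cl_scalar_sum)
  finally show ?thesis by simp
qed

lemma ee_de_sum:
  assumes s: "s = 1 \<or> s = -1"
  shows "(\<Sum>i\<in>UNIV. ee s i * de s i) = (cl_scalar (of_nat CARD('m)) :: 'm::finite cliff)"
proof -
  have ss: "s * s = 1" using s by auto
  have "ee s i * de s i = cl_scalar (1/2)" for i :: "'m + 'm"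
  proof -
    have "ee s i * de s i = cl_scalar (s / 4) * (ee s i * ee s i + ee s i * ee s i)"
      unfolding de_def cl_scalar_left distrib_left
      by (simp only: distrib_right[symmetric] cl_scalar_add[symmetric]) simp
    then show ?thesis unfolding ee_relation[OF s] using ss by (simp add: cl_scalar_mult[symmetric])
  qed
  then have "(\<Sum>i\<in>UNIV. ee s i * de s i) = (\<Sum>i\<in>(UNIV :: ('m + 'm) set). cl_scalar (1/2) :: 'm cliff)" by simp
  also have "\<dots> = cl_scalar (\<Sum>i\<in>(UNIV :: ('m + 'm) set). 1/2)" by (simp only: cl_scalar_sum)
  finally show ?thesis by (simp add: card_UNIV_sum)
qed

text \<open>Each of the 2m even directions contributes 1/2 and each odd pair -1, the sign being that
  of \<open>gpar\<close>. The value m - n is half the superdimension, for both signs s.\<close>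

lemma dirac_right_Xv:
  assumes s: "s = 1 \<or> s = -1"
  shows "dirac_right n (de s) (df s) (Xv n s y) x = (cnum (of_nat CARD('m) - of_nat n) :: 'm::finite sval)"
proof -
  have "dirac_right n (de s) (df s) (Xv n s y) x
     = gconst (\<Sum>i\<in>UNIV. ee s i * de s i) + (\<Sum>k=1..2*n. - gconst (os s k * df s k))"
    unfolding dirac_right_def pd_Xv gconst_sum gconst_mult
    by (intro arg_cong2[of _ _ _ _ "(+)"] sum.cong refl) (simp add: gderiv_gpar_Xv)
  also have "(\<Sum>k=1..2*n. - gconst (os s k * df s k)) = - gconst (\<Sum>k=1..2*n. os s k * df s k)"
    by (simp add: gconst_sum sum_negf)
  finally show ?thesis unfolding ee_de_sum[OF s] os_df_sum[OF s] by (simp add: cl_scalar_diff gconst_diff)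
qed

subsection \<open>Functions of the squared distance\<close>

text \<open>A function of \<open>|Z - U|\<^sup>2\<close> is given by the sequence of its derivatives at the body, through
  Taylor's formula in the nilpotent part.\<close>

definition smooth_seq :: "real set \<Rightarrow> (nat \<Rightarrow> real \<Rightarrow> complex) \<Rightarrow> bool" where
  "smooth_seq U p \<longleftrightarrow> open U \<and> (\<forall>j. \<forall>r\<in>U. (p j has_vector_derivative p (Suc j) r) (at r))"

lemma smooth_seq_smooth: assumes "smooth_seq U p" shows "smooth_on U (p j)"
proof -
  have U: "open U" and d: "\<And>j r. r \<in> U \<Longrightarrow> (p j has_vector_derivative p (Suc j) r) (at r)"
    using assms by (auto simp: smooth_seq_def)
  have "ck_on k U (p j)" for k
  proof (induction k arbitrary: j)
    case 0
    show ?case using d by (auto intro!: continuous_at_imp_continuous_on has_vector_derivative_continuous)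
  next
    case (Suc k)
    show ?case
    proof (rule ck_on_SucI[OF U])
      show "(p j has_derivative (\<lambda>v. of_real v * p (Suc j) r)) (at r)" if "r \<in> U" for r
        using d[OF that, of j] by (simp add: has_vector_derivative_def scaleR_conv_of_real)
      show "ck_on k U (\<lambda>r. of_real v * p (Suc j) r)" for v
        by (intro ck_on_mult ck_on_const Suc U)
    qed
  qed
  then show ?thesis by (simp add: smooth_on_def)
qed

lemma smooth_on_rho: "open S \<Longrightarrow> smooth_on S (\<lambda>x. complex_of_real (rho y x))"
  unfolding rho_def by (rule smooth_on_dist2)

lemma smooth_seq_rho:
  assumes "smooth_seq U p" "open S" "\<And>x. x \<in> S \<Longrightarrow> rho y x \<in> U"
  shows "smooth_on S (\<lambda>x. p j (rho y x))"
  using assms smooth_on_compose[OF smooth_seq_smooth[OF assms(1)] smooth_on_rho[OF assms(2)] assms(2)]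
  by (simp add: smooth_seq_def)

lemma pderivative_rho:
  assumes "smooth_seq U p" "rho y x \<in> U"
  shows "pderivative i (\<lambda>x. p j (rho y x)) x = of_real (2 * (x $ i - y $ i)) * p (Suc j) (rho y x)"
proof -
  have d: "(p j has_derivative (\<lambda>v. v *\<^sub>R p (Suc j) (rho y x))) (at (rho y x))"
    using assms by (simp add: smooth_seq_def has_vector_derivative_def)
  have "(rho y has_derivative (\<lambda>v. (x - y) \<bullet> v + v \<bullet> (x - y))) (at x)"
    unfolding rho_def[abs_def] by (auto intro!: derivative_eq_intros)
  from has_derivative_compose[OF this d]
  have "((\<lambda>x. p j (rho y x)) has_derivative (\<lambda>v. ((x - y) \<bullet> v + v \<bullet> (x - y)) *\<^sub>R p (Suc j) (rho y x))) (at x)" .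
  then show ?thesis
    by (simp add: pderivative_def frechet_derivative_at[symmetric] inner_axis inner_axis' scaleR_conv_of_real)
qed

text \<open>The Taylor sum is exact when it stops at n, as \<open>zeta n ^ Suc n\<close> is 0. Its
  terms are central, so an \<open>fc\<close> can be moved to any place in a product.\<close>

definition fc :: "nat \<Rightarrow> (nat \<Rightarrow> real \<Rightarrow> complex) \<Rightarrow> real \<Rightarrow> 'm::finite sval" where
  "fc n p r = (\<Sum>j=0..n. cnum (p j r / fact j) * zeta n ^ j)"

abbreviation (input) shift :: "(nat \<Rightarrow> 'b) \<Rightarrow> nat \<Rightarrow> 'b" where
  "shift p \<equiv> \<lambda>j. p (Suc j)"

lemma fr_fc:
  "smooth_seq U p \<Longrightarrow> open S \<Longrightarrow> (\<And>x. x \<in> S \<Longrightarrow> rho y x \<in> U) \<Longrightarrow> smooth_fr S (\<lambda>x. fc n p (rho y x))"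
  unfolding fc_def divide_inverse
  by (intro fr_sum smooth_fr.single smooth_on_mult smooth_on_const smooth_seq_rho)

lemma central_fc: "central (fc n p r)"
  unfolding fc_def by (intro central_sum central_mult central_cnum central_power central_zeta)

lemma gpar_zeta_power: "gpar (zeta n ^ j) = zeta n ^ j"
  by (induction j) (simp_all add: gpar_mult gpar_zeta gpar_gconst[of 1, simplified])

lemma gpar_fc: "gpar (fc n p r) = fc n p r"
  by (simp add: fc_def gpar_sum gpar_mult gpar_zeta_power)

lemma gsup_fc: "gsup {1..4*n} (fc n p r)"
  unfolding fc_def by (intro gsup_sum gsup_mult gsup_gconst gsup_power gsup_zeta)

lemma pd_fc:
  assumes "smooth_seq U p" "open S" "\<And>x. x \<in> S \<Longrightarrow> rho y x \<in> U" "x \<in> S"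
  shows "pd i (\<lambda>x. fc n p (rho y x)) x = cnum (of_real (2 * (x $ i - y $ i))) * fc n (shift p) (rho y x)"
proof -
  have sm: "smooth_on S (\<lambda>x. p j (rho y x) / fact j)" for j
    unfolding divide_inverse by (intro smooth_on_mult smooth_on_const smooth_seq_rho[OF assms(1-3)] assms(2))
  have "pd i (\<lambda>x. fc n p (rho y x)) x = (\<Sum>j=0..n. pd i (\<lambda>x. cnum (p j (rho y x) / fact j) * zeta n ^ j) x)"
    unfolding fc_def by (rule pd_sum[OF assms(2,4)]) (rule smooth_fr.single[OF sm])
  also have "\<dots> = (\<Sum>j=0..n. cnum (pderivative i (\<lambda>x. p j (rho y x) / fact j) x) * zeta n ^ j)"
    by (simp only: pd_single[OF sm assms(4)])
  also have "\<dots> = (\<Sum>j=0..n. cnum (of_real (2 * (x $ i - y $ i))) * (cnum (p (Suc j) (rho y x) / fact j) * zeta n ^ j))"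
  proof (intro sum.cong refl)
    fix j
    have "pderivative i (\<lambda>x. p j (rho y x) / fact j) x = of_real (2 * (x $ i - y $ i)) * (p (Suc j) (rho y x) / fact j)"
      using pderivative_multc[OF smooth_seq_rho[OF assms(1-3)] assms(4), of i j "inverse (fact j)"]
        pderivative_rho[OF assms(1) assms(3)[OF assms(4)], of i j] by (simp add: divide_inverse mult.assoc)
    then show "cnum (pderivative i (\<lambda>x. p j (rho y x) / fact j) x) * zeta n ^ j
       = cnum (of_real (2 * (x $ i - y $ i))) * (cnum (p (Suc j) (rho y x) / fact j) * zeta n ^ j)"
      by (simp only: cnum_mult mult.assoc)
  qed
  finally show ?thesis unfolding fc_def sum_distrib_left .
qed

lemma of_nat_cnum: "of_nat k = (cnum (of_nat k) :: 'm::finite sval)"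
  by (induction k) (simp_all add: cl_scalar_add gconst_add)

lemma sum_shift: "(\<Sum>j=Suc 0..n. f j) = (\<Sum>j=0..<n. f (Suc j))" for f :: "nat \<Rightarrow> 'b::comm_monoid_add"
  by (induction n) simp_all

lemma gderiv_fc: "gderiv k (fc n p r :: 'm::finite sval) = gderiv k (zeta n) * fc n (shift p) r"
proof -
  let ?z = "zeta n :: 'm sval" and ?d = "gderiv k (zeta n :: 'm sval)"
  \<comment> \<open>Up to the factor n + 1 this is the derivative of zeta^(n+1) = 0. It permits
    adding the term j = n that the index shift leaves out.\<close>
  have top: "?z ^ n * ?d = 0"
  proof -
    have "of_nat (Suc n) * ?z ^ n * ?d = 0"
      unfolding gderiv_power[OF central_zeta gpar_zeta, symmetric] zeta_power(2) by simp
    then have "cnum (of_nat (Suc n)) * (?z ^ n * ?d) = cnum (of_nat (Suc n)) * 0"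
      by (simp only: of_nat_cnum mult.assoc mult_zero_right)
    then show ?thesis by (rule cnum_cancel[rotated]) (simp del: of_nat_Suc)
  qed
  have "gderiv k (fc n p r) = (\<Sum>j=0..n. cnum (p j r / fact j) * gderiv k (?z ^ j))"
    by (simp add: fc_def gderiv_sum gderiv_gconst_mult)
  also have "\<dots> = (\<Sum>j=0..<n. cnum (p (Suc j) r / fact j) * (?z ^ j * ?d))"
  proof -
    have "(\<Sum>j=0..n. cnum (p j r / fact j) * gderiv k (?z ^ j))
        = (\<Sum>j=Suc 0..n. cnum (p j r / fact j) * gderiv k (?z ^ j))"
      by (subst sum.atLeast_Suc_atMost) (simp_all add: gderiv_gconst[of _ 1, simplified])
    also have "\<dots> = (\<Sum>j=0..<n. cnum (p (Suc j) r / fact (Suc j)) * gderiv k (?z ^ Suc j))"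
      by (rule sum_shift)
    also have "\<dots> = (\<Sum>j=0..<n. cnum (p (Suc j) r / fact j) * (?z ^ j * ?d))"
    proof (intro sum.cong refl)
      fix j
      have "p (Suc j) r / fact (Suc j) * of_nat (Suc j) = p (Suc j) r / fact j"
        by (simp add: field_simps del: of_nat_Suc)
      then have "cnum (p (Suc j) r / fact (Suc j)) * cnum (of_nat (Suc j)) = (cnum (p (Suc j) r / fact j) :: 'm sval)"
        unfolding cnum_mult[symmetric] by (rule arg_cong)
      then show "cnum (p (Suc j) r / fact (Suc j)) * gderiv k (?z ^ Suc j) = cnum (p (Suc j) r / fact j) * (?z ^ j * ?d)"
        unfolding gderiv_power[OF central_zeta gpar_zeta] by (simp only: of_nat_cnum mult.assoc[symmetric])
    qed
    finally show ?thesis .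
  qed
  also have "\<dots> = (\<Sum>j=0..n. cnum (p (Suc j) r / fact j) * (?z ^ j * ?d))"
    by (simp only: atLeastLessThanSuc_atLeastAtMost[symmetric] sum.atLeastLessThan_Suc[OF le0] top mult_zero_right add_0_right)
  also have "\<dots> = fc n (shift p) r * ?d" by (simp only: fc_def sum_distrib_right mult.assoc)
  finally show ?thesis using centralD[OF central_fc] by simp
qed

text \<open>The j-th derivative of M p + r p': differentiating r p' j times yields r p^(j+1) + j
  p^(j).\<close>

definition euler_seq :: "nat \<Rightarrow> (nat \<Rightarrow> real \<Rightarrow> complex) \<Rightarrow> nat \<Rightarrow> real \<Rightarrow> complex" where
  "euler_seq M p j r = of_nat (M + j) * p j r + of_real r * p (Suc j) r"

lemma fc_euler:
  "cnum (of_nat M) * fc n p r + (cnum (of_real r) + zeta n) * fc n (shift p) r = (fc n (euler_seq M p) r :: 'm::finite sval)"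
proof -
  let ?z = "zeta n :: 'm sval"
  have "?z * fc n (shift p) r = (\<Sum>j=0..n. cnum (p (Suc j) r / fact j) * ?z ^ Suc j)"
    unfolding fc_def sum_distrib_left by (simp only: cnum_left[of ?z] power_Suc)
  \<comment> \<open>The term j = n carries zeta^(n+1) = 0.\<close>
  also have "\<dots> = (\<Sum>j=0..<n. cnum (p (Suc j) r / fact j) * ?z ^ Suc j)"
    by (simp only: atLeastLessThanSuc_atLeastAtMost[symmetric] sum.atLeastLessThan_Suc[OF le0] zeta_power mult_zero_right add_0_right)
  also have "\<dots> = (\<Sum>j=0..<n. cnum (of_nat (Suc j) * p (Suc j) r / fact (Suc j)) * ?z ^ Suc j)"
    by (intro sum.cong refl) (simp add: field_simps del: of_nat_Suc power_Suc)
  also have "\<dots> = (\<Sum>j=Suc 0..n. cnum (of_nat j * p j r / fact j) * ?z ^ j)"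
    by (rule sum_shift[symmetric])
  also have "\<dots> = (\<Sum>j=0..n. cnum (of_nat j * p j r / fact j) * ?z ^ j)"
    by (subst (2) sum.atLeast_Suc_atMost) simp_all
  finally have z: "?z * fc n (shift p) r = (\<Sum>j=0..n. cnum (of_nat j * p j r / fact j) * ?z ^ j)" .
  have "cnum (of_nat M) * fc n p r + (cnum (of_real r) + ?z) * fc n (shift p) r
     = (\<Sum>j=0..n. cnum (of_nat M) * (cnum (p j r / fact j) * ?z ^ j) + (cnum (of_real r) * (cnum (p (Suc j) r / fact j) * ?z ^ j)
         + cnum (of_nat j * p j r / fact j) * ?z ^ j))"
    unfolding distrib_right z by (simp only: fc_def sum_distrib_left sum.distrib)
  also have "\<dots> = fc n (euler_seq M p) r"
    unfolding fc_def
  proof (intro sum.cong refl)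
    fix j
    have "euler_seq M p j r / fact j = of_nat M * (p j r / fact j) + (of_real r * (p (Suc j) r / fact j) + of_nat j * p j r / fact j)"
      by (simp add: euler_seq_def field_simps)
    then show "cnum (of_nat M) * (cnum (p j r / fact j) * ?z ^ j) + (cnum (of_real r) * (cnum (p (Suc j) r / fact j) * ?z ^ j)
         + cnum (of_nat j * p j r / fact j) * ?z ^ j) = cnum (euler_seq M p j r / fact j) * ?z ^ j"
      by (simp only: cnum_add cnum_mult distrib_right mult.assoc)
  qed
  finally show ?thesis .
qed

lemma dirac_right_cong:
  assumes "open S" "x \<in> S" "\<And>x. x \<in> S \<Longrightarrow> F x = G x"
  shows "dirac_right n e f F x = dirac_right n e f G x"
proof -
  have "pd i F x = pd i G x" for i by (rule pd_cong[OF assms])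
  then show ?thesis using assms by (simp add: dirac_right_def)
qed

lemma dirac_left_cong:
  assumes "open S" "x \<in> S" "\<And>x. x \<in> S \<Longrightarrow> F x = G x"
  shows "dirac_left n e f F x = dirac_left n e f G x"
proof -
  have "pd i F x = pd i G x" for i by (rule pd_cong[OF assms])
  then show ?thesis using assms by (simp add: dirac_left_def)
qed

lemma dirac_right_cmult:
  assumes "smooth_fr S F" "open S" "x \<in> S"
  shows "dirac_right n e f (\<lambda>x. cnum c * F x) x = cnum c * dirac_right n e f F x"
proof -
  have "pd i (\<lambda>x. cnum c * F x) x = cnum c * pd i F x" for i
    by (rule pd_clinear_map[OF assms clinear_map_left])
  then show ?thesis
    by (simp add: dirac_right_def gpar_mult gderiv_gconst_mult distrib_left sum_distrib_left mult.assoc)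
qed

text \<open>The sums form the gradient of |Z - U|^2 belonging to D. That it is s X, together with
  X^2 = s |Z - U|^2, makes X times the gradient equal to |Z - U|^2.\<close>

lemma Xv_gradient:
  "(\<Sum>i\<in>UNIV. cnum (of_real (2 * (x $ i - y $ i))) * gconst (de s i)) + (\<Sum>k=1..2*n. gderiv k (zeta n) * gconst (df s k))
    = cnum s * (Xv n s y x :: 'm::finite sval)"
proof -
  have e: "cnum (of_real (2 * (x $ i - y $ i))) * gconst (de s i) = cnum s * (cnum (of_real (x $ i - y $ i)) * (gconst (ee s i) :: 'm sval))" for i
  proof -
    have "of_real (2 * (x $ i - y $ i)) * (s / 2) = s * of_real (x $ i - y $ i)" by (simp add: algebra_simps)
    then show ?thesis unfolding de_def gconst_mult mult.assoc[symmetric] cnum_mult[symmetric] by (simp only:)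
  qed
  have o: "gderiv (2*j-1) (zeta n) * gconst (df s (2*j-1)) + gderiv (2*j) (zeta n) * gconst (df s (2*j))
      = cnum s * (xi n (2*j-1) * gconst (os s (2*j-1)) + xi n (2*j) * (gconst (os s (2*j)) :: 'm sval))" if j: "j \<in> {1..n}" for j
  proof -
    have od: "odd (2*j-1)" "Suc (2*j-1) = 2*j" using j by auto
    have "gderiv (2*j-1) (zeta n) * gconst (df s (2*j-1)) = cnum s * (xi n (2*j) * (gconst (os s (2*j)) :: 'm sval))"
      unfolding gderiv_zeta(1)[OF j] df_def using od
      by (simp add: gconst_mult cnum_left[of "xi n (2*j)"] cl_scalar_uminus gconst_uminus)
    moreover have "gderiv (2*j) (zeta n) * gconst (df s (2*j)) = cnum s * (xi n (2*j-1) * (gconst (os s (2*j-1)) :: 'm sval))"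
      unfolding gderiv_zeta(2)[OF j] df_def by (simp add: gconst_mult cnum_left[of "xi n (2*j-Suc 0)"])
    ultimately show ?thesis by (simp only: distrib_left add_ac)
  qed
  have "(\<Sum>k=1..2*n. gderiv k (zeta n) * gconst (df s k)) = cnum s * (\<Sum>k=1..2*n. xi n k * (gconst (os s k) :: 'm sval))"
    unfolding sum_pairs sum_distrib_left by (rule sum.cong[OF refl o])
  moreover have "(\<Sum>i\<in>UNIV. cnum (of_real (2 * (x $ i - y $ i))) * gconst (de s i))
     = cnum s * (\<Sum>i\<in>UNIV. cnum (of_real (x $ i - y $ i)) * (gconst (ee s i) :: 'm sval))"
    unfolding sum_distrib_left e ..
  ultimately show ?thesis unfolding Xv_def distrib_left by simp
qed

text \<open>For a central function f of |X|^2 the Leibniz rule gives (X f) D = (X D) f + X (|X|^2 D)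
  f', which is M f + |X|^2 f' by \<open>dirac_right_Xv\<close>, \<open>Xv_gradient\<close> and
  \<open>Xv_square\<close>.\<close>

lemma dirac_right_kernel:
  fixes y :: "'m::finite point"
  assumes s: "s = 1 \<or> s = -1" and p: "smooth_seq U p" and S: "open S" "\<And>x. x \<in> S \<Longrightarrow> rho y x \<in> U" "x \<in> S"
    and M: "CARD('m) = n + M"
  shows "dirac_right n (de s) (df s) (\<lambda>x. Xv n s y x * fc n p (rho y x)) x = fc n (euler_seq M p) (rho y x)"
proof -
  let ?X = "Xv n s y x" and ?f = "fc n p (rho y x) :: 'm sval" and ?f' = "fc n (shift p) (rho y x) :: 'm sval"
  have ss: "s * s = 1" using s by auto
  have pdi: "pd i (\<lambda>x. Xv n s y x * fc n p (rho y x)) x * gconst (de s i)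
      = pd i (Xv n s y) x * gconst (de s i) * ?f + ?X * (cnum (of_real (2 * (x $ i - y $ i))) * gconst (de s i)) * ?f'" for i
  proof -
    have "pd i (\<lambda>x. Xv n s y x * fc n p (rho y x)) x
       = pd i (Xv n s y) x * ?f + ?X * (cnum (of_real (2 * (x $ i - y $ i))) * ?f')"
    proof -
      have "smooth_fr S (\<lambda>x. fc n p (rho y x))" by (rule fr_fc[OF p S(1)]) (rule S(2))
      moreover have "pd i (\<lambda>x. fc n p (rho y x)) x = cnum (of_real (2 * (x $ i - y $ i))) * ?f'"
        by (rule pd_fc[OF p S(1) _ S(3)]) (rule S(2))
      ultimately show ?thesis using pd_mult[OF fr_Xv[OF S(1)] _ S(1,3)] by simp
    qed
    then show ?thesis
      by (simp only: distrib_right mult.assoc centralD[OF central_fc, of n p _ "gconst (de s i)"]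
         centralD[OF central_fc, of n "shift p" _ "gconst (de s i)"])
  qed
  have gdk: "gderiv k (gpar (?X * ?f)) * gconst (df s k)
      = gderiv k (gpar ?X) * gconst (df s k) * ?f + ?X * (gderiv k (zeta n) * gconst (df s k)) * ?f'" for k
    unfolding gpar_mult gpar_fc gderiv_mult gpar_gpar gderiv_fc
    by (simp only: distrib_right mult.assoc centralD[OF central_fc, of n p _ "gconst (df s k)"]
         centralD[OF central_fc, of n "shift p" _ "gconst (df s k)"])
  have "dirac_right n (de s) (df s) (\<lambda>x. Xv n s y x * fc n p (rho y x)) x
     = dirac_right n (de s) (df s) (Xv n s y) x * ?f
       + ?X * ((\<Sum>i\<in>UNIV. cnum (of_real (2 * (x $ i - y $ i))) * gconst (de s i)) + (\<Sum>k=1..2*n. gderiv k (zeta n) * gconst (df s k))) * ?f'"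
    unfolding dirac_right_def[of n _ _ "\<lambda>x. Xv n s y x * fc n p (rho y x)"] pdi gdk
    unfolding dirac_right_def sum.distrib sum_distrib_left sum_distrib_right distrib_left distrib_right
    by (simp only: add_ac)
  also have "?X * ((\<Sum>i\<in>UNIV. cnum (of_real (2 * (x $ i - y $ i))) * gconst (de s i)) + (\<Sum>k=1..2*n. gderiv k (zeta n) * gconst (df s k)))
      = cnum (of_real (rho y x)) + zeta n"
    unfolding Xv_gradient cnum_left[of ?X s] Xv_square[OF s] using ss
    by (simp only: mult.assoc[symmetric] cnum_mult[symmetric]) simp
  also have "dirac_right n (de s) (df s) (Xv n s y) x = cnum (of_nat M)"
    unfolding dirac_right_Xv[OF s] M by simp
  finally show ?thesis unfolding fc_euler .
qed

subsection \<open>The kernel as a function of the squared distance\<close>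

text \<open>The derivatives of r^-M. With M = m - n, half the superdimension, this is the kernel's
  power of |Z - U|, since r stands for the square.\<close>

definition pw :: "nat \<Rightarrow> nat \<Rightarrow> real \<Rightarrow> complex" where
  "pw M j r = of_real ((\<Prod>i<j. - real M - real i) * r powr (- real M - real j))"

lemma smooth_seq_pw: "smooth_seq {0<..} (pw M)"
  unfolding smooth_seq_def
proof (intro conjI allI ballI)
  fix j and r :: real assume "r \<in> {0<..}"
  then have "((\<lambda>r. (\<Prod>i<j. - real M - real i) * r powr (- real M - real j)) has_real_derivative
     (\<Prod>i<Suc j. - real M - real i) * r powr (- real M - real (Suc j))) (at r)"
    by (auto intro!: derivative_eq_intros simp: algebra_simps)
  then show "(pw M j has_vector_derivative pw M (Suc j) r) (at r)"
    unfolding pw_def[abs_def] by (rule has_vector_derivative_of_real[unfolded has_real_derivative_iff_has_vector_derivative[symmetric]])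
qed simp

lemma gcomplex_xi: "gcomplex (xi n k) = xi n k"
  by (simp add: xi_def gcomplex_diff)

lemma gcomplex_zeta: "gcomplex (zeta n) = zeta n"
  by (simp add: zeta_def gcomplex_minus gcomplex_sum om_def gcomplex_mult gcomplex_xi)

lemma gcoeff_zeta_empty: "gcoeff (zeta n) {} = 0"
  by (simp add: zeta_def om_def gcoeff_sum times_grass.rep_eq xi_def gcoeff_gmono)

lemma Zvec_combine:
  fixes x y :: "'m::finite point"
  assumes s: "s = 1 \<or> s = -1"
  shows "Zvec n (x - y) (xi n) + cnum s * Zvec_dag n (x - y) (xi n) = Xv n s y x"
proof -
  have e: "cnum (zco (x - y) j) * gconst (ff j) + cnum s * (cnum (zco_c (x - y) j) * gconst (ff_dag j))
     = cnum (of_real (x $ Inl j - y $ Inl j)) * gconst (ee s (Inl j)) + cnum (of_real (x $ Inr j - y $ Inr j)) * gconst (ee s (Inr j))"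
    for j :: 'm
  proof -
    have *: "cnum (a + \<i> * b) * gconst u + cnum s * (cnum (a - \<i> * b) * gconst v)
       = cnum a * gconst (u + cl_scalar s * v) + cnum b * (gconst (cl_scalar \<i> * (u - cl_scalar s * v)) :: 'm sval)" for a b u v
    proof -
      have "cnum (a + \<i> * b) * gconst u + cnum s * (cnum (a - \<i> * b) * gconst v)
        = cnum a * gconst u + cnum (b * \<i>) * gconst u + (cnum (a * s) * gconst v - cnum (b * (\<i> * s)) * gconst v)"
        unfolding mult.assoc[symmetric] cnum_mult[symmetric]
        by (simp only: cl_scalar_add[symmetric] gconst_add[symmetric] distrib_right[symmetric] left_diff_distrib[symmetric]
           gconst_diff[symmetric] cl_scalar_diff[symmetric]) (simp add: algebra_simps)
      then show ?thesis
        by (simp only: gconst_add gconst_diff gconst_mult cnum_mult distrib_left right_diff_distrib mult.assoc)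
          (simp only: add_ac diff_conv_add_uminus)
    qed
    show ?thesis unfolding zco_def zco_c_def * ff_combine[OF s] by simp
  qed
  have o: "gcomplex (szco (xi n) j) * gconst (fs j) + cnum s * (gcomplex (szco_c (xi n) j) * gconst (fs_dag j))
     = xi n (2*j-1) * gconst (os s (2*j-1)) + xi n (2*j) * (gconst (os s (2*j)) :: 'm sval)" if j: "j \<in> {1..n}" for j
  proof -
    have *: "(a + cnum \<i> * b) * gconst u + cnum s * ((a - cnum \<i> * b) * gconst v)
       = a * gconst (u + cl_scalar s * v) + b * (gconst (cl_scalar \<i> * (u - cl_scalar s * v)) :: 'm sval)" for a b u v
      by (simp only: gconst_add gconst_diff gconst_mult distrib_left distrib_right left_diff_distrib right_diff_distrib mult.assoc
            cnum_left[of a] cnum_left[of b] cnum_left[of "cnum s" \<i>])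
         (simp only: add_ac diff_conv_add_uminus)
    have "1 \<le> j" using j by simp
    then show ?thesis
      by (simp only: szco_def szco_c_def gcomplex_add gcomplex_diff gcomplex_mult gcomplex_gconst gcomplex_xi * fs_combine[OF s])
  qed
  have "Zvec n (x - y) (xi n) + cnum s * Zvec_dag n (x - y) (xi n)
     = (\<Sum>j\<in>UNIV. cnum (zco (x - y) j) * gconst (ff j) + cnum s * (cnum (zco_c (x - y) j) * gconst (ff_dag j)))
      + (\<Sum>j=1..n. gcomplex (szco (xi n) j) * gconst (fs j) + cnum s * (gcomplex (szco_c (xi n) j) * gconst (fs_dag j)))"
    unfolding Zvec_def Zvec_dag_def distrib_left sum_distrib_left sum.distrib by (simp only: add_ac)
  also have "(\<Sum>j=1..n. gcomplex (szco (xi n) j) * gconst (fs j) + cnum s * (gcomplex (szco_c (xi n) j) * gconst (fs_dag j)))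
     = (\<Sum>j=1..n. xi n (2*j-1) * gconst (os s (2*j-1)) + xi n (2*j) * (gconst (os s (2*j)) :: 'm sval))"
    by (rule sum.cong[OF refl o])
  finally show ?thesis unfolding e Xv_def sum_UNIV_Plus sum_pairs by (simp only: sum.distrib)
qed

lemma Znorm2_xi: "Znorm2 n (x - y) (xi n) = gconst (of_real (rho y x)) + zeta n"
proof -
  have "zco (x - y) j * zco_c (x - y) j = of_real ((x $ Inl j - y $ Inl j)\<^sup>2 + (x $ Inr j - y $ Inr j)\<^sup>2)" for j
    by (simp add: zco_def zco_c_def power2_eq_square algebra_simps)
  then have "(\<Sum>j\<in>UNIV. zco (x - y) j * zco_c (x - y) j) = of_real (rho y x)"
    by (simp add: rho_sum sum_UNIV_Plus sum.distrib)
  moreover have "gconst (\<i> / 2) * (\<Sum>j=1..n. szco (xi n) j * szco_c (xi n) j) = (\<Sum>j=1..n. om n j)"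
    unfolding sum_distrib_left
  proof (intro sum.cong refl)
    fix j
    let ?a = "xi n (2*j-1) :: complex grass" and ?b = "xi n (2*j) :: complex grass" and ?i = "gconst \<i> :: complex grass"
    have ci: "c * ?i = ?i * c" for c :: "complex grass" by (rule grass_eqI) (simp add: mult.commute)
    have ci': "c * (?i * d) = ?i * (c * d)" for c d :: "complex grass" by (simp only: mult.assoc[symmetric] ci)
    have "(?a + ?i * ?b) * (?a - ?i * ?b) = ?a * ?a - ?i * (?a * ?b) + ?i * (?b * ?a) - ?i * (?i * (?b * ?b))"
      by (simp only: distrib_right right_diff_distrib mult.assoc ci'[of ?a] ci'[of ?b]) (simp add: algebra_simps)
    also have "\<dots> = - (?i * (?a * ?b)) - ?i * (?a * ?b)"
      using xi_anticommute[of n "2*j" "2*j-1", where 'a = complex] by (simp add: xi_square)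
    also have "\<dots> = gconst (-2 * \<i>) * (?a * ?b)"
    proof -
      have "gconst (-2 * \<i>) = - ?i - ?i" by (rule grass_eqI) (simp add: gcoeff_gconst)
      then show ?thesis by (simp only: left_diff_distrib mult_minus_left)
    qed
    finally have "gconst (\<i> / 2) * (szco (xi n) j * szco_c (xi n) j) = gconst (\<i> / 2) * (gconst (-2 * \<i>) * (?a * ?b))"
      by (simp only: szco_def szco_c_def)
    also have "\<dots> = gconst (\<i> / 2 * (-2 * \<i>)) * (?a * ?b)" by (simp only: gconst_mult mult.assoc)
    finally show "gconst (\<i> / 2) * (szco (xi n) j * szco_c (xi n) j) = om n j"
      by (simp add: om_def)
  qed
  ultimately show ?thesis by (simp add: Znorm2_def zeta_def)
qed

lemma Psi_combine:
  fixes x y :: "'m::finite point"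
  assumes s: "s = 1 \<or> s = -1" and M: "CARD('m) = n + M" and x: "x \<noteq> y"
  shows "Psi1 n (x - y) (xi n) + cnum s * Psi1_dag n (x - y) (xi n)
    = cnum (of_real (2 / supersphere_area n TYPE('m))) * (Xv n s y x * fc n (pw M) (rho y x))"
proof -
  let ?N = "Znorm2 n (x - y) (xi n)" and ?C = "cnum (of_real (2 / supersphere_area n TYPE('m)))"
  have r: "body ?N = rho y x" "nilpart ?N = zeta n"
    unfolding Znorm2_xi by (simp_all add: body_def nilpart_def gcoeff_gconst gcoeff_zeta_empty)
  have d: "superdim n TYPE('m) / 2 = real M" by (simp add: superdim_def M)
  have p: "gcomplex (gpow n ?N (- (superdim n TYPE('m) / 2))) = (fc n (pw M) (rho y x) :: 'm sval)"
    unfolding d gpow_def r fc_def gcomplex_sum gcomplex_mult gcomplex_gconst gcomplex_power gcomplex_zeta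
    by (simp add: pw_def)
  have "Psi1 n (x - y) (xi n) + cnum s * Psi1_dag n (x - y) (xi n)
    = ?C * (Zvec n (x - y) (xi n) + cnum s * Zvec_dag n (x - y) (xi n)) * fc n (pw M) (rho y x)"
    unfolding Psi1_def Psi1_dag_def p by (simp only: distrib_left distrib_right mult.assoc cnum_left[of ?C s])
  then show ?thesis unfolding Zvec_combine[OF s] by (simp only: mult.assoc)
qed

subsection \<open>Regularised kernels\<close>

lemma smooth_seq_vd_iter: "smooth_on U f \<Longrightarrow> open U \<Longrightarrow> smooth_seq U (\<lambda>j. (vd ^^ j) f)"
  unfolding smooth_seq_def using smooth_on_vd(1)[OF smooth_on_vd_iter] by auto

lemma vd_iter_smooth_seq:
  assumes "smooth_seq U p" shows "r \<in> U \<Longrightarrow> (vd ^^ j) (p 0) r = p j r"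
proof (induction j arbitrary: r)
  case (Suc j)
  have "vd ((vd ^^ j) (p 0)) r = vd (p j) r"
    by (rule vd_cong[of U]) (use assms Suc in \<open>auto simp: smooth_seq_def\<close>)
  then show ?case using assms Suc.prems by (simp add: smooth_seq_def vd_eqI)
qed simp

text \<open>\<open>W M\<close> is the power \<open>u^-M\<close>, set to \<open>0\<close> near the origin. Its rescaling \<open>ww M c\<close> agrees with the kernel
  function \<open>pw M\<close> where \<open>c * r > 1\<close>, and \<open>KK\<close> describes the image of the modified kernel under the Dirac
  operator; it vanishes outside the unit interval because \<open>u^-M\<close> is homogeneous of degree \<open>-M\<close>.\<close>

definition W :: "nat \<Rightarrow> real \<Rightarrow> complex" where
  "W M u = smooth_step (2 * u - 1) * inverse (of_real u) ^ M"

definition WW :: "nat \<Rightarrow> nat \<Rightarrow> real \<Rightarrow> complex" where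
  "WW M j = (vd ^^ j) (W M)"

lemma smooth_on_W: "smooth_on UNIV (W M)"
proof (rule smooth_on_local)
  fix u :: real
  show "\<exists>T. open T \<and> u \<in> T \<and> smooth_on T (W M)"
  proof (cases "u < 1/2")
    case True
    have "smooth_on {..<1/2} (W M)"
      by (rule smooth_on_cong[OF smooth_on_const[of _ 0]]) (auto simp: W_def smooth_step_eq)
    then show ?thesis using True by (intro exI[of _ "{..<1/2}"]) auto
  next
    case False
    have a: "smooth_on {1/4<..} (\<lambda>u. complex_of_real u)"
      by (intro smooth_on_bounded_linear bounded_linear_of_real) simp
    have "smooth_on {1/4<..} (\<lambda>u. of_real 2 * complex_of_real u - 1)"
      by (intro smooth_on_diff smooth_on_mult smooth_on_const a) auto
    then have "smooth_on {1/4<..} (\<lambda>u. complex_of_real (2 * u - 1))" by simp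
    then have b: "smooth_on {1/4<..} (\<lambda>u. smooth_step (2 * u - 1))"
      by (rule smooth_on_compose[OF smooth_on_smooth_step]) auto
    have "smooth_on {1/4<..} (W M)"
      unfolding W_def[abs_def] by (intro smooth_on_mult smooth_on_power smooth_on_inverse a b) auto
    then show ?thesis using False by (intro exI[of _ "{1/4<..}"]) auto
  qed
qed

lemma smooth_seq_WW: "smooth_seq UNIV (WW M)"
  unfolding WW_def[abs_def] by (intro smooth_seq_vd_iter smooth_on_W open_UNIV)

lemma WW_zero: "u < 1/2 \<Longrightarrow> WW M j u = 0"
proof -
  assume u: "u < 1/2"
  have "WW M j u = (vd ^^ j) (\<lambda>_. 0) u"
    unfolding WW_def by (rule vd_iter_cong[of "{..<1/2}"]) (use u in \<open>auto simp: W_def smooth_step_eq\<close>)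
  also have "\<dots> = 0" using vd_iter_const[of j 0] by (cases "j = 0") auto
  finally show ?thesis .
qed

lemma WW_pw: "u > 1 \<Longrightarrow> WW M j u = pw M j u"
proof -
  assume u: "u > 1"
  have w: "W M v = pw M 0 v" if "v \<in> {1<..}" for v
  proof -
    have "v powr (- real M) = inverse v ^ M"
      using that by (simp add: powr_minus powr_realpow power_inverse)
    then show ?thesis using that by (simp add: W_def smooth_step_eq pw_def)
  qed
  have "smooth_seq {1<..} (pw M)" using smooth_seq_pw[of M] by (auto simp: smooth_seq_def)
  then have "(vd ^^ j) (pw M 0) u = pw M j u" by (rule vd_iter_smooth_seq) (use u in simp)
  moreover have "WW M j u = (vd ^^ j) (pw M 0) u"
    unfolding WW_def by (rule vd_iter_cong[of "{1<..}"]) (use u w in auto)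
  ultimately show ?thesis by simp
qed

definition ww :: "nat \<Rightarrow> real \<Rightarrow> nat \<Rightarrow> real \<Rightarrow> complex" where
  "ww M c j r = of_real (c ^ (M + j)) * WW M j (c * r)"

lemma smooth_seq_ww: "smooth_seq UNIV (ww M c)"
  unfolding smooth_seq_def
proof (intro conjI allI ballI)
  fix j and r :: real
  have "(WW M j has_vector_derivative WW M (Suc j) (c * r)) (at (c * r))"
    using smooth_seq_WW by (simp add: smooth_seq_def)
  moreover have "((\<lambda>r. c * r) has_vector_derivative c) (at r)"
    by (auto intro!: derivative_eq_intros simp: has_real_derivative_iff_has_vector_derivative[symmetric])
  ultimately have "((WW M j \<circ> (\<lambda>r. c * r)) has_vector_derivative c *\<^sub>R WW M (Suc j) (c * r)) (at r)"
    by (intro vector_diff_chain_at) auto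
  from has_vector_derivative_mult_right[OF this, of "of_real (c ^ (M + j))"]
  show "(ww M c j has_vector_derivative ww M c (Suc j) r) (at r)"
    by (simp add: ww_def[abs_def] comp_def scaleR_conv_of_real mult_ac)
qed simp

text \<open>The j-th derivative of r^-M is homogeneous of degree -M - j, which the factor c^(M + j)
  compensates.\<close>

lemma ww_pw:
  assumes "c > 0" "c * r > 1" shows "ww M c j r = pw M j r"
proof -
  have r: "r > 0" using assms by (metis less_trans zero_less_mult_pos zero_less_one)
  have "c ^ (M + j) * (c * r) powr (- real M - real j) = r powr (- real M - real j)"
  proof -
    have "(c * r) powr (- real M - real j) = c powr (- real M - real j) * r powr (- real M - real j)"
      by (rule powr_mult)
    moreover have "- real M - real j = - real (M + j)" by simp
    then have "c powr (- real M - real j) = inverse (c ^ (M + j))"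
      using assms by (simp only: powr_minus powr_realpow)
    ultimately show ?thesis using assms by simp
  qed
  then have "c ^ (M + j) * ((\<Prod>i<j. - real M - real i) * (c * r) powr (- real M - real j))
      = (\<Prod>i<j. - real M - real i) * r powr (- real M - real j)"
    by (subst mult.left_commute) (simp only:)
  then show ?thesis
    unfolding ww_def WW_pw[OF assms(2)] pw_def of_real_mult[symmetric] by (rule arg_cong)
qed

definition KK :: "nat \<Rightarrow> nat \<Rightarrow> real \<Rightarrow> complex" where
  "KK M = euler_seq M (WW M)"

lemma euler_seq_ww: "euler_seq M (ww M c) j r = of_real (c ^ (M + j)) * KK M j (c * r)"
  by (simp add: euler_seq_def KK_def ww_def algebra_simps)

lemma smooth_seq_KK: "smooth_seq UNIV (KK M)"
  unfolding smooth_seq_def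
proof (intro conjI allI ballI)
  fix j and u :: real
  have d: "(WW M j has_vector_derivative WW M (Suc j) u) (at u)" for j
    using smooth_seq_WW by (simp add: smooth_seq_def)
  have "((\<lambda>u. complex_of_real u) has_vector_derivative 1) (at u)"
    using has_vector_derivative_of_real[OF DERIV_ident] by fastforce
  then have "((\<lambda>u. of_nat (M + j) * WW M j u + of_real u * WW M (Suc j) u) has_vector_derivative
     of_nat (M + j) * WW M (Suc j) u + (of_real u * WW M (Suc (Suc j)) u + 1 * WW M (Suc j) u)) (at u)"
    by (intro has_vector_derivative_add has_vector_derivative_mult has_vector_derivative_mult_right d)
  then show "(KK M j has_vector_derivative KK M (Suc j) u) (at u)"
    by (simp add: KK_def euler_seq_def[abs_def] algebra_simps)
qed simp

lemma KK_continuous: "continuous_on UNIV (KK M j)"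
  using smooth_seq_smooth[OF smooth_seq_KK] smooth_on_continuous by blast

text \<open>Below 1/2 the cutoff is 0; above 1 the Euler operator annihilates u^-M; the point 1 is
  reached by continuity.\<close>

lemma KK_zero: "u \<notin> {0<..<1} \<Longrightarrow> KK M j u = 0"
proof -
  have a: "KK M j u = 0" if "u < 1/2" for u
    using that by (simp add: KK_def euler_seq_def WW_zero)
  have b: "KK M j u = 0" if "u > 1" for u
  proof -
    define b where "b = u powr (- real M - real (Suc j))"
    have "u powr (- real M - real j) = u * b"
      using that by (simp add: b_def powr_diff powr_minus field_simps powr_add)
    then have "real (M + j) * ((\<Prod>i<j. - real M - real i) * u powr (- real M - real j))
       + u * ((\<Prod>i<Suc j. - real M - real i) * b) = 0"
      by (simp add: algebra_simps)
    note this [unfolded b_def]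
    then have "complex_of_real (real (M + j) * ((\<Prod>i<j. - real M - real i) * u powr (- real M - real j))
       + u * ((\<Prod>i<Suc j. - real M - real i) * u powr (- real M - real (Suc j)))) = 0"
      by (simp only: of_real_0)
    then show ?thesis
      unfolding KK_def euler_seq_def WW_pw[OF that] pw_def by (simp only: of_real_add of_real_mult of_real_of_nat_eq)
  qed
  have c: "KK M j 1 = 0"
  proof (rule tendsto_unique)
    show "(KK M j \<longlongrightarrow> KK M j 1) (at_right 1)"
      using KK_continuous by (auto simp: continuous_on_eq_continuous_at isCont_def intro: tendsto_within_subset)
    show "(KK M j \<longlongrightarrow> 0) (at_right 1)"
      by (rule Lim_transform_eventually[OF tendsto_const]) (auto simp: eventually_at_filter b)
  qed simp
  show "u \<notin> {0<..<1} \<Longrightarrow> KK M j u = 0" using a[of u] b[of u] c by (cases "u = 1") auto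
qed

section \<open>The radial integral\<close>

lemma KK_deriv: "(KK M j has_vector_derivative KK M (Suc j) t) (at t)"
  using smooth_seq_KK by (simp add: smooth_seq_def)

lemma power_deriv: "((\<lambda>t. complex_of_real t ^ Suc p) has_vector_derivative of_nat (Suc p) * of_real t ^ p) (at t)"
  using has_vector_derivative_of_real[OF DERIV_pow[of "Suc p" t UNIV]] by (simp del: of_nat_Suc)

text \<open>Integration by parts, without boundary terms since \<open>KK\<close> vanishes at 0 and
  at 1.\<close>

lemma KK_moment_step:
  "integral {0..1} (\<lambda>t. of_real t ^ Suc p * KK M (Suc j) t) = - of_nat (Suc p) * integral {0..1} (\<lambda>t. of_real t ^ p * KK M j t)"
proof -
  have ci: "(\<lambda>t. complex_of_real t ^ k * KK M i t) integrable_on {0..1}" for k i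
  proof -
    have "continuous_on {0..1} (KK M i)" by (rule continuous_on_subset[OF KK_continuous]) simp
    then show ?thesis by (intro integrable_continuous_real continuous_intros)
  qed
  have "((\<lambda>t. complex_of_real t ^ Suc p * KK M j t) has_vector_derivative
     (of_real t ^ Suc p * KK M (Suc j) t + of_nat (Suc p) * of_real t ^ p * KK M j t)) (at t within {0..1})" for t
    by (rule has_vector_derivative_at_within, rule has_vector_derivative_mult[OF power_deriv KK_deriv])
  then have "((\<lambda>t. of_real t ^ Suc p * KK M (Suc j) t + of_nat (Suc p) * of_real t ^ p * KK M j t) has_integral
     complex_of_real 1 ^ Suc p * KK M j 1 - complex_of_real 0 ^ Suc p * KK M j 0) {0..1}"
    by (intro fundamental_theorem_of_calculus) auto
  then have "((\<lambda>t. of_real t ^ Suc p * KK M (Suc j) t + of_nat (Suc p) * (of_real t ^ p * KK M j t)) has_integral 0) {0..1}"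
    by (simp add: KK_zero mult.assoc)
  then have "integral {0..1} (\<lambda>t. of_real t ^ Suc p * KK M (Suc j) t + of_nat (Suc p) * (of_real t ^ p * KK M j t)) = 0"
    by (rule integral_unique)
  moreover have "integral {0..1} (\<lambda>t. of_real t ^ Suc p * KK M (Suc j) t + of_nat (Suc p) * (of_real t ^ p * KK M j t))
     = integral {0..1} (\<lambda>t. of_real t ^ Suc p * KK M (Suc j) t) + of_nat (Suc p) * integral {0..1} (\<lambda>t. of_real t ^ p * KK M j t)"
    by (subst Henstock_Kurzweil_Integration.integral_add[OF ci integrable_on_mult_right[OF ci]]) simp
  ultimately show ?thesis by (simp add: add_eq_0_iff2 del: of_nat_Suc power_Suc)
qed

text \<open>With M = p + 1 the integrand is the derivative of t^M W(t), so the integral is W(1) = 1,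
  whatever the cutoff does in between.\<close>

lemma KK_moment_base: "integral {0..1} (\<lambda>t. of_real t ^ p * KK (Suc p) 0 t) = 1"
proof -
  have dW: "(W (Suc p) has_vector_derivative WW (Suc p) 1 t) (at t)" for t
  proof -
    have "(WW (Suc p) 0 has_vector_derivative WW (Suc p) (Suc 0) t) (at t)"
      using smooth_seq_WW[of "Suc p"] unfolding smooth_seq_def by blast
    moreover have "WW (Suc p) 0 = W (Suc p)" by (simp add: WW_def)
    ultimately show ?thesis by simp
  qed
  have "((\<lambda>t. complex_of_real t ^ Suc p * W (Suc p) t) has_vector_derivative
     (of_real t ^ Suc p * WW (Suc p) 1 t + of_nat (Suc p) * of_real t ^ p * W (Suc p) t)) (at t within {0..1})" for t
    by (rule has_vector_derivative_at_within, rule has_vector_derivative_mult[OF power_deriv dW])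
  then have "((\<lambda>t. of_real t ^ Suc p * WW (Suc p) 1 t + of_nat (Suc p) * of_real t ^ p * W (Suc p) t) has_integral
     complex_of_real 1 ^ Suc p * W (Suc p) 1 - complex_of_real 0 ^ Suc p * W (Suc p) 0) {0..1}"
    by (intro fundamental_theorem_of_calculus) auto
  moreover have "of_real t ^ Suc p * WW (Suc p) 1 t + of_nat (Suc p) * of_real t ^ p * W (Suc p) t = of_real t ^ p * KK (Suc p) 0 t" for t
    by (simp add: KK_def euler_seq_def WW_def algebra_simps)
  ultimately have "((\<lambda>t. of_real t ^ p * KK (Suc p) 0 t) has_integral 1) {0..1}"
    by (simp add: W_def smooth_step_eq)
  then show ?thesis by (rule integral_unique)
qed

lemma KK_moment:
  "integral {0..1} (\<lambda>t. of_real t ^ (p + k) * KK (Suc p) k t) = (-1) ^ k * (fact (p + k) / fact p)"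
proof (induction k)
  case 0
  then show ?case by (simp add: KK_moment_base)
next
  case (Suc k)
  have "integral {0..1} (\<lambda>t. of_real t ^ (p + Suc k) * KK (Suc p) (Suc k) t)
     = - of_nat (Suc (p + k)) * integral {0..1} (\<lambda>t. of_real t ^ (p + k) * KK (Suc p) k t)"
    unfolding add_Suc_right by (rule KK_moment_step)
  then show ?case unfolding Suc.IH by (simp del: of_nat_Suc)
qed

lemma ball_level_measure:
  fixes t :: real
  assumes "t \<ge> 0"
  shows "measure lborel {v :: 'm::finite point. v \<bullet> v \<le> t} = pi ^ CARD('m) / fact CARD('m) * t ^ CARD('m)"
proof -
  have "v \<bullet> v \<le> t \<longleftrightarrow> v \<in> cball 0 (sqrt t)" for v :: "'m point"
    using assms by (metis dot_square_norm mem_cball_0 norm_ge_zero real_sqrt_le_iff real_sqrt_abs abs_of_nonneg)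
  then have "{v :: 'm point. v \<bullet> v \<le> t} = cball 0 (sqrt t)" by blast
  moreover have D: "DIM('m point) = 2 * CARD('m)" by (simp add: card_UNIV_sum)
  moreover have q: "sqrt t ^ (2 * CARD('m)) = t ^ CARD('m)" using assms by (simp only: power_mult real_sqrt_pow2)
  have "measure lborel (cball (0 :: 'm point) (sqrt t)) = unit_ball_vol (real DIM('m point)) * sqrt t ^ DIM('m point)"
    using assms by (intro content_cball) simp
  ultimately show ?thesis unfolding D unit_ball_vol_even q by simp
qed

text \<open>As \<open>KK\<close> vanishes at 1 and beyond, its value at |v|^2 \<le> 1 is minus the
  integral of its derivative from |v|^2 to 1. Exchanging the integrals produces the ball volume pi^m
  t^m / m!, and the moment of order m = p + (n + 1) gives (-1)^(n+1) m!/p!.\<close>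

lemma radial_integral:
  assumes "CARD('m::finite) = n + Suc p"
  shows "(LINT v :: 'm point|lborel. KK (Suc p) n (v \<bullet> v)) = (-1) ^ n * of_real (pi ^ CARD('m)) / fact p"
proof -
  let ?K = "KK (Suc p) n" and ?K' = "KK (Suc p) (Suc n)" and ?m = "CARD('m)"
  define P where "P z = indicator {z. fst z \<in> {0..1} \<and> snd z \<bullet> snd z \<le> fst z} z *\<^sub>R ?K' (fst z)" for z :: "real \<times> 'm point"
  have K'c: "continuous_on UNIV ?K'" by (rule KK_continuous)
  have K'm [measurable]: "?K' \<in> borel_measurable borel" by (rule borel_measurable_continuous_onI[OF K'c])
  have set: "{z :: real \<times> 'm point. fst z \<in> {0..1} \<and> snd z \<bullet> snd z \<le> fst z} \<in> sets (lborel \<Otimes>\<^sub>M lborel)"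
  proof -
    have "closed {z :: real \<times> 'm point. fst z \<in> {0..1} \<and> snd z \<bullet> snd z \<le> fst z}"
      unfolding atLeastAtMost_iff by (intro closed_Collect_conj closed_Collect_le continuous_intros)
    then show ?thesis unfolding lborel_prod sets_lborel by (rule borel_closed)
  qed
  have base: "integrable (lborel \<Otimes>\<^sub>M lborel) (\<lambda>z. indicator ({0..1} \<times> cball (0 :: 'm point) 1) z *\<^sub>R ?K' (fst z))"
    unfolding lborel_prod
    by (intro borel_integrable_compact continuous_on_compose2[OF K'c] continuous_intros) (auto intro: compact_Times)
  have Pi: "integrable (lborel \<Otimes>\<^sub>M lborel) P"
  proof -
    have "integrable (lborel \<Otimes>\<^sub>M lborel) (\<lambda>z. indicator {z. fst z \<in> {0..1} \<and> snd z \<bullet> snd z \<le> fst z} z *\<^sub>R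
        (indicator ({0..1} \<times> cball (0 :: 'm point) 1) z *\<^sub>R ?K' (fst z)))"
      by (rule integrable_mult_indicator[OF set base])
    moreover have "indicator {z. fst z \<in> {0..1} \<and> snd z \<bullet> snd z \<le> fst z} z *\<^sub>R
        (indicator ({0..1} \<times> cball (0 :: 'm point) 1) z *\<^sub>R ?K' (fst z)) = P z" for z
    proof -
      have "snd z \<in> cball 0 1" if "snd z \<bullet> snd z \<le> fst z" "fst z \<le> 1"
      proof -
        have "(norm (snd z))\<^sup>2 \<le> 1\<^sup>2" using that by (simp add: dot_square_norm)
        then show ?thesis using power2_le_imp_le[of "norm (snd z)" 1] by simp
      qed
      then show ?thesis by (cases z) (auto simp: P_def indicator_def)
    qed
    ultimately show ?thesis by simp
  qed
  have in1: "(LINT v|lborel. P (t, v)) = indicator {0..1} t *\<^sub>R (of_real (pi ^ ?m / fact ?m) * (of_real t ^ ?m * ?K' t))" for t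
  proof (cases "t \<in> {0..1}")
    case True
    have fin: "emeasure lborel {v :: 'm point. v \<bullet> v \<le> t} < \<infinity>"
    proof -
      have "{v :: 'm point. v \<bullet> v \<le> t} \<subseteq> cball 0 1"
      proof
        fix v :: "'m point" assume "v \<in> {v. v \<bullet> v \<le> t}"
        then have "(norm v)\<^sup>2 \<le> 1\<^sup>2" using True by (simp add: dot_square_norm)
        then show "v \<in> cball 0 1" using power2_le_imp_le[of "norm v" 1] by simp
      qed
      then have "emeasure lborel {v :: 'm point. v \<bullet> v \<le> t} \<le> emeasure lborel (cball (0 :: 'm point) 1)"
        by (rule emeasure_mono) simp
      also have "\<dots> < \<infinity>" by (rule emeasure_lborel_cball_finite)
      finally show ?thesis .
    qed
    have "(LINT v|lborel. P (t, v)) = (LINT v|lborel. indicator {v :: 'm point. v \<bullet> v \<le> t} v *\<^sub>R ?K' t)"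
      using True unfolding P_def by (intro Bochner_Integration.integral_cong) (auto simp: indicator_def)
    also have "\<dots> = (LINT v|lborel. indicator {v :: 'm point. v \<bullet> v \<le> t} v) *\<^sub>R ?K' t"
      using fin by (intro integral_scaleR_left integrable_real_indicator) auto
    finally show ?thesis using True ball_level_measure[of t, where 'm = 'm] by (simp add: scaleR_conv_of_real)
  next
    case False
    then have "P (t, v) = 0" for v by (auto simp: P_def)
    then show ?thesis using False by simp
  qed
  have in2: "(LINT t|lborel. P (t, v)) = - ?K (v \<bullet> v)" for v
  proof (cases "v \<bullet> v \<le> 1")
    case True
    have "(LINT t|lborel. P (t, v)) = (LINT t:{v \<bullet> v..1}|lborel. ?K' t)"
      unfolding set_lebesgue_integral_def P_def
    proof (intro Bochner_Integration.integral_cong refl)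
      fix t
      have "0 \<le> t" if "v \<bullet> v \<le> t" using inner_ge_zero[of v] that by linarith
      then show "indicator {z. fst z \<in> {0..1} \<and> snd z \<bullet> snd z \<le> fst z} (t, v) *\<^sub>R ?K' (fst (t, v)) = indicator {v \<bullet> v..1} t *\<^sub>R ?K' t"
        by (cases "v \<bullet> v \<le> t") (simp_all add: indicator_def)
    qed
    also have "\<dots> = integral {v \<bullet> v..1} ?K'"
      by (rule set_borel_integral_eq_integral, rule borel_integrable_atLeastAtMost', rule continuous_on_subset[OF K'c subset_UNIV])
    also have "\<dots> = ?K 1 - ?K (v \<bullet> v)"
      by (rule integral_unique, rule fundamental_theorem_of_calculus[OF True])
        (rule has_vector_derivative_at_within[OF KK_deriv])
    finally show ?thesis by (simp add: KK_zero)
  next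
    case False
    then have "P (t, v) = 0" for t by (auto simp: P_def indicator_def)
    then show ?thesis using False by (simp add: KK_zero)
  qed
  have "(LINT v|lborel. LINT t|lborel. P (t, v)) = (LINT t|lborel. LINT v|lborel. P (t, v))"
    using lborel_pair.Fubini_integral[of "\<lambda>t v. P (t, v)"] Pi by simp
  then have "- (LINT v :: 'm point|lborel. ?K (v \<bullet> v)) = (LINT t:{0..1}|lborel. of_real (pi ^ ?m / fact ?m) * (of_real t ^ ?m * ?K' t))"
    by (simp only: in1 in2 set_lebesgue_integral_def Bochner_Integration.integral_minus)
  also have "\<dots> = of_real (pi ^ ?m / fact ?m) * (LINT t:{0..1}|lborel. of_real t ^ ?m * ?K' t)"
    by (rule set_integral_mult_right)
  also have "(LINT t:{0..1}|lborel. of_real t ^ ?m * ?K' t) = integral {0..1} (\<lambda>t. of_real t ^ ?m * ?K' t)"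
    by (rule set_borel_integral_eq_integral, rule borel_integrable_atLeastAtMost',
        intro continuous_on_mult continuous_on_power continuous_on_of_real continuous_on_id, rule continuous_on_subset[OF K'c subset_UNIV])
  also have "\<dots> = (-1) ^ Suc n * (fact ?m / fact p)"
    using KK_moment[of p "Suc n"] assms by (simp add: add.commute)
  finally have "(LINT v :: 'm point|lborel. ?K (v \<bullet> v)) = - (of_real (pi ^ ?m / fact ?m) * ((-1) ^ Suc n * (fact ?m / fact p)))"
    by (simp only: minus_equation_iff[of "LINT v :: 'm point|lborel. ?K (v \<bullet> v)"] eq_commute)
  also have "of_real (pi ^ ?m / fact ?m) * ((-1) ^ Suc n * (fact ?m / fact p)) = - ((-1) ^ n * complex_of_real (pi ^ ?m) / fact p)"
    by simp
  finally show ?thesis by simp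
qed

section \<open>Rescaling and the approximate identity\<close>

lemma lborel_scale:
  fixes F :: "'m::finite point \<Rightarrow> complex"
  assumes F: "continuous_on UNIV F" and e: "e > 0"
  shows "(LINT x|lborel. F x) = of_real (e ^ (2 * CARD('m))) * (LINT v|lborel. F (y + e *\<^sub>R v))"
proof -
  have m: "F \<in> borel_measurable borel" using F by (rule borel_measurable_continuous_onI)
  have T: "(\<lambda>x. y + e *\<^sub>R x) \<in> borel_measurable lborel" by simp
  have D: "DIM('m point) = 2 * CARD('m)" by (simp add: card_UNIV_sum)
  have "(LINT x|lborel. F x) = (LINT x|density (distr lborel borel (\<lambda>x. y + e *\<^sub>R x)) (\<lambda>_. ennreal (e ^ (2 * CARD('m)))). F x)"
    using e by (subst lborel_affine[of e y]) (simp, simp only: D abs_of_pos ennreal_power less_imp_le)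
  also have "\<dots> = (LINT x|distr lborel borel (\<lambda>x. y + e *\<^sub>R x). (e ^ (2 * CARD('m))) *\<^sub>R F x)"
    using m e by (intro integral_density) auto
  also have "\<dots> = (LINT v|lborel. (e ^ (2 * CARD('m))) *\<^sub>R F (y + e *\<^sub>R v))"
    using m by (intro integral_distr) auto
  finally show ?thesis by (simp add: scaleR_conv_of_real)
qed

text \<open>The substitution x = y + v/(k+1) has Jacobian (k+1)^(-2m) against the prefactor
  (k+1)^(2(M+j)); by m = n + M the power (k+1)^(-2(n-j)) remains, which tends to 0 unless j =
  n.\<close>

lemma scaling_limit:
  fixes \<phi> :: "'m::finite point \<Rightarrow> complex"
  assumes \<phi>: "test_function \<phi>" and M: "CARD('m) = n + M" and j: "j \<le> n"
  shows "(\<lambda>k. LINT x|lborel. of_real (((real (Suc k))\<^sup>2) ^ (M + j)) * KK M j ((real (Suc k))\<^sup>2 * rho y x) * \<phi> x)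
    \<longlonglongrightarrow> (if j = n then (LINT v :: 'm point|lborel. KK M n (v \<bullet> v)) * \<phi> y else 0)"
proof -
  have \<phi>c: "continuous_on UNIV \<phi>" using \<phi> by (simp add: test_function_def smooth_on_continuous)
  obtain B where B: "\<And>x. norm (\<phi> x) \<le> B"
  proof -
    have "compact (closure {x. \<phi> x \<noteq> 0})" using \<phi> by (simp add: test_function_def)
    then have "bounded (\<phi> ` closure {x. \<phi> x \<noteq> 0})"
      by (intro compact_imp_bounded compact_continuous_image continuous_on_subset[OF \<phi>c]) auto
    then obtain B where B: "\<And>x. x \<in> closure {x. \<phi> x \<noteq> 0} \<Longrightarrow> norm (\<phi> x) \<le> B" by (auto simp: bounded_iff)
    have "norm (\<phi> x) \<le> max B 0" for x
      using B[of x] test_function_outside[of x \<phi>] by (cases "x \<in> closure {x. \<phi> x \<noteq> 0}") auto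
    then show ?thesis using that by blast
  qed
  let ?K = "\<lambda>v :: 'm point. KK M j (v \<bullet> v)"
  have Kc: "continuous_on UNIV ?K" by (intro continuous_on_compose2[OF KK_continuous] continuous_intros) auto
  have Ki: "integrable lborel ?K"
  proof (rule compact_support_integrable[OF Kc compact_cball[of 0 1]])
    fix v :: "'m point" assume "v \<notin> cball 0 1"
    then have "1\<^sup>2 < (norm v)\<^sup>2" by (intro power_strict_mono) auto
    then show "?K v = 0" by (intro KK_zero) (simp add: dot_square_norm)
  qed
  define I where "I k = (LINT v|lborel. ?K v * \<phi> (y + (1 / real (Suc k)) *\<^sub>R v))" for k
  have I: "I \<longlonglongrightarrow> (LINT v|lborel. ?K v * \<phi> y)"
    unfolding I_def
  proof (rule integral_dominated_convergence[where w = "\<lambda>v. B * norm (?K v)"])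
    have "(\<lambda>k. y + (1 / real (Suc k)) *\<^sub>R v) \<longlonglongrightarrow> y + 0 *\<^sub>R v" for v
      using LIMSEQ_inverse_real_of_nat by (intro tendsto_intros) (simp add: inverse_eq_divide)
    then have "(\<lambda>k. \<phi> (y + (1 / real (Suc k)) *\<^sub>R v)) \<longlonglongrightarrow> \<phi> y" for v
      using \<phi>c by (intro isCont_tendsto_compose[of _ \<phi>]) (auto simp: continuous_on_eq_continuous_at)
    then show "AE v in lborel. (\<lambda>k. ?K v * \<phi> (y + (1 / real (Suc k)) *\<^sub>R v)) \<longlonglongrightarrow> ?K v * \<phi> y"
      by (intro AE_I2 tendsto_mult tendsto_const)
    show "AE v in lborel. norm (?K v * \<phi> (y + (1 / real (Suc k)) *\<^sub>R v)) \<le> B * norm (?K v)" for k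
      using B by (intro AE_I2) (simp add: norm_mult mult.commute[of B] mult_left_mono)
    show "(\<lambda>v. ?K v * \<phi> (y + (1 / real (Suc k)) *\<^sub>R v)) \<in> borel_measurable lborel" for k
    proof -
      have "continuous_on UNIV (\<lambda>v. ?K v * \<phi> (y + (1 / real (Suc k)) *\<^sub>R v))"
        by (intro continuous_intros Kc continuous_on_compose2[OF \<phi>c]) auto
      then show ?thesis using borel_measurable_continuous_onI by force
    qed
    show "(\<lambda>v. ?K v * \<phi> y) \<in> borel_measurable lborel" using Ki by auto
  qed (use Ki in auto)
  have eq: "(LINT x|lborel. of_real (((real (Suc k))\<^sup>2) ^ (M + j)) * KK M j ((real (Suc k))\<^sup>2 * rho y x) * \<phi> x)
     = of_real ((1 / real (Suc k)) ^ (2 * (n - j))) * I k" for k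
  proof -
    define c where "c = real (Suc k)"
    have c: "c > 0" by (simp add: c_def)
    have r: "c\<^sup>2 * rho y (y + (1 / c) *\<^sub>R v) = v \<bullet> v" for v
      using c by (simp add: rho_def power2_eq_square)
    have cont: "continuous_on UNIV (\<lambda>x. of_real ((c\<^sup>2) ^ (M + j)) * KK M j (c\<^sup>2 * rho y x) * \<phi> x)"
      unfolding rho_def by (intro continuous_intros \<phi>c continuous_on_compose2[OF KK_continuous]) auto
    have "(LINT x|lborel. of_real ((c\<^sup>2) ^ (M + j)) * KK M j (c\<^sup>2 * rho y x) * \<phi> x)
       = of_real ((1 / c) ^ (2 * CARD('m))) * (LINT v|lborel. of_real ((c\<^sup>2) ^ (M + j)) * (?K v * \<phi> (y + (1 / c) *\<^sub>R v)))"
      by (subst lborel_scale[OF cont, of "1 / c" y]) (use c in \<open>simp_all add: r mult.assoc\<close>)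
    also have "\<dots> = of_real ((1 / c) ^ (2 * CARD('m)) * (c\<^sup>2) ^ (M + j)) * I k"
      unfolding I_def c_def by simp
    also have "(1 / c) ^ (2 * CARD('m)) * (c\<^sup>2) ^ (M + j) = (1 / c) ^ (2 * (n - j))"
    proof -
      have "2 * CARD('m) = 2 * (n - j) + 2 * (M + j)" using M j by simp
      then have "(1 / c) ^ (2 * CARD('m)) = (1 / c) ^ (2 * (n - j)) * (1 / c) ^ (2 * (M + j))"
        by (simp only: power_add)
      moreover have "(1 / c) ^ (2 * (M + j)) * (c\<^sup>2) ^ (M + j) = 1"
        using c by (simp add: power_mult[symmetric] power_one_over)
      ultimately show ?thesis by (simp only: mult.assoc mult_1_right)
    qed
    finally show ?thesis unfolding c_def .
  qed
  have z: "(\<lambda>k. complex_of_real ((1 / real (Suc k)) ^ (2 * (n - j)))) \<longlonglongrightarrow> (if j = n then 1 else 0)"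
  proof (cases "j = n")
    case False
    have "(\<lambda>k. (1 / real (Suc k)) ^ (2 * (n - j))) \<longlonglongrightarrow> 0 ^ (2 * (n - j))"
      using LIMSEQ_inverse_real_of_nat by (intro tendsto_power) (simp add: inverse_eq_divide)
    then have "(\<lambda>k. complex_of_real ((1 / real (Suc k)) ^ (2 * (n - j)))) \<longlonglongrightarrow> of_real (0 ^ (2 * (n - j)))"
      by (rule tendsto_of_real)
    then show ?thesis using False j by (simp add: power_0_left)
  qed simp
  show ?thesis unfolding eq using tendsto_mult[OF z I] by (auto split: if_splits)
qed

section \<open>The integral with the regularised kernel\<close>

lemma fc_cong: "(\<And>j. p j r = q j r) \<Longrightarrow> fc n p r = fc n q r"
  by (simp add: fc_def)

lemma fc_euler_zero:
  assumes "c * r \<notin> {0<..<1}" shows "fc n (euler_seq M (ww M c)) r = 0"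
  by (simp add: fc_def euler_seq_ww KK_zero[OF assms])

lemma fr_dirac_left: "smooth_fr S F \<Longrightarrow> open S \<Longrightarrow> smooth_fr S (dirac_left n e f F)"
  unfolding dirac_left_def[abs_def]
  by (intro smooth_fr.add fr_sum fr_clinear_map[OF _ clinear_map_left] fr_pd fr_clinear_map[OF _ clinear_map_gderiv])

lemma gsup_dirac_left:
  assumes "smooth_fr S F" "open S" "x \<in> S" "\<And>x. x \<in> S \<Longrightarrow> gsup N (F x)"
  shows "gsup N (dirac_left n e f F x)"
  unfolding dirac_left_def
  by (intro gsup_add gsup_sum gsup_mult gsup_gconst gsup_gderiv assms gsup_pd[OF assms])

context phase
begin

lemma fr_g: "smooth_fr UNIV (\<lambda>x. gcomplex (g x) :: 'm sval)"
proof -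
  have "smooth_fr UNIV (\<lambda>x. cnum (of_real (h x)) + bg x)"
    by (intro smooth_fr.add fr_cnum smooth_h fr_bg)
  then show ?thesis by (simp add: gcomplex_g)
qed

lemma gsup_g: "gsup {1..2*n} (gcomplex (g x) :: 'm sval)"
  unfolding gcomplex_g by (intro gsup_add gsup_gconst bg_props)

lemma Q_eq_local:
  assumes "k \<ge> 1" "test_function a" "test_function b" "open V" "{x. h x = 0} \<subseteq> V" "\<And>x. x \<in> V \<Longrightarrow> a x = b x"
  shows "Q k a = Q k b"
proof -
  have t: "test_function (\<lambda>x. (-1) * b x)" by (rule test_function_cmult[OF assms(3)])
  have "Q k (\<lambda>x. a x + (-1) * b x) = 0"
    by (rule Q_local[OF assms(1) test_function_add[OF assms(2) t] assms(4,5)]) (use assms(6) in simp)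
  then show ?thesis unfolding Q_add[OF assms(2) t] Q_cmult[OF assms(3)] by simp
qed

text \<open>The left side sees only a neighbourhood of h = 0, where c rho > 1 and the smoothed
  kernel is the true one. So \<open>stokes\<close> applies with the smoothed kernel, and of its
  right side only the volume term j = 0 is left.\<close>

lemma super_integral_regularised:
  fixes y :: "'m point" and C c :: real
  assumes s: "s = 1 \<or> s = -1" and M: "CARD('m) = n + M"
    and \<Omega>: "open \<Omega>" and G: "smooth_fr \<Omega> G" "\<And>x. x \<in> \<Omega> \<Longrightarrow> gsup {1..2*n} (G x)"
    and DG: "\<And>x. x \<in> \<Omega> \<Longrightarrow> dirac_left n (de s) (df s) G x = 0"
    and K: "compact {x. h x \<le> 0}" "{x. h x \<le> 0} \<subseteq> \<Omega>" and l: "glin l"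
    and c: "c > 0" "\<And>x. h x = 0 \<Longrightarrow> c * rho y x > 1"
    and P: "\<And>x. x \<noteq> y \<Longrightarrow> P x = cnum (of_real C) * (Xv n s y x * fc n (pw M) (rho y x))"
  shows "l (super_integral n P (super_delta n g) (\<lambda>x. dirac_left n (de s) (df s) (\<lambda>x. gcomplex (g x)) x * G x))
    = (LINT x:{x. h x \<le> 0}|lborel. l (berezin n (cnum (of_real C) * (fc n (euler_seq M (ww M c)) (rho y x) * G x))))"
proof -
  define K0 where "K0 = {x. h x \<le> 0}"
  let ?DG = "dirac_left n (de s) (df s)" and ?DF = "dirac_right n (de s) (df s)"
  let ?C = "cnum (of_real C) :: 'm sval" and ?\<mu> = "\<lambda>a. l (berezin n a)"
  let ?Dg = "?DG (\<lambda>x. gcomplex (g x))"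
  \<comment> \<open>\<open>stokes\<close> needs F with compact support and G on the whole space:
    \<eta> cuts off the kernel inside \<Omega>, and \<theta>, equal to 1 near the support of \<eta>,
    extends G by zero.\<close>
  obtain \<eta> where "cutoff K0 \<Omega> \<eta>" using cutoff_exists[OF K(1) \<Omega> K(2)] unfolding K0_def by blast
  then obtain W1 where W1: "open W1" "K0 \<subseteq> W1" "\<forall>x\<in>W1. \<eta> x = 1" and \<eta>: "test_function \<eta>" "closure {x. \<eta> x \<noteq> 0} \<subseteq> \<Omega>"
    by (auto simp: cutoff_def)
  have cs: "compact (closure {x. \<eta> x \<noteq> 0})" using \<eta>(1) by (simp add: test_function_def)
  obtain \<theta> where "cutoff (closure {x. \<eta> x \<noteq> 0}) \<Omega> \<theta>" using cutoff_exists[OF cs \<Omega> \<eta>(2)] by blast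
  then obtain W2 where W2: "open W2" "closure {x. \<eta> x \<noteq> 0} \<subseteq> W2" "\<forall>x\<in>W2. \<theta> x = 1"
    and \<theta>: "test_function \<theta>" "closure {x. \<theta> x \<noteq> 0} \<subseteq> \<Omega>" by (auto simp: cutoff_def)
  \<comment> \<open>A neighbourhood of the sublevel set on which both cutoffs are 1, so that their
    derivatives do not enter.\<close>
  define N where "N = W1 \<inter> W2 \<inter> \<Omega>"
  have N: "open N" "K0 \<subseteq> N"
  proof -
    have "K0 \<subseteq> closure {x. \<eta> x \<noteq> 0}" using W1 closure_subset[of "{x. \<eta> x \<noteq> 0}"] by force
    then show "K0 \<subseteq> N" using W1(2) W2(2) \<eta>(2) by (auto simp: N_def)
    show "open N" unfolding N_def using W1 W2 \<Omega> by auto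
  qed
  have N1: "\<eta> x = 1" "\<theta> x = 1" "x \<in> \<Omega>" if "x \<in> N" for x using that W1(3) W2(3) by (auto simp: N_def)
  define F where "F x = cnum (\<eta> x) * (?C * (Xv n s y x * fc n (ww M c) (rho y x)))" for x
  define G' where "G' x = cnum (\<theta> x) * G x" for x
  have XfU: "smooth_fr UNIV (\<lambda>x. Xv n s y x * fc n (ww M c) (rho y x))"
    by (intro fr_mult fr_Xv fr_fc[OF smooth_seq_ww] open_UNIV) auto
  have tF: "test_fr F" unfolding F_def
    by (rule fr_extend[OF fr_clinear_map[OF XfU clinear_map_left] \<eta>(1) open_UNIV]) simp
  have tG': "test_fr G'" unfolding G'_def by (rule fr_extend[OF G(1) \<theta>(1) \<Omega> \<theta>(2)])
  then have fG': "smooth_fr UNIV G'" by (simp add: test_fr_def)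
  have DF: "?DF F x = ?C * fc n (euler_seq M (ww M c)) (rho y x)" if "x \<in> N" for x
  proof -
    have "?DF F x = ?DF (\<lambda>x. ?C * (Xv n s y x * fc n (ww M c) (rho y x))) x"
      by (rule dirac_right_cong[OF N(1) that]) (simp add: F_def N1)
    also have "\<dots> = ?C * ?DF (\<lambda>x. Xv n s y x * fc n (ww M c) (rho y x)) x"
      by (rule dirac_right_cmult[OF XfU open_UNIV UNIV_I])
    also have "?DF (\<lambda>x. Xv n s y x * fc n (ww M c) (rho y x)) x = fc n (euler_seq M (ww M c)) (rho y x)"
      by (rule dirac_right_kernel[OF s smooth_seq_ww open_UNIV _ UNIV_I M]) simp
    finally show ?thesis .
  qed
  have DG': "?DG G' x = 0" if "x \<in> N" for x
  proof -
    have "?DG G' x = ?DG G x" by (rule dirac_left_cong[OF N(1) that]) (simp add: G'_def N1)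
    then show ?thesis using DG N1(3)[OF that] by simp
  qed
  \<comment> \<open>Here, around the zero level, the smoothed kernel moreover equals the true one
    and its image under the right Dirac operator is 0.\<close>
  define V where "V = N \<inter> {x. c * rho y x > 1}"
  have V: "open V" "{x. h x = 0} \<subseteq> V"
  proof -
    have "open {x. c * rho y x > 1}" unfolding rho_def by (intro open_Collect_less continuous_intros)
    then show "open V" using N(1) by (auto simp: V_def)
    show "{x. h x = 0} \<subseteq> V" using N(2) c(2) by (auto simp: V_def K0_def)
  qed
  have ny: "x \<noteq> y" if "x \<in> V" for x using that by (auto simp: V_def rho_def)
  \<comment> \<open>The true kernel is smooth only off y; the zero level avoids y because c rho > 1
    there.\<close>
  define S where "S = \<Omega> \<inter> - {y}"
  have S: "open S" "{x. h x = 0} \<subseteq> S" using \<Omega> V ny N1(3) by (auto simp: S_def V_def)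
  obtain \<kappa> where \<kappa>: "cutoff {x. h x = 0} S \<kappa>" using cutoff_exists[OF compact_zero_set S] by blast
  then obtain W3 where W3: "open W3" "{x. h x = 0} \<subseteq> W3" "\<forall>x\<in>W3. \<kappa> x = 1"
    and t\<kappa>: "test_function \<kappa>" "closure {x. \<kappa> x \<noteq> 0} \<subseteq> S" by (auto simp: cutoff_def)
  have rS: "rho y x \<in> {0<..}" if "x \<in> S" for x using that by (simp add: S_def rho_def)
  have frP: "smooth_fr S P"
  proof (rule smooth_fr.cong)
    have "smooth_fr S (\<lambda>x. fc n (pw M) (rho y x))" by (rule fr_fc[OF smooth_seq_pw S(1) rS])
    then show "smooth_fr S (\<lambda>x. ?C * (Xv n s y x * fc n (pw M) (rho y x)))"
      by (intro fr_clinear_map[OF _ clinear_map_left] fr_mult fr_Xv S(1))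
    show "?C * (Xv n s y x * fc n (pw M) (rho y x)) = P x" if "x \<in> S" for x
      using P[of x] that by (simp add: S_def)
  qed
  have gP: "gsup {1..4*n} (P x)" if "x \<in> S" for x
  proof -
    have "x \<noteq> y" using that by (simp add: S_def)
    then show ?thesis unfolding P[OF \<open>x \<noteq> y\<close>] by (intro gsup_mult gsup_gconst gsup_Xv gsup_fc)
  qed
  have frDg: "smooth_fr UNIV ?Dg" by (rule fr_dirac_left[OF fr_g open_UNIV])
  have gDg: "gsup {1..2*n} (?Dg x)" for x by (rule gsup_dirac_left[OF fr_g open_UNIV UNIV_I gsup_g])
  define H where "H x = ?Dg x * G x" for x
  have frH: "smooth_fr S H" unfolding H_def
    by (intro fr_mult S(1) fr_subset[OF frDg] fr_subset[OF G(1)]) (auto simp: S_def)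
  have gH: "gsup {1..4*n} (H x)" if "x \<in> S" for x
  proof (rule gsup_mono)
    show "gsup {1..2*n} (H x)" unfolding H_def using that by (intro gsup_mult gDg G(2)) (simp add: S_def)
  qed auto
  have Q1: "Q (Suc j) (\<lambda>x. \<kappa> x * ?\<mu> (P x * bg x ^ j * H x)) = Q (Suc j) (\<lambda>x. ?\<mu> (F x * bg x ^ j * (?Dg x * G' x)))" for j
  proof (rule Q_eq_local)
    have "smooth_fr S (\<lambda>x. P x * bg x ^ j * H x)"
      by (intro fr_mult fr_power frP frH S(1) fr_subset[OF fr_bg]) simp
    from fr_glin[OF this glin_berezin[OF l] S(1)]
    show "test_function (\<lambda>x. \<kappa> x * ?\<mu> (P x * bg x ^ j * H x))"
      by (rule test_function_mult_local[OF t\<kappa>(1) S(1) t\<kappa>(2)])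
    show "test_function (\<lambda>x. ?\<mu> (F x * bg x ^ j * (?Dg x * G' x)))"
      by (intro test_fr_glin[OF _ glin_berezin[OF l]] test_fr_mult_right tF fr_power fr_bg fr_mult frDg fG' open_UNIV)
    show "open (V \<inter> W3)" "{x. h x = 0} \<subseteq> V \<inter> W3" using V W3 by auto
    fix x assume x: "x \<in> V \<inter> W3"
    then have N': "x \<in> N" and big: "c * rho y x > 1" by (auto simp: V_def)
    have "fc n (ww M c) (rho y x) = (fc n (pw M) (rho y x) :: 'm sval)" by (rule fc_cong) (rule ww_pw[OF c(1) big])
    then have "P x = F x" using P[OF ny] x N1[OF N'] by (simp add: F_def)
    moreover have "H x = ?Dg x * G' x" by (simp add: H_def G'_def N1[OF N'])
    moreover have "\<kappa> x = 1" using W3 x by auto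
    ultimately show "\<kappa> x * ?\<mu> (P x * bg x ^ j * H x) = ?\<mu> (F x * bg x ^ j * (?Dg x * G' x))" by simp
  qed simp
  define R where "R j x = ?\<mu> (?DF F x * (bg x ^ j * G' x) + F x * bg x ^ j * ?DG G' x)" for j x
  have tR: "test_function (R j)" for j
  proof -
    have tDF: "test_fr (?DF F)"
      unfolding dirac_right_def[abs_def]
      by (intro test_fr_add test_fr_sum test_fr_clinear_map[OF _ clinear_map_right] test_fr_pd
          test_fr_clinear_map[OF _ clinear_map_gderiv] test_fr_clinear_map[OF _ clinear_map_gpar] tF)
    have fDG: "smooth_fr UNIV (?DG G')" by (rule fr_dirac_left[OF fG' open_UNIV])
    show ?thesis unfolding R_def[abs_def]
      by (intro test_fr_glin[OF _ glin_berezin[OF l]] test_fr_add test_fr_mult_right tF tDF fr_power fr_bg fr_mult fDG fG' open_UNIV)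
  qed
  \<comment> \<open>Both F D and D G vanish near the zero level, so every boundary term drops
    out.\<close>
  have R0: "Q j (R j) = 0" if "j \<ge> 1" for j
  proof (rule Q_local[OF that tR V], rule ballI)
    fix x assume x: "x \<in> V"
    then have N': "x \<in> N" and big: "c * rho y x > 1" by (auto simp: V_def)
    have "fc n (euler_seq M (ww M c)) (rho y x) = (0 :: 'm sval)" by (rule fc_euler_zero) (use big in simp)
    then have "?DF F x = 0" using DF[OF N'] by simp
    then show "R j x = 0" by (simp add: R_def DG'[OF N'] glin_zero[OF l])
  qed
  have "l (super_integral n P (super_delta n g) H)
     = (\<Sum>j=0..n. (-1) ^ j / fact j * Q (Suc j) (\<lambda>x. \<kappa> x * ?\<mu> (P x * bg x ^ j * H x)))"
    by (rule super_integral_glin[OF frP gP frH gH S(1) \<kappa> l])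
  also have "\<dots> = (\<Sum>j=0..n. (-1) ^ j / fact j * Q j (R j))"
    unfolding Q1 R_def[abs_def] by (rule stokes[OF tF fG' l])
  also have "\<dots> = (\<Sum>j=0..n. if j = 0 then Q 0 (R 0) else 0)"
    by (intro sum.cong refl) (auto simp: R0)
  also have "\<dots> = Q 0 (R 0)" by simp
  also have "\<dots> = (LINT x:K0|lborel. ?\<mu> (?C * (fc n (euler_seq M (ww M c)) (rho y x) * G x)))"
    unfolding Q_0 K0_def[symmetric] set_lebesgue_integral_def
  proof (intro Bochner_Integration.integral_cong refl)
    fix x
    show "indicator K0 x *\<^sub>R R 0 x = indicator K0 x *\<^sub>R ?\<mu> (?C * (fc n (euler_seq M (ww M c)) (rho y x) * G x))"
    proof (cases "x \<in> K0")
      case True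
      then have N': "x \<in> N" using N(2) by auto
      show ?thesis by (simp add: R_def DF[OF N'] DG'[OF N'] G'_def N1[OF N'] mult.assoc)
    qed simp
  qed
  finally show ?thesis unfolding H_def[abs_def] K0_def .
qed

end

section \<open>The Cauchy formula for the components of the kernel\<close>

lemma eval_y_combine: "eval_y n (\<lambda>x. G1 x + cnum s * G2 x) y = eval_y n G1 y + cnum s * eval_y n G2 y"
  unfolding eval_y_def sum_distrib_left sum.distrib[symmetric]
  by (intro sum.cong refl) (simp add: gcoeff_add gconst_add gconst_mult distrib_right mult.assoc)

lemma kernel_constant:
  assumes "CARD('m::finite) = n + Suc p"
  shows "2 / supersphere_area n TYPE('m) = fact p / pi ^ Suc p"
proof -
  have "superdim n TYPE('m) / 2 = real (Suc p)" using assms by (simp add: superdim_def)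
  moreover have "Gamma (real (Suc p)) = fact p" using Gamma_fact[of p, where 'a = real] by simp
  moreover have "pi powr real (Suc p) = pi ^ Suc p" by (rule powr_realpow) simp
  ultimately show ?thesis unfolding supersphere_area_def by (simp only:) simp
qed

text \<open>If the ball of radius e about y misses K, then c0 = 2/e^2 makes the product at least 2
  on K.\<close>

lemma rho_bound:
  assumes "closed K" "y \<notin> K"
  obtains c0 where "c0 > 0" "\<And>c x. c \<ge> c0 \<Longrightarrow> x \<in> K \<Longrightarrow> c * rho y x > 1"
proof -
  have "open (- K)" "y \<in> - K" using assms by auto
  then obtain e where e: "e > 0" "ball y e \<subseteq> - K" by (meson open_contains_ball)
  have "c * rho y x > 1" if c: "c \<ge> 2 / e\<^sup>2" and x: "x \<in> K" for c x
  proof -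
    have "e \<le> norm (x - y)" using e(2) x by (auto simp: subset_iff dist_norm norm_minus_commute not_less[symmetric])
    then have "e\<^sup>2 \<le> rho y x" using e(1) unfolding rho_def dot_square_norm by (intro power_mono) auto
    moreover have "0 \<le> c" using order_trans[OF _ c, of 0] by simp
    ultimately have "2 / e\<^sup>2 * e\<^sup>2 \<le> c * rho y x" using c by (intro mult_mono) auto
    then show ?thesis using e(1) by simp
  qed
  moreover have "2 / e\<^sup>2 > 0" using e(1) by simp
  ultimately show ?thesis using that by blast
qed

context phase
begin

text \<open>\<open>reg\<close> represents the same number I for every admissible c. For h y > 0 one
  large c makes the integrand vanish on h \<le> 0; for h y < 0 the limit of large c is taken of a
  constant.\<close>

lemma cauchy_component:
  fixes y :: "'m point"
  assumes s: "s = 1 \<or> s = -1" and M: "CARD('m) = n + Suc p"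
    and \<Omega>: "open \<Omega>" and G: "smooth_fr \<Omega> G" "\<And>x. x \<in> \<Omega> \<Longrightarrow> gsup {1..2*n} (G x)"
    and DG: "\<And>x. x \<in> \<Omega> \<Longrightarrow> dirac_left n (de s) (df s) G x = 0"
    and K: "compact {x. h x \<le> 0}" "{x. h x \<le> 0} \<subseteq> \<Omega>" and l: "glin l"
    and P: "\<And>x. x \<noteq> y \<Longrightarrow> P x = cnum (of_real (2 / supersphere_area n TYPE('m))) * (Xv n s y x * fc n (pw (Suc p)) (rho y x))"
  defines "I \<equiv> l (super_integral n P (super_delta n g) (\<lambda>x. dirac_left n (de s) (df s) (\<lambda>x. gcomplex (g x)) x * G x))"
  shows "h y > 0 \<Longrightarrow> I = 0" "h y < 0 \<Longrightarrow> I = l (eval_y n G y)"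
proof -
  let ?C = "2 / supersphere_area n TYPE('m)" and ?M = "Suc p" and ?\<mu> = "\<lambda>a. l (berezin n a)"
  let ?K0 = "{x. h x \<le> 0}"
  have \<mu>: "glin ?\<mu>" by (rule glin_berezin[OF l])
  have hc: "continuous_on UNIV h" by (rule smooth_on_real(1)[OF smooth_h])
  have reg: "I = (LINT x:?K0|lborel. ?\<mu> (cnum (of_real ?C) * (fc n (euler_seq ?M (ww ?M c)) (rho y x) * G x)))"
    if "c > 0" "\<And>x. h x = 0 \<Longrightarrow> c * rho y x > 1" for c
    unfolding I_def by (rule super_integral_regularised[OF s M \<Omega> G DG K l that P])
  show "I = 0" if y: "h y > 0"
  proof -
    have "closed ?K0" "y \<notin> ?K0" using K(1) y by (auto intro: compact_imp_closed)
    then obtain c where c: "c > 0" "\<And>c' x. c' \<ge> c \<Longrightarrow> x \<in> ?K0 \<Longrightarrow> c' * rho y x > 1" by (rule rho_bound) blast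
    have "I = (LINT x:?K0|lborel. ?\<mu> (cnum (of_real ?C) * (fc n (euler_seq ?M (ww ?M c)) (rho y x) * G x)))"
      by (rule reg[OF c(1)]) (use c(2)[of c] in simp)
    also have "\<dots> = 0"
    proof -
      have "fc n (euler_seq ?M (ww ?M c)) (rho y x) = (0 :: 'm sval)" if "x \<in> ?K0" for x
        by (rule fc_euler_zero) (use c(2)[of c x] that in simp)
      then have "indicator ?K0 x *\<^sub>R ?\<mu> (cnum (of_real ?C) * (fc n (euler_seq ?M (ww ?M c)) (rho y x) * G x)) = 0" for x
        by (cases "x \<in> ?K0") (simp_all add: glin_zero[OF l])
      then show ?thesis unfolding set_lebesgue_integral_def by (simp only: Bochner_Integration.integral_zero)
    qed
    finally show ?thesis .
  qed
  show "I = l (eval_y n G y)" if y: "h y < 0"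
  proof -
    \<comment> \<open>Bounding rho on all of 0 \<le> h, and not just on the zero level, makes the
      integrand vanish outside h \<le> 0, so the integral extends to the whole space.\<close>
    have "closed {x. 0 \<le> h x}" by (intro closed_Collect_le continuous_on_const hc)
    then obtain c0 where c0: "c0 > 0" "\<And>c x. c \<ge> c0 \<Longrightarrow> x \<in> {x. 0 \<le> h x} \<Longrightarrow> c * rho y x > 1"
      by (rule rho_bound) (use y in auto)
    obtain \<theta> where "cutoff ?K0 \<Omega> \<theta>" using cutoff_exists[OF K(1) \<Omega> K(2)] by blast
    then obtain W1 where W1: "?K0 \<subseteq> W1" "\<forall>x\<in>W1. \<theta> x = 1" and \<theta>: "test_function \<theta>" "closure {x. \<theta> x \<noteq> 0} \<subseteq> \<Omega>"
      by (auto simp: cutoff_def)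
    \<comment> \<open>The cutoff turns each Taylor term into a test function on the whole space
      without changing it on h \<le> 0.\<close>
    define \<phi> where "\<phi> j x = ?\<mu> (zeta n ^ j * (cnum (\<theta> x) * G x))" for j x
    have t\<phi>: "test_function (\<phi> j)" for j
      unfolding \<phi>_def[abs_def]
      by (rule test_fr_glin[OF test_fr_clinear_map[OF fr_extend[OF G(1) \<theta>(1) \<Omega> \<theta>(2)] clinear_map_left] \<mu>])
    define J where "J c j = (LINT x|lborel. of_real (c ^ (?M + j)) * KK ?M j (c * rho y x) * \<phi> j x)" for c j
    have I_eq: "I = (\<Sum>j=0..n. of_real ?C / fact j * J c j)" if c: "c \<ge> c0" for c
    proof -
      let ?r = "\<lambda>j x. of_real (c ^ (?M + j)) * KK ?M j (c * rho y x) * \<phi> j x"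
      have int: "integrable lborel (?r j)" for j
      proof (rule compact_support_integrable[where K = "closure {x. \<phi> j x \<noteq> 0}"])
        have "continuous_on UNIV (\<phi> j)" using t\<phi> by (simp add: test_function_def smooth_on_continuous)
        then show "continuous_on UNIV (?r j)"
          unfolding rho_def by (intro continuous_intros continuous_on_compose2[OF KK_continuous]) auto
        show "compact (closure {x. \<phi> j x \<noteq> 0})" using t\<phi> by (simp add: test_function_def)
        show "?r j x = 0" if "x \<notin> closure {x. \<phi> j x \<noteq> 0}" for x
          using test_function_outside[OF that] by (simp only: mult_zero_right)
      qed
      have "I = (LINT x:?K0|lborel. ?\<mu> (cnum (of_real ?C) * (fc n (euler_seq ?M (ww ?M c)) (rho y x) * G x)))"
        using c0(1) c c0(2)[OF c] by (intro reg) auto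
      also have "\<dots> = (LINT x|lborel. (\<Sum>j=0..n. of_real ?C / fact j * ?r j x))"
        unfolding set_lebesgue_integral_def
      proof (intro Bochner_Integration.integral_cong refl)
        fix x
        show "indicator ?K0 x *\<^sub>R ?\<mu> (cnum (of_real ?C) * (fc n (euler_seq ?M (ww ?M c)) (rho y x) * G x))
          = (\<Sum>j=0..n. of_real ?C / fact j * ?r j x)"
        proof (cases "x \<in> ?K0")
          case True
          then have "\<theta> x = 1" using W1 by blast
          then have \<phi>: "\<phi> j x = ?\<mu> (zeta n ^ j * G x)" for j by (simp add: \<phi>_def)
          have "?\<mu> (fc n (euler_seq ?M (ww ?M c)) (rho y x) * G x)
            = (\<Sum>j=0..n. euler_seq ?M (ww ?M c) j (rho y x) / fact j * \<phi> j x)"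
            unfolding fc_def sum_distrib_right glin_sum[OF \<mu>] mult.assoc glin_cnum[OF \<mu>] \<phi> ..
          then have "?\<mu> (cnum (of_real ?C) * (fc n (euler_seq ?M (ww ?M c)) (rho y x) * G x))
            = (\<Sum>j=0..n. of_real ?C * (euler_seq ?M (ww ?M c) j (rho y x) / fact j * \<phi> j x))"
            unfolding glin_cnum[OF \<mu>] by (simp only: sum_distrib_left)
          also have "\<dots> = (\<Sum>j=0..n. of_real ?C / fact j * ?r j x)"
            unfolding euler_seq_ww by (intro sum.cong refl) (simp only: times_divide_eq_left times_divide_eq_right mult.assoc)
          finally show ?thesis using True by simp
        next
          case False
          then have "c * rho y x > 1" using c0(2)[OF c, of x] by simp
          then have "KK ?M j (c * rho y x) = 0" for j by (intro KK_zero) simp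
          then show ?thesis using False by simp
        qed
      qed
      also have "\<dots> = (\<Sum>j=0..n. of_real ?C / fact j * J c j)"
        unfolding J_def
        by (subst Bochner_Integration.integral_sum[OF integrable_mult_right[OF int]]) (simp only: integral_mult_right_zero)
      finally show ?thesis .
    qed
    let ?I0 = "LINT v :: 'm point|lborel. KK ?M n (v \<bullet> v)"
    have "(\<lambda>k. \<Sum>j=0..n. of_real ?C / fact j * J ((real (Suc k))\<^sup>2) j)
      \<longlonglongrightarrow> (\<Sum>j=0..n. of_real ?C / fact j * (if j = n then ?I0 * \<phi> j y else 0))"
      unfolding J_def by (intro tendsto_sum tendsto_mult tendsto_const scaling_limit[OF t\<phi> M]) auto
    \<comment> \<open>c = (k+1)^2 eventually exceeds c0, and from then on the sum equals I.\<close>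
    moreover have "\<forall>\<^sub>F k in sequentially. (\<Sum>j=0..n. of_real ?C / fact j * J ((real (Suc k))\<^sup>2) j) = I"
    proof (rule eventually_sequentiallyI)
      fix k assume "k \<ge> nat \<lceil>c0\<rceil>"
      then have "c0 \<le> real (Suc k)" by linarith
      also have "\<dots> \<le> (real (Suc k))\<^sup>2" by (rule self_le_power) auto
      finally show "(\<Sum>j=0..n. of_real ?C / fact j * J ((real (Suc k))\<^sup>2) j) = I" by (rule I_eq[symmetric])
    qed
    ultimately have "(\<lambda>k. I) \<longlonglongrightarrow> (\<Sum>j=0..n. of_real ?C / fact j * (if j = n then ?I0 * \<phi> j y else 0))"
      by (rule Lim_transform_eventually)
    then have "I = (\<Sum>j=0..n. of_real ?C / fact j * (if j = n then ?I0 * \<phi> j y else 0))"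
      using LIMSEQ_unique tendsto_const by blast
    also have "\<dots> = (\<Sum>j=0..n. if j = n then of_real ?C / fact n * (?I0 * \<phi> n y) else 0)"
      by (intro sum.cong refl) auto
    also have "\<dots> = of_real ?C / fact n * (?I0 * \<phi> n y)" by simp
    also have "\<phi> n y = (-1) ^ n * fact n / of_real pi ^ n * l (eval_y n G y)"
    proof -
      have yK: "y \<in> ?K0" using y by simp
      then have "\<theta> y = 1" "y \<in> \<Omega>" using W1 K(2) by blast+
      then have "\<phi> n y = l (berezin n (zeta n ^ n * G y))" "gsup {1..2*n} (G y)" using G(2) by (simp_all add: \<phi>_def)
      then show ?thesis unfolding eval_y_def by (simp add: berezin_zeta_power glin_cnum[OF l])
    qed
    also have "of_real ?C / fact n * (?I0 * ((-1) ^ n * fact n / of_real pi ^ n * l (eval_y n G y))) = l (eval_y n G y)"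
    proof -
      have "of_real ?C = (fact p / of_real pi ^ Suc p :: complex)" unfolding kernel_constant[OF M] by simp
      moreover have "?I0 = (-1) ^ n * (of_real pi ^ Suc p * of_real pi ^ n) / fact p"
        unfolding radial_integral[OF M] M by (simp add: power_add)
      moreover have "(-1 :: complex) ^ n * (-1) ^ n = 1" by (simp add: power_mult_distrib[symmetric])
      \<comment> \<open>Read A = pi^(p+1), B = pi^n, E = (-1)^n, F = p!, N = n! and C the kernel
        constant; A B is pi^m.\<close>
      moreover have "C / N * (E * (A * B) / F * (E * N / B * L)) = L"
        if "C = F / A" "E * E = 1" "A \<noteq> 0" "B \<noteq> 0" "F \<noteq> 0" "N \<noteq> 0" for C N E A B F L :: complex
        using that by (simp add: field_simps)
      ultimately show ?thesis by simp
    qed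
    finally show ?thesis .
  qed
qed

section \<open>Undoing the diagonalisation\<close>

definition superfunction_on :: "'m point set \<Rightarrow> ('m point \<Rightarrow> 'm sval) \<Rightarrow> bool" where
  "superfunction_on S F \<longleftrightarrow> smooth_fr S F \<and> (\<forall>x\<in>S. gsup {1..4*n} (F x))"

lemma superfunction_on_mult: "open S \<Longrightarrow> superfunction_on S F \<Longrightarrow> superfunction_on S H \<Longrightarrow> superfunction_on S (\<lambda>x. F x * H x)"
  by (simp add: superfunction_on_def fr_mult gsup_mult)

lemma superfunction_on_lincomb:
  "open S \<Longrightarrow> superfunction_on S F \<Longrightarrow> superfunction_on S H \<Longrightarrow> superfunction_on S (\<lambda>x. F x + cnum c * H x)"
  by (simp add: superfunction_on_def smooth_fr.add fr_clinear_map[OF _ clinear_map_left] gsup_add gsup_mult)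

text \<open>Regularity is established for the two combinations, because only these have explicit
  formulas; F1 and F2 are their half sum and half difference.\<close>

lemma superfunction_on_halves:
  assumes S: "open S" and F: "\<And>s. s = 1 \<or> s = -1 \<Longrightarrow> superfunction_on S (\<lambda>x. F1 x + cnum s * F2 x)"
  shows "superfunction_on S F1" "superfunction_on S F2"
proof -
  have p: "superfunction_on S (\<lambda>x. F1 x + F2 x)" using F[of 1] by simp
  have m: "superfunction_on S (\<lambda>x. F1 x - F2 x)" using F[of "-1"] by (simp add: cl_scalar_uminus gconst_uminus)
  have half: "superfunction_on S (\<lambda>x. cnum (1/2) * P x)" if "superfunction_on S P" for P
    using that by (simp add: superfunction_on_def fr_clinear_map[OF _ clinear_map_left] gsup_mult)
  have e: "cnum (1/2) * (a + a) = a" for a :: "'m sval"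
    by (simp only: cnum_two[symmetric] mult.assoc[symmetric] cnum_mult[symmetric]) simp
  show "superfunction_on S F1"
    using half[OF superfunction_on_lincomb[OF S p m, of 1]] e by simp
  show "superfunction_on S F2"
    using half[OF superfunction_on_lincomb[OF S p m, of "-1"]] e by (simp add: cl_scalar_uminus gconst_uminus)
qed

context
  fixes S :: "'m point set" and l :: "'m sval \<Rightarrow> complex"
  assumes S: "open S" "{x. h x = 0} \<subseteq> S" and l: "glin l"
begin

text \<open>Resting on definite descriptions, the integral is shown bilinear on admissible
  arguments: one common cutoff turns all integrals into values of the linear
  \<open>Q\<close>.\<close>

lemma super_integral_lincomb:
  assumes F: "superfunction_on S F1" "superfunction_on S F2" and H: "superfunction_on S H1" "superfunction_on S H2"
  shows "l (super_integral n (\<lambda>x. F1 x + cnum s * F2 x) (super_delta n g) (\<lambda>x. H1 x + cnum s * H2 x))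
    = l (super_integral n F1 (super_delta n g) H1) + s * l (super_integral n F2 (super_delta n g) H1)
      + s * (l (super_integral n F1 (super_delta n g) H2) + s * l (super_integral n F2 (super_delta n g) H2))"
proof -
  obtain \<eta> where \<eta>: "cutoff {x. h x = 0} S \<eta>" using cutoff_exists[OF compact_zero_set S] by blast
  let ?\<mu> = "\<lambda>a. l (berezin n a)"
  have \<mu>: "glin ?\<mu>" by (rule glin_berezin[OF l])
  define r where "r j F H = (\<lambda>x. \<eta> x * ?\<mu> (F x * bg x ^ j * H x))" for j F H
  have SI: "l (super_integral n F (super_delta n g) H) = (\<Sum>j=0..n. (-1) ^ j / fact j * Q (Suc j) (r j F H))"
    if "superfunction_on S F" "superfunction_on S H" for F H
    unfolding r_def using that by (intro super_integral_glin[OF _ _ _ _ S(1) \<eta> l]) (auto simp: superfunction_on_def)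
  have t: "test_function (r j F H)" if "superfunction_on S F" "superfunction_on S H" for j F H
  proof -
    have "smooth_fr S (\<lambda>x. F x * bg x ^ j * H x)"
      using that by (intro fr_mult fr_power S(1) fr_subset[OF fr_bg]) (auto simp: superfunction_on_def)
    then show ?thesis unfolding r_def
      using \<eta> by (intro test_function_mult_local[OF _ S(1)] fr_glin[OF _ \<mu> S(1)]) (auto simp: cutoff_def)
  qed
  have left: "l (super_integral n (\<lambda>x. F1 x + cnum s * F2 x) (super_delta n g) H)
      = l (super_integral n F1 (super_delta n g) H) + s * l (super_integral n F2 (super_delta n g) H)"
    if H: "superfunction_on S H" for H
  proof -
    have "r j (\<lambda>x. F1 x + cnum s * F2 x) H = (\<lambda>x. r j F1 H x + s * r j F2 H x)" for j
      by (simp add: r_def fun_eq_iff distrib_right distrib_left mult.assoc glin_add[OF \<mu>] glin_cnum[OF \<mu>])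
    then have "Q (Suc j) (r j (\<lambda>x. F1 x + cnum s * F2 x) H) = Q (Suc j) (r j F1 H) + s * Q (Suc j) (r j F2 H)" for j
      by (simp only: Q_add[OF t[OF F(1) H] test_function_cmult[OF t[OF F(2) H]]] Q_cmult[OF t[OF F(2) H]])
    then show ?thesis
      by (simp add: SI superfunction_on_lincomb S(1) F H distrib_left sum.distrib sum_distrib_left mult_ac)
  qed
  have right: "l (super_integral n F (super_delta n g) (\<lambda>x. H1 x + cnum s * H2 x))
      = l (super_integral n F (super_delta n g) H1) + s * l (super_integral n F (super_delta n g) H2)"
    if F: "superfunction_on S F" for F
  proof -
    have "r j F (\<lambda>x. H1 x + cnum s * H2 x) = (\<lambda>x. r j F H1 x + s * r j F H2 x)" for j
      by (simp add: r_def fun_eq_iff distrib_left cnum_left glin_add[OF \<mu>] glin_cnum[OF \<mu>])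
    then have "Q (Suc j) (r j F (\<lambda>x. H1 x + cnum s * H2 x)) = Q (Suc j) (r j F H1) + s * Q (Suc j) (r j F H2)" for j
      by (simp only: Q_add[OF t[OF F H(1)] test_function_cmult[OF t[OF F H(2)]]] Q_cmult[OF t[OF F H(2)]])
    then show ?thesis
      by (simp add: SI superfunction_on_lincomb S(1) F H distrib_left sum.distrib sum_distrib_left mult_ac)
  qed
  show ?thesis
    unfolding left[OF superfunction_on_lincomb[OF S(1) H]] right[OF F(1)] right[OF F(2)] by (simp add: algebra_simps)
qed

text \<open>For s = 1 and s = -1 the expansion gives the sum and the difference of the two entries
  of the circulant product, and these determine the entries.\<close>

lemma super_integral_circulant:
  assumes F: "superfunction_on S F1" "superfunction_on S F2" and H: "superfunction_on S H1" "superfunction_on S H2"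
    and e: "\<And>s. s = 1 \<or> s = -1 \<Longrightarrow>
      l (super_integral n (\<lambda>x. F1 x + cnum s * F2 x) (super_delta n g) (\<lambda>x. H1 x + cnum s * H2 x)) = a + s * b"
  shows "l (super_integral n F1 (super_delta n g) H1 + super_integral n F2 (super_delta n g) H2) = a"
    "l (super_integral n F1 (super_delta n g) H2 + super_integral n F2 (super_delta n g) H1) = b"
proof -
  let ?I = "\<lambda>F H. l (super_integral n F (super_delta n g) H)"
  have p: "?I F1 H1 + ?I F2 H1 + (?I F1 H2 + ?I F2 H2) = a + b"
    using e[of 1] super_integral_lincomb[OF F H, of 1] by simp
  have m: "?I F1 H1 - ?I F2 H1 - (?I F1 H2 - ?I F2 H2) = a - b"
    using e[of "-1"] super_integral_lincomb[OF F H, of "-1"] by (simp add: algebra_simps)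
  have x: "2 * (?I F1 H1 + ?I F2 H2) = 2 * a"
    using arg_cong2[OF p m, of "(+)"] by (simp add: algebra_simps)
  have y: "2 * (?I F1 H2 + ?I F2 H1) = 2 * b"
    using arg_cong2[OF p m, of "(-)"] by (simp add: algebra_simps)
  show "l (super_integral n F1 (super_delta n g) H1 + super_integral n F2 (super_delta n g) H2) = a"
    using x by (simp only: glin_add[OF l] mult_cancel_left) simp
  show "l (super_integral n F1 (super_delta n g) H2 + super_integral n F2 (super_delta n g) H1) = b"
    using y by (simp only: glin_add[OF l] mult_cancel_left) simp
qed

end

end

lemma circulant_mult: "circulant a b ** circulant c d = circulant (a * c + b * d) (a * d + b * c)"
  for a :: "'r::ring_1"
  by (simp add: circulant_def matrix_matrix_mult_def vec_eq_iff forall_2 sum_2 add.commute)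

lemma super_integral_mat_circulant:
  "super_integral_mat n (\<lambda>x. circulant (F1 x) (F2 x)) \<alpha> (\<lambda>x. circulant (H1 x) (H2 x))
    = circulant (super_integral n F1 \<alpha> H1 + super_integral n F2 \<alpha> H2)
        (super_integral n F1 \<alpha> H2 + super_integral n F2 \<alpha> H1)"
  by (simp add: super_integral_mat_def circulant_def vec_eq_iff forall_2 sum_2 add.commute)

lemma dirac_matrix_circulant:
  "dirac_matrix n (\<lambda>x. circulant (G1 x) (G2 x)) x
    = circulant (dirac_Z n G1 x + dirac_Z_dag n G2 x) (dirac_Z n G2 x + dirac_Z_dag n G1 x)"
  by (simp add: dirac_matrix_def circulant_def vec_eq_iff forall_2 sum_2 add.commute)

lemma circulant_eq_zero: "circulant a b = 0 \<longleftrightarrow> a = 0 \<and> b = 0"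
  by (auto simp: circulant_def vec_eq_iff forall_2)

text \<open>By s^2 = 1 the terms regroup into the two entries of the circulant matrix product
  (\<open>dirac_matrix_circulant\<close>), the second weighted by s; monogenicity of the matrix thus
  gives it for each combination.\<close>

lemma dirac_left_lincomb:
  assumes s: "s = 1 \<or> s = -1" and S: "open S" "x \<in> S"
    and G1: "smooth_fr S G1" "\<And>x. x \<in> S \<Longrightarrow> gsup {1..2*n} (G1 x)"
    and G2: "smooth_fr S G2" "\<And>x. x \<in> S \<Longrightarrow> gsup {1..2*n} (G2 x)"
  shows "dirac_left n (de s) (df s) (\<lambda>x. G1 x + cnum s * G2 x) x
    = (dirac_Z n G1 x + dirac_Z_dag n G2 x) + cnum s * (dirac_Z n G2 x + dirac_Z_dag n G1 x)"
proof -
  have "pd i (\<lambda>x. G1 x + cnum s * G2 x) x = pd i G1 x + cnum s * pd i G2 x" for i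
    unfolding pd_add[OF G1(1) fr_clinear_map[OF G2(1) clinear_map_left] S]
      pd_clinear_map[OF G2(1) S clinear_map_left] ..
  then have "dirac_left n (de s) (df s) (\<lambda>x. G1 x + cnum s * G2 x) x
      = dirac_left n (de s) (df s) G1 x + cnum s * dirac_left n (de s) (df s) G2 x"
    by (simp add: dirac_left_def gderiv_add gderiv_gconst_mult distrib_left sum.distrib sum_distrib_left cnum_left add_ac)
  also have "\<dots> = (dirac_Z n G1 x + cnum s * dirac_Z_dag n G1 x)
      + (cnum s * dirac_Z n G2 x + cnum (s * s) * dirac_Z_dag n G2 x)"
  proof -
    have "dirac_left n (de s) (df s) G1 x = dirac_Z n G1 x + cnum s * dirac_Z_dag n G1 x"
      by (rule dirac_left_combine[OF s G1(1) S, symmetric]) (rule G1(2))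
    moreover have "dirac_left n (de s) (df s) G2 x = dirac_Z n G2 x + cnum s * dirac_Z_dag n G2 x"
      by (rule dirac_left_combine[OF s G2(1) S, symmetric]) (rule G2(2))
    ultimately show ?thesis by (simp only: distrib_left cnum_mult mult.assoc)
  qed
  also have "s * s = 1" using s by auto
  finally show ?thesis by (simp add: distrib_left add_ac)
qed

theorem corollary6:
  fixes n :: nat
    and \<Omega> :: "(real ^ ('m::finite + 'm)) set"
    and G1 G2 :: "real ^ ('m + 'm) \<Rightarrow> ('m + 'm) clifford grass"
    and g :: "real ^ ('m + 'm) \<Rightarrow> complex grass"
    and y :: "real ^ ('m + 'm)"
  assumes "CARD('m) > n"
    and "open \<Omega>"
    and "G1 \<in> super_space n \<Omega>" and "G2 \<in> super_space n \<Omega>"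
    and "\<forall>x\<in>\<Omega>. dirac_matrix n (\<lambda>x. circulant (G1 x) (G2 x)) x = 0"
    and "phase_function n g"
    and "compact {x. body (g x) \<le> 0}" and "{x. body (g x) \<le> 0} \<subseteq> \<Omega>"
    and "\<forall>x D. body (g x) = 0 \<longrightarrow> GDERIV (\<lambda>x. body (g x)) x :> D \<longrightarrow> D \<noteq> 0"
  shows "(body (g y) < 0 \<longrightarrow>
            super_integral_mat n (Psi_matrix n y) (super_delta n g)
              (\<lambda>x. dirac_matrix_of n g x ** circulant (G1 x) (G2 x))
            = circulant (eval_y n G1 y) (eval_y n G2 y)) \<and>
         (body (g y) > 0 \<longrightarrow>
            super_integral_mat n (Psi_matrix n y) (super_delta n g)
              (\<lambda>x. dirac_matrix_of n g x ** circulant (G1 x) (G2 x))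
            = 0)"
\<comment> \<open>On the zero level both implications are vacuous; elsewhere y stays off the set
  where the kernel has to be smooth.\<close>
proof (cases "body (g y) = 0")
  case False
  have sm: "smooth_on UNIV (\<lambda>x. complex_of_real (body (g x)))"
  proof -
    have "gcoeff (g x) {} \<in> \<real>" for x using assms(6) by (simp add: phase_function_def)
    then have "complex_of_real (body (g x)) = gcoeff (g x) {}" for x by (simp add: body_def)
    then show ?thesis using assms(6) by (simp add: phase_function_def)
  qed
  have "closed {x. body (g x) = 0}"
    by (intro closed_Collect_eq smooth_on_real(1)[OF sm] continuous_on_const)
  with assms(7) have "compact ({x. body (g x) \<le> 0} \<inter> {x. body (g x) = 0})" by (rule compact_Int_closed)
  moreover have "{x. body (g x) \<le> 0} \<inter> {x. body (g x) = 0} = {x. body (g x) = 0}" by auto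
  ultimately interpret phase n g
    using assms(6,9) by unfold_locales auto
  \<comment> \<open>p = m - n - 1, so that the Gamma factor of the kernel becomes p!.\<close>
  obtain p where M: "CARD('m) = n + Suc p" using assms(1) less_imp_Suc_add by fastforce
  note fr = super_space_fr[OF assms(3)] super_space_fr[OF assms(4)]
  note gs = super_space_gsup[OF assms(3)] super_space_gsup[OF assms(4)]
  define S where "S = \<Omega> \<inter> - {y}"
  have S: "open S" "{x. h x = 0} \<subseteq> S" using assms(2,8) False by (auto simp: S_def)
  let ?P = "\<lambda>x. Psi1 n (x - y) (xi n)" and ?P' = "\<lambda>x. Psi1_dag n (x - y) (xi n)"
  let ?d = "dirac_Z n (\<lambda>x. gcomplex (g x))" and ?d' = "dirac_Z_dag n (\<lambda>x. gcomplex (g x))"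
  define H1 where "H1 x = ?d x * G1 x + ?d' x * G2 x" for x
  define H2 where "H2 x = ?d x * G2 x + ?d' x * G1 x" for x
  have sup4: "gsup {1..4*n} a" if "gsup {1..2*n} a" for a :: "'m sval" using that by (rule gsup_mono) auto
  have Dg: "dirac_left n (de s) (df s) (\<lambda>x. gcomplex (g x)) x = ?d x + cnum s * ?d' x" if "s = 1 \<or> s = -1" for s x
    by (rule dirac_left_combine[OF that fr_g open_UNIV UNIV_I gsup_g, symmetric])
  have sP: "superfunction_on S ?P" "superfunction_on S ?P'"
  proof -
    have "superfunction_on S (\<lambda>x. ?P x + cnum s * ?P' x)" if s: "s = 1 \<or> s = -1" for s
    proof -
      let ?K = "\<lambda>x. cnum (of_real (2 / supersphere_area n TYPE('m))) * (Xv n s y x * fc n (pw (Suc p)) (rho y x))"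
      have "rho y x \<in> {0<..}" if "x \<in> S" for x using that by (simp add: S_def rho_def)
      then have "smooth_fr S (\<lambda>x. fc n (pw (Suc p)) (rho y x))" by (rule fr_fc[OF smooth_seq_pw S(1)])
      then have "smooth_fr S ?K" by (intro fr_clinear_map[OF _ clinear_map_left] fr_mult fr_Xv S(1))
      then have "superfunction_on S ?K"
        unfolding superfunction_on_def by (intro conjI ballI gsup_mult gsup_gconst gsup_Xv gsup_fc)
      moreover have "?K x = ?P x + cnum s * ?P' x" if "x \<in> S" for x
        using Psi_combine[OF s M, of x y] that by (simp add: S_def)
      ultimately show ?thesis
        unfolding superfunction_on_def using smooth_fr.cong[of S ?K "\<lambda>x. ?P x + cnum s * ?P' x"] by fastforce
    qed
    from superfunction_on_halves[OF S(1) this]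
    show "superfunction_on S ?P" "superfunction_on S ?P'" by blast+
  qed
  have sd: "superfunction_on S ?d" "superfunction_on S ?d'"
  proof -
    have "superfunction_on S (\<lambda>x. ?d x + cnum s * ?d' x)" if s: "s = 1 \<or> s = -1" for s
      unfolding Dg[OF s, symmetric] superfunction_on_def
      using fr_subset[OF fr_dirac_left[OF fr_g open_UNIV], of S] sup4[OF gsup_dirac_left[OF fr_g open_UNIV UNIV_I gsup_g]] by auto
    from superfunction_on_halves[OF S(1) this]
    show "superfunction_on S ?d" "superfunction_on S ?d'" by blast+
  qed
  have sG: "superfunction_on S G1" "superfunction_on S G2"
    unfolding superfunction_on_def using fr_subset[OF fr(1), of S] fr_subset[OF fr(2), of S] sup4 gs by (auto simp: S_def)
  have sH: "superfunction_on S H1" "superfunction_on S H2"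
    unfolding H1_def[abs_def] H2_def[abs_def]
    using superfunction_on_lincomb[OF S(1) superfunction_on_mult[OF S(1) sd(1) sG(1)] superfunction_on_mult[OF S(1) sd(2) sG(2)], of 1]
      superfunction_on_lincomb[OF S(1) superfunction_on_mult[OF S(1) sd(1) sG(2)] superfunction_on_mult[OF S(1) sd(2) sG(1)], of 1]
    by simp_all
  \<comment> \<open>Covers both cases of the claim at once, so that the matrix entries are recovered
    only once.\<close>
  define v where "v l G = (if h y < 0 then l (eval_y n G y) else 0)" for l :: "'m sval \<Rightarrow> complex" and G
  have key: "l (super_integral n (\<lambda>x. ?P x + cnum s * ?P' x) (super_delta n g) (\<lambda>x. H1 x + cnum s * H2 x)) = v l G1 + s * v l G2"
    if s: "s = 1 \<or> s = -1" and l: "glin l" for s l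
  proof -
    let ?G = "\<lambda>x. G1 x + cnum s * G2 x"
    have G: "smooth_fr \<Omega> ?G" "\<And>x. x \<in> \<Omega> \<Longrightarrow> gsup {1..2*n} (?G x)"
      using fr gs by (auto intro!: smooth_fr.add fr_clinear_map[OF _ clinear_map_left] gsup_add gsup_mult)
    have DG: "dirac_left n (de s) (df s) ?G x = 0" if "x \<in> \<Omega>" for x
    proof -
      have "dirac_left n (de s) (df s) ?G x
        = (dirac_Z n G1 x + dirac_Z_dag n G2 x) + cnum s * (dirac_Z n G2 x + dirac_Z_dag n G1 x)"
        by (rule dirac_left_lincomb[OF s assms(2) that fr(1) _ fr(2)]) (rule gs, assumption)+
      then show ?thesis using assms(5) that unfolding dirac_matrix_circulant circulant_eq_zero by simp
    qed
    have H: "dirac_left n (de s) (df s) (\<lambda>x. gcomplex (g x)) x * ?G x = H1 x + cnum s * H2 x" for x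
    proof -
      have "cnum s * (?d' x * (cnum s * G2 x)) = cnum (s * s) * (?d' x * G2 x)"
        by (simp only: cnum_left[of "?d' x"] mult.assoc cnum_mult)
      also have "s * s = 1" using s by auto
      finally have "cnum s * (?d' x * (cnum s * G2 x)) = ?d' x * G2 x" by simp
      then show ?thesis
        unfolding Dg[OF s] H1_def H2_def
        by (simp add: distrib_left distrib_right mult.assoc cnum_left[of "?d x"] add_ac)
    qed
    note c = cauchy_component[OF s M assms(2) G DG assms(7,8) l Psi_combine[OF s M], unfolded H]
    show ?thesis
    proof (cases "h y < 0")
      case True
      then show ?thesis using c(2) by (simp add: v_def eval_y_combine glin_add[OF l] glin_cnum[OF l])
    next
      case F: False
      then have "h y > 0" using False by linarith
      then show ?thesis using c(1) F by (simp add: v_def)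
    qed
  qed
  have ent: "l (super_integral n ?P (super_delta n g) H1 + super_integral n ?P' (super_delta n g) H2) = v l G1"
    "l (super_integral n ?P (super_delta n g) H2 + super_integral n ?P' (super_delta n g) H1) = v l G2" if l: "glin l" for l
    using super_integral_circulant[OF S l sP sH key[OF _ l]] by blast+
  have mat: "super_integral_mat n (Psi_matrix n y) (super_delta n g) (\<lambda>x. dirac_matrix_of n g x ** circulant (G1 x) (G2 x))
    = circulant (super_integral n ?P (super_delta n g) H1 + super_integral n ?P' (super_delta n g) H2)
        (super_integral n ?P (super_delta n g) H2 + super_integral n ?P' (super_delta n g) H1)"
  proof -
    have "Psi_matrix n y = (\<lambda>x. circulant (?P x) (?P' x))"
      by (simp add: Psi_matrix_def Let_def fun_eq_iff xi_def[abs_def])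
    moreover have "(\<lambda>x. dirac_matrix_of n g x ** circulant (G1 x) (G2 x)) = (\<lambda>x. circulant (H1 x) (H2 x))"
      by (simp add: dirac_matrix_of_def circulant_mult H1_def H2_def)
    ultimately show ?thesis by (simp only: super_integral_mat_circulant)
  qed
  show ?thesis
  proof (intro conjI impI)
    assume "h y < 0"
    then have "super_integral n ?P (super_delta n g) H1 + super_integral n ?P' (super_delta n g) H2 = eval_y n G1 y"
      "super_integral n ?P (super_delta n g) H2 + super_integral n ?P' (super_delta n g) H1 = eval_y n G2 y"
      using ent by (auto intro!: glin_separates simp: v_def)
    then show "super_integral_mat n (Psi_matrix n y) (super_delta n g) (\<lambda>x. dirac_matrix_of n g x ** circulant (G1 x) (G2 x))
      = circulant (eval_y n G1 y) (eval_y n G2 y)" unfolding mat by simp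
  next
    assume "h y > 0"
    then have "super_integral n ?P (super_delta n g) H1 + super_integral n ?P' (super_delta n g) H2 = 0"
      "super_integral n ?P (super_delta n g) H2 + super_integral n ?P' (super_delta n g) H1 = 0"
      using ent by (auto intro!: glin_separates simp: v_def glin_zero)
    then show "super_integral_mat n (Psi_matrix n y) (super_delta n g) (\<lambda>x. dirac_matrix_of n g x ** circulant (G1 x) (G2 x)) = 0"
      unfolding mat circulant_eq_zero by blast
  qed
qed simp

end
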